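(* Let $V$ be a real Banach space, $\overline V=V\oplus\mathbb{R}$, let $\Lambda$ be a tensor normalization on $\mathbf{T}_1(\overline V)$, and let $\overline\Phi:\mathcal{C}^1(V)\to\mathbf{T}_1(\overline V)$, $\overline\Phi(x)=\Lambda(\mathrm{S}(\overline x))$, where $\overline x(t)=(x(t),t)$. Let $\mu,\nu$ be (Borel) probability measures on $(\mathcal{C}^1(V),\overline\rho)$. Then $$\mu=\nu\quad\text{if and only if}\quad\mathbb{E}_{X\sim\mu}\big[\overline\Phi(X)^m\big]=\mathbb{E}_{Y\sim\nu}\big[\overline\Phi(Y)^m\big]\quad\text{for all }m\ge1,$$ where $\overline\Phi(x)^m\in\overline V^{\otimes m}$ denotes the degree-$m$ component of $\overline\Phi(x)$.
   Context: **Tensors.** For a Banach space $W$ (here $W=\overline V$): $W^{\otimes 0}=\mathbb{R}$, and $W^{\otimes m}$, $m\ge2$, are the Banach spaces obtained by completing the algebraic tensor powers with respect to an admissible system of tensor norms (i.e. $\|s\otimes t\|\le\|s\|\|t\|$ and permutations of factors act isometrically). $\mathbf{T}(W)$ is the Banach space of $\mathbf{t}=(\mathbf{t}^m)_{m\ge0}\in\prod_{m\ge0}W^{\otimes m}$ with $\|\mathbf{t}\|=(\sum_m\|\mathbf{t}^m\|^2)^{1/2}<\infty$; $\mathbf{T}_1(W)=\{\mathbf{t}\in\mathbf{T}(W):\mathbf{t}^0=1\}$. For $c\in\mathbb{R}$, $\delta_c(\mathbf{t})=(c^m\mathbf{t}^m)_{m\ge0}$. A *tensor normalization* is a continuous injective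 map $\Lambda:\mathbf{T}_1(W)\to\{\mathbf{t}\in\mathbf{T}_1(W):\|\mathbf{t}\|\le R\}$ of the form $\Lambda(\mathbf{t})=\delta_{\lambda(\mathbf{t})}\mathbf{t}$, with $R>0$ constant and $\lambda:\mathbf{T}_1(W)\to(0,\infty)$. **Paths.** $\mathcal{C}^1(V)=\bigcup_{T>0}\{x\in C([0,T],V):\exists\,\dot x\in L^1([0,T],V),\ x=\int_0^\cdot\dot x(t)\,dt\}$; $[0,T_x]$ is the interval of $x$. The signature of $x\in\mathcal{C}^1(W)$ is $\mathrm{S}(x)=(\int dx^{\otimes m})_{m\ge0}\in\mathbf{T}_1(W)$, $\int dx^{\otimes m}=\int_{0\le t_1\le\dots\le t_m\le T_x}dx(t_1)\otimes\cdots\otimes dx(t_m)$. The metric $\overline\rho$ on $\mathcal{C}^1(V)$ is $\overline\rho(x,y)=\inf_\tau\|\overline x-\overline y\circ\tau\|_{1\text{-var};[0,T_x]}$, infimum over increasing bijections $\tau:[0,T_x]\to[0,T_y]$, where $\|\cdot\|_{1\text{-var}}$ is the total variation. Expectations of $\overline V^{\otimes m}$-valued maps are understood weakly, i.e. as the functional $\ell\mapsto\mathbb{E}[\langle\ell,\overline\Phi(X)^m\rangle]$ on the dual of $\overline V^{\otimes m}$.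
   Formalization: Two hypotheses are added: tensor products of bounded functionals on V̄ are bounded on the completed tensor powers (usual for tensor norms), and μ, ν are concentrated on separable sets (automatic for separable V; otherwise failing only if real-valued measurable cardinals exist). *)

theory Defs
  imports "HOL-Probability.Probability" "HOL-Combinatorics.Permutations"
begin

section \<open>Completed tensor powers\<close>

abbreviation words :: "nat \<Rightarrow> 'w list set" where
  "words m \<equiv> {ws. length ws = m}"

definition multilinear_on_words ::
    "nat \<Rightarrow> ('w::real_vector list \<Rightarrow> 'b::real_vector) \<Rightarrow> bool" where
  "multilinear_on_words m B \<longleftrightarrow>
     (\<forall>ws\<in>words m. \<forall>i<m. linear (\<lambda>w. B (ws[i := w])))"

text \<open>
  The tensor powers of a Banach space \<open>W\<close> are presented by the map
  \<open>tens [w\<^sub>1, \<dots>, w\<^sub>m] = w\<^sub>1 \<otimes> \<dots> \<otimes> w\<^sub>m\<close>. All completed powers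
  are realised as closed subspaces of one Banach space \<open>'e\<close>. This is no restriction:
  any sequence of Banach spaces embeds isometrically into a single one (for example into
  its \<open>\<ell>\<^sup>2\<close>-sum), and \<open>'e\<close> and \<open>tens\<close> are arbitrary.

  The linear span of \<open>tens ` words m\<close> is the algebraic \<open>m\<close>-th tensor power: \<open>tens\<close> is
  multilinear on words of length \<open>m\<close>, and every multilinear form factors through it by a
  linear form. (The functional \<open>f\<close> in \<open>universal\<close> need not be continuous.
  Only its values on the span matter, and there it is unique.) The norm of \<open>'e\<close>
  restricted to this span is the tensor norm, and its closure is the completion.
\<close>

definition tensor_power :: "('w::banach list \<Rightarrow> 'e::banach) \<Rightarrow> nat \<Rightarrow> 'e set" where
  "tensor_power tens m = closure (span (tens ` words m))"

locale algebraic_tensor_powers =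
  fixes tens :: "'w::banach list \<Rightarrow> 'e::banach"
  assumes multilinear: "multilinear_on_words m tens"
    and universal: "multilinear_on_words m B \<Longrightarrow>
          \<exists>f :: 'e \<Rightarrow> real. linear f \<and> (\<forall>ws\<in>words m. f (tens ws) = B ws)"

text \<open>
  The assumptions \<open>norm_empty\<close> and \<open>norm_single\<close> identify the powers of degree 0 and 1
  isometrically with \<open>\<real>\<close> and \<open>W\<close>; \<open>norm_mult\<close> and \<open>norm_permute\<close> are
  the two admissibility conditions, for general elements \<open>s\<close>, \<open>t\<close> of the algebraic powers
  written as finite linear combinations of elementary tensors.

  The assumption \<open>dual_tensor\<close> is the lower bound that is part of the usual notion of a
  tensor norm (there in the form: the norm dominates the injective norm). It says that
  \<open>\<ell>\<^sub>1 \<otimes> \<dots> \<otimes> \<ell>\<^sub>m\<close> is bounded for all bounded linear forms \<open>\<ell>\<^sub>i\<close> on \<open>W\<close>, so that it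
  extends to the completion. The constant is allowed to depend on the \<open>\<ell>\<^sub>i\<close>.
\<close>

locale admissible_tensor_powers = algebraic_tensor_powers tens
  for tens :: "'w::banach list \<Rightarrow> 'e::banach" +
  assumes norm_empty: "norm (tens []) = 1"
    and norm_single: "norm (tens [w]) = norm w"
    and norm_mult:
      "\<lbrakk>finite A; A \<subseteq> words m; finite B; B \<subseteq> words n\<rbrakk> \<Longrightarrow>
        norm (\<Sum>u\<in>A. \<Sum>v\<in>B. (a u * b v) *\<^sub>R tens (u @ v))
          \<le> norm (\<Sum>u\<in>A. a u *\<^sub>R tens u) * norm (\<Sum>v\<in>B. b v *\<^sub>R tens v)"
    and norm_permute:
      "\<lbrakk>finite A; A \<subseteq> words m; \<sigma> permutes {..<m}\<rbrakk> \<Longrightarrow>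
        norm (\<Sum>u\<in>A. a u *\<^sub>R tens (permute_list \<sigma> u)) = norm (\<Sum>u\<in>A. a u *\<^sub>R tens u)"
    and dual_tensor:
      "\<lbrakk>\<And>i. i < m \<Longrightarrow> bounded_linear (l i :: 'w \<Rightarrow> real)\<rbrakk> \<Longrightarrow>
        \<exists>C. \<forall>A a. finite A \<and> A \<subseteq> words m \<longrightarrow>
          \<bar>\<Sum>u\<in>A. a u * (\<Prod>i<m. l i (u ! i))\<bar> \<le> C * norm (\<Sum>u\<in>A. a u *\<^sub>R tens u)"

definition dual_space :: "'e::real_normed_vector set \<Rightarrow> ('e \<Rightarrow> real) set" where
  "dual_space E = {l.
     (\<forall>x\<in>E. \<forall>y\<in>E. l (x + y) = l x + l y) \<and>
     (\<forall>x\<in>E. \<forall>c. l (c *\<^sub>R x) = c * l x) \<and>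
     (\<exists>K. \<forall>x\<in>E. \<bar>l x\<bar> \<le> K * norm x)}"

definition tensor_seqs :: "('w::banach list \<Rightarrow> 'e::banach) \<Rightarrow> (nat \<Rightarrow> 'e) set" where
  "tensor_seqs tens =
     {t. (\<forall>m. t m \<in> tensor_power tens m) \<and> summable (\<lambda>m. (norm (t m))\<^sup>2)}"

definition tensor_seqs1 :: "('w::banach list \<Rightarrow> 'e::banach) \<Rightarrow> (nat \<Rightarrow> 'e) set" where
  "tensor_seqs1 tens = {t \<in> tensor_seqs tens. t 0 = tens []}"

definition seq_norm :: "(nat \<Rightarrow> 'e::real_normed_vector) \<Rightarrow> real" where
  "seq_norm t = sqrt (\<Sum>m. (norm (t m))\<^sup>2)"

definition dilate :: "real \<Rightarrow> (nat \<Rightarrow> 'e::real_vector) \<Rightarrow> nat \<Rightarrow> 'e" where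
  "dilate c t = (\<lambda>m. c ^ m *\<^sub>R t m)"

definition tensor_normalization ::
    "('w::banach list \<Rightarrow> 'e::banach) \<Rightarrow> ((nat \<Rightarrow> 'e) \<Rightarrow> nat \<Rightarrow> 'e) \<Rightarrow> bool" where
  "tensor_normalization tens \<Lambda> \<longleftrightarrow>
     (\<exists>R>0. \<forall>t\<in>tensor_seqs1 tens. \<Lambda> t \<in> tensor_seqs1 tens \<and> seq_norm (\<Lambda> t) \<le> R) \<and>
     (\<exists>lam. \<forall>t\<in>tensor_seqs1 tens. lam t > (0::real) \<and> \<Lambda> t = dilate (lam t) t) \<and>
     inj_on \<Lambda> (tensor_seqs1 tens) \<and>
     (\<forall>t\<in>tensor_seqs1 tens. \<forall>\<epsilon>>0. \<exists>\<delta>>0. \<forall>s\<in>tensor_seqs1 tens.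
        seq_norm (\<lambda>m. s m - t m) < \<delta> \<longrightarrow> seq_norm (\<lambda>m. \<Lambda> s m - \<Lambda> t m) < \<epsilon>)"


section \<open>Paths and signatures\<close>

text \<open>
  The Bochner integral for arbitrary Banach spaces. The body is that of the library predicate
  \<open>has_bochner_integral\<close>, which is restricted to second-countable (separable) spaces.
\<close>

definition has_banach_integral ::
    "'a measure \<Rightarrow> ('a \<Rightarrow> 'b::banach) \<Rightarrow> 'b \<Rightarrow> bool" where
  "has_banach_integral M f I \<longleftrightarrow> f \<in> borel_measurable M \<and>
     (\<exists>s. (\<forall>i. Bochner_Integration.simple_bochner_integrable M (s i)) \<and>
          (\<lambda>i. \<integral>\<^sup>+x. ennreal (norm (f x - s i x)) \<partial>M) \<longlonglongrightarrow> 0 \<and>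
          (\<lambda>i. Bochner_Integration.simple_bochner_integral M (s i)) \<longlonglongrightarrow> I)"

text \<open>
  A path \<open>x\<close> on \<open>[0, T]\<close> is the pair \<open>(T, x)\<close>, where \<open>x\<close> is extensional, so that equality of
  pairs is equality of paths.
\<close>

type_synonym 'v path = "real \<times> (real \<Rightarrow> 'v)"

definition has_path_derivative :: "'v::banach path \<Rightarrow> (real \<Rightarrow> 'v) \<Rightarrow> bool" where
  "has_path_derivative p xd \<longleftrightarrow>
     (\<forall>t\<in>{0..fst p}. has_banach_integral (restrict_space lborel {0..t}) xd (snd p t))"

definition C1_paths :: "'v::banach path set" where
  "C1_paths = {(T, x). 0 < T \<and> x \<in> extensional {0..T} \<and> continuous_on {0..T} x \<and>
     (\<exists>xd. has_path_derivative (T, x) xd)}"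

definition time_augment :: "'v::banach path \<Rightarrow> ('v \<times> real) path" where
  "time_augment p = (fst p, \<lambda>t\<in>{0..fst p}. (snd p t, t))"

definition total_variation :: "real \<Rightarrow> real \<Rightarrow> (real \<Rightarrow> 'b::real_normed_vector) \<Rightarrow> real" where
  "total_variation a b f =
     Sup {\<Sum>i<n. norm (f (t (Suc i)) - f (t i)) | n t.
            mono_on {..n} t \<and> t ` {..n} \<subseteq> {a..b}}"

definition increasing_bijections :: "real \<Rightarrow> real \<Rightarrow> (real \<Rightarrow> real) set" where
  "increasing_bijections S T =
     {\<tau>. strict_mono_on {0..S} \<tau> \<and> bij_betw \<tau> {0..S} {0..T}}"

text \<open>The value outside \<open>C1_paths\<close> is immaterial. It is 0 so that the distance is symmetric on
  the whole type, as \<open>Metric_space\<close> demands.\<close>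

definition path_dist :: "'v::banach path \<Rightarrow> 'v path \<Rightarrow> real" where
  "path_dist x y =
     (if x \<in> C1_paths \<and> y \<in> C1_paths
      then INF \<tau>\<in>increasing_bijections (fst x) (fst y).
             total_variation 0 (fst x)
               (\<lambda>t. snd (time_augment x) t - snd (time_augment y) (\<tau> t))
      else 0)"

definition path_borel :: "'v::banach path measure" where
  "path_borel = sigma C1_paths {U. openin (Metric_space.mtopology C1_paths path_dist) U}"

definition simplex_measure :: "nat \<Rightarrow> real \<Rightarrow> (nat \<Rightarrow> real) measure" where
  "simplex_measure m T =
     restrict_space (\<Pi>\<^sub>M i\<in>{..<m}. lborel) {t. t ` {..<m} \<subseteq> {0..T} \<and> mono_on {..<m} t}"

text \<open>
  The degree-\<open>m\<close> iterated integral, with \<open>dx(t) = xd(t) dt\<close>, as a Bochner integral over the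
  ordered simplex. It does not depend on the version of the derivative.
\<close>

definition signature :: "('w::banach list \<Rightarrow> 'e::banach) \<Rightarrow> 'w path \<Rightarrow> nat \<Rightarrow> 'e" where
  "signature tens p m = (THE I. \<exists>xd. has_path_derivative p xd \<and>
     has_banach_integral (simplex_measure m (fst p))
       (\<lambda>t. tens (map (\<lambda>i. xd (t i)) [0..<m])) I)"

definition normalized_signature ::
    "(('v::banach \<times> real) list \<Rightarrow> 'e::banach) \<Rightarrow> ((nat \<Rightarrow> 'e) \<Rightarrow> nat \<Rightarrow> 'e) \<Rightarrow>
     'v path \<Rightarrow> nat \<Rightarrow> 'e" where
  "normalized_signature tens \<Lambda> x = \<Lambda> (signature tens (time_augment x))"

definition path_law :: "'v::banach path measure \<Rightarrow> bool" where
  "path_law \<mu> \<longleftrightarrow> prob_space \<mu> \<and> sets \<mu> = sets path_borel"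

text \<open>
  Concentrated on a separable set. This holds for every \<open>path_law\<close> if \<open>'v\<close> is separable. If
  \<open>'v\<close> is not separable, it can only fail if a real-valued measurable cardinal exists.
\<close>

definition separably_supported :: "'v::banach path measure \<Rightarrow> bool" where
  "separably_supported \<mu> \<longleftrightarrow>
     (\<exists>D. countable D \<and> D \<subseteq> C1_paths \<and>
        (AE x in \<mu>. \<forall>\<epsilon>>0. \<exists>d\<in>D. path_dist x d < \<epsilon>))"

end

theory Submission
  imports Defs
begin

text \<open>
  Let \<open>\<lambda>(x)\<close> be the scale for which \<open>\<Lambda>\<close> dilates the signature of the time-augmented path \<open>x\<close>.
  A form \<open>\<ell>\<^sub>1 \<otimes> \<dots> \<otimes> \<ell>\<^sub>m\<close> evaluated at the normalized signature is the real iterated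
  integral of the path \<open>\<lambda>(x) (x(t), t)\<close> along \<open>\<ell>\<^sub>1, \<dots>, \<ell>\<^sub>m\<close>. By the shuffle relation these
  coordinates span an algebra of bounded continuous functions. If the expectations agree, polynomial
  approximation of indicators shows that the two laws agree on the \<open>\<sigma>\<close>-algebra generated by the algebra.

  It remains to see that, up to the common separable support, this \<open>\<sigma>\<close>-algebra contains every open set.
  After reparametrization to \<open>[0,1]\<close>, a coordinate along one space direction and \<open>k\<close> time directions
  is, up to a power of the total time, a moment \<open>\<integral> s\<^sup>k \<ell>(v(s)) ds\<close> of the scaled velocity \<open>v\<close>. Hence
  the positions of the scaled path are measurable, and so are, as limits of dyadic variation sums, the
  \<open>L\<^sup>1\<close> distances of \<open>v\<close> to step functions. These determine the path up to the scale, and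
  injectivity of \<open>\<Lambda>\<close> determines the scale. Both steps are continuous, so every open set is a
  countable union of such measurable sets on the support.
\<close>

text \<open>Signature coordinates are unbounded; their boundedness comes from \<Lambda>, and the
  price is that they see a path only after multiplication by an unknown scale. This scale is not
  assumed continuous. What helps is that scale times total time is a degree-one coordinate, hence
  continuous together with \<Lambda>, and that injectivity of \<Lambda> makes the total dilation an
  increasing function along each ray of dilated signatures. A second obstacle is the metric: its
  time changes need not be absolutely continuous, so they do not act on velocities. The time
  coordinate helps, since a small distance forces the normalized time change to differ from the
  identity by a function of small variation. Therefore the topology is that of the L1 distance of
  velocities after linear reparametrization. A third obstacle is the lack of separability: sums of
  Borel functions need not be Borel, and a norm need not be a supremum of countably many
  functionals. Integrands are therefore kept as limits of simple functions, and norms are measured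
  only on paths with values in a separable set, where countably many norming functionals
  suffice.\<close>

section \<open>Hahn-Banach extension and norming functionals\<close>

text \<open>A dominated functional is represented by its graph, a subspace of the product with the
  reals on which the second component is at most \<open>C\<close> times the norm of the first.
  Zorn's lemma then runs over sets ordered by inclusion, and the bound alone makes a maximal graph
  single-valued.\<close>

lemma hahn_banach_extension:
  fixes g :: "'a::real_normed_vector \<Rightarrow> real"
  assumes S: "subspace S" and C: "0 \<le> C"
    and add: "\<And>x y. x \<in> S \<Longrightarrow> y \<in> S \<Longrightarrow> g (x + y) = g x + g y"
    and scale: "\<And>c x. x \<in> S \<Longrightarrow> g (c *\<^sub>R x) = c * g x"
    and bound: "\<And>x. x \<in> S \<Longrightarrow> \<bar>g x\<bar> \<le> C * norm x"
  obtains L where "bounded_linear L" "\<And>x. x \<in> S \<Longrightarrow> L x = g x" "\<And>x. \<bar>L x\<bar> \<le> C * norm x"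
proof -
  define G0 where "G0 = (\<lambda>x. (x, g x)) ` S"
  define \<A> where "\<A> = {G. subspace G \<and> G0 \<subseteq> G \<and> (\<forall>(x, r)\<in>G. r \<le> C * norm x)}"
  have G0: "G0 \<in> \<A>"
  proof -
    have "subspace G0"
      unfolding subspace_def
    proof (intro conjI ballI allI)
      have "g 0 = 0" using scale[of 0 0] S by (simp add: subspace_0)
      then show "0 \<in> G0" using S by (auto simp: G0_def image_iff zero_prod_def subspace_0)
    next
      fix p q assume "p \<in> G0" "q \<in> G0"
      then show "p + q \<in> G0" using S add by (auto simp: G0_def image_iff subspace_add)
    next
      fix c p assume "p \<in> G0"
      then show "c *\<^sub>R p \<in> G0" using S scale by (auto simp: G0_def image_iff subspace_scale)
    qed
    moreover have "\<forall>(x, r)\<in>G0. r \<le> C * norm x" using bound by (force simp: G0_def)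
    ultimately show ?thesis by (simp add: \<A>_def)
  qed
  have "\<exists>M\<in>\<A>. \<forall>X\<in>\<A>. M \<subseteq> X \<longrightarrow> X = M"
  proof (rule subset_Zorn_nonempty)
    show "\<A> \<noteq> {}" using G0 by auto
  next
    fix \<C> assume ne: "\<C> \<noteq> {}" and ch: "subset.chain \<A> \<C>"
    have sub: "\<C> \<subseteq> \<A>" and tot: "\<And>X Y. X \<in> \<C> \<Longrightarrow> Y \<in> \<C> \<Longrightarrow> X \<subseteq> Y \<or> Y \<subseteq> X"
      using ch by (auto simp: subset.chain_def)
    have "subspace (\<Union>\<C>)"
      unfolding subspace_def
    proof (intro conjI ballI allI)
      obtain X where "X \<in> \<C>" using ne by auto
      then show "0 \<in> \<Union>\<C>" using sub subspace_0 by (force simp: \<A>_def)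
    next
      fix p q assume "p \<in> \<Union>\<C>" "q \<in> \<Union>\<C>"
      then obtain X where "X \<in> \<C>" "p \<in> X" "q \<in> X" using tot by blast
      then show "p + q \<in> \<Union>\<C>" using sub subspace_add unfolding \<A>_def by blast
    next
      fix c p assume "p \<in> \<Union>\<C>"
      then show "c *\<^sub>R p \<in> \<Union>\<C>" using sub subspace_scale unfolding \<A>_def by blast
    qed
    moreover have "G0 \<subseteq> \<Union>\<C>" using ne sub by (auto simp: \<A>_def)
    moreover have "\<forall>(x, r)\<in>\<Union>\<C>. r \<le> C * norm x" using sub by (auto simp: \<A>_def)
    ultimately show "\<Union>\<C> \<in> \<A>" by (simp add: \<A>_def)
  qed
  then obtain M where M: "M \<in> \<A>" and max: "\<And>X. X \<in> \<A> \<Longrightarrow> M \<subseteq> X \<Longrightarrow> X = M" by blast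
  have sM: "subspace M" and G0M: "G0 \<subseteq> M" and bM: "\<And>x r. (x, r) \<in> M \<Longrightarrow> r \<le> C * norm x"
    using M by (auto simp: \<A>_def)
  have total: "\<exists>r. (x0, r) \<in> M" for x0
  proof (rule ccontr)
    assume no: "\<nexists>r. (x0, r) \<in> M"
    \<comment> \<open>The value \<open>a\<close> at \<open>x0\<close> must lie above every
      \<open>s - C * norm (y - x0)\<close> and below every \<open>C * norm (x + x0) - r\<close>. The
      estimate \<open>le\<close> puts each lower bound below each upper one, so the supremum of the
      lower bounds is admissible.\<close>
    define B where "B = (\<lambda>(y, s). s - C * norm (y - x0)) ` M"
    have le: "s - C * norm (y - x0) \<le> C * norm (x + x0) - r" if "(x, r) \<in> M" "(y, s) \<in> M" for x r y s
    proof -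
      have "(x + y, r + s) \<in> M" using subspace_add[OF sM that] by simp
      then have "r + s \<le> C * norm (x + y)" by (rule bM)
      also have "\<dots> = C * norm ((x + x0) + (y - x0))" by simp
      also have "\<dots> \<le> C * (norm (x + x0) + norm (y - x0))"
        using C by (intro mult_left_mono norm_triangle_ineq)
      finally show ?thesis by (simp add: algebra_simps)
    qed
    have M0: "(0, 0) \<in> M" using subspace_0[OF sM] by (simp add: zero_prod_def)
    have Bne: "B \<noteq> {}" using M0 by (auto simp: B_def)
    have Bbdd: "bdd_above B"
      using le[OF M0] by (auto simp: B_def intro!: bdd_aboveI[where M = "C * norm x0"])
    define a where "a = Sup B"
    have a1: "s - C * norm (y - x0) \<le> a" if "(y, s) \<in> M" for y s
      unfolding a_def by (rule cSup_upper) (use that Bbdd in \<open>auto simp: B_def image_iff intro!: bexI[of _ "(y, s)"]\<close>)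
    have a2: "a \<le> C * norm (x + x0) - r" if "(x, r) \<in> M" for x r
      unfolding a_def by (rule cSup_least) (use that Bne le in \<open>auto simp: B_def\<close>)
    define X where "X = span (insert (x0, a) M)"
    have X: "X = {v. \<exists>k. v - k *\<^sub>R (x0, a) \<in> M}"
      using span_breakdown_eq[of _ "(x0, a)" M] sM by (auto simp: X_def span_eq_iff[THEN iffD2])
    have "X \<in> \<A>"
    proof -
      have "M \<subseteq> X" unfolding X_def by (auto intro: span_base)
      moreover have "r \<le> C * norm x" if xr: "(x, r) \<in> X" for x r
      proof -
        obtain k where k: "(x - k *\<^sub>R x0, r - k * a) \<in> M" using xr by (auto simp: X)
        \<comment> \<open>Division by the absolute value of \<open>k\<close> reduces to coefficient
          1 or -1, where \<open>a2\<close> or \<open>a1\<close> is the required bound.\<close>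
        consider "k = 0" | "k > 0" | "k < 0" by linarith
        then show ?thesis
        proof cases
          case 1 then show ?thesis using bM[OF k] by simp
        next
          case 2
          have "((1/k) *\<^sub>R (x - k *\<^sub>R x0), (1/k) * (r - k * a)) \<in> M"
            using subspace_scale[OF sM k, of "1/k"] by simp
          from a2[OF this] have "a \<le> C * norm ((1/k) *\<^sub>R x) - (1/k) * (r - k * a)"
            using 2 by (simp add: algebra_simps)
          then have "k * a \<le> k * (C * (norm x / k) - (1/k) * (r - k * a))"
            using 2 by (intro mult_left_mono) auto
          also have "\<dots> = C * norm x - (r - k * a)" using 2 by (simp add: field_simps)
          finally show ?thesis by simp
        next
          case 3
          define j where "j = - k"
          have j: "j > 0" "k = - j" using 3 by (auto simp: j_def)
          have "((1/j) *\<^sub>R (x - k *\<^sub>R x0), (1/j) * (r - k * a)) \<in> M"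
            using subspace_scale[OF sM k, of "1/j"] by simp
          from a1[OF this] have "(1/j) * (r + j * a) - C * norm ((1/j) *\<^sub>R x) \<le> a"
            using j by (simp add: algebra_simps)
          then have "j * ((1/j) * (r + j * a) - C * (norm x / j)) \<le> j * a"
            using j by (intro mult_left_mono) auto
          also have "j * ((1/j) * (r + j * a) - C * (norm x / j)) = r + j * a - C * norm x"
            using j by (simp add: field_simps)
          finally show ?thesis by simp
        qed
      qed
      ultimately show ?thesis using G0M by (auto simp: \<A>_def X_def)
    qed
    moreover have "M \<subseteq> X" unfolding X_def by (auto intro: span_base)
    ultimately have "X = M" by (rule max)
    moreover have "(x0, a) \<in> X" unfolding X_def by (rule span_base) simp
    ultimately show False using no by auto
  qed
  \<comment> \<open>The difference of two values over one point lies over 0, where the bound is 0;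
    both signs together force equality.\<close>
  have uniq: "r = s" if "(x, r) \<in> M" "(x, s) \<in> M" for x r s
  proof -
    have "(0, r - s) \<in> M" "(0, s - r) \<in> M"
      using subspace_diff[OF sM that] subspace_diff[OF sM that(2,1)] by auto
    then show ?thesis using bM[of 0 "r - s"] bM[of 0 "s - r"] by auto
  qed
  define L where "L x = (THE r. (x, r) \<in> M)" for x
  have L: "(x, L x) \<in> M" for x
    unfolding L_def using total uniq by (metis theI)
  have Leq: "L x = r" if "(x, r) \<in> M" for x r using L uniq that by blast
  have lin: "linear L"
  proof (rule linearI)
    show "L (x + y) = L x + L y" for x y
      using subspace_add[OF sM L L, of x y] by (intro Leq) simp
    show "L (c *\<^sub>R x) = c *\<^sub>R L x" for c x
      using subspace_scale[OF sM L, of c x] by (intro Leq) simp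
  qed
  have bnd: "\<bar>L x\<bar> \<le> C * norm x" for x
    using bM[OF L, of x] bM[OF L, of "- x"] linear_neg[OF lin, of x] by auto
  have "bounded_linear L"
    using lin bnd by (intro bounded_linear_intro[where K = C])
      (auto simp: linear_add linear_scale mult.commute)
  moreover have "L x = g x" if "x \<in> S" for x
    using that G0M by (intro Leq) (auto simp: G0_def)
  ultimately show ?thesis using bnd that by blast
qed

text \<open>Bounds for vector-valued integrals, and later the measurability of norms, are reduced to
  real-valued statements through such a functional.\<close>

lemma norming_functional:
  fixes v :: "'a::real_normed_vector"
  obtains L where "bounded_linear L" "L v = norm v" "\<And>x. \<bar>L x\<bar> \<le> norm x"
proof (cases "v = 0")
  case True
  show ?thesis by (rule that[of "\<lambda>_. 0"]) (use True in auto)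
next
  case False
  \<comment> \<open>The coefficient of a multiple of \<open>v\<close> is unique because
    \<open>v\<close> is nonzero, so the choice is the coordinate on the line through
    \<open>v\<close>.\<close>
  define g where "g x = (SOME c. x = c *\<^sub>R v) * norm v" for x
  have g: "g (c *\<^sub>R v) = c * norm v" for c
  proof -
    have "c *\<^sub>R v = (SOME d. c *\<^sub>R v = d *\<^sub>R v) *\<^sub>R v" by (rule someI[of _ c]) simp
    then show ?thesis using False by (simp add: g_def)
  qed
  have sp: "span {v} = range (\<lambda>c. c *\<^sub>R v)" by (simp add: span_singleton)
  obtain L where L: "bounded_linear L" "\<And>x. x \<in> span {v} \<Longrightarrow> L x = g x" "\<And>x. \<bar>L x\<bar> \<le> 1 * norm x"
  proof (rule hahn_banach_extension[of "span {v}" 1 g])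
    show "g (x + y) = g x + g y" if "x \<in> span {v}" "y \<in> span {v}" for x y
    proof -
      obtain d e where "x = d *\<^sub>R v" "y = e *\<^sub>R v"
        using \<open>x \<in> span {v}\<close> \<open>y \<in> span {v}\<close> by (auto simp: sp)
      then show ?thesis using g[of d] g[of e] g[of "d + e"] by (simp add: algebra_simps)
    qed
    show "g (c *\<^sub>R x) = c * g x" if "x \<in> span {v}" for c x
    proof -
      obtain d where "x = d *\<^sub>R v" using \<open>x \<in> span {v}\<close> by (auto simp: sp)
      then show ?thesis using g[of d] g[of "c * d"] by simp
    qed
    show "\<bar>g x\<bar> \<le> 1 * norm x" if "x \<in> span {v}" for x
      using that by (auto simp: sp g abs_mult)
  qed (auto simp: subspace_span)
  have "L v = norm v" using L(2)[of v] g[of 1] by (simp add: span_base)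
  then show ?thesis using L that by auto
qed

section \<open>Bounded algebras of functions determine measures\<close>

lemma poly_indicator_approx:
  fixes a C :: real
  obtains p :: "nat \<Rightarrow> real poly" where
    "\<And>r. \<bar>r\<bar> \<le> C \<Longrightarrow> (\<lambda>n. poly (p n) r) \<longlonglongrightarrow> (if r > a then 1 else 0)"
    "\<And>n r. \<bar>r\<bar> \<le> C \<Longrightarrow> \<bar>poly (p n) r\<bar> \<le> 2"
proof -
  \<comment> \<open>A ramp rising from 0 at \<open>a\<close> to 1 at \<open>a + 1/n\<close>. It is 0
    at \<open>a\<close> itself, so the limit is the indicator of the strict inequality.
    Approximation up to \<open>1/(n+1)\<close> keeps the limit and bounds the polynomials by 1 +
    1.\<close>
  define h where "h n r = min 1 (max 0 (real n * (r - a)))" for n r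
  have "\<exists>p :: real poly. \<forall>r\<in>{-C..C}. \<bar>h n r - poly p r\<bar> < 1 / (real n + 1)" for n
  proof -
    have "continuous_on {-C..C} (h n)" unfolding h_def by (intro continuous_intros)
    then obtain g where g: "real_polynomial_function g" "\<And>r. r \<in> {-C..C} \<Longrightarrow> \<bar>h n r - g r\<bar> < 1 / (real n + 1)"
      using Stone_Weierstrass_real_polynomial_function[of "{-C..C}" "h n" "1 / (real n + 1)"] by auto
    obtain c m where "g = (\<lambda>x. \<Sum>i\<le>m. c i * x ^ i)"
      using g(1) unfolding real_polynomial_function_iff_sum by blast
    then have "poly (\<Sum>i\<le>m. monom (c i) i) r = g r" for r by (simp add: poly_sum poly_monom)
    then show ?thesis using g(2) by (intro exI[of _ "\<Sum>i\<le>m. monom (c i) i"]) auto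
  qed
  then obtain p :: "nat \<Rightarrow> real poly" where p: "\<And>n r. r \<in> {-C..C} \<Longrightarrow> \<bar>h n r - poly (p n) r\<bar> < 1 / (real n + 1)"
    by metis
  have hlim: "(\<lambda>n. h n r) \<longlonglongrightarrow> (if r > a then 1 else 0)" for r
  proof (cases "r > a")
    case True
    have "eventually (\<lambda>n. real n > 1 / (r - a)) sequentially"
      using filterlim_real_sequentially by (simp add: filterlim_at_top_dense)
    then have "eventually (\<lambda>n. h n r = 1) sequentially"
      by eventually_elim (use True in \<open>auto simp: h_def field_simps min_def max_def\<close>)
    then show ?thesis using True tendsto_eventually by auto
  next
    case False
    have "h n r = 0" for n
      using False mult_nonneg_nonpos[of "real n" "r - a"] by (auto simp: h_def)
    then show ?thesis using False by simp
  qed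
  show ?thesis
  proof (rule that)
    fix r assume r: "\<bar>r\<bar> \<le> C"
    then have r': "r \<in> {-C..C}" by auto
    have "(\<lambda>n. h n r - poly (p n) r) \<longlonglongrightarrow> 0"
    proof (rule Lim_null_comparison)
      show "(\<lambda>n. 1 / (real n + 1)) \<longlonglongrightarrow> 0" using LIMSEQ_inverse_real_of_nat by (simp add: inverse_eq_divide add.commute)
      show "\<forall>\<^sub>F n in sequentially. norm (h n r - poly (p n) r) \<le> 1 / (real n + 1)"
        using p[OF r'] by (auto intro!: always_eventually less_imp_le)
    qed
    from tendsto_diff[OF hlim[of r] this] show "(\<lambda>n. poly (p n) r) \<longlonglongrightarrow> (if r > a then 1 else 0)"
      by (simp del: if_split_asm split del: if_split)
    fix n
    have "\<bar>h n r\<bar> \<le> 1" by (auto simp: h_def)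
    moreover have "1 / (real n + 1) \<le> 1" by simp
    ultimately show "\<bar>poly (p n) r\<bar> \<le> 2" using p[OF r', of n] by linarith
  qed
qed

text \<open>Boundedness puts the range of each \<open>f\<close> into a compact interval, where
  polynomials approximate indicators of half-lines. Polynomials in \<open>f\<close> stay in the
  algebra, so integrals against indicators agree as well, and a Dynkin argument finishes. No
  topology on the underlying space enters.\<close>

lemma algebra_determines_measure:
  fixes \<A> :: "('a \<Rightarrow> real) set"
  assumes M: "prob_space M" and N: "prob_space N" and sets: "sets N = sets M"
    and meas: "\<And>f. f \<in> \<A> \<Longrightarrow> f \<in> borel_measurable M"
    and bdd: "\<And>f. f \<in> \<A> \<Longrightarrow> \<exists>B. \<forall>x\<in>space M. \<bar>f x\<bar> \<le> B"
    and add: "\<And>f g. f \<in> \<A> \<Longrightarrow> g \<in> \<A> \<Longrightarrow> (\<lambda>x. f x + g x) \<in> \<A>"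
    and mult: "\<And>f g. f \<in> \<A> \<Longrightarrow> g \<in> \<A> \<Longrightarrow> (\<lambda>x. f x * g x) \<in> \<A>"
    and const: "\<And>c. (\<lambda>x. c) \<in> \<A>"
    and int: "\<And>f. f \<in> \<A> \<Longrightarrow> (\<integral>x. f x \<partial>M) = (\<integral>x. f x \<partial>N)"
    and A: "A \<in> sigma_sets (space M) {{x\<in>space M. f x > a} | f a. f \<in> \<A>}"
  shows "A \<in> sets M" "emeasure M A = emeasure N A"
proof -
  interpret M: prob_space M by fact
  interpret N: prob_space N by fact
  have space: "space N = space M" using sets by (rule sets_eq_imp_space_eq)
  have polyA: "(\<lambda>x. poly p (f x)) \<in> \<A>" if "f \<in> \<A>" for f p
    by (induction p) (use const add mult that in auto)
  \<comment> \<open>Finite intersections of superlevel sets, indexed by lists; concatenation of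
    lists is intersection, which makes the generator intersection-stable.\<close>
  define R where "R L = {x\<in>space M. \<forall>(f, a)\<in>set L. f x > a}" for L :: "(('a \<Rightarrow> real) \<times> real) list"
  define G where "G = {R L | L. fst ` set L \<subseteq> \<A>}"
  have RM: "R L \<in> sets M" if "fst ` set L \<subseteq> \<A>" for L
    using that
  proof (induction L)
    case (Cons z L)
    obtain f a where z: "z = (f, a)" by force
    have [measurable]: "f \<in> borel_measurable M" using Cons z meas by auto
    have "R (z # L) = {x\<in>space M. f x > a} \<inter> R L" by (auto simp: R_def z)
    moreover have "R L \<in> sets M" using Cons by auto
    ultimately show ?case by auto
  qed (simp add: R_def)
  \<comment> \<open>The weight \<open>g\<close> stays arbitrary: one indicator after the other is
    replaced by polynomials, which the induction hypothesis absorbs into the weight.\<close>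
  have key: "(\<integral>x. g x * indicator (R L) x \<partial>M) = (\<integral>x. g x * indicator (R L) x \<partial>N)"
    if "fst ` set L \<subseteq> \<A>" "g \<in> \<A>" for L g
    using that
  proof (induction L arbitrary: g)
    case Nil
    have "(\<integral>x. g x * indicator (R []) x \<partial>M) = (\<integral>x. g x \<partial>M)"
      by (intro Bochner_Integration.integral_cong) (auto simp: R_def)
    moreover have "(\<integral>x. g x * indicator (R []) x \<partial>N) = (\<integral>x. g x \<partial>N)"
      by (intro Bochner_Integration.integral_cong) (auto simp: R_def space)
    ultimately show ?case using int[OF Nil(2)] by simp
  next
    case (Cons z L)
    obtain f a where z: "z = (f, a)" by force
    have f: "f \<in> \<A>" and L: "fst ` set L \<subseteq> \<A>" and g: "g \<in> \<A>" using Cons z by auto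
    obtain B where B: "\<And>x. x \<in> space M \<Longrightarrow> \<bar>f x\<bar> \<le> B" using bdd[OF f] by auto
    obtain E where E: "\<And>x. x \<in> space M \<Longrightarrow> \<bar>g x\<bar> \<le> E" using bdd[OF g] by auto
    obtain p :: "nat \<Rightarrow> real poly" where
      p: "\<And>r. \<bar>r\<bar> \<le> B \<Longrightarrow> (\<lambda>n. poly (p n) r) \<longlonglongrightarrow> (if r > a then 1 else 0)"
         "\<And>n r. \<bar>r\<bar> \<le> B \<Longrightarrow> \<bar>poly (p n) r\<bar> \<le> 2"
      using poly_indicator_approx by blast
    have lim: "(\<lambda>n. \<integral>x. (poly (p n) (f x) * g x) * indicator (R L) x \<partial>Q)
        \<longlonglongrightarrow> (\<integral>x. g x * indicator (R (z # L)) x \<partial>Q)"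
      if Q: "prob_space Q" "sets Q = sets M" for Q
    proof (rule integral_dominated_convergence[where w = "\<lambda>_. 2 * E"])
      interpret Q: prob_space Q by fact
      have sp: "space Q = space M" using Q(2) by (rule sets_eq_imp_space_eq)
      have mc: "measurable Q borel = measurable M (borel :: real measure)"
        using Q(2) by (rule measurable_cong_sets) simp
      have [measurable]: "f \<in> borel_measurable Q" "g \<in> borel_measurable Q"
        "R L \<in> sets Q" "R (z # L) \<in> sets Q"
        "\<And>n. (\<lambda>x. poly (p n) (f x)) \<in> borel_measurable Q"
        using meas[OF f] meas[OF g] RM[OF L] RM[OF Cons.prems(1)] meas[OF polyA[OF f]] Q(2)
        by (auto simp: mc)
      show "(\<lambda>x. g x * indicator (R (z # L)) x) \<in> borel_measurable Q" by measurable
      show "(\<lambda>x. poly (p n) (f x) * g x * indicator (R L) x) \<in> borel_measurable Q" for n by measurable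
      show "integrable Q (\<lambda>_. 2 * E)" by simp
      show "AE x in Q. (\<lambda>n. poly (p n) (f x) * g x * indicator (R L) x)
          \<longlonglongrightarrow> g x * indicator (R (z # L)) x"
      proof (intro AE_I2)
        fix x assume "x \<in> space Q"
        then have x: "x \<in> space M" using sp by simp
        have "(\<lambda>n. poly (p n) (f x) * g x * indicator (R L) x)
          \<longlonglongrightarrow> (if f x > a then 1 else 0) * g x * indicator (R L) x"
          by (intro tendsto_intros p(1) B x)
        also have "(if f x > a then 1 else 0) * g x * indicator (R L) x = g x * indicator (R (z # L)) x"
          using x by (auto simp: R_def z indicator_def)
        finally show "(\<lambda>n. poly (p n) (f x) * g x * indicator (R L) x)
          \<longlonglongrightarrow> g x * indicator (R (z # L)) x" .
      qed
      show "AE x in Q. norm (poly (p n) (f x) * g x * indicator (R L) x) \<le> 2 * E" for n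
      proof (intro AE_I2)
        fix x assume "x \<in> space Q"
        then have x: "x \<in> space M" using sp by simp
        have "\<bar>poly (p n) (f x)\<bar> * \<bar>g x\<bar> * \<bar>indicator (R L) x\<bar> \<le> 2 * E * 1"
          using p(2)[OF B[OF x], of n] E[OF x]
          by (intro mult_mono) (auto intro: order_trans[OF abs_ge_zero])
        then show "norm (poly (p n) (f x) * g x * indicator (R L) x) \<le> 2 * E" by (simp add: abs_mult)
      qed
    qed
    have "(\<integral>x. (poly (p n) (f x) * g x) * indicator (R L) x \<partial>M)
        = (\<integral>x. (poly (p n) (f x) * g x) * indicator (R L) x \<partial>N)" for n
      by (rule Cons.IH[OF L]) (intro mult polyA f g)
    then show ?case using LIMSEQ_unique[OF lim[OF M refl]] lim[OF N sets] by simp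
  qed
  have G_eq: "emeasure M X = emeasure N X" if X: "X \<in> G" for X
  proof -
    obtain L where L: "X = R L" "fst ` set L \<subseteq> \<A>" using X unfolding G_def by blast
    have "measure M X = measure N X"
      using key[OF L(2) const[of 1]] L(1) RM[OF L(2)] sets by simp
    then show ?thesis by (simp add: M.emeasure_eq_measure N.emeasure_eq_measure)
  qed
  have GM: "G \<subseteq> sets M" using RM by (auto simp: G_def)
  have stable: "Int_stable G"
  proof (rule Int_stableI)
    fix X Y assume "X \<in> G" "Y \<in> G"
    then obtain L K where "X = R L" "Y = R K" "fst ` set L \<subseteq> \<A>" "fst ` set K \<subseteq> \<A>" by (auto simp: G_def)
    moreover have "R L \<inter> R K = R (L @ K)" by (auto simp: R_def)
    ultimately show "X \<inter> Y \<in> G" unfolding G_def by (force intro!: exI[of _ "L @ K"])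
  qed
  have base: "{{x\<in>space M. f x > a} | f a. f \<in> \<A>} \<subseteq> G"
  proof clarify
    fix f a assume "f \<in> \<A>"
    then show "{x\<in>space M. f x > a} \<in> G"
      unfolding G_def by (intro CollectI exI[of _ "[(f, a)]"]) (auto simp: R_def)
  qed
  have AG: "A \<in> sigma_sets (space M) G" using A sigma_sets_mono'[OF base] by auto
  have subP: "G \<subseteq> Pow (space M)" by (auto simp: G_def R_def)
  have "A \<in> sets M \<and> emeasure M A = emeasure N A"
    using stable subP AG
  proof (induction rule: sigma_sets_induct_disjoint)
    case (basic X) then show ?case using G_eq GM by auto
  next
    case empty then show ?case by simp
  next
    case (compl X)
    then have XM: "X \<in> sets M" and XN: "X \<in> sets N" and eq: "measure M X = measure N X"
      using sets by (auto simp: M.emeasure_eq_measure N.emeasure_eq_measure)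
    have "measure M (space M - X) = measure N (space M - X)"
      using M.prob_compl[OF XM] N.prob_compl[OF XN] eq unfolding space by simp
    then show ?case using XM by (simp add: M.emeasure_eq_measure N.emeasure_eq_measure)
  next
    case (union X)
    then have XM: "range X \<subseteq> sets M" "range X \<subseteq> sets N" using sets by auto
    have "emeasure M (\<Union>i. X i) = (\<Sum>i. emeasure M (X i))"
      using union by (intro suminf_emeasure[symmetric] XM) auto
    also have "\<dots> = (\<Sum>i. emeasure N (X i))" using union by simp
    also have "\<dots> = emeasure N (\<Union>i. X i)"
      using union by (intro suminf_emeasure XM) auto
    finally show ?case using sets.countable_UN[OF XM(1)] by simp
  qed
  then show "A \<in> sets M" "emeasure M A = emeasure N A" by auto
qed

section \<open>Bochner integrals without separability\<close>

abbreviation "sbi \<equiv> Bochner_Integration.simple_bochner_integrable"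
abbreviation "sint \<equiv> Bochner_Integration.simple_bochner_integral"

lemma sbi_simple: "sbi M s \<Longrightarrow> simple_function M s"
  by (auto elim: simple_bochner_integrable.cases)

lemma sbi_measurable: "sbi M s \<Longrightarrow> s \<in> borel_measurable M"
  by (intro borel_measurable_simple_function sbi_simple)

text \<open>Subtraction need not be Borel on a nonseparable space. A simple function has finitely
  many values, so the difference is, piece by piece, \<open>f\<close> minus a constant.\<close>

lemma borel_measurable_norm_diff_simple:
  fixes f s :: "'a \<Rightarrow> 'b::real_normed_vector"
  assumes f: "f \<in> borel_measurable M" and s: "simple_function M s"
  shows "(\<lambda>x. norm (f x - s x)) \<in> borel_measurable M"
proof -
  have fin: "finite (s ` space M)" using s by (auto simp: simple_function_def)
  have "(\<lambda>x. norm (f x - y)) \<in> borel_measurable M" for y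
    using f by (rule measurable_compose) (intro borel_measurable_continuous_onI continuous_intros)
  moreover have "{x\<in>space M. s x = y} \<in> sets M" if "y \<in> s ` space M" for y
    using that s by (auto simp: simple_function_def vimage_def Int_def conj_commute)
  ultimately have "(\<lambda>x. \<Sum>y\<in>s ` space M. norm (f x - y) * indicator {x\<in>space M. s x = y} x) \<in> borel_measurable M"
    by (intro borel_measurable_sum borel_measurable_times borel_measurable_indicator) auto
  moreover have "(\<Sum>y\<in>s ` space M. norm (f x - y) * indicator {x\<in>space M. s x = y} x) = norm (f x - s x)"
    if "x \<in> space M" for x
  proof -
    have "(\<Sum>y\<in>s ` space M. norm (f x - y) * indicator {x\<in>space M. s x = y} x)
        = (\<Sum>y\<in>{s x}. norm (f x - y) * indicator {x\<in>space M. s x = y} x)"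
      using fin that by (intro sum.mono_neutral_right) (auto simp: indicator_def)
    then show ?thesis using that by simp
  qed
  ultimately show ?thesis by (simp cong: measurable_cong)
qed

lemma nn_integral_norm_triangle:
  fixes f g h :: "'a \<Rightarrow> 'b::real_normed_vector"
  assumes "(\<lambda>x. norm (f x - g x)) \<in> borel_measurable M" "(\<lambda>x. norm (g x - h x)) \<in> borel_measurable M"
  shows "(\<integral>\<^sup>+x. norm (f x - h x) \<partial>M) \<le> (\<integral>\<^sup>+x. norm (f x - g x) \<partial>M) + (\<integral>\<^sup>+x. norm (g x - h x) \<partial>M)"
proof -
  have "norm (f x - h x) \<le> norm (f x - g x) + norm (g x - h x)" for x
    using norm_triangle_ineq[of "f x - g x" "g x - h x"] by simp
  then have "(\<integral>\<^sup>+x. norm (f x - h x) \<partial>M) \<le> (\<integral>\<^sup>+x. ennreal (norm (f x - g x)) + ennreal (norm (g x - h x)) \<partial>M)"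
    by (intro nn_integral_mono) (simp flip: ennreal_plus)
  also have "\<dots> = (\<integral>\<^sup>+x. norm (f x - g x) \<partial>M) + (\<integral>\<^sup>+x. norm (g x - h x) \<partial>M)"
    using assms by (intro nn_integral_add) auto
  finally show ?thesis .
qed

lemma norm_sint_diff_le:
  fixes s t :: "'a \<Rightarrow> 'b::real_normed_vector"
  assumes s: "sbi M s" and t: "sbi M t"
  shows "ennreal (norm (sint M s - sint M t)) \<le> (\<integral>\<^sup>+x. norm (s x - t x) \<partial>M)"
proof -
  have d: "sbi M (\<lambda>x. s x - t x)" using simple_bochner_integrable_compose2[of "(-)" M s t] s t by simp
  have "norm (sint M s - sint M t) = norm (sint M (\<lambda>x. s x - t x))"
    using s t by (simp add: simple_bochner_integral_diff)
  also have "\<dots> \<le> sint M (\<lambda>x. norm (s x - t x))" by (rule simple_bochner_integral_norm_bound[OF d])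
  also have "ennreal \<dots> = (\<integral>\<^sup>+x. norm (s x - t x) \<partial>M)"
    using simple_bochner_integrable_compose2[of "\<lambda>x y. norm (x - y)" M s t] s t
    by (intro simple_bochner_integral_eq_nn_integral) auto
  finally show ?thesis by (simp add: ennreal_leI)
qed

text \<open>The two approximating sequences are compared through \<open>f\<close>, so measurability
  is only asked of the distance of \<open>f\<close> to a simple function; almost everywhere equality
  then exchanges \<open>f\<close> for \<open>g\<close> under the integral sign.\<close>

lemma has_banach_integral_AE_unique:
  fixes f g :: "'a \<Rightarrow> 'b::banach"
  assumes f: "has_banach_integral M f I" and g: "has_banach_integral M g J" and ae: "AE x in M. f x = g x"
  shows "I = J"
proof -
  obtain s t where s: "\<And>i. sbi M (s i)" "(\<lambda>i. \<integral>\<^sup>+x. norm (f x - s i x) \<partial>M) \<longlonglongrightarrow> 0" "(\<lambda>i. sint M (s i)) \<longlonglongrightarrow> I"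
    and t: "\<And>i. sbi M (t i)" "(\<lambda>i. \<integral>\<^sup>+x. norm (g x - t i x) \<partial>M) \<longlonglongrightarrow> 0" "(\<lambda>i. sint M (t i)) \<longlonglongrightarrow> J"
    and mf: "f \<in> borel_measurable M"
    using f g unfolding has_banach_integral_def by blast
  have le: "ennreal (norm (sint M (s i) - sint M (t i)))
      \<le> (\<integral>\<^sup>+x. norm (f x - s i x) \<partial>M) + (\<integral>\<^sup>+x. norm (g x - t i x) \<partial>M)" for i
  proof -
    have ms: "(\<lambda>x. norm (s i x - f x)) \<in> borel_measurable M"
      using borel_measurable_norm_diff_simple[OF mf sbi_simple[OF s(1)]] by (simp add: norm_minus_commute)
    have mt: "(\<lambda>x. norm (f x - t i x)) \<in> borel_measurable M"
      by (rule borel_measurable_norm_diff_simple[OF mf sbi_simple[OF t(1)]])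
    have "ennreal (norm (sint M (s i) - sint M (t i))) \<le> (\<integral>\<^sup>+x. norm (s i x - t i x) \<partial>M)"
      by (rule norm_sint_diff_le) fact+
    also have "\<dots> \<le> (\<integral>\<^sup>+x. norm (s i x - f x) \<partial>M) + (\<integral>\<^sup>+x. norm (f x - t i x) \<partial>M)"
      by (rule nn_integral_norm_triangle[OF ms mt])
    also have "(\<integral>\<^sup>+x. norm (f x - t i x) \<partial>M) = (\<integral>\<^sup>+x. norm (g x - t i x) \<partial>M)"
      by (rule nn_integral_cong_AE) (use ae in auto)
    finally show ?thesis by (simp add: norm_minus_commute)
  qed
  have "(\<lambda>i. ennreal (norm (sint M (s i) - sint M (t i)))) \<longlonglongrightarrow> 0"
  proof (rule tendsto_sandwich[OF _ _ tendsto_const])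
    show "(\<lambda>i. (\<integral>\<^sup>+x. norm (f x - s i x) \<partial>M) + (\<integral>\<^sup>+x. norm (g x - t i x) \<partial>M)) \<longlonglongrightarrow> 0"
      using tendsto_add[OF s(2) t(2)] by simp
  qed (use le in auto)
  moreover have "(\<lambda>i. ennreal (norm (sint M (s i) - sint M (t i)))) \<longlonglongrightarrow> ennreal (norm (I - J))"
    by (intro tendsto_intros s t)
  ultimately have "ennreal (norm (I - J)) = 0" by (metis LIMSEQ_unique)
  then show ?thesis by simp
qed

text \<open>On a nonseparable space a sum of Borel functions need not be Borel. Everywhere pointwise limits
  of simple functions do not have this defect.\<close>

definition nice :: "'a measure \<Rightarrow> ('a \<Rightarrow> 'b::real_normed_vector) \<Rightarrow> bool" where
  "nice M g \<longleftrightarrow> (\<exists>s. (\<forall>k. sbi M (s k)) \<and> (\<forall>x\<in>space M. (\<lambda>k. s k x) \<longlonglongrightarrow> g x) \<and>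
     (\<lambda>k. \<integral>\<^sup>+x. norm (g x - s k x) \<partial>M) \<longlonglongrightarrow> 0)"

definition bint :: "'a measure \<Rightarrow> ('a \<Rightarrow> 'b::banach) \<Rightarrow> 'b" where
  "bint M g = (THE I. has_banach_integral M g I)"

lemma nice_measurable:
  assumes "nice M g" shows "g \<in> borel_measurable M"
proof -
  obtain s where "\<And>k. sbi M (s k)" "\<And>x. x \<in> space M \<Longrightarrow> (\<lambda>k. s k x) \<longlonglongrightarrow> g x"
    using assms unfolding nice_def by blast
  then show ?thesis using borel_measurable_LIMSEQ_metric[of s M g] sbi_measurable by blast
qed

lemma nice_integral_exists:
  fixes g :: "'a \<Rightarrow> 'b::banach"
  assumes "nice M g" shows "\<exists>I. has_banach_integral M g I"
proof -
  obtain s where s: "\<And>k. sbi M (s k)" "(\<lambda>k. \<integral>\<^sup>+x. norm (g x - s k x) \<partial>M) \<longlonglongrightarrow> 0"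
    using assms unfolding nice_def by blast
  note g = nice_measurable[OF assms]
  have le: "ennreal (norm (sint M (s i) - sint M (s j)))
      \<le> (\<integral>\<^sup>+x. norm (g x - s i x) \<partial>M) + (\<integral>\<^sup>+x. norm (g x - s j x) \<partial>M)" for i j
  proof -
    have m: "(\<lambda>x. norm (g x - s i x)) \<in> borel_measurable M" for i
      by (rule borel_measurable_norm_diff_simple[OF g sbi_simple[OF s(1)]])
    have m': "(\<lambda>x. norm (s i x - g x)) \<in> borel_measurable M" for i
      using m by (simp add: norm_minus_commute)
    have "ennreal (norm (sint M (s i) - sint M (s j))) \<le> (\<integral>\<^sup>+x. norm (s i x - s j x) \<partial>M)"
      by (rule norm_sint_diff_le) fact+
    also have "\<dots> \<le> (\<integral>\<^sup>+x. norm (s i x - g x) \<partial>M) + (\<integral>\<^sup>+x. norm (g x - s j x) \<partial>M)"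
      by (rule nn_integral_norm_triangle[OF m' m])
    finally show ?thesis by (simp add: norm_minus_commute)
  qed
  have "Cauchy (\<lambda>i. sint M (s i))"
  proof (rule metric_CauchyI)
    fix e :: real assume e: "0 < e"
    have "eventually (\<lambda>i. (\<integral>\<^sup>+x. norm (g x - s i x) \<partial>M) < ennreal (e/2)) sequentially"
      using order_tendstoD(2)[OF s(2), of "ennreal (e/2)"] e by auto
    then obtain N where N: "\<And>i. i \<ge> N \<Longrightarrow> (\<integral>\<^sup>+x. norm (g x - s i x) \<partial>M) < ennreal (e/2)"
      by (auto simp: eventually_sequentially)
    show "\<exists>N. \<forall>i\<ge>N. \<forall>j\<ge>N. dist (sint M (s i)) (sint M (s j)) < e"
    proof (intro exI allI impI)
      fix i j assume ij: "i \<ge> N" "j \<ge> N"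
      have "ennreal (norm (sint M (s i) - sint M (s j))) < ennreal (e/2) + ennreal (e/2)"
        using le[of i j] add_strict_mono[OF N[OF ij(1)] N[OF ij(2)]] by (rule le_less_trans)
      also have "\<dots> = ennreal e" using e by (simp flip: ennreal_plus)
      finally show "dist (sint M (s i)) (sint M (s j)) < e"
        using e by (simp add: dist_norm ennreal_less_iff)
    qed
  qed
  then obtain I where "(\<lambda>i. sint M (s i)) \<longlonglongrightarrow> I" by (auto simp: Cauchy_convergent_iff convergent_def)
  then show ?thesis unfolding has_banach_integral_def using s g by blast
qed

lemma has_banach_integral_unique:
  "has_banach_integral M f I \<Longrightarrow> has_banach_integral M f J \<Longrightarrow> I = J"
  by (rule has_banach_integral_AE_unique) auto

lemma nice_has_integral: "nice M g \<Longrightarrow> has_banach_integral M g (bint M g)"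
  unfolding bint_def using nice_integral_exists has_banach_integral_unique by (metis (mono_tags) theI)

lemma bint_eqI_has: "has_banach_integral M g I \<Longrightarrow> bint M g = I"
  unfolding bint_def using has_banach_integral_unique by blast

lemma has_banach_integral_real:
  fixes f :: "'a \<Rightarrow> real"
  shows "has_banach_integral M f I \<longleftrightarrow> has_bochner_integral M f I"
  unfolding has_banach_integral_def has_bochner_integral.simps by auto

text \<open>Continuity gives pointwise convergence, the Lipschitz bound gives L1 convergence, and
  \<open>T 0 = 0\<close> keeps the supports of the simple functions of finite measure.\<close>

lemma nice_compose:
  assumes T: "continuous_on UNIV T" "T 0 = 0" and K: "\<And>x y. norm (T x - T y) \<le> K * norm (x - y)" and g: "nice M g"
  shows "nice M (\<lambda>x. T (g x))"
proof -
  obtain s where s: "\<And>k. sbi M (s k)" "\<And>x. x \<in> space M \<Longrightarrow> (\<lambda>k. s k x) \<longlonglongrightarrow> g x"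
     "(\<lambda>k. \<integral>\<^sup>+x. norm (g x - s k x) \<partial>M) \<longlonglongrightarrow> 0"
    using g unfolding nice_def by blast
  define K' where "K' = max K 0"
  have K': "K' \<ge> 0" "norm (T x - T y) \<le> K' * norm (x - y)" for x y
    using K[of x y] by (auto simp: K'_def intro: order_trans[OF _ mult_right_mono])
  have m: "(\<lambda>x. norm (g x - s i x)) \<in> borel_measurable M" for i
    by (rule borel_measurable_norm_diff_simple[OF nice_measurable[OF g] sbi_simple[OF s(1)]])
  have "(\<lambda>k. \<integral>\<^sup>+x. norm (T (g x) - T (s k x)) \<partial>M) \<longlonglongrightarrow> 0"
  proof (rule tendsto_sandwich[OF _ _ tendsto_const])
    show "\<forall>\<^sub>F k in sequentially. (\<integral>\<^sup>+x. norm (T (g x) - T (s k x)) \<partial>M) \<le> ennreal K' * (\<integral>\<^sup>+x. norm (g x - s k x) \<partial>M)"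
    proof (intro always_eventually allI)
      fix k
      have "(\<integral>\<^sup>+x. norm (T (g x) - T (s k x)) \<partial>M) \<le> (\<integral>\<^sup>+x. ennreal K' * ennreal (norm (g x - s k x)) \<partial>M)"
        using K' by (intro nn_integral_mono) (simp flip: ennreal_mult add: ennreal_leI)
      then show "(\<integral>\<^sup>+x. norm (T (g x) - T (s k x)) \<partial>M) \<le> ennreal K' * (\<integral>\<^sup>+x. norm (g x - s k x) \<partial>M)"
        using m by (simp add: nn_integral_cmult)
    qed
    show "(\<lambda>k. ennreal K' * (\<integral>\<^sup>+x. norm (g x - s k x) \<partial>M)) \<longlonglongrightarrow> 0"
      using ennreal_tendsto_cmult[OF _ s(3), of "ennreal K'"] by simp
  qed auto
  moreover have "sbi M (\<lambda>x. T (s k x))" for k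
    using simple_bochner_integrable_compose2[of "\<lambda>x y. T x" M "s k" "s k"] s(1) T(2) by simp
  moreover have "(\<lambda>k. T (s k x)) \<longlonglongrightarrow> T (g x)" if "x \<in> space M" for x
    using s(2)[OF that] T(1) by (auto intro: continuous_on_tendsto_compose[of UNIV T])
  ultimately show ?thesis unfolding nice_def by (intro exI[of _ "\<lambda>k x. T (s k x)"]) auto
qed

lemma nice_bounded_linear:
  assumes "bounded_linear L" "nice M g" shows "nice M (\<lambda>x. L (g x))"
proof -
  interpret bounded_linear L by fact
  obtain K where K: "\<And>x. norm (L x) \<le> norm x * K" using bounded by blast
  show ?thesis
    by (rule nice_compose[where K = K]) (use K assms zero in \<open>auto intro: linear_continuous_on simp: diff[symmetric] mult.commute\<close>)
qed

lemma nice_norm: "nice M g \<Longrightarrow> nice M (\<lambda>x. norm (g x))"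
  by (rule nice_compose[where K = 1]) (auto intro: continuous_intros norm_triangle_ineq3)

text \<open>Sums and differences are obtained below as linear images of pairs, which circumvents the
  measurability of addition.\<close>

lemma nice_Pair:
  assumes f: "nice M f" and g: "nice M g" shows "nice M (\<lambda>x. (f x, g x))"
proof -
  obtain s where s: "\<And>k. sbi M (s k)" "\<And>x. x \<in> space M \<Longrightarrow> (\<lambda>k. s k x) \<longlonglongrightarrow> f x"
     "(\<lambda>k. \<integral>\<^sup>+x. norm (f x - s k x) \<partial>M) \<longlonglongrightarrow> 0"
    using f unfolding nice_def by blast
  obtain t where t: "\<And>k. sbi M (t k)" "\<And>x. x \<in> space M \<Longrightarrow> (\<lambda>k. t k x) \<longlonglongrightarrow> g x"
     "(\<lambda>k. \<integral>\<^sup>+x. norm (g x - t k x) \<partial>M) \<longlonglongrightarrow> 0"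
    using g unfolding nice_def by blast
  have ms: "(\<lambda>x. norm (f x - s i x)) \<in> borel_measurable M" for i
    by (rule borel_measurable_norm_diff_simple[OF nice_measurable[OF f] sbi_simple[OF s(1)]])
  have mt: "(\<lambda>x. norm (g x - t i x)) \<in> borel_measurable M" for i
    by (rule borel_measurable_norm_diff_simple[OF nice_measurable[OF g] sbi_simple[OF t(1)]])
  have "(\<lambda>k. \<integral>\<^sup>+x. norm ((f x, g x) - (s k x, t k x)) \<partial>M) \<longlonglongrightarrow> 0"
  proof (rule tendsto_sandwich[OF _ _ tendsto_const])
    show "\<forall>\<^sub>F k in sequentially. (\<integral>\<^sup>+x. norm ((f x, g x) - (s k x, t k x)) \<partial>M)
        \<le> (\<integral>\<^sup>+x. norm (f x - s k x) \<partial>M) + (\<integral>\<^sup>+x. norm (g x - t k x) \<partial>M)"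
    proof (intro always_eventually allI)
      fix k
      have "(\<integral>\<^sup>+x. norm ((f x, g x) - (s k x, t k x)) \<partial>M)
          \<le> (\<integral>\<^sup>+x. ennreal (norm (f x - s k x)) + ennreal (norm (g x - t k x)) \<partial>M)"
        using norm_Pair_le by (intro nn_integral_mono) (simp flip: ennreal_plus add: ennreal_leI)
      also have "\<dots> = (\<integral>\<^sup>+x. norm (f x - s k x) \<partial>M) + (\<integral>\<^sup>+x. norm (g x - t k x) \<partial>M)"
        using ms mt by (intro nn_integral_add) auto
      finally show "(\<integral>\<^sup>+x. norm ((f x, g x) - (s k x, t k x)) \<partial>M)
        \<le> (\<integral>\<^sup>+x. norm (f x - s k x) \<partial>M) + (\<integral>\<^sup>+x. norm (g x - t k x) \<partial>M)" .
    qed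
    show "(\<lambda>k. (\<integral>\<^sup>+x. norm (f x - s k x) \<partial>M) + (\<integral>\<^sup>+x. norm (g x - t k x) \<partial>M)) \<longlonglongrightarrow> 0"
      using tendsto_add[OF s(3) t(3)] by simp
  qed auto
  moreover have "sbi M (\<lambda>x. (s k x, t k x))" for k
  proof
    show "simple_function M (\<lambda>x. (s k x, t k x))"
      by (intro simple_function_Pair sbi_simple s t)
    have [measurable]: "s k \<in> borel_measurable M" "t k \<in> borel_measurable M"
      using sbi_measurable[OF s(1)] sbi_measurable[OF t(1)] by auto
    have "{x\<in>space M. s k x \<noteq> 0} \<in> sets M" "{x\<in>space M. t k x \<noteq> 0} \<in> sets M" by measurable
    then have "emeasure M {x\<in>space M. (s k x, t k x) \<noteq> 0}
       \<le> emeasure M {x\<in>space M. s k x \<noteq> 0} + emeasure M {x\<in>space M. t k x \<noteq> 0}"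
      by (intro order_trans[OF emeasure_mono emeasure_subadditive]) (auto simp: zero_prod_def)
    also have "\<dots> < \<infinity>"
      using s(1)[of k] t(1)[of k] by (auto elim!: simple_bochner_integrable.cases simp: top.not_eq_extremum)
    finally show "emeasure M {x\<in>space M. (s k x, t k x) \<noteq> 0} \<noteq> \<infinity>" by simp
  qed
  moreover have "(\<lambda>k. (s k x, t k x)) \<longlonglongrightarrow> (f x, g x)" if "x \<in> space M" for x
    by (intro tendsto_Pair s t that)
  ultimately show ?thesis unfolding nice_def by (intro exI[of _ "\<lambda>k x. (s k x, t k x)"]) auto
qed

lemma nice_add:
  assumes "nice M f" "nice M g" shows "nice M (\<lambda>x. f x + g x)"
  using nice_bounded_linear[OF bounded_linear_add[OF bounded_linear_fst bounded_linear_snd] nice_Pair[OF assms]] by simp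

lemma nice_diff:
  assumes "nice M f" "nice M g" shows "nice M (\<lambda>x. f x - g x)"
  using nice_bounded_linear[OF bounded_linear_sub[OF bounded_linear_fst bounded_linear_snd] nice_Pair[OF assms]] by simp

lemma nice_scaleR: "nice M f \<Longrightarrow> nice M (\<lambda>x. c *\<^sub>R f x)"
  by (rule nice_bounded_linear[OF bounded_linear_scaleR_right])

lemma nice_indicator:
  fixes g :: "'a \<Rightarrow> 'b::real_normed_vector"
  assumes g: "nice M g" and A: "A \<in> sets M" shows "nice M (\<lambda>x. indicator A x *\<^sub>R g x)"
proof -
  obtain s where s: "\<And>k. sbi M (s k)" "\<And>x. x \<in> space M \<Longrightarrow> (\<lambda>k. s k x) \<longlonglongrightarrow> g x"
     "(\<lambda>k. \<integral>\<^sup>+x. norm (g x - s k x) \<partial>M) \<longlonglongrightarrow> 0"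
    using g unfolding nice_def by blast
  have "(\<lambda>k. \<integral>\<^sup>+x. norm (indicator A x *\<^sub>R g x - indicator A x *\<^sub>R s k x) \<partial>M) \<longlonglongrightarrow> 0"
    by (rule tendsto_sandwich[OF _ _ tendsto_const s(3)])
       (auto intro!: always_eventually nn_integral_mono simp: indicator_def)
  moreover have "sbi M (\<lambda>x. indicator A x *\<^sub>R s k x)" for k
  proof
    show "simple_function M (\<lambda>x. indicator A x *\<^sub>R s k x)"
      by (rule simple_function_compose2[of M "indicator A :: _ \<Rightarrow> real" "s k" "(*\<^sub>R)"])
         (auto intro: A sbi_simple s)
    have [measurable]: "s k \<in> borel_measurable M" by (rule sbi_measurable[OF s(1)])
    have "emeasure M {x\<in>space M. indicator A x *\<^sub>R s k x \<noteq> 0} \<le> emeasure M {x\<in>space M. s k x \<noteq> 0}"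
      by (intro emeasure_mono) auto
    also have "\<dots> < \<infinity>"
      using s(1)[of k] by (auto elim!: simple_bochner_integrable.cases simp: top.not_eq_extremum)
    finally show "emeasure M {x\<in>space M. indicator A x *\<^sub>R s k x \<noteq> 0} \<noteq> \<infinity>" by simp
  qed
  moreover have "(\<lambda>k. indicator A x *\<^sub>R s k x) \<longlonglongrightarrow> indicator A x *\<^sub>R g x" if "x \<in> space M" for x
    by (intro tendsto_intros s that)
  ultimately show ?thesis unfolding nice_def by (intro exI[of _ "\<lambda>k x. indicator A x *\<^sub>R s k x"]) auto
qed

text \<open>Along a subsequence the L1 errors are below \<open>(1/2)^k\<close>, so the sum of the
  pointwise errors is integrable and convergence holds off a null set. Setting \<open>f\<close> to 0
  there makes it hold everywhere.\<close>

lemma has_banach_integral_version: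
  fixes f :: "'a \<Rightarrow> 'b::banach"
  assumes "has_banach_integral M f I"
  obtains g where "nice M g" "AE x in M. f x = g x"
proof -
  obtain s where s: "\<And>i. sbi M (s i)" "(\<lambda>i. \<integral>\<^sup>+x. norm (f x - s i x) \<partial>M) \<longlonglongrightarrow> 0"
    and mf: "f \<in> borel_measurable M"
    using assms unfolding has_banach_integral_def by blast
  have "\<exists>i. (\<integral>\<^sup>+x. norm (f x - s i x) \<partial>M) < ennreal ((1/2)^k)" for k
    using order_tendstoD(2)[OF s(2), of "ennreal ((1/2)^k)"] by (auto simp: eventually_sequentially)
  then obtain r where r: "\<And>k. (\<integral>\<^sup>+x. norm (f x - s (r k) x) \<partial>M) < ennreal ((1/2)^k)" by metis
  define t where "t k = s (r k)" for k
  have t: "sbi M (t k)" for k using s by (simp add: t_def)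
  have m[measurable]: "(\<lambda>x. norm (f x - t k x)) \<in> borel_measurable M" for k
    by (rule borel_measurable_norm_diff_simple[OF mf sbi_simple[OF t]])
  define G where "G = {x\<in>space M. (\<Sum>k. ennreal (norm (f x - t k x))) < \<infinity>}"
  have G[measurable]: "G \<in> sets M" unfolding G_def by measurable
  have "(\<integral>\<^sup>+x. (\<Sum>k. ennreal (norm (f x - t k x))) \<partial>M) = (\<Sum>k. \<integral>\<^sup>+x. norm (f x - t k x) \<partial>M)"
    by (rule nn_integral_suminf) measurable
  also have "\<dots> \<le> (\<Sum>k. ennreal ((1/2)^k))"
    using r by (intro suminf_le) (auto simp: t_def less_imp_le)
  also have "\<dots> < \<infinity>" by (simp add: suminf_ennreal_eq[OF _ sums_summable[THEN summable_sums]] ennreal_suminf_neq_top top.not_eq_extremum[symmetric])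
  finally have "(\<integral>\<^sup>+x. (\<Sum>k. ennreal (norm (f x - t k x))) \<partial>M) \<noteq> \<infinity>" by simp
  then have "AE x in M. (\<Sum>k. ennreal (norm (f x - t k x))) \<noteq> \<infinity>"
    by (intro nn_integral_PInf_AE) measurable
  then have ae: "AE x in M. x \<in> G"
    using AE_space by eventually_elim (auto simp: G_def top.not_eq_extremum)
  have conv: "(\<lambda>k. t k x) \<longlonglongrightarrow> f x" if "x \<in> G" for x
  proof -
    have "summable (\<lambda>k. norm (f x - t k x))"
      using that by (intro summable_suminf_not_top) (auto simp: G_def)
    then have "(\<lambda>k. norm (f x - t k x)) \<longlonglongrightarrow> 0" by (rule summable_LIMSEQ_zero)
    then have "(\<lambda>k. f x - t k x) \<longlonglongrightarrow> 0" by (rule tendsto_norm_zero_cancel)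
    from tendsto_diff[OF tendsto_const[of "f x"] this] show ?thesis by simp
  qed
  have lim0: "(\<lambda>k. \<integral>\<^sup>+x. norm (f x - t k x) \<partial>M) \<longlonglongrightarrow> 0"
  proof (rule tendsto_sandwich[OF _ _ tendsto_const])
    have "(\<lambda>k. (1/2::real)^k) \<longlonglongrightarrow> 0" by (rule LIMSEQ_realpow_zero) auto
    then show "(\<lambda>k. ennreal ((1/2)^k)) \<longlonglongrightarrow> 0" using tendsto_ennrealI[of _ 0] by simp
  qed (use r in \<open>auto intro!: always_eventually simp: t_def less_imp_le\<close>)
  have "nice M (\<lambda>x. indicator G x *\<^sub>R f x)"
    unfolding nice_def
  proof (intro exI[of _ "\<lambda>k x. indicator G x *\<^sub>R t k x"] conjI allI ballI)
    fix k
    show "sbi M (\<lambda>x. indicator G x *\<^sub>R t k x)"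
    proof
      show "simple_function M (\<lambda>x. indicator G x *\<^sub>R t k x)"
        by (rule simple_function_compose2[of M "indicator G :: _ \<Rightarrow> real" "t k" "(*\<^sub>R)"])
           (auto intro: G sbi_simple t)
      have [measurable]: "t k \<in> borel_measurable M" by (rule sbi_measurable[OF t])
      have "emeasure M {x\<in>space M. indicator G x *\<^sub>R t k x \<noteq> 0} \<le> emeasure M {x\<in>space M. t k x \<noteq> 0}"
        by (intro emeasure_mono) auto
      also have "\<dots> < \<infinity>"
        using t[of k] by (auto elim!: simple_bochner_integrable.cases simp: top.not_eq_extremum)
      finally show "emeasure M {x\<in>space M. indicator G x *\<^sub>R t k x \<noteq> 0} \<noteq> \<infinity>" by simp
    qed
  next
    fix x show "(\<lambda>k. indicator G x *\<^sub>R t k x) \<longlonglongrightarrow> indicator G x *\<^sub>R f x"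
      using conv by (cases "x \<in> G") auto
  next
    show "(\<lambda>k. \<integral>\<^sup>+x. norm (indicator G x *\<^sub>R f x - indicator G x *\<^sub>R t k x) \<partial>M) \<longlonglongrightarrow> 0"
      by (rule tendsto_sandwich[OF _ _ tendsto_const lim0])
         (auto intro!: always_eventually nn_integral_mono simp: indicator_def)
  qed
  moreover have "AE x in M. f x = indicator G x *\<^sub>R f x" using ae by eventually_elim auto
  ultimately show ?thesis by (rule that)
qed

lemma bint_bounded_linear:
  fixes L :: "'b::banach \<Rightarrow> 'c::banach"
  assumes L: "bounded_linear L" and g: "nice M g"
  shows "L (bint M g) = bint M (\<lambda>x. L (g x))"
proof -
  interpret L: bounded_linear L by fact
  obtain s where s: "\<And>i. sbi M (s i)" "(\<lambda>i. \<integral>\<^sup>+x. norm (g x - s i x) \<partial>M) \<longlonglongrightarrow> 0" "(\<lambda>i. sint M (s i)) \<longlonglongrightarrow> bint M g"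
    using nice_has_integral[OF g] unfolding has_banach_integral_def by blast
  obtain K where K: "K \<ge> 0" "\<And>x. norm (L x) \<le> norm x * K" using L.nonneg_bounded by blast
  have m: "(\<lambda>x. norm (g x - s i x)) \<in> borel_measurable M" for i
    by (rule borel_measurable_norm_diff_simple[OF nice_measurable[OF g] sbi_simple[OF s(1)]])
  have "(\<lambda>k. \<integral>\<^sup>+x. norm (L (g x) - L (s k x)) \<partial>M) \<longlonglongrightarrow> 0"
  proof (rule tendsto_sandwich[OF _ _ tendsto_const])
    show "\<forall>\<^sub>F k in sequentially. (\<integral>\<^sup>+x. norm (L (g x) - L (s k x)) \<partial>M) \<le> ennreal K * (\<integral>\<^sup>+x. norm (g x - s k x) \<partial>M)"
    proof (intro always_eventually allI)
      fix k
      have "norm (L (g x) - L (s k x)) \<le> K * norm (g x - s k x)" for x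
        using K(2)[of "g x - s k x"] by (simp add: L.diff mult.commute)
      then have "(\<integral>\<^sup>+x. norm (L (g x) - L (s k x)) \<partial>M) \<le> (\<integral>\<^sup>+x. ennreal K * ennreal (norm (g x - s k x)) \<partial>M)"
        using K by (intro nn_integral_mono) (simp flip: ennreal_mult add: ennreal_leI)
      then show "(\<integral>\<^sup>+x. norm (L (g x) - L (s k x)) \<partial>M) \<le> ennreal K * (\<integral>\<^sup>+x. norm (g x - s k x) \<partial>M)"
        using m by (simp add: nn_integral_cmult)
    qed
    show "(\<lambda>k. ennreal K * (\<integral>\<^sup>+x. norm (g x - s k x) \<partial>M)) \<longlonglongrightarrow> 0"
      using ennreal_tendsto_cmult[OF _ s(2), of "ennreal K"] by simp
  qed auto
  moreover have "sbi M (\<lambda>x. L (s k x))" for k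
    using simple_bochner_integrable_compose2[of "\<lambda>x y. L x" M "s k" "s k"] s(1) L.zero by simp
  moreover have "(\<lambda>i. sint M (\<lambda>x. L (s i x))) \<longlonglongrightarrow> L (bint M g)"
    using L.tendsto[OF s(3)] s(1) by (simp add: simple_bochner_integral_linear L.linear_axioms)
  ultimately have "has_banach_integral M (\<lambda>x. L (g x)) (L (bint M g))"
    using nice_measurable[OF nice_bounded_linear[OF L g]] unfolding has_banach_integral_def
    by (intro conjI exI[of _ "\<lambda>i x. L (s i x)"]) auto
  then show ?thesis by (simp add: bint_eqI_has)
qed

lemma nice_real:
  fixes g :: "'a \<Rightarrow> real"
  assumes "nice M g" shows "integrable M g" "bint M g = (\<integral>x. g x \<partial>M)"
  using nice_has_integral[OF assms] by (auto simp: has_banach_integral_real has_bochner_integral_iff)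

lemma functional_bint:
  fixes L :: "'b::banach \<Rightarrow> real"
  assumes "bounded_linear L" "nice M g"
  shows "L (bint M g) = (\<integral>x. L (g x) \<partial>M)" "integrable M (\<lambda>x. L (g x))"
  using bint_bounded_linear[OF assms] nice_real[OF nice_bounded_linear[OF assms]] by auto

text \<open>Identities between Banach-valued integrals are tested on functionals, where they become
  identities of real Lebesgue integrals.\<close>

lemma functionals_separate:
  fixes a b :: "'b::real_normed_vector"
  assumes "\<And>L :: 'b \<Rightarrow> real. bounded_linear L \<Longrightarrow> L a = L b" shows "a = b"
proof -
  obtain L where L: "bounded_linear L" "L (a - b) = norm (a - b)" using norming_functional by blast
  have "L (a - b) = L a - L b" using L(1) by (simp add: bounded_linear.linear linear_diff)
  then show ?thesis using L assms[OF L(1)] by simp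
qed

lemma norm_bint_le:
  fixes g :: "'a \<Rightarrow> 'b::banach"
  assumes "nice M g" shows "norm (bint M g) \<le> (\<integral>x. norm (g x) \<partial>M)"
proof -
  obtain L where L: "bounded_linear L" "L (bint M g) = norm (bint M g)" "\<And>x. \<bar>L x\<bar> \<le> norm x"
    using norming_functional[of "bint M g"] by blast
  have "norm (bint M g) = (\<integral>x. L (g x) \<partial>M)" using functional_bint[OF L(1) assms] L(2) by simp
  also have "\<dots> \<le> (\<integral>x. norm (g x) \<partial>M)"
    using L(3) functional_bint(2)[OF L(1) assms] nice_real(1)[OF nice_norm[OF assms]]
    by (intro integral_mono) (auto intro: order_trans[OF abs_ge_self])
  finally show ?thesis .
qed

lemma bint_add: "nice M f \<Longrightarrow> nice M g \<Longrightarrow> bint M (\<lambda>x. f x + g x) = bint M f + bint M g"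
  by (rule functionals_separate)
     (simp add: functional_bint nice_add bounded_linear.linear linear_add)

lemma bint_diff: "nice M f \<Longrightarrow> nice M g \<Longrightarrow> bint M (\<lambda>x. f x - g x) = bint M f - bint M g"
  by (rule functionals_separate)
     (simp add: functional_bint nice_diff bounded_linear.linear linear_diff)

lemma bint_scaleR: "nice M f \<Longrightarrow> bint M (\<lambda>x. c *\<^sub>R f x) = c *\<^sub>R bint M f"
  using bint_bounded_linear[OF bounded_linear_scaleR_right] by metis

lemma bint_cong: "(\<And>x. x \<in> space M \<Longrightarrow> f x = g x) \<Longrightarrow> bint M f = bint M g"
  unfolding bint_def has_banach_integral_def by (simp cong: measurable_cong nn_integral_cong)

lemma nice_cong: "(\<And>x. x \<in> space M \<Longrightarrow> f x = g x) \<Longrightarrow> nice M f \<longleftrightarrow> nice M g"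
  unfolding nice_def by (simp cong: nn_integral_cong)

lemma nice_restrict:
  fixes g :: "'a \<Rightarrow> 'b::banach"
  assumes g: "nice M g" and A: "A \<in> sets M"
  shows "nice (restrict_space M A) g" "bint (restrict_space M A) g = bint M (\<lambda>x. indicator A x *\<^sub>R g x)"
proof -
  have AM: "A \<inter> space M \<in> sets M" using A by auto
  obtain s where s: "\<And>k. sbi M (s k)" "\<And>x. x \<in> space M \<Longrightarrow> (\<lambda>k. s k x) \<longlonglongrightarrow> g x"
     "(\<lambda>k. \<integral>\<^sup>+x. norm (g x - s k x) \<partial>M) \<longlonglongrightarrow> 0"
    using g unfolding nice_def by blast
  have "sbi (restrict_space M A) (s k)" for k
  proof -
    have "sbi M (\<lambda>x. indicator A x *\<^sub>R s k x)"
    proof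
      show "simple_function M (\<lambda>x. indicator A x *\<^sub>R s k x)"
        by (rule simple_function_compose2[of M "indicator A :: _ \<Rightarrow> real" "s k" "(*\<^sub>R)"])
           (auto intro: A sbi_simple s)
      have [measurable]: "s k \<in> borel_measurable M" by (rule sbi_measurable[OF s(1)])
      have "emeasure M {x\<in>space M. indicator A x *\<^sub>R s k x \<noteq> 0} \<le> emeasure M {x\<in>space M. s k x \<noteq> 0}"
        by (intro emeasure_mono) auto
      also have "\<dots> < \<infinity>"
        using s(1)[of k] by (auto elim!: simple_bochner_integrable.cases simp: top.not_eq_extremum)
      finally show "emeasure M {x\<in>space M. indicator A x *\<^sub>R s k x \<noteq> 0} \<noteq> \<infinity>" by simp
    qed
    then show ?thesis using simple_bochner_integrable_restrict_space[OF AM] by auto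
  qed
  moreover have "(\<lambda>k. \<integral>\<^sup>+x. norm (g x - s k x) \<partial>restrict_space M A) \<longlonglongrightarrow> 0"
    by (rule tendsto_sandwich[OF _ _ tendsto_const s(3)])
       (auto intro!: always_eventually nn_integral_mono simp: nn_integral_restrict_space[OF AM] indicator_def)
  ultimately show 1: "nice (restrict_space M A) g"
    unfolding nice_def using s(2) by (intro exI[of _ s]) (auto simp: space_restrict_space)
  show "bint (restrict_space M A) g = bint M (\<lambda>x. indicator A x *\<^sub>R g x)"
  proof (rule functionals_separate)
    fix L :: "'b \<Rightarrow> real" assume L: "bounded_linear L"
    then have "L (indicator A x *\<^sub>R g x) = indicator A x *\<^sub>R L (g x)" for x
      by (simp add: bounded_linear.linear linear_scale)
    then show "L (bint (restrict_space M A) g) = L (bint M (\<lambda>x. indicator A x *\<^sub>R g x))"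
      using functional_bint(1)[OF L 1] functional_bint(1)[OF L nice_indicator[OF g A]] integral_restrict_space[OF AM, of "\<lambda>x. L (g x)"]
      by simp
  qed
qed

lemma nice_unrestrict:
  fixes g :: "'a \<Rightarrow> 'b::banach"
  assumes g: "nice (restrict_space M A) g" and A: "A \<in> sets M"
  shows "nice M (\<lambda>x. indicator A x *\<^sub>R g x)"
proof -
  have AM: "A \<inter> space M \<in> sets M" using A by auto
  obtain s where s: "\<And>k. sbi (restrict_space M A) (s k)" "\<And>x. x \<in> space (restrict_space M A) \<Longrightarrow> (\<lambda>k. s k x) \<longlonglongrightarrow> g x"
     "(\<lambda>k. \<integral>\<^sup>+x. norm (g x - s k x) \<partial>restrict_space M A) \<longlonglongrightarrow> 0"
    using g unfolding nice_def by blast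
  have "sbi M (\<lambda>x. indicator A x *\<^sub>R s k x)" for k
    using s(1) simple_bochner_integrable_restrict_space[OF AM] by auto
  moreover have "(\<lambda>k. \<integral>\<^sup>+x. norm (indicator A x *\<^sub>R g x - indicator A x *\<^sub>R s k x) \<partial>M) \<longlonglongrightarrow> 0"
    by (rule Lim_transform_eventually[OF s(3)])
       (auto intro!: always_eventually nn_integral_cong simp: nn_integral_restrict_space[OF AM] indicator_def)
  moreover have "(\<lambda>k. indicator A x *\<^sub>R s k x) \<longlonglongrightarrow> indicator A x *\<^sub>R g x" if "x \<in> space M" for x
    using s(2)[of x] that by (cases "x \<in> A") (auto simp: space_restrict_space)
  ultimately show ?thesis unfolding nice_def by (intro exI[of _ "\<lambda>k x. indicator A x *\<^sub>R s k x"]) auto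
qed

lemma integral_scale_measure:
  fixes h :: "'a \<Rightarrow> real"
  assumes h: "h \<in> borel_measurable N" and r: "0 \<le> r"
  shows "(\<integral>x. h x \<partial>scale_measure (ennreal r) N) = r * (\<integral>x. h x \<partial>N)"
proof -
  have "scale_measure (ennreal r) N = density N (\<lambda>_. ennreal r)"
    by (rule measure_eqI) (auto simp: emeasure_density nn_integral_cmult_indicator)
  then show ?thesis using h r by (simp add: integral_density)
qed

text \<open>Stated for push-forwards that are multiples of the target measure, because division by
  \<open>T\<close> multiplies Lebesgue measure by \<open>T\<close>, and by \<open>T^m\<close> in
  \<open>m\<close> coordinates.\<close>

lemma nice_distr:
  fixes g :: "'a \<Rightarrow> 'b::banach"
  assumes \<phi>[measurable]: "\<phi> \<in> measurable M N" and r: "0 < r" and d: "distr M N \<phi> = scale_measure (ennreal r) N"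
    and g: "nice N g"
  shows "nice M (\<lambda>x. g (\<phi> x))" "bint M (\<lambda>x. g (\<phi> x)) = r *\<^sub>R bint N g"
proof -
  obtain s where s: "\<And>k. sbi N (s k)" "\<And>x. x \<in> space N \<Longrightarrow> (\<lambda>k. s k x) \<longlonglongrightarrow> g x"
     "(\<lambda>k. \<integral>\<^sup>+x. norm (g x - s k x) \<partial>N) \<longlonglongrightarrow> 0"
    using g unfolding nice_def by blast
  have nn: "(\<integral>\<^sup>+x. h (\<phi> x) \<partial>M) = ennreal r * (\<integral>\<^sup>+x. h x \<partial>N)" if "h \<in> borel_measurable N" for h
    using nn_integral_distr[OF \<phi>, of h] that by (simp add: d nn_integral_scale_measure)
  have "sbi M (\<lambda>x. s k (\<phi> x))" for k
  proof
    show "simple_function M (\<lambda>x. s k (\<phi> x))"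
      unfolding simple_function_def
    proof (intro conjI ballI)
      have "(\<lambda>x. s k (\<phi> x)) ` space M \<subseteq> s k ` space N" using measurable_space[OF \<phi>] by auto
      then show "finite ((\<lambda>x. s k (\<phi> x)) ` space M)"
        using sbi_simple[OF s(1)[of k]] finite_subset by (auto simp: simple_function_def)
      fix y assume "y \<in> (\<lambda>x. s k (\<phi> x)) ` space M"
      have "s k \<in> measurable N (count_space UNIV)" by (rule measurable_simple_function[OF sbi_simple[OF s(1)]])
      then have "(\<lambda>x. s k (\<phi> x)) \<in> measurable M (count_space UNIV)" by (rule measurable_compose[OF \<phi>])
      then show "(\<lambda>x. s k (\<phi> x)) -` {y} \<inter> space M \<in> sets M" by (rule measurable_sets) simp
    qed
    have [measurable]: "s k \<in> borel_measurable N" by (rule sbi_measurable[OF s(1)])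
    have S: "{x\<in>space N. s k x \<noteq> 0} \<in> sets N" by measurable
    have "{x\<in>space M. s k (\<phi> x) \<noteq> 0} = \<phi> -` {x\<in>space N. s k x \<noteq> 0} \<inter> space M"
      using measurable_space[OF \<phi>] by auto
    then have "emeasure M {x\<in>space M. s k (\<phi> x) \<noteq> 0} = emeasure (distr M N \<phi>) {x\<in>space N. s k x \<noteq> 0}"
      using emeasure_distr[OF \<phi> S] by simp
    also have "\<dots> = ennreal r * emeasure N {x\<in>space N. s k x \<noteq> 0}" by (simp add: d)
    also have "\<dots> < \<infinity>"
      using s(1)[of k] by (auto elim!: simple_bochner_integrable.cases simp: top.not_eq_extremum ennreal_mult_less_top)
    finally show "emeasure M {x\<in>space M. s k (\<phi> x) \<noteq> 0} \<noteq> \<infinity>" by simp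
  qed
  moreover have "(\<lambda>k. \<integral>\<^sup>+x. norm (g (\<phi> x) - s k (\<phi> x)) \<partial>M) \<longlonglongrightarrow> 0"
  proof -
    have "(\<integral>\<^sup>+x. norm (g (\<phi> x) - s k (\<phi> x)) \<partial>M) = ennreal r * (\<integral>\<^sup>+x. norm (g x - s k x) \<partial>N)" for k
      using borel_measurable_norm_diff_simple[OF nice_measurable[OF g] sbi_simple[OF s(1)]]
      by (intro nn[of "\<lambda>x. ennreal (norm (g x - s k x))"]) auto
    then show ?thesis using ennreal_tendsto_cmult[OF _ s(3), of "ennreal r"] by simp
  qed
  ultimately show 1: "nice M (\<lambda>x. g (\<phi> x))"
    unfolding nice_def using s(2) measurable_space[OF \<phi>] by (intro exI[of _ "\<lambda>k x. s k (\<phi> x)"]) auto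
  show "bint M (\<lambda>x. g (\<phi> x)) = r *\<^sub>R bint N g"
  proof (rule functionals_separate)
    fix L :: "'b \<Rightarrow> real" assume L: "bounded_linear L"
    have i: "integrable N (\<lambda>x. L (g x))" by (rule functional_bint(2)[OF L g])
    have "(\<integral>x. L (g (\<phi> x)) \<partial>M) = (\<integral>x. L (g x) \<partial>distr M N \<phi>)"
      using i by (subst integral_distr) auto
    also have "\<dots> = r * (\<integral>x. L (g x) \<partial>N)"
      using r i by (simp add: d integral_scale_measure)
    finally show "L (bint M (\<lambda>x. g (\<phi> x))) = L (r *\<^sub>R bint N g)"
      using functional_bint(1)[OF L 1] functional_bint(1)[OF L g] L
      by (simp add: bounded_linear.linear linear_scale)
  qed
qed

section \<open>Integrable functions on the unit interval and dyadic steps\<close>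

lemma sbi_indicator:
  assumes A: "A \<in> sets M" "emeasure M A < \<infinity>" shows "sbi M (\<lambda>x. indicator A x *\<^sub>R c)"
proof
  show "simple_function M (\<lambda>x. indicator A x *\<^sub>R c)"
    by (rule simple_function_compose1[of M "indicator A :: _ \<Rightarrow> real" "\<lambda>r. r *\<^sub>R c"]) (auto intro: A)
  have "emeasure M {x\<in>space M. indicator A x *\<^sub>R c \<noteq> 0} \<le> emeasure M A"
    using A by (intro emeasure_mono) (auto simp: indicator_def)
  then show "emeasure M {x\<in>space M. indicator A x *\<^sub>R c \<noteq> 0} \<noteq> \<infinity>"
    using A(2) by auto
qed

lemma nice_sbi: "sbi M s \<Longrightarrow> nice M s"
  unfolding nice_def by (rule exI[of _ "\<lambda>_. s"]) simp

lemma nice_const_indicator: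
  "A \<in> sets M \<Longrightarrow> emeasure M A < \<infinity> \<Longrightarrow> nice M (\<lambda>x. indicator A x *\<^sub>R c)"
  by (intro nice_sbi sbi_indicator)

lemma nice_zero: "nice M (\<lambda>x. 0)"
  using nice_const_indicator[of "{}" M 0] by simp

lemma nice_sum: "(\<And>i. i \<in> I \<Longrightarrow> nice M (f i)) \<Longrightarrow> nice M (\<lambda>x. \<Sum>i\<in>I. f i x)"
  by (induction I rule: infinite_finite_induct) (auto intro: nice_zero nice_add)

lemma bint_const_indicator:
  fixes c :: "'b::banach"
  assumes A: "A \<in> sets M" "emeasure M A < \<infinity>"
  shows "bint M (\<lambda>x. indicator A x *\<^sub>R c) = measure M A *\<^sub>R c"
proof (rule functionals_separate)
  fix L :: "'b \<Rightarrow> real" assume L: "bounded_linear L"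
  then have eq: "L (r *\<^sub>R c) = r * L c" for r by (simp add: bounded_linear.linear linear_scale)
  have "A \<inter> space M = A" using A sets.sets_into_space by blast
  then show "L (bint M (\<lambda>x. indicator A x *\<^sub>R c)) = L (measure M A *\<^sub>R c)"
    using functional_bint(1)[OF L nice_const_indicator[OF A]] A by (simp add: eq)
qed

section \<open>L1 norm, primitives and their variation\<close>

text \<open>The real integral has the default value 0 if the norm is not integrable, hence the
  assumption \<open>nice\<close> in the triangle inequalities.\<close>

definition L1n :: "(real \<Rightarrow> 'b::real_normed_vector) \<Rightarrow> real" where
  "L1n f = (\<integral>t. norm (f t) \<partial>lborel)"

lemma nice_norm_integrable: "nice M f \<Longrightarrow> integrable M (\<lambda>x. norm (f x))"
  by (intro nice_real nice_norm)

lemma L1n_nonneg: "0 \<le> L1n f"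
  unfolding L1n_def by (rule integral_nonneg_AE) auto

lemma L1n_add_le: "nice lborel f \<Longrightarrow> nice lborel g \<Longrightarrow> L1n (\<lambda>t. f t + g t) \<le> L1n f + L1n g"
  unfolding L1n_def
  by (subst Bochner_Integration.integral_add[symmetric])
     (auto intro!: integral_mono nice_norm_integrable nice_add norm_triangle_ineq Bochner_Integration.integrable_add)

lemma L1n_diff_le:
  assumes "nice lborel f" "nice lborel g" "nice lborel h"
  shows "L1n (\<lambda>t. f t - h t) \<le> L1n (\<lambda>t. f t - g t) + L1n (\<lambda>t. g t - h t)"
  using L1n_add_le[of "\<lambda>t. f t - g t" "\<lambda>t. g t - h t"] assms by (simp add: nice_diff)

lemma L1n_le: "nice lborel f \<Longrightarrow> nice lborel g \<Longrightarrow> L1n f \<le> L1n g + L1n (\<lambda>t. f t - g t)"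
  using L1n_add_le[of g "\<lambda>t. f t - g t"] by (simp add: nice_diff)

lemma L1n_minus_commute: "L1n (\<lambda>t. f t - g t) = L1n (\<lambda>t. g t - f t)"
  unfolding L1n_def by (simp add: norm_minus_commute)

lemma L1n_scaleR: "L1n (\<lambda>t. c *\<^sub>R f t) = \<bar>c\<bar> * L1n f"
  unfolding L1n_def by simp

definition prim :: "(real \<Rightarrow> 'b::banach) \<Rightarrow> real \<Rightarrow> 'b" where
  "prim f s = bint lborel (\<lambda>t. indicator {0..s} t *\<^sub>R f t)"

lemma nice_ind[intro]: "nice lborel f \<Longrightarrow> A \<in> sets borel \<Longrightarrow> nice lborel (\<lambda>t. indicator A t *\<^sub>R f t)"
  by (rule nice_indicator) auto

lemma prim_increment:
  assumes f: "nice lborel f" and "0 \<le> a" "a \<le> b"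
  shows "prim f b - prim f a = bint lborel (\<lambda>t. indicator {a<..b} t *\<^sub>R f t)"
proof -
  have "prim f b - prim f a = bint lborel (\<lambda>t. indicator {0..b} t *\<^sub>R f t - indicator {0..a} t *\<^sub>R f t)"
    unfolding prim_def using f by (intro bint_diff[symmetric] nice_ind) auto
  also have "\<dots> = bint lborel (\<lambda>t. indicator {a<..b} t *\<^sub>R f t)"
    using assms(2,3) by (intro bint_cong) (auto simp: indicator_def)
  finally show ?thesis .
qed

lemma prim_diff: "nice lborel f \<Longrightarrow> nice lborel g \<Longrightarrow> prim (\<lambda>t. f t - g t) s = prim f s - prim g s"
  unfolding prim_def by (subst bint_diff[symmetric]) (auto intro!: bint_cong simp: algebra_simps)

lemma prim_scaleR: "nice lborel f \<Longrightarrow> prim (\<lambda>t. c *\<^sub>R f t) s = c *\<^sub>R prim f s"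
  unfolding prim_def by (subst bint_scaleR[symmetric]) (auto intro!: bint_cong simp: algebra_simps)

lemma prim_0:
  fixes f :: "real \<Rightarrow> 'b::banach"
  assumes f: "nice lborel f" shows "prim f 0 = 0"
proof -
  have "has_banach_integral lborel (\<lambda>t. indicator {0..0} t *\<^sub>R f t) (prim f 0)"
    unfolding prim_def using f by (intro nice_has_integral) auto
  moreover have "has_banach_integral lborel (\<lambda>t::real. 0::'b) (bint lborel (\<lambda>t::real. 0))"
    by (rule nice_has_integral[OF nice_zero])
  moreover have "AE t in lborel. indicator {0..0} t *\<^sub>R f t = 0"
    using AE_lborel_singleton[of 0] by eventually_elim (auto simp: indicator_def)
  ultimately have "prim f 0 = bint lborel (\<lambda>t::real. 0::'b)" by (rule has_banach_integral_AE_unique)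
  also have "\<dots> = 0" using bint_const_indicator[of "{}" "lborel :: real measure" "0::'b"] by simp
  finally show ?thesis .
qed

lemma norm_prim_increment_le:
  assumes f: "nice lborel f" and "0 \<le> a" "a \<le> b"
  shows "norm (prim f b - prim f a) \<le> prim (\<lambda>t. norm (f t)) b - prim (\<lambda>t. norm (f t)) a"
proof -
  have "norm (prim f b - prim f a) \<le> (\<integral>t. norm (indicator {a<..b} t *\<^sub>R f t) \<partial>lborel)"
    unfolding prim_increment[OF assms] using f by (intro norm_bint_le) auto
  also have "\<dots> = prim (\<lambda>t. norm (f t)) b - prim (\<lambda>t. norm (f t)) a"
    unfolding prim_increment[OF nice_norm[OF f] assms(2,3)]
    using nice_real(2)[OF nice_ind[OF nice_norm[OF f], of "{a<..b}"]] by simp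
  finally show ?thesis .
qed

lemma prim_norm_bounds:
  assumes f: "nice lborel f" shows "0 \<le> prim (\<lambda>t. norm (f t)) s" "prim (\<lambda>t. norm (f t)) s \<le> L1n f"
proof -
  have n: "nice lborel (\<lambda>t. indicator {0..s} t *\<^sub>R norm (f t))" by (intro nice_ind nice_norm f) simp
  have "prim (\<lambda>t. norm (f t)) s = (\<integral>t. indicator {0..s} t *\<^sub>R norm (f t) \<partial>lborel)"
    unfolding prim_def by (rule nice_real(2)[OF n])
  moreover have "0 \<le> (\<integral>t. indicator {0..s} t *\<^sub>R norm (f t) \<partial>lborel)"
    by (rule integral_nonneg_AE) auto
  moreover have "(\<integral>t. indicator {0..s} t *\<^sub>R norm (f t) \<partial>lborel) \<le> L1n f"
    unfolding L1n_def using f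
    by (intro integral_mono nice_real(1)[OF n] nice_norm_integrable) (auto simp: indicator_def)
  ultimately show "0 \<le> prim (\<lambda>t. norm (f t)) s" "prim (\<lambda>t. norm (f t)) s \<le> L1n f" by auto
qed

text \<open>Each increment is dominated by the increment of the primitive of the norm, and those
  telescope.\<close>

lemma sum_norm_increments_prim_le:
  assumes f: "nice lborel f" and t: "mono_on {..n} t" "\<And>i. i \<le> n \<Longrightarrow> 0 \<le> t i"
  shows "(\<Sum>i<n. norm (prim f (t (Suc i)) - prim f (t i))) \<le> L1n f"
proof -
  have "(\<Sum>i<n. norm (prim f (t (Suc i)) - prim f (t i)))
      \<le> (\<Sum>i<n. prim (\<lambda>t. norm (f t)) (t (Suc i)) - prim (\<lambda>t. norm (f t)) (t i))"
    by (intro sum_mono norm_prim_increment_le f t) (auto intro: mono_onD[OF t(1)] t)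
  also have "\<dots> = prim (\<lambda>t. norm (f t)) (t n) - prim (\<lambda>t. norm (f t)) (t 0)"
    by (rule sum_lessThan_telescope)
  also have "\<dots> \<le> L1n f" using prim_norm_bounds[OF f, of "t n"] prim_norm_bounds[OF f, of "t 0"] by linarith
  finally show ?thesis .
qed

section \<open>Dyadic step functions and variation sums\<close>

text \<open>The coefficients form a total sequence of which only the first \<open>2^n\<close>
  entries are read, so a list with \<open>(!)\<close> can serve as \<open>c\<close>.\<close>

definition step :: "nat \<Rightarrow> (nat \<Rightarrow> 'b::real_vector) \<Rightarrow> real \<Rightarrow> 'b" where
  "step n c t = (if 0 \<le> t \<and> t < 1 then c (nat \<lfloor>t * 2 ^ n\<rfloor>) else 0)"

lemma dyadic_cell:
  assumes "0 \<le> t" "t < 1"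
  shows "nat \<lfloor>t * 2 ^ n\<rfloor> < 2 ^ n" "nat \<lfloor>t * 2 ^ n\<rfloor> = j \<longleftrightarrow> real j / 2 ^ n \<le> t \<and> t < (real j + 1) / 2 ^ n"
proof -
  have "t * 2 ^ n < 2 ^ n" using assms by simp
  then have "\<lfloor>t * 2 ^ n\<rfloor> < 2 ^ n" by (simp add: floor_less_iff)
  then show "nat \<lfloor>t * 2 ^ n\<rfloor> < 2 ^ n" by (simp add: nat_less_iff assms)
  have "nat \<lfloor>t * 2 ^ n\<rfloor> = j \<longleftrightarrow> \<lfloor>t * 2 ^ n\<rfloor> = int j" using assms by (auto simp: nat_eq_iff)
  also have "\<dots> \<longleftrightarrow> real j \<le> t * 2 ^ n \<and> t * 2 ^ n < real j + 1" by (simp add: floor_eq_iff)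
  also have "\<dots> \<longleftrightarrow> real j / 2 ^ n \<le> t \<and> t < (real j + 1) / 2 ^ n" by (simp add: field_simps)
  finally show "nat \<lfloor>t * 2 ^ n\<rfloor> = j \<longleftrightarrow> real j / 2 ^ n \<le> t \<and> t < (real j + 1) / 2 ^ n" .
qed

lemma step_eq_sum:
  "step n c t = (\<Sum>j<2^n. indicator {real j / 2 ^ n..<(real j + 1) / 2 ^ n} t *\<^sub>R c j)"
proof (cases "0 \<le> t \<and> t < 1")
  case True
  define k where "k = nat \<lfloor>t * 2 ^ n\<rfloor>"
  have k: "k < 2 ^ n" and kk: "t \<in> {real j / 2 ^ n..<(real j + 1) / 2 ^ n} \<longleftrightarrow> j = k" for j
    using dyadic_cell(1)[of t n] dyadic_cell(2)[of t n j] True unfolding k_def atLeastLessThan_iff by blast+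
  have "(\<Sum>j<2^n. indicator {real j / 2 ^ n..<(real j + 1) / 2 ^ n} t *\<^sub>R c j) = (\<Sum>j<2^n. if j = k then c j else 0)"
    by (intro sum.cong) (auto simp: indicator_def kk simp del: atLeastLessThan_iff)
  then show ?thesis using k True by (simp add: step_def k_def)
next
  case False
  have "indicator {real j / 2 ^ n..<(real j + 1) / 2 ^ n} t *\<^sub>R c j = 0" if "j < 2 ^ n" for j
  proof -
    have "real j + 1 \<le> 2 ^ n" using that by (metis Suc_leI add.commute of_nat_Suc of_nat_le_iff of_nat_numeral of_nat_power)
    then have "(real j + 1) / 2 ^ n \<le> 1" by simp
    moreover have "0 \<le> real j / 2 ^ n" by simp
    ultimately have "t \<notin> {real j / 2 ^ n..<(real j + 1) / 2 ^ n}"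
      using False unfolding atLeastLessThan_iff by linarith
    then show ?thesis by (simp del: atLeastLessThan_iff)
  qed
  then have "(\<Sum>j<2^n. indicator {real j / 2 ^ n..<(real j + 1) / 2 ^ n} t *\<^sub>R c j) = 0"
    by (intro sum.neutral) auto
  then show ?thesis using False by (auto simp: step_def simp del: indicator_scaleR_eq_if sum_of_bool_eq)
qed

lemma nice_step: "nice lborel (step n c)"
proof -
  have "nice lborel (\<lambda>t. \<Sum>j<2^n. indicator {real j / 2 ^ n..<(real j + 1) / 2 ^ n} t *\<^sub>R c j)"
    by (intro nice_sum nice_const_indicator) (auto simp: field_simps)
  moreover have "step n c = (\<lambda>t. \<Sum>j<2^n. indicator {real j / 2 ^ n..<(real j + 1) / 2 ^ n} t *\<^sub>R c j)"
    by (rule ext) (rule step_eq_sum)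
  ultimately show ?thesis by simp
qed

text \<open>The dyadic cell \<open>j\<close> of level \<open>n + k\<close> lies in the cell
  \<open>j div 2^k\<close> of level \<open>n\<close>; step functions can thus be brought to a common
  level.\<close>

lemma step_refine: "step n c = step (n + k) (\<lambda>j. c (j div 2 ^ k))"
proof (rule ext)
  fix t :: real
  show "step n c t = step (n + k) (\<lambda>j. c (j div 2 ^ k)) t"
  proof (cases "0 \<le> t \<and> t < 1")
    case True
    have "\<lfloor>t * 2 ^ (n + k) / real_of_int (2 ^ k)\<rfloor> = \<lfloor>t * 2 ^ (n + k)\<rfloor> div 2 ^ k"
      by (rule floor_divide_real_eq_div) simp
    then have "\<lfloor>t * 2 ^ n\<rfloor> = \<lfloor>t * 2 ^ (n + k)\<rfloor> div 2 ^ k" by (simp add: power_add field_simps)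
    then have "nat \<lfloor>t * 2 ^ n\<rfloor> = nat \<lfloor>t * 2 ^ (n + k)\<rfloor> div 2 ^ k"
      using True by (simp add: nat_div_distrib nat_power_eq)
    then show ?thesis by (simp add: step_def)
  qed (auto simp: step_def)
qed

lemma step_diff: "step n c t - step n d t = step n (\<lambda>j. c j - d j) t"
  by (simp add: step_def)

lemma L1n_step: "L1n (step n c) = (\<Sum>j<2^n. norm (c j)) / 2 ^ n"
proof -
  have "norm (step n c t) = step n (\<lambda>j. norm (c j)) t" for t by (simp add: step_def)
  then have "L1n (step n c) = (\<integral>t. (\<Sum>j<2^n. indicator {real j / 2 ^ n..<(real j + 1) / 2 ^ n} t *\<^sub>R norm (c j)) \<partial>lborel)"
    unfolding L1n_def by (simp add: step_eq_sum)
  also have "\<dots> = (\<Sum>j<2^n. \<integral>t. indicator {real j / 2 ^ n..<(real j + 1) / 2 ^ n} t *\<^sub>R norm (c j) \<partial>lborel)"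
    by (rule Bochner_Integration.integral_sum) (auto simp: field_simps)
  also have "\<dots> = (\<Sum>j<2^n. (1 / 2 ^ n) * norm (c j))"
    by (intro sum.cong) (auto simp: field_simps diff_divide_distrib[symmetric])
  finally show ?thesis by (simp add: sum_divide_distrib)
qed

text \<open>Only finitely many values of \<open>F\<close> enter, so on paths this is a measurable
  substitute for the L1 norm of the velocity, to which it converges.\<close>

definition dysum :: "nat \<Rightarrow> (real \<Rightarrow> 'b::real_normed_vector) \<Rightarrow> real" where
  "dysum n F = (\<Sum>j<2^n. norm (F ((real j + 1) / 2 ^ n) - F (real j / 2 ^ n)))"

lemma prim_step_increment:
  assumes j: "j < 2 ^ n"
  shows "prim (step n c) ((real j + 1) / 2 ^ n) - prim (step n c) (real j / 2 ^ n) = (1 / 2 ^ n) *\<^sub>R c j"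
proof -
  define A where "A = {real j / 2 ^ n<..(real j + 1) / 2 ^ n}"
  have j1: "(real j + 1) / 2 ^ n \<le> 1"
    using j by (simp add: field_simps) (metis Suc_leI add.commute of_nat_Suc of_nat_le_iff of_nat_numeral of_nat_power)
  have 1: "prim (step n c) ((real j + 1) / 2 ^ n) - prim (step n c) (real j / 2 ^ n)
      = bint lborel (\<lambda>t. indicator A t *\<^sub>R step n c t)"
    unfolding A_def by (rule prim_increment[OF nice_step]) (auto simp: field_simps)
  have le: "real j / 2 ^ n \<le> (real j + 1) / 2 ^ n" by (simp add: divide_right_mono)
  have eA: "emeasure lborel A = ennreal ((real j + 1) / 2 ^ n - real j / 2 ^ n)"
    unfolding A_def by (rule emeasure_lborel_Ioc[OF le])
  have A: "A \<in> sets lborel" "emeasure lborel A < \<infinity>" by (simp_all add: eA) (simp add: A_def)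
  have mA: "measure lborel A = 1 / 2 ^ n" by (simp add: measure_def eA diff_divide_distrib[symmetric])
  \<comment> \<open>Cells of \<open>step\<close> are closed on the left, the intervals of increments
    of a primitive on the right; the right end point is discarded as a null set.\<close>
  have "AE t in lborel. t \<noteq> (real j + 1) / 2 ^ n" by (rule AE_lborel_singleton)
  then have ae: "AE t in lborel. indicator A t *\<^sub>R step n c t = indicator A t *\<^sub>R c j"
  proof eventually_elim
    case (elim t)
    show ?case
    proof (cases "t \<in> A")
      case True
      then have t: "real j / 2 ^ n \<le> t" "t < (real j + 1) / 2 ^ n" using elim by (auto simp: A_def)
      have "0 \<le> real j / 2 ^ n" by simp
      then have "0 \<le> t" "t < 1" using t j1 by linarith+
      then show ?thesis using dyadic_cell(2)[of t n j] t by (simp add: step_def)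
    qed simp
  qed
  have "bint lborel (\<lambda>t. indicator A t *\<^sub>R step n c t) = bint lborel (\<lambda>t. indicator A t *\<^sub>R c j)"
    by (rule has_banach_integral_AE_unique[OF _ _ ae])
       (use A in \<open>auto intro!: nice_has_integral nice_ind nice_step nice_const_indicator\<close>)
  then show ?thesis using 1 bint_const_indicator[OF A] mA by simp
qed

text \<open>From its own level on, a step function is constant on every dyadic cell, so nothing
  cancels inside a cell and the sum is exact.\<close>

lemma dysum_step: "n \<le> m \<Longrightarrow> dysum m (prim (step n c)) = L1n (step n c)"
proof -
  assume "n \<le> m"
  then obtain k where m: "m = n + k" by (auto simp: le_iff_add)
  show ?thesis
    unfolding m step_refine[of n c k] dysum_def L1n_step
    by (subst sum.cong[OF refl arg_cong[where f = norm, OF prim_step_increment]])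
       (auto simp: sum_divide_distrib)
qed

lemma dysum_le:
  assumes f: "nice lborel f" shows "dysum n (prim f) \<le> L1n f"
  using sum_norm_increments_prim_le[OF f, of "2^n" "\<lambda>j. real j / 2 ^ n"]
  by (auto simp: dysum_def add.commute monotone_on_def divide_right_mono)

lemma dysum_triangle: "dysum n F \<le> dysum n G + dysum n (\<lambda>s. F s - G s)"
  unfolding dysum_def sum.distrib[symmetric]
proof (rule sum_mono)
  fix j
  let ?a = "(real j + 1) / 2 ^ n" and ?b = "real j / 2 ^ n"
  show "norm (F ?a - F ?b) \<le> norm (G ?a - G ?b) + norm (F ?a - G ?a - (F ?b - G ?b))"
    using norm_triangle_ineq[of "G ?a - G ?b" "F ?a - G ?a - (F ?b - G ?b)"] by (simp add: algebra_simps)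
qed

section \<open>Density of step functions in L1\<close>

definition step_approx :: "(real \<Rightarrow> 'b::real_normed_vector) \<Rightarrow> bool" where
  "step_approx f \<longleftrightarrow> nice lborel f \<and> (\<forall>\<epsilon>>0. \<exists>n c. L1n (\<lambda>t. f t - step n c t) < \<epsilon>)"

lemma step_approx_add:
  assumes f: "step_approx f" and g: "step_approx g" shows "step_approx (\<lambda>t. f t + g t)"
  unfolding step_approx_def
proof (intro conjI allI impI)
  note nf = f[unfolded step_approx_def, THEN conjunct1] and ng = g[unfolded step_approx_def, THEN conjunct1]
  show "nice lborel (\<lambda>t. f t + g t)" by (rule nice_add[OF nf ng])
  fix \<epsilon> :: real assume "\<epsilon> > 0"
  then have "\<epsilon> / 2 > 0" by simp
  obtain n c where 1: "L1n (\<lambda>t. f t - step n c t) < \<epsilon> / 2" using f \<open>\<epsilon> / 2 > 0\<close> unfolding step_approx_def by blast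
  obtain m d where 2: "L1n (\<lambda>t. g t - step m d t) < \<epsilon> / 2" using g \<open>\<epsilon> / 2 > 0\<close> unfolding step_approx_def by blast
  \<comment> \<open>Both step functions are refined to the common level \<open>n + m\<close>, where
    they can be added coefficientwise.\<close>
  define c' where "c' j = c (j div 2 ^ m)" for j
  define d' where "d' j = d (j div 2 ^ n)" for j
  have c': "step n c = step (n + m) c'" using step_refine[of n c m] by (simp add: c'_def[abs_def])
  have d': "step m d = step (n + m) d'" using step_refine[of m d n] by (simp add: d'_def[abs_def] add.commute)
  have "L1n (\<lambda>t. (f t - step n c t) + (g t - step m d t)) \<le> L1n (\<lambda>t. f t - step n c t) + L1n (\<lambda>t. g t - step m d t)"
    by (intro L1n_add_le nice_diff nf ng nice_step)
  also have "\<dots> < \<epsilon>" using 1 2 by simp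
  also have "(\<lambda>t. (f t - step n c t) + (g t - step m d t)) = (\<lambda>t. f t + g t - step (n + m) (\<lambda>j. c' j + d' j) t)"
    unfolding c' d' by (rule ext) (simp add: step_def)
  finally show "\<exists>n c. L1n (\<lambda>t. f t + g t - step n c t) < \<epsilon>" by blast
qed

lemma step_approx_linear:
  assumes f: "step_approx f" and T: "bounded_linear T" shows "step_approx (\<lambda>t. T (f t))"
  unfolding step_approx_def
proof (intro conjI allI impI)
  note nf = f[unfolded step_approx_def, THEN conjunct1]
  interpret T: bounded_linear T by fact
  show "nice lborel (\<lambda>t. T (f t))" by (rule nice_bounded_linear[OF T nf])
  obtain K where K: "K > 0" "\<And>x. norm (T x) \<le> norm x * K" using T.pos_bounded by blast
  fix \<epsilon> :: real assume "\<epsilon> > 0"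
  then have "\<epsilon> / K > 0" using K by simp
  then obtain n c where 1: "L1n (\<lambda>t. f t - step n c t) < \<epsilon> / K" using f unfolding step_approx_def by blast
  have st: "T (step n c t) = step n (\<lambda>j. T (c j)) t" for t by (simp add: step_def T.zero)
  have "L1n (\<lambda>t. T (f t) - step n (\<lambda>j. T (c j)) t) \<le> (\<integral>t. norm (f t - step n c t) * K \<partial>lborel)"
    unfolding L1n_def st[symmetric] T.diff[symmetric]
    by (intro integral_mono nice_norm_integrable nice_bounded_linear[OF T] nice_diff nf nice_step
        integrable_mult_left K(2))
  also have "\<dots> = L1n (\<lambda>t. f t - step n c t) * K" by (simp add: L1n_def)
  also have "\<dots> < \<epsilon>" using 1 K by (simp add: field_simps)
  finally show "\<exists>n c. L1n (\<lambda>t. T (f t) - step n c t) < \<epsilon>" by blast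
qed

lemma step_approx_limit:
  assumes f: "nice lborel f" and lim: "\<And>\<epsilon>. \<epsilon> > 0 \<Longrightarrow> \<exists>g. step_approx g \<and> L1n (\<lambda>t. f t - g t) < \<epsilon>"
  shows "step_approx f"
  unfolding step_approx_def
proof (intro conjI allI impI f)
  fix \<epsilon> :: real assume "\<epsilon> > 0"
  then have e: "\<epsilon> / 2 > 0" by simp
  obtain g where g: "step_approx g" "L1n (\<lambda>t. f t - g t) < \<epsilon> / 2" using lim[OF e] by blast
  obtain n c where c: "L1n (\<lambda>t. g t - step n c t) < \<epsilon> / 2" and ng: "nice lborel g"
    using g(1) e unfolding step_approx_def by blast
  have "L1n (\<lambda>t. f t - step n c t) < \<epsilon>" using L1n_diff_le[OF f ng nice_step[of n c]] g c by linarith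
  then show "\<exists>n c. L1n (\<lambda>t. f t - step n c t) < \<epsilon>" by blast
qed

lemma step_approx_step: "step_approx (step n c)"
  unfolding step_approx_def
  by (intro conjI nice_step allI impI exI[of _ n] exI[of _ c]) (simp add: L1n_def)

lemma step_approx_diff: "step_approx f \<Longrightarrow> step_approx g \<Longrightarrow> step_approx (\<lambda>t. f t - g t)"
  using step_approx_add[OF _ step_approx_linear[OF _ bounded_linear_minus[OF bounded_linear_ident]]] by force

lemma nice_indicator_real: "A \<in> sets M \<Longrightarrow> emeasure M A < \<infinity> \<Longrightarrow> nice M (indicator A :: _ \<Rightarrow> real)"
  using nice_const_indicator[of A M "1::real"] by simp

lemma unit_Int_fin: "emeasure lborel (A \<inter> {0..<1::real}) < \<infinity>"
  by (rule le_less_trans[OF emeasure_mono[of _ "{0..<1}"]]) auto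

text \<open>The sets with this property form a Dynkin system that contains the open half-lines, an
  intersection-stable generator of the Borel sets.\<close>

lemma step_approx_indicator:
  assumes "A \<in> sets borel" shows "step_approx (indicator (A \<inter> {0..<1::real}) :: real \<Rightarrow> real)"
proof -
  define G :: "real set set" where "G = range (\<lambda>a. {..<a})"
  have "Int_stable G"
  proof (rule Int_stableI)
    fix X Y assume "X \<in> G" "Y \<in> G"
    then obtain a b where "X = {..<a}" "Y = {..<b}" by (auto simp: G_def)
    then have "X \<inter> Y = {..<min a b}" by auto
    then show "X \<inter> Y \<in> G" by (auto simp: G_def)
  qed
  moreover have "G \<subseteq> Pow UNIV" by auto
  moreover have "A \<in> sigma_sets UNIV G" using assms unfolding G_def borel_Iio by (simp add: sets_measure_of)
  ultimately show ?thesis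
  proof (induction rule: sigma_sets_induct_disjoint)
    case (basic A)
    then obtain a where A: "A = {..<a}" by (auto simp: G_def)
    have nA: "nice lborel (indicator (A \<inter> {0..<1}) :: real \<Rightarrow> real)"
      by (intro nice_indicator_real unit_Int_fin) (simp add: A)
    show ?case
      unfolding step_approx_def
    proof (intro conjI nA allI impI)
      fix \<epsilon> :: real assume "\<epsilon> > 0"
      then obtain n where n: "(1/2) ^ n < \<epsilon>" using real_arch_pow_inv[of \<epsilon> "1/2"] by auto
      \<comment> \<open>Cells whose right end is at most \<open>a\<close> get 1. Only the cell
        around \<open>a\<close> can be wrong, hence an error set of length \<open>1/2^n\<close> to
        the left of \<open>a\<close>.\<close>
      define c :: "nat \<Rightarrow> real" where "c j = (if (real j + 1) / 2 ^ n \<le> a then 1 else 0)" for j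
      have "L1n (\<lambda>t. indicator (A \<inter> {0..<1}) t - step n c t) \<le> (\<integral>t. indicator {a - 1 / 2 ^ n..a} t \<partial>lborel)"
        unfolding L1n_def
      proof (intro integral_mono nice_norm_integrable nice_diff nA nice_step)
        fix t :: real
        show "norm (indicator (A \<inter> {0..<1}) t - step n c t) \<le> indicator {a - 1 / 2 ^ n..a} t"
        proof (cases "0 \<le> t \<and> t < 1")
          case True
          define j where "j = nat \<lfloor>t * 2 ^ n\<rfloor>"
          have "real j / 2 ^ n \<le> t" "t < (real j + 1) / 2 ^ n"
            using dyadic_cell(2)[of t n j] True by (auto simp: j_def)
          then have j: "t < (real j + 1) / 2 ^ n" "(real j + 1) / 2 ^ n \<le> t + 1 / 2 ^ n"
            by (auto simp: add_divide_distrib)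
          have "step n c t = c j" using True by (simp add: step_def j_def)
          then show ?thesis using True j by (auto simp: c_def A indicator_def)
        qed (auto simp: step_def)
      qed auto
      also have "\<dots> = (1/2) ^ n" by (simp add: power_one_over)
      finally show "\<exists>n c. L1n (\<lambda>t. indicator (A \<inter> {0..<1}) t - step n c t :: real) < \<epsilon>" 
        using n by (intro exI[of _ n] exI[of _ c]) linarith
    qed
  next
    case empty
    have "(indicator ({} \<inter> {0..<1}) :: real \<Rightarrow> real) = step 0 (\<lambda>_. 0)" by (auto simp: step_def)
    then show ?case using step_approx_step by metis
  next
    case (compl A)
    have "(indicator ((UNIV - A) \<inter> {0..<1}) :: real \<Rightarrow> real) = (\<lambda>t. step 0 (\<lambda>_. 1) t - indicator (A \<inter> {0..<1}) t)"
      by (auto simp: step_def indicator_def)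
    then show ?case using step_approx_diff[OF step_approx_step compl(2)] by metis
  next
    case (union A)
    have A: "A i \<in> sets borel" for i
      using union(2) unfolding G_def borel_Iio by (auto simp: sets_measure_of)
    define B where "B = (\<Union>i. A i)"
    have B: "B \<in> sets borel" using A by (auto simp: B_def)
    have nB: "nice lborel (indicator (B \<inter> {0..<1}) :: real \<Rightarrow> real)"
      by (intro nice_indicator_real unit_Int_fin) (use B in auto)
    have part: "step_approx (\<lambda>t. \<Sum>i<N. indicator (A i \<inter> {0..<1}) t :: real)" for N
    proof (induction N)
      case 0
      have "(\<lambda>t. \<Sum>i<0. indicator (A i \<inter> {0..<1}) t :: real) = step 0 (\<lambda>_. 0)" by (auto simp: step_def)
      then show ?case using step_approx_step by metis
    next
      case (Suc N) then show ?case using step_approx_add[OF Suc union(3)] by simp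
    qed
    have partn: "nice lborel (\<lambda>t. \<Sum>i<N. indicator (A i \<inter> {0..<1}) t :: real)" for N
      using part[of N] by (simp add: step_approx_def)
    have sum_ind: "(\<Sum>i<N. indicator (A i \<inter> {0..<1}) t :: real) = indicator ((\<Union>i<N. A i) \<inter> {0..<1}) t" for N t
    proof -
      have "(\<Sum>i<N. indicator (A i \<inter> {0..<1}) t :: real) = indicator (\<Union>i<N. A i \<inter> {0..<1}) t"
        using union(1) by (intro indicator_UN_disjoint[symmetric]) (auto simp: disjoint_family_on_def)
      moreover have "(\<Union>i<N. A i \<inter> {0..<1}) = (\<Union>i<N. A i) \<inter> {0..<1}" by auto
      ultimately show ?thesis by metis
    qed
    have "(\<lambda>N. \<integral>t. norm (indicator (B \<inter> {0..<1}) t - (\<Sum>i<N. indicator (A i \<inter> {0..<1}) t :: real)) \<partial>lborel)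
        \<longlonglongrightarrow> (\<integral>t. (0::real) \<partial>(lborel :: real measure))"
    proof (rule integral_dominated_convergence[where w = "indicator {0..<1::real}"])
      show "AE t in lborel. (\<lambda>N. norm (indicator (B \<inter> {0..<1}) t - (\<Sum>i<N. indicator (A i \<inter> {0..<1}) t :: real))) \<longlonglongrightarrow> 0"
      proof (intro AE_I2 tendsto_eventually)
        fix t :: real
        show "\<forall>\<^sub>F N in sequentially. norm (indicator (B \<inter> {0..<1}) t - (\<Sum>i<N. indicator (A i \<inter> {0..<1}) t :: real)) = 0"
        proof (cases "t \<in> B")
          case True
          then obtain i where "t \<in> A i" by (auto simp: B_def)
          then show ?thesis
            unfolding sum_ind by (intro eventually_mono[OF eventually_gt_at_top[of i]]) (auto simp: indicator_def B_def)
        next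
          case False then show ?thesis unfolding sum_ind by (auto simp: B_def)
        qed
      qed
      show "AE t in lborel. norm (norm (indicator (B \<inter> {0..<1}) t - (\<Sum>i<N. indicator (A i \<inter> {0..<1}) t :: real))) \<le> indicator {0..<1} t" for N
        unfolding sum_ind by (rule AE_I2) (auto simp: indicator_def B_def)
      show "(\<lambda>t. norm (indicator (B \<inter> {0..<1}) t - (\<Sum>i<N. indicator (A i \<inter> {0..<1}) t :: real))) \<in> borel_measurable lborel" for N
        by (intro borel_measurable_integrable nice_norm_integrable nice_diff nB partn)
    qed auto
    then have lim: "(\<lambda>N. L1n (\<lambda>t. indicator (B \<inter> {0..<1}) t - (\<Sum>i<N. indicator (A i \<inter> {0..<1}) t :: real))) \<longlonglongrightarrow> 0"
      by (simp add: L1n_def)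
    have "step_approx (indicator (B \<inter> {0..<1}) :: real \<Rightarrow> real)"
    proof (rule step_approx_limit[OF nB])
      fix \<epsilon> :: real assume "\<epsilon> > 0"
      then obtain N where "L1n (\<lambda>t. indicator (B \<inter> {0..<1}) t - (\<Sum>i<N. indicator (A i \<inter> {0..<1}) t :: real)) < \<epsilon>"
        using order_tendstoD(2)[OF lim, of \<epsilon>] unfolding eventually_sequentially by blast
      then show "\<exists>g. step_approx g \<and> L1n (\<lambda>t. indicator (B \<inter> {0..<1}) t - g t :: real) < \<epsilon>"
        by (intro exI[of _ "\<lambda>t. \<Sum>i<N. indicator (A i \<inter> {0..<1}) t"] conjI part)
    qed
    then show ?case by (simp add: B_def)
  qed
qed

text \<open>A simple function approximates in L1, and its finitely many level sets reduce the claim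
  to indicators.\<close>

lemma nice_step_approx:
  fixes f :: "real \<Rightarrow> 'b::banach"
  assumes f: "nice lborel f" and zero: "\<And>t. t \<notin> {0..1} \<Longrightarrow> f t = 0"
  shows "step_approx f"
proof (rule step_approx_limit[OF f])
  fix \<epsilon> :: real assume e: "\<epsilon> > 0"
  obtain s where s: "\<And>k. sbi lborel (s k)" "(\<lambda>k. \<integral>\<^sup>+x. norm (f x - s k x) \<partial>lborel) \<longlonglongrightarrow> 0"
    using f unfolding nice_def by blast
  obtain k where k: "(\<integral>\<^sup>+x. norm (f x - s k x) \<partial>lborel) < ennreal \<epsilon>"
    using order_tendstoD(2)[OF s(2), of "ennreal \<epsilon>"] e by (auto simp: eventually_sequentially)
  \<comment> \<open>Since \<open>f\<close> vanishes outside [0,1], cutting down to [0,1) affects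
    only the null point 1 and regions where it cannot increase the distance to
    \<open>f\<close>.\<close>
  define g where "g t = indicator {0..<1} t *\<^sub>R s k t" for t
  have ng: "nice lborel g" unfolding g_def by (intro nice_ind nice_sbi s) auto
  have fin: "finite (range (s k))" using sbi_simple[OF s(1)[of k]] by (auto simp: simple_function_def)
  have ms: "{t. s k t = y} \<in> sets borel" if "y \<in> range (s k)" for y
    using sbi_simple[OF s(1)[of k]] that by (auto simp: simple_function_def vimage_def)
  have g_sum: "g t = (\<Sum>y\<in>range (s k). indicator ({t. s k t = y} \<inter> {0..<1}) t *\<^sub>R y)" for t
  proof -
    have "(\<Sum>y\<in>range (s k). indicator ({t. s k t = y} \<inter> {0..<1}) t *\<^sub>R y)
        = (\<Sum>y\<in>{s k t}. indicator ({t. s k t = y} \<inter> {0..<1}) t *\<^sub>R y)"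
      using fin by (intro sum.mono_neutral_right) (auto simp: indicator_def)
    then show ?thesis by (simp add: g_def indicator_def)
  qed
  have part: "step_approx (\<lambda>t. \<Sum>y\<in>Y. indicator ({t. s k t = y} \<inter> {0..<1}) t *\<^sub>R y)"
    if "Y \<subseteq> range (s k)" "finite Y" for Y
    using that(2,1)
  proof (induction Y)
    case empty
    have "(\<lambda>t::real. \<Sum>y\<in>{}. indicator ({t. s k t = y} \<inter> {0..<1}) t *\<^sub>R y) = step 0 (\<lambda>_. 0)" by (auto simp: step_def)
    then show ?case using step_approx_step by metis
  next
    case (insert y Y)
    have "step_approx (\<lambda>t. indicator ({t. s k t = y} \<inter> {0..<1}) t *\<^sub>R y)"
      using step_approx_linear[OF step_approx_indicator[OF ms] bounded_linear_scaleR_left] insert by auto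
    then have "step_approx (\<lambda>t. indicator ({t. s k t = y} \<inter> {0..<1}) t *\<^sub>R y
        + (\<Sum>y\<in>Y. indicator ({t. s k t = y} \<inter> {0..<1}) t *\<^sub>R y))"
      using insert by (intro step_approx_add) auto
    then show ?case by (simp only: sum.insert[OF insert(1,2)])
  qed
  have "step_approx g" using part[of "range (s k)"] fin by (simp add: g_sum[abs_def])
  moreover have "L1n (\<lambda>t. f t - g t) < \<epsilon>"
  proof -
    have "ennreal (L1n (\<lambda>t. f t - g t)) = (\<integral>\<^sup>+t. norm (f t - g t) \<partial>lborel)"
      unfolding L1n_def
      by (rule nn_integral_eq_integral[symmetric]) (auto intro!: nice_norm_integrable nice_diff f ng)
    also have "\<dots> \<le> (\<integral>\<^sup>+t. norm (f t - s k t) \<partial>lborel)"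
    proof (rule nn_integral_mono_AE)
      show "AE t in lborel. ennreal (norm (f t - g t)) \<le> ennreal (norm (f t - s k t))"
        using AE_lborel_singleton[of 1]
      proof eventually_elim
        case (elim t)
        show ?case
        proof (cases "t \<in> {0..<1}")
          case False
          then have "f t = 0" "g t = 0" using zero[of t] elim by (auto simp: g_def)
          then show ?thesis by simp
        qed (simp add: g_def)
      qed
    qed
    also have "\<dots> < ennreal \<epsilon>" by (rule k)
    finally show ?thesis using e by (simp add: ennreal_less_iff L1n_nonneg)
  qed
  ultimately show "\<exists>g. step_approx g \<and> L1n (\<lambda>t. f t - g t) < \<epsilon>" by blast
qed

text \<open>Equality holds for step functions from their level on, and both sides change by at most
  the L1 distance when \<open>f\<close> is replaced by a step function.\<close>

lemma dysum_tendsto: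
  assumes f: "step_approx f" shows "(\<lambda>n. dysum n (prim f)) \<longlonglongrightarrow> L1n f"
proof (rule LIMSEQ_I)
  fix r :: real assume r: "0 < r"
  note nf = f[unfolded step_approx_def, THEN conjunct1]
  obtain n c where c: "L1n (\<lambda>t. f t - step n c t) < r / 2" using f r unfolding step_approx_def by (meson half_gt_zero)
  have "norm (dysum m (prim f) - L1n f) < r" if m: "m \<ge> n" for m
  proof -
    have eq: "(\<lambda>s. prim (step n c) s - prim f s) = prim (\<lambda>t. step n c t - f t)"
      by (rule ext) (simp add: prim_diff[OF nice_step nf])
    have "dysum m (prim (step n c)) \<le> dysum m (prim f) + dysum m (prim (\<lambda>t. step n c t - f t))"
      using dysum_triangle[of m "prim (step n c)" "prim f"] by (simp add: eq)
    moreover have "dysum m (prim (\<lambda>t. step n c t - f t)) \<le> L1n (\<lambda>t. step n c t - f t)"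
      by (intro dysum_le nice_diff nice_step nf)
    moreover have "L1n f \<le> L1n (step n c) + L1n (\<lambda>t. f t - step n c t)" by (intro L1n_le nf nice_step)
    moreover have "dysum m (prim f) \<le> L1n f" by (rule dysum_le[OF nf])
    ultimately show ?thesis
      using c dysum_step[OF m, of c] L1n_minus_commute[of f "step n c"] by simp
  qed
  then show "\<exists>no. \<forall>n\<ge>no. norm (dysum n (prim f) - L1n f) < r" by blast
qed

text \<open>The coefficients are the averages of \<open>f\<close> over the cells. Averaging fixes
  step functions of level \<open>n\<close> and does not increase L1 distances, so it at most doubles
  the error of a given approximation. Averages matter because they are scaled increments of the
  primitive, that is, of a path.\<close>

lemma dyadic_average_approx:
  assumes f: "step_approx f" and e: "\<epsilon> > 0"
  shows "\<exists>n. L1n (\<lambda>t. f t - step n (\<lambda>j. 2 ^ n *\<^sub>R (prim f ((real j + 1) / 2 ^ n) - prim f (real j / 2 ^ n))) t) < \<epsilon>"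
proof -
  note nf = f[unfolded step_approx_def, THEN conjunct1]
  obtain n c where c: "L1n (\<lambda>t. f t - step n c t) < \<epsilon> / 2" using f e unfolding step_approx_def by (meson half_gt_zero)
  define d where "d j = 2 ^ n *\<^sub>R (prim f ((real j + 1) / 2 ^ n) - prim f (real j / 2 ^ n))" for j
  have "L1n (\<lambda>t. step n c t - step n d t) = dysum n (prim (\<lambda>t. step n c t - f t))"
    unfolding step_diff L1n_step dysum_def sum_divide_distrib
  proof (rule sum.cong[OF refl])
    fix j assume "j \<in> {..<(2::nat)^n}"
    then have j: "j < 2 ^ n" by simp
    have "c j - d j = 2 ^ n *\<^sub>R ((1 / 2 ^ n) *\<^sub>R c j - (prim f ((real j + 1) / 2 ^ n) - prim f (real j / 2 ^ n)))"
      by (simp add: d_def algebra_simps)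
    also have "\<dots> = 2 ^ n *\<^sub>R (prim (\<lambda>t. step n c t - f t) ((real j + 1) / 2 ^ n) - prim (\<lambda>t. step n c t - f t) (real j / 2 ^ n))"
      unfolding prim_step_increment[OF j, symmetric] prim_diff[OF nice_step nf] by (simp add: algebra_simps)
    finally show "norm (c j - d j) / 2 ^ n = norm (prim (\<lambda>t. step n c t - f t) ((real j + 1) / 2 ^ n) - prim (\<lambda>t. step n c t - f t) (real j / 2 ^ n))"
      by simp
  qed
  also have "\<dots> \<le> L1n (\<lambda>t. step n c t - f t)" by (intro dysum_le nice_diff nice_step nf)
  finally have "L1n (\<lambda>t. step n c t - step n d t) < \<epsilon> / 2" using c L1n_minus_commute[of f "step n c"] by simp
  then have "L1n (\<lambda>t. f t - step n d t) < \<epsilon>"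
    using L1n_diff_le[OF nf nice_step[of n c] nice_step[of n d]] c by linarith
  then show ?thesis by (auto simp: d_def[abs_def])
qed

section \<open>Real iterated integrals\<close>

lemma integrable_pair_mult:
  fixes f :: "'a \<Rightarrow> real" and g :: "'b \<Rightarrow> real"
  assumes M: "sigma_finite_measure M1" "sigma_finite_measure M2"
    and f: "integrable M1 f" and g: "integrable M2 g"
  shows "integrable (M1 \<Otimes>\<^sub>M M2) (\<lambda>(x, y). f x * g y)"
proof -
  interpret pair_sigma_finite M1 M2 using M by (simp add: pair_sigma_finite_def)
  have [measurable]: "f \<in> borel_measurable M1" "g \<in> borel_measurable M2" using f g by auto
  show ?thesis
  proof (rule Fubini_integrable)
    show "integrable M1 (\<lambda>x. \<integral>y. norm (case (x, y) of (x, y) \<Rightarrow> f x * g y) \<partial>M2)"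
      using f by (simp add: abs_mult)
    show "AE x in M1. integrable M2 (\<lambda>y. case (x, y) of (x, y) \<Rightarrow> f x * g y)"
      using g by simp
  qed measurable
qed

section \<open>Iterated integrals and the shuffle relation\<close>

text \<open>The outermost integral comes first, so that the product rule for primitives and the
  recursion of \<open>shuffle_words\<close> both peel off the head.\<close>

primrec iter_int :: "(real \<Rightarrow> real) list \<Rightarrow> real \<Rightarrow> real" where
  "iter_int [] u = 1"
| "iter_int (g # gs) u = (\<integral>s. indicator {0..u} s * (g s * iter_int gs s) \<partial>lborel)"

lemma iter_int_bounded:
  assumes "\<forall>g\<in>set gs. integrable lborel g"
  shows "iter_int gs \<in> borel_measurable borel \<and> (\<forall>u. \<bar>iter_int gs u\<bar> \<le> (\<Prod>g\<leftarrow>gs. \<integral>s. \<bar>g s\<bar> \<partial>lborel))"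
  using assms
proof (induction gs)
  case (Cons g gs)
  then have [measurable]: "iter_int gs \<in> borel_measurable borel" and B: "\<And>u. \<bar>iter_int gs u\<bar> \<le> (\<Prod>g\<leftarrow>gs. \<integral>s. \<bar>g s\<bar> \<partial>lborel)"
    and g: "integrable lborel g" by auto
  have [measurable]: "g \<in> borel_measurable borel" using borel_measurable_integrable[OF g] by simp
  define C where "C = (\<Prod>g\<leftarrow>gs. \<integral>s. \<bar>g s\<bar> \<partial>lborel)"
  have m: "(\<lambda>u. \<integral>s. indicator {0..u} s * (g s * iter_int gs s) \<partial>lborel) \<in> borel_measurable borel"
  proof -
    \<comment> \<open>Measurability in the upper limit comes from joint measurability of the moving
      interval in the pair of upper limit and integration variable.\<close>
    have [measurable]: "(\<lambda>p :: real \<times> real. indicator {0..fst p} (snd p) :: real) \<in> borel_measurable (borel \<Otimes>\<^sub>M lborel)"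
    proof -
      have eq: "(indicator {0..fst p} (snd p) :: real) = indicator {p :: real \<times> real. 0 \<le> snd p \<and> snd p \<le> fst p} p" for p
        by (auto simp: indicator_def)
      have "{p \<in> space (borel \<Otimes>\<^sub>M lborel). 0 \<le> snd p \<and> snd p \<le> fst p} \<in> sets (borel \<Otimes>\<^sub>M (lborel :: real measure))"
        by measurable
      then have "{p :: real \<times> real. 0 \<le> snd p \<and> snd p \<le> fst p} \<in> sets (borel \<Otimes>\<^sub>M lborel)"
        by (simp only: space_pair_measure space_borel space_lborel UNIV_Times_UNIV UNIV_I simp_thms)
      then show ?thesis unfolding eq by (rule borel_measurable_indicator)
    qed
    have "(\<lambda>p. indicator {0..fst p} (snd p) * (g (snd p) * iter_int gs (snd p))) \<in> borel_measurable (borel \<Otimes>\<^sub>M lborel)"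
      by measurable
    then show ?thesis
      by (intro lborel.borel_measurable_lebesgue_integral) (simp add: case_prod_beta')
  qed
  have "\<bar>\<integral>s. indicator {0..u} s * (g s * iter_int gs s) \<partial>lborel\<bar> \<le> (\<integral>s. \<bar>g s\<bar> \<partial>lborel) * C" for u
  proof -
    have le: "norm (indicator {0..u} s * (g s * iter_int gs s)) \<le> \<bar>g s\<bar> * C" for s
      using B[of s] by (auto simp: indicator_def abs_mult C_def intro: mult_left_mono)
    have int: "integrable lborel (\<lambda>s. indicator {0..u} s * (g s * iter_int gs s))"
      by (rule Bochner_Integration.integrable_bound[where f = "\<lambda>s. \<bar>g s\<bar> * C"])
         (use g le in \<open>auto intro: order_trans[OF _ abs_ge_self]\<close>)
    have "\<bar>\<integral>s. indicator {0..u} s * (g s * iter_int gs s) \<partial>lborel\<bar>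
       \<le> (\<integral>s. norm (indicator {0..u} s * (g s * iter_int gs s)) \<partial>lborel)"
      using integral_norm_bound[of lborel "\<lambda>s. indicator {0..u} s * (g s * iter_int gs s)"] by simp
    also have "\<dots> \<le> (\<integral>s. \<bar>g s\<bar> * C \<partial>lborel)"
      using int g le by (intro integral_mono) auto
    finally show ?thesis by simp
  qed
  then show ?case using m by (auto simp: C_def)
next
  case Nil
  have "iter_int [] = (\<lambda>_. 1)" by auto
  then show ?case by simp
qed

lemma iter_int_mult_integrable:
  assumes gs: "\<forall>h\<in>set gs. integrable lborel h" and g: "integrable lborel g"
  shows "integrable lborel (\<lambda>s. g s * iter_int gs s)"
proof -
  have [measurable]: "iter_int gs \<in> borel_measurable borel" using iter_int_bounded[OF gs] by blast
  define C where "C = (\<Prod>g\<leftarrow>gs. \<integral>s. \<bar>g s\<bar> \<partial>lborel)"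
  have B: "\<bar>iter_int gs u\<bar> \<le> C" for u using iter_int_bounded[OF gs] by (auto simp: C_def)
  have [measurable]: "g \<in> borel_measurable borel" using borel_measurable_integrable[OF g] by simp
  show ?thesis
    by (rule Bochner_Integration.integrable_bound[where f = "\<lambda>s. \<bar>g s\<bar> * C"])
       (use g B in \<open>auto simp: abs_mult intro!: mult_left_mono order_trans[OF B abs_ge_self]\<close>)
qed

text \<open>Integration by parts for merely integrable densities, by Fubini: the square over [0,u]
  is the union of the triangles \<open>S\<close> and \<open>S'\<close>, which meet only in the null
  diagonal.\<close>

lemma product_of_primitives:
  fixes a b :: "real \<Rightarrow> real"
  assumes a: "integrable lborel a" and b: "integrable lborel b"
  shows "(\<integral>s. indicator {0..u} s * a s \<partial>lborel) * (\<integral>s. indicator {0..u} s * b s \<partial>lborel)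
    = (\<integral>s. indicator {0..u} s * (a s * (\<integral>r. indicator {0..s} r * b r \<partial>lborel)) \<partial>lborel)
    + (\<integral>s. indicator {0..u} s * (b s * (\<integral>r. indicator {0..s} r * a r \<partial>lborel)) \<partial>lborel)"
proof -
  have [measurable]: "a \<in> borel_measurable borel" "b \<in> borel_measurable borel"
    using borel_measurable_integrable a b by auto
  define S where "S = {p :: real \<times> real. 0 \<le> snd p \<and> snd p \<le> fst p \<and> fst p \<le> u}"
  define S' where "S' = {p :: real \<times> real. 0 \<le> fst p \<and> fst p \<le> snd p \<and> snd p \<le> u}"
  have "{p \<in> space (borel \<Otimes>\<^sub>M borel). 0 \<le> snd p \<and> snd p \<le> fst p \<and> fst p \<le> u} \<in> sets (borel \<Otimes>\<^sub>M borel)"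
    "{p \<in> space (borel \<Otimes>\<^sub>M borel). 0 \<le> fst p \<and> fst p \<le> snd p \<and> snd p \<le> u} \<in> sets (borel \<Otimes>\<^sub>M borel)"
    by measurable
  then have [measurable]: "S \<in> sets (borel \<Otimes>\<^sub>M borel)" "S' \<in> sets (borel \<Otimes>\<^sub>M borel)"
    by (simp_all add: S_def S'_def space_pair_measure)
  have ab: "integrable (lborel \<Otimes>\<^sub>M lborel) (\<lambda>(s, r). a s * b r)"
    by (rule integrable_pair_mult) (use a b in \<open>auto intro: lborel.sigma_finite_measure_axioms\<close>)
  have i: "integrable (lborel \<Otimes>\<^sub>M lborel) (\<lambda>(s, r). indicator X (s, r) * (a s * b r))"
    if [measurable]: "X \<in> sets (borel \<Otimes>\<^sub>M borel)" for X
  proof (rule Bochner_Integration.integrable_bound[OF ab])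
    have "(\<lambda>p. indicator X p * (a (fst p) * b (snd p))) \<in> borel_measurable (borel \<Otimes>\<^sub>M borel)" by measurable
    then show "(\<lambda>(s, r). indicator X (s, r) * (a s * b r)) \<in> borel_measurable (lborel \<Otimes>\<^sub>M lborel)"
      by (simp add: case_prod_beta')
  qed (auto simp: indicator_def)
  define C where "C = {0..u} \<times> {0..u}"
  have [measurable]: "C \<in> sets (borel \<Otimes>\<^sub>M borel)" unfolding C_def by measurable
  have "(\<integral>s. indicator {0..u} s * a s \<partial>lborel) * (\<integral>r. indicator {0..u} r * b r \<partial>lborel)
      = (\<integral>s. (\<integral>r. indicator C (s, r) * (a s * b r) \<partial>lborel) \<partial>lborel)"
  proof -
    have "indicator C (s, r) * (a s * b r) = (indicator {0..u} s * a s) * (indicator {0..u} r * b r)" for s r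
      by (auto simp: C_def indicator_def)
    then show ?thesis by (simp only: integral_mult_right_zero integral_mult_left_zero)
  qed
  also have "\<dots> = (\<integral>s. (\<integral>r. indicator S (s, r) * (a s * b r) + indicator S' (s, r) * (a s * b r) \<partial>lborel) \<partial>lborel)"
  proof (rule Bochner_Integration.integral_cong[OF refl])
    fix s :: real
    have [measurable]: "(\<lambda>r. indicator X (s, r) :: real) \<in> borel_measurable borel"
      if [measurable]: "X \<in> sets (borel \<Otimes>\<^sub>M borel)" for X
      by (rule measurable_compose[of "\<lambda>r. (s, r)" _ "borel \<Otimes>\<^sub>M borel"]) measurable
    show "(\<integral>r. indicator C (s, r) * (a s * b r) \<partial>lborel)
        = (\<integral>r. indicator S (s, r) * (a s * b r) + indicator S' (s, r) * (a s * b r) \<partial>lborel)"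
    proof (rule integral_cong_AE)
      \<comment> \<open>For fixed \<open>s\<close> the diagonal is a single point.\<close>
      have "AE r in lborel. r \<noteq> s" by (rule AE_lborel_singleton)
      then show "AE r in lborel. indicator C (s, r) * (a s * b r)
          = indicator S (s, r) * (a s * b r) + indicator S' (s, r) * (a s * b r)"
        by eventually_elim (auto simp: C_def S_def S'_def indicator_def)
    qed measurable
  qed
  also have "\<dots> = (\<integral>p. indicator S p * (a (fst p) * b (snd p)) + indicator S' p * (a (fst p) * b (snd p)) \<partial>(lborel \<Otimes>\<^sub>M lborel))"
    using lborel_pair.integral_fst[of "\<lambda>s r. indicator S (s, r) * (a s * b r) + indicator S' (s, r) * (a s * b r)"]
      i[of S] i[of S'] by (simp add: case_prod_beta')
  also have "\<dots> = (\<integral>p. indicator S p * (a (fst p) * b (snd p)) \<partial>(lborel \<Otimes>\<^sub>M lborel))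
      + (\<integral>p. indicator S' p * (a (fst p) * b (snd p)) \<partial>(lborel \<Otimes>\<^sub>M lborel))"
    using i[of S] i[of S'] by (intro Bochner_Integration.integral_add) (auto simp: case_prod_beta')
  also have "(\<integral>p. indicator S p * (a (fst p) * b (snd p)) \<partial>(lborel \<Otimes>\<^sub>M lborel))
      = (\<integral>s. (\<integral>r. indicator S (s, r) * (a s * b r) \<partial>lborel) \<partial>lborel)"
    using lborel_pair.integral_fst[of "\<lambda>s r. indicator S (s, r) * (a s * b r)"] i[of S] by (simp add: case_prod_beta')
  also have "\<dots> = (\<integral>s. indicator {0..u} s * (a s * (\<integral>r. indicator {0..s} r * b r \<partial>lborel)) \<partial>lborel)"
  proof (rule Bochner_Integration.integral_cong[OF refl])
    fix s :: real
    have "indicator S (s, r) * (a s * b r) = (indicator {0..u} s * a s) * (indicator {0..s} r * b r)" for r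
      by (auto simp: S_def indicator_def)
    then show "(\<integral>r. indicator S (s, r) * (a s * b r) \<partial>lborel)
        = indicator {0..u} s * (a s * (\<integral>r. indicator {0..s} r * b r \<partial>lborel))"
      by (simp only: integral_mult_right_zero mult.assoc)
  qed
  also have "(\<integral>p. indicator S' p * (a (fst p) * b (snd p)) \<partial>(lborel \<Otimes>\<^sub>M lborel))
      = (\<integral>r. (\<integral>s. indicator S' (s, r) * (a s * b r) \<partial>lborel) \<partial>lborel)"
    using lborel_pair.integral_snd[of "\<lambda>s r. indicator S' (s, r) * (a s * b r)"] i[of S'] by (simp add: case_prod_beta')
  also have "\<dots> = (\<integral>s. indicator {0..u} s * (b s * (\<integral>r. indicator {0..s} r * a r \<partial>lborel)) \<partial>lborel)"
  proof (rule Bochner_Integration.integral_cong[OF refl])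
    fix r :: real
    have "indicator S' (s, r) * (a s * b r) = (indicator {0..u} r * b r) * (indicator {0..r} s * a s)" for s
      by (auto simp: S'_def indicator_def)
    then show "(\<integral>s. indicator S' (s, r) * (a s * b r) \<partial>lborel)
        = indicator {0..u} r * (b r * (\<integral>s. indicator {0..r} s * a s \<partial>lborel))"
      by (simp only: integral_mult_right_zero mult.assoc)
  qed
  finally show ?thesis .
qed

text \<open>A list rather than a set, since equal shuffles count with multiplicity.\<close>

fun shuffle_words :: "'a list \<Rightarrow> 'a list \<Rightarrow> 'a list list" where
  "shuffle_words [] ys = [ys]"
| "shuffle_words (x # xs) [] = [x # xs]"
| "shuffle_words (x # xs) (y # ys) =
     map ((#) x) (shuffle_words xs (y # ys)) @ map ((#) y) (shuffle_words (x # xs) ys)"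

lemma shuffle_words_props:
  "ws \<in> set (shuffle_words xs ys) \<Longrightarrow> length ws = length xs + length ys \<and> set ws = set xs \<union> set ys"
  by (induction xs ys arbitrary: ws rule: shuffle_words.induct) auto

lemma shuffle_words_map: "shuffle_words (map f xs) (map f ys) = map (map f) (shuffle_words xs ys)"
  by (induction xs ys rule: shuffle_words.induct) auto

text \<open>Integration by parts splits the product according to which word supplies the latest
  time, and this is the recursion of \<open>shuffle_words\<close>.\<close>

lemma iter_int_mult:
  assumes "\<forall>g\<in>set gs. integrable lborel g" "\<forall>g\<in>set hs. integrable lborel g"
  shows "iter_int gs u * iter_int hs u = (\<Sum>ws\<leftarrow>shuffle_words gs hs. iter_int ws u)"
  using assms
proof (induction gs hs arbitrary: u rule: shuffle_words.induct)
  case (3 x xs y ys)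
  have sum: "(\<Sum>ws\<leftarrow>W. \<integral>s. indicator {0..u} s * (z s * iter_int ws s) \<partial>lborel)
      = (\<integral>s. indicator {0..u} s * (z s * (\<Sum>ws\<leftarrow>W. iter_int ws s)) \<partial>lborel)"
    if z: "integrable lborel z" and W: "\<forall>ws\<in>set W. \<forall>g\<in>set ws. integrable lborel g" for z W
    using W
  proof (induction W)
    case (Cons ws W)
    have i: "integrable lborel (\<lambda>s. indicator {0..u} s * (z s * iter_int v s))" if "\<forall>g\<in>set v. integrable lborel g" for v
      using integrable_mult_indicator[OF _ iter_int_mult_integrable[OF that z], of "{0..u}"] by simp
    have "integrable lborel (\<lambda>s. indicator {0..u} s * (z s * (\<Sum>ws\<leftarrow>W. iter_int ws s)))"
      using Cons.prems
    proof (induction W)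
      case (Cons v W)
      then have "integrable lborel (\<lambda>s. indicator {0..u} s * (z s * iter_int v s) + indicator {0..u} s * (z s * (\<Sum>ws\<leftarrow>W. iter_int ws s)))"
        by (intro Bochner_Integration.integrable_add i) auto
      then show ?case by (simp add: algebra_simps)
    qed simp
    then show ?case
      using Cons i[of ws] by (simp add: algebra_simps)
  qed simp
  have x: "integrable lborel x" and y: "integrable lborel y" and xs: "\<forall>g\<in>set xs. integrable lborel g"
    and ys: "\<forall>g\<in>set ys. integrable lborel g" using 3 by auto
  have "iter_int (x # xs) u * iter_int (y # ys) u
     = (\<integral>s. indicator {0..u} s * ((x s * iter_int xs s) * iter_int (y # ys) s) \<partial>lborel)
     + (\<integral>s. indicator {0..u} s * ((y s * iter_int ys s) * iter_int (x # xs) s) \<partial>lborel)"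
    using product_of_primitives[OF iter_int_mult_integrable[OF xs x] iter_int_mult_integrable[OF ys y], of u] by simp
  also have "(\<integral>s. indicator {0..u} s * ((x s * iter_int xs s) * iter_int (y # ys) s) \<partial>lborel)
     = (\<integral>s. indicator {0..u} s * (x s * (\<Sum>ws\<leftarrow>shuffle_words xs (y # ys). iter_int ws s)) \<partial>lborel)"
    using 3 by (intro Bochner_Integration.integral_cong[OF refl]) (simp del: iter_int.simps add: mult.assoc)
  also have "\<dots> = (\<Sum>ws\<leftarrow>shuffle_words xs (y # ys). iter_int (x # ws) u)"
    using 3(3,4) by (subst sum[symmetric, OF x]) (auto dest!: shuffle_words_props)
  also have "(\<integral>s. indicator {0..u} s * ((y s * iter_int ys s) * iter_int (x # xs) s) \<partial>lborel)
     = (\<integral>s. indicator {0..u} s * (y s * (\<Sum>ws\<leftarrow>shuffle_words (x # xs) ys. iter_int ws s)) \<partial>lborel)"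
    using 3 by (intro Bochner_Integration.integral_cong[OF refl]) (simp del: iter_int.simps add: mult.assoc mult.commute mult.left_commute)
  also have "\<dots> = (\<Sum>ws\<leftarrow>shuffle_words (x # xs) ys. iter_int (y # ws) u)"
    using 3(3,4) by (subst sum[symmetric, OF y]) (auto dest!: shuffle_words_props)
  finally show ?case by (simp del: iter_int.simps add: comp_def)
qed auto

text \<open>Shuffling one letter into \<open>m\<close> equal ones gives \<open>m + 1\<close> copies
  of the same word; this is where the factorial arises.\<close>

lemma iter_int_replicate:
  assumes h: "integrable lborel h"
  shows "iter_int (replicate m h) u = (\<integral>s. indicator {0..u} s * h s \<partial>lborel) ^ m / fact m"
proof (induction m)
  case (Suc m)
  have sh: "shuffle_words [h] (replicate m h) = replicate (Suc m) (replicate (Suc m) h)"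
    by (induction m) auto
  have "iter_int [h] u * iter_int (replicate m h) u = real (Suc m) * iter_int (replicate (Suc m) h) u"
    using h by (subst iter_int_mult) (auto simp: sh sum_list_replicate simp del: iter_int.simps replicate_Suc)
  then have "real (Suc m) * iter_int (replicate (Suc m) h) u
      = (\<integral>s. indicator {0..u} s * h s \<partial>lborel) * ((\<integral>s. indicator {0..u} s * h s \<partial>lborel) ^ m / fact m)"
    unfolding Suc by simp
  then have "iter_int (replicate (Suc m) h) u
      = (\<integral>s. indicator {0..u} s * h s \<partial>lborel) * ((\<integral>s. indicator {0..u} s * h s \<partial>lborel) ^ m / fact m) / real (Suc m)"
    by (metis nonzero_mult_div_cancel_left of_nat_neq_0)
  then show ?case by (simp del: iter_int.simps replicate_Suc)
qed simp

section \<open>Integrals over the ordered simplex\<close>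

definition osimplex :: "nat \<Rightarrow> real \<Rightarrow> (nat \<Rightarrow> real) set" where
  "osimplex m u = {t. t ` {..<m} \<subseteq> {0..u} \<and> mono_on {..<m} t}"

abbreviation cube :: "nat \<Rightarrow> (nat \<Rightarrow> real) measure" where
  "cube m \<equiv> \<Pi>\<^sub>M i\<in>{..<m}. lborel"

interpretation cube: product_sigma_finite "\<lambda>i. lborel :: real measure" ..

lemma simplex_measure_eq: "simplex_measure m u = restrict_space (cube m) (osimplex m u)"
  by (simp add: simplex_measure_def osimplex_def)

text \<open>\<open>osimplex\<close> constrains only the coordinates below \<open>m\<close> and
  contains functions that are not extensional; hence the intersection with the space.\<close>

lemma sets_simplex: "osimplex m u \<inter> space (cube m) \<in> sets (cube m)"
proof -
  have "osimplex m u \<inter> space (cube m) = {t\<in>space (cube m). (\<forall>i\<in>{..<m}. 0 \<le> t i \<and> t i \<le> u) \<and>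
      (\<forall>i\<in>{..<m}. \<forall>j\<in>{..<m}. i \<le> j \<longrightarrow> t i \<le> t j)}"
    by (auto simp: osimplex_def monotone_on_def)
  also have "\<dots> \<in> sets (cube m)"
  proof -
    have c: "(\<lambda>t. t i) \<in> borel_measurable (cube m)" if "i < m" for i
      using measurable_component_singleton[of i "{..<m}" "\<lambda>_. lborel"] that by simp
    have 1: "{t\<in>space (cube m). i \<in> {..<m} \<longrightarrow> 0 \<le> t i \<and> t i \<le> u} \<in> sets (cube m)" for i
    proof (cases "i < m")
      case True
      note [measurable] = c[OF True]
      have "{t\<in>space (cube m). 0 \<le> t i \<and> t i \<le> u} \<in> sets (cube m)" by measurable
      then show ?thesis using True by simp
    qed simp
    have 2: "{t\<in>space (cube m). i \<in> {..<m} \<longrightarrow> j \<in> {..<m} \<longrightarrow> i \<le> j \<longrightarrow> t i \<le> t j} \<in> sets (cube m)" for i j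
    proof (cases "i < m \<and> j < m \<and> i \<le> j")
      case True
      then have [measurable]: "(\<lambda>t. t i) \<in> borel_measurable (cube m)" "(\<lambda>t. t j) \<in> borel_measurable (cube m)"
        using c by auto
      have "{t\<in>space (cube m). t i \<le> t j} \<in> sets (cube m)" by measurable
      then show ?thesis using True by simp
    next
      case False
      then have "{t\<in>space (cube m). i \<in> {..<m} \<longrightarrow> j \<in> {..<m} \<longrightarrow> i \<le> j \<longrightarrow> t i \<le> t j} = space (cube m)" by auto
      then show ?thesis by simp
    qed
    have "{t\<in>space (cube m). (\<forall>i. i \<in> {..<m} \<longrightarrow> 0 \<le> t i \<and> t i \<le> u) \<and>
      (\<forall>i j. i \<in> {..<m} \<longrightarrow> j \<in> {..<m} \<longrightarrow> i \<le> j \<longrightarrow> t i \<le> t j)} \<in> sets (cube m)"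
      by (intro sets.sets_Collect_conj sets.sets_Collect_countable_All 1 2)
    moreover have "{t\<in>space (cube m). (\<forall>i. i \<in> {..<m} \<longrightarrow> 0 \<le> t i \<and> t i \<le> u) \<and>
      (\<forall>i j. i \<in> {..<m} \<longrightarrow> j \<in> {..<m} \<longrightarrow> i \<le> j \<longrightarrow> t i \<le> t j)}
      = {t\<in>space (cube m). (\<forall>i\<in>{..<m}. 0 \<le> t i \<and> t i \<le> u) \<and>
      (\<forall>i\<in>{..<m}. \<forall>j\<in>{..<m}. i \<le> j \<longrightarrow> t i \<le> t j)}" by blast
    ultimately show ?thesis by (rule back_subst[where P = "\<lambda>X. X \<in> sets (cube m)"])
  qed
  finally show ?thesis .
qed

text \<open>The last coordinate is the largest; fixing it leaves the simplex up to that time, which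
  matches the recursion of \<open>iter_int\<close>.\<close>

lemma simplex_Suc:
  "x(m := y) \<in> osimplex (Suc m) u \<longleftrightarrow> y \<in> {0..u} \<and> x \<in> osimplex m y"
proof
  assume *: "x(m := y) \<in> osimplex (Suc m) u"
  then have m: "mono_on {..<Suc m} (x(m := y))" and r: "(x(m := y)) ` {..<Suc m} \<subseteq> {0..u}"
    by (auto simp: osimplex_def)
  have "x i \<le> y" if "i < m" for i using mono_onD[OF m, of i m] that by simp
  moreover have "0 \<le> x i" if "i < m" for i
  proof -
    have "(x(m := y)) i \<in> {0..u}" using r that by (intro subsetD[OF r] imageI) auto
    then show ?thesis using that by simp
  qed
  moreover have "y \<in> {0..u}"
  proof -
    have "(x(m := y)) m \<in> {0..u}" by (intro subsetD[OF r] imageI) auto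
    then show ?thesis by simp
  qed
  moreover have "mono_on {..<m} x"
  proof (rule mono_onI)
    fix i j assume "i \<in> {..<m}" "j \<in> {..<m}" "i \<le> j"
    then show "x i \<le> x j" using mono_onD[OF m, of i j] by simp
  qed
  ultimately show "y \<in> {0..u} \<and> x \<in> osimplex m y" by (auto simp: osimplex_def)
next
  assume *: "y \<in> {0..u} \<and> x \<in> osimplex m y"
  then have x: "0 \<le> x i" "x i \<le> y" if "i < m" for i using that by (auto simp: osimplex_def)
  have m: "x i \<le> x j" if "i \<le> j" "j < m" for i j
    using * that by (auto simp: osimplex_def intro: mono_onD)
  have "(x(m := y)) i \<in> {0..u}" if "i < Suc m" for i
  proof (cases "i = m")
    case False
    then show ?thesis using x[of i] that * by auto
  qed (use * in simp)
  moreover have "mono_on {..<Suc m} (x(m := y))"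
  proof (rule mono_onI)
    fix i j assume "i \<in> {..<Suc m}" "j \<in> {..<Suc m}" "i \<le> j"
    then show "(x(m := y)) i \<le> (x(m := y)) j" using x(2)[of i] m[of i j] by (cases "j = m"; cases "i = m") auto
  qed
  ultimately show "x(m := y) \<in> osimplex (Suc m) u" unfolding osimplex_def by blast
qed

lemma integrable_cube_prod:
  assumes "\<forall>g\<in>set gs. integrable lborel g"
  shows "integrable (cube (length gs)) (\<lambda>t. \<Prod>i<length gs. (gs ! i) (t i) :: real)"
  using assms by (intro cube.product_integrable_prod) auto

text \<open>The last factor carries the largest time and thus the outermost integral, hence the
  induction from the right end and the reversed list.\<close>

lemma integral_simplex_prod:
  fixes gs :: "(real \<Rightarrow> real) list"
  assumes "\<forall>g\<in>set gs. integrable lborel g"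
  shows "(\<integral>t. indicator (osimplex (length gs) u) t * (\<Prod>i<length gs. (gs ! i) (t i)) \<partial>cube (length gs)) = iter_int (rev gs) u"
  using assms
proof (induction gs arbitrary: u rule: rev_induct)
  case Nil
  have "osimplex 0 u = UNIV" by (auto simp: osimplex_def monotone_on_def)
  then show ?case by (simp add: measure_def space_PiM emeasure_PiM_empty prod_emb_def PiM_empty)
next
  case (snoc g gs)
  define m where "m = length gs"
  have g: "integrable lborel g" and gs: "\<forall>g\<in>set gs. integrable lborel g" using snoc by auto
  define P where "P t = (\<Prod>i<m. (gs ! i) (t i))" for t :: "nat \<Rightarrow> real"
  define F where "F t = indicator (osimplex (Suc m) u) t * (\<Prod>i<Suc m. ((gs @ [g]) ! i) (t i))" for t :: "nat \<Rightarrow> real"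
  have F_upd: "F (x(m := y)) = indicator {0..u} y * (g y * (indicator (osimplex m y) x * P x))" for x y
  proof -
    have "(\<Prod>i<m. ((gs @ [g]) ! i) ((x(m := y)) i)) = P x"
      unfolding P_def by (rule prod.cong) (auto simp: m_def nth_append)
    then show ?thesis
      using simplex_Suc[of x m y u] by (auto simp: F_def indicator_def m_def)
  qed
  have iF: "integrable (cube (Suc m)) F"
  proof -
    have "integrable (cube (Suc m)) (\<lambda>t. indicator (osimplex (Suc m) u \<inter> space (cube (Suc m))) t *\<^sub>R (\<Prod>i<Suc m. ((gs @ [g]) ! i) (t i)))"
      using integrable_cube_prod[of "gs @ [g]"] snoc.prems by (intro integrable_mult_indicator sets_simplex) (simp_all add: m_def)
    then show ?thesis
      by (rule Bochner_Integration.integrable_cong[THEN iffD1, rotated -1]) (auto simp: F_def indicator_def)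
  qed
  have ins: "{..<Suc m} = insert m {..<m}" by auto
  interpret Q: pair_sigma_finite "cube m" "lborel :: real measure"
    by (intro pair_sigma_finite.intro cube.sigma_finite lborel.sigma_finite_measure_axioms) auto
  have [measurable]: "(\<lambda>(x, y). x(m := y)) \<in> measurable (cube m \<Otimes>\<^sub>M lborel) (cube (Suc m))"
    unfolding ins by (rule measurable_add_dim)
  have iP: "integrable (cube m) P" unfolding P_def m_def using integrable_cube_prod[OF gs] .
  \<comment> \<open>Fubini needs integrability over the product; the indicators only cut down a
    product of two integrable functions.\<close>
  have pair: "integrable (cube m \<Otimes>\<^sub>M lborel) (\<lambda>(x, y). F (x(m := y)))"
  proof (rule Bochner_Integration.integrable_bound)
    show "integrable (cube m \<Otimes>\<^sub>M lborel) (\<lambda>(x, y). P x * g y)"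
      by (rule integrable_pair_mult[OF _ _ iP g]) (auto intro: cube.sigma_finite lborel.sigma_finite_measure_axioms)
    have "F \<in> borel_measurable (cube (Suc m))" using iF by auto
    then have "(\<lambda>p. F ((\<lambda>(x, y). x(m := y)) p)) \<in> borel_measurable (cube m \<Otimes>\<^sub>M lborel)" by measurable
    then show "(\<lambda>(x, y). F (x(m := y))) \<in> borel_measurable (cube m \<Otimes>\<^sub>M lborel)" by (simp add: case_prod_beta')
    show "AE p in cube m \<Otimes>\<^sub>M lborel. norm (case p of (x, y) \<Rightarrow> F (x(m := y))) \<le> norm (case p of (x, y) \<Rightarrow> P x * g y)"
      by (rule AE_I2) (auto simp: F_upd indicator_def abs_mult)
  qed
  have "(\<integral>t. F t \<partial>cube (Suc m)) = (\<integral>x. (\<integral>y. F (x(m := y)) \<partial>lborel) \<partial>cube m)"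
    using iF unfolding ins by (intro cube.product_integral_insert) auto
  also have "\<dots> = (\<integral>y. (\<integral>x. F (x(m := y)) \<partial>cube m) \<partial>lborel)"
    using Q.Fubini_integral[of "\<lambda>x y. F (x(m := y))"] pair by simp
  also have "\<dots> = (\<integral>y. indicator {0..u} y * (g y * iter_int (rev gs) y) \<partial>lborel)"
  proof (rule Bochner_Integration.integral_cong[OF refl])
    fix y
    have "(\<integral>x. F (x(m := y)) \<partial>cube m) = indicator {0..u} y * (g y * (\<integral>x. indicator (osimplex m y) x * P x \<partial>cube m))"
      by (simp only: F_upd integral_mult_right_zero)
    then show "(\<integral>x. F (x(m := y)) \<partial>cube m) = indicator {0..u} y * (g y * iter_int (rev gs) y)"
      using snoc.IH[OF gs, of y] by (simp add: P_def m_def)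
  qed
  finally show ?case by (simp add: F_def m_def)
qed

lemma integral_simplex_measure:
  fixes h :: "(nat \<Rightarrow> real) \<Rightarrow> real"
  shows "(\<integral>t. h t \<partial>simplex_measure m u) = (\<integral>t. indicator (osimplex m u) t * h t \<partial>cube m)"
  unfolding simplex_measure_eq using integral_restrict_space[OF sets_simplex, where f = h] by simp

lemma integrable_simplex_prod:
  assumes "\<forall>g\<in>set gs. integrable lborel g"
  shows "integrable (simplex_measure (length gs) u) (\<lambda>t. \<Prod>i<length gs. (gs ! i) (t i) :: real)"
proof -
  have "integrable (cube (length gs)) (\<lambda>t. indicator (osimplex (length gs) u \<inter> space (cube (length gs))) t *\<^sub>R (\<Prod>i<length gs. (gs ! i) (t i)))"
    by (intro integrable_mult_indicator sets_simplex integrable_cube_prod assms)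
  then have "integrable (cube (length gs)) (\<lambda>t. indicator (osimplex (length gs) u) t *\<^sub>R (\<Prod>i<length gs. (gs ! i) (t i)))"
    by (rule Bochner_Integration.integrable_cong[THEN iffD1, rotated -1]) (auto simp: indicator_def)
  then show ?thesis
    unfolding simplex_measure_eq using integrable_restrict_space[OF sets_simplex] by blast
qed

lemma iter_int_eq_simplex:
  assumes "\<forall>g\<in>set gs. integrable lborel g"
  shows "(\<integral>t. (\<Prod>i<length gs. (gs ! i) (t i)) \<partial>simplex_measure (length gs) u) = iter_int (rev gs) u"
  using integral_simplex_prod[OF assms] by (simp add: integral_simplex_measure)

text \<open>The source of the factorial decay in all signature estimates.\<close>

lemma nn_integral_simplex_power:
  assumes h: "integrable lborel h" "\<And>t. 0 \<le> h t"
  shows "(\<integral>\<^sup>+t. ennreal (\<Prod>i<m. h (t i)) \<partial>simplex_measure m u) = ennreal ((\<integral>s. indicator {0..u} s * h s \<partial>lborel) ^ m / fact m)"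
proof -
  have "integrable (simplex_measure m u) (\<lambda>t. \<Prod>i<m. h (t i))"
    using integrable_simplex_prod[of "replicate m h" u] h(1) by (simp cong: prod.cong_simp)
  moreover have "(\<integral>t. (\<Prod>i<m. h (t i)) \<partial>simplex_measure m u) = (\<integral>s. indicator {0..u} s * h s \<partial>lborel) ^ m / fact m"
    using iter_int_eq_simplex[of "replicate m h" u] iter_int_replicate[OF h(1), of m u] h(1)
    by (simp cong: prod.cong_simp)
  ultimately show ?thesis
    using h(2) by (subst nn_integral_eq_integral) (auto intro: prod_nonneg)
qed

lemma finite_simplex_measure: "finite_measure (simplex_measure m u)"
proof
  have "emeasure (simplex_measure m u) (space (simplex_measure m u)) = emeasure (cube m) (osimplex m u \<inter> space (cube m))"
    unfolding simplex_measure_eq by (subst emeasure_restrict_space[OF sets_simplex]) (auto simp: space_restrict_space)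
  also have "\<dots> \<le> emeasure (cube m) (\<Pi>\<^sub>E i\<in>{..<m}. {0..u})"
    by (intro emeasure_mono sets_PiM_I_finite) (auto simp: osimplex_def space_PiM)
  also have "\<dots> = (\<Prod>i<m. emeasure lborel {0..u})" by (intro cube.emeasure_PiM) auto
  also have "\<dots> < \<infinity>" by (simp add: power_less_top_ennreal emeasure_lborel_Icc_eq)
  finally show "emeasure (simplex_measure m u) (space (simplex_measure m u)) \<noteq> \<infinity>" by simp
qed

section \<open>Signatures of integrable functions on the unit interval\<close>

lemma nice_L1_approx:
  assumes f: "nice lborel f" and e: "\<epsilon> > 0"
  obtains s where "sbi lborel s" "L1n (\<lambda>t. f t - s t) < \<epsilon>"
proof -
  obtain s where s: "\<And>k. sbi lborel (s k)" "(\<lambda>k. \<integral>\<^sup>+x. norm (f x - s k x) \<partial>lborel) \<longlonglongrightarrow> 0"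
    using f unfolding nice_def by blast
  obtain k where k: "(\<integral>\<^sup>+x. norm (f x - s k x) \<partial>lborel) < ennreal \<epsilon>"
    using order_tendstoD(2)[OF s(2), of "ennreal \<epsilon>"] e by (auto simp: eventually_sequentially)
  have "ennreal (L1n (\<lambda>t. f t - s k t)) = (\<integral>\<^sup>+x. norm (f x - s k x) \<partial>lborel)"
    unfolding L1n_def
    by (rule nn_integral_eq_integral[OF nice_norm_integrable[OF nice_diff[OF f nice_sbi[OF s(1)]]], symmetric]) auto
  then have "L1n (\<lambda>t. f t - s k t) < \<epsilon>" using k by (metis L1n_nonneg ennreal_less_iff)
  then show ?thesis using that s(1) by blast
qed

lemma prod_list_upt: "prod_list (map f [0..<m]) = (\<Prod>i<m. f i :: real)"
  by (induction m) auto

lemma prod_list_map_mono: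
  fixes f g :: "'i \<Rightarrow> real"
  assumes "\<And>i. i \<in> set is \<Longrightarrow> 0 \<le> f i \<and> f i \<le> g i"
  shows "prod_list (map f is) \<le> prod_list (map g is)"
proof -
  have "0 \<le> prod_list (map f is) \<and> prod_list (map f is) \<le> prod_list (map g is)"
    using assms
  proof (induction "is")
    case (Cons i "is")
    then have i: "0 \<le> f i" "f i \<le> g i" and P: "0 \<le> prod_list (map f is)" "prod_list (map f is) \<le> prod_list (map g is)"
      by simp_all
    have "0 \<le> g i" using i by (rule order_trans)
    then show ?case
      using mult_mono[OF i(2) P(2) _ P(1)] mult_nonneg_nonneg[OF i(1) P(1)] by (simp only: list.map prod_list.Cons simp_thms)
  qed simp
  then show ?thesis ..
qed

lemma measurable_simplex_component:
  "i < m \<Longrightarrow> (\<lambda>t. t i) \<in> measurable (simplex_measure m u) lborel"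
  unfolding simplex_measure_eq by (intro measurable_restrict_space1 measurable_component_singleton) auto

text \<open>\<open>seq_norm\<close> is a square-sum norm; this bound compares the squares of the
  signature estimates with the exponential series at \<open>K\<^sup>2\<close>.\<close>

lemma power_div_fact_sq_le: "((K::real) ^ m / fact m)\<^sup>2 \<le> (K\<^sup>2) ^ m / fact m"
proof -
  have "(K ^ m / fact m)\<^sup>2 = (K\<^sup>2) ^ m / (fact m * fact m)" by (simp add: power2_eq_square power_mult_distrib)
  also have "\<dots> \<le> (K\<^sup>2) ^ m / (fact m * 1)"
    by (intro divide_left_mono mult_left_mono) (auto simp: fact_ge_1)
  finally show ?thesis by simp
qed

lemma exp_series: "summable (\<lambda>m. (K::real) ^ m / fact m)" "(\<Sum>m. K ^ m / fact m) = exp K"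
proof -
  have "(\<lambda>m. K ^ m / fact m) sums exp K"
    using exp_converges[of K] by (simp add: divide_inverse mult.commute)
  then show "summable (\<lambda>m. K ^ m / fact m)" "(\<Sum>m. K ^ m / fact m) = exp K"
    by (auto simp: sums_iff)
qed

section \<open>Norm estimates for elementary tensors\<close>

context admissible_tensor_powers
begin

lemma norm_tens_append: "norm (tens (u @ v)) \<le> norm (tens u) * norm (tens v)"
  using norm_mult[of "{u}" "length u" "{v}" "length v" "\<lambda>_. 1" "\<lambda>_. 1"] by simp

lemma norm_tens_le: "norm (tens u) \<le> prod_list (map norm u)"
proof (induction u)
  case (Cons a u)
  have "norm (tens (a # u)) \<le> norm (tens [a]) * norm (tens u)" using norm_tens_append[of "[a]" u] by simp
  also have "\<dots> \<le> norm a * prod_list (map norm u)" using Cons by (simp add: norm_single mult_left_mono)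
  finally show ?case by simp
qed (simp add: norm_empty)

lemma norm_tens_cons_diff:
  assumes "length u = length v"
  shows "norm (tens (a # u) - tens (a # v)) \<le> norm a * norm (tens u - tens v)"
\<comment> \<open>For \<open>u = v\<close> the set \<open>{u, v}\<close> is a singleton and the
  coefficients 1 and -1 would collide.\<close>
proof (cases "u = v")
  case False
  have "norm (\<Sum>u'\<in>{[a]}. \<Sum>w\<in>{u, v}. (1 * (if w = u then 1 else - 1)) *\<^sub>R tens (u' @ w))
      \<le> norm (\<Sum>u'\<in>{[a]}. 1 *\<^sub>R tens u') * norm (\<Sum>w\<in>{u, v}. (if w = u then 1 else - 1) *\<^sub>R tens w)"
    using assms by (intro norm_mult[of _ 1 _ "length u"]) auto
  then show ?thesis using False by (simp add: norm_single)
qed simp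

lemma linear_tens_at: "linear (\<lambda>w. tens (p @ w # q))"
proof -
  have "linear (\<lambda>w. tens ((p @ 0 # q)[length p := w]))"
    using multilinear[of "length (p @ 0 # q)", unfolded multilinear_on_words_def,
        THEN bspec[of _ _ "p @ 0 # q"], THEN spec[of _ "length p"]] by simp
  then show ?thesis by simp
qed

text \<open>The prefix \<open>p\<close> is there for the induction: already treated factors move
  into it.\<close>

lemma tens_scale:
  "tens (p @ map (\<lambda>i. c *\<^sub>R F i) is) = c ^ length is *\<^sub>R tens (p @ map F is)"
proof (induction "is" arbitrary: p)
  case (Cons i "is")
  have "tens (p @ map (\<lambda>i. c *\<^sub>R F i) (i # is)) = tens (p @ (c *\<^sub>R F i) # map (\<lambda>i. c *\<^sub>R F i) is)" by simp
  also have "\<dots> = c *\<^sub>R tens ((p @ [F i]) @ map (\<lambda>i. c *\<^sub>R F i) is)"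
    using linear_scale[OF linear_tens_at] by simp
  also have "\<dots> = c *\<^sub>R c ^ length is *\<^sub>R tens (p @ F i # map F is)" unfolding Cons by simp
  finally show ?case by simp
qed simp

text \<open>The parameter \<open>\<theta>\<close> trades the sum over the positions of the single difference for a plain product,
  whose integral over the simplex is known.\<close>

lemma tens_diff_bound:
  assumes \<theta>: "\<theta> > 0"
    and b: "\<And>i. i \<in> set is \<Longrightarrow> norm (F i) \<le> h i \<and> norm (G i) \<le> h i \<and> norm (F i - G i) \<le> k i"
  shows "\<theta> * norm (tens (map F is) - tens (map G is))
    \<le> prod_list (map (\<lambda>i. h i + \<theta> * k i) is) - prod_list (map h is)"
  using b
proof (induction "is")
  case (Cons i "is")
  define d where "d = norm (tens (map F is) - tens (map G is))"
  define P where "P = prod_list (map h is)"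
  define Q where "Q = prod_list (map (\<lambda>i. h i + \<theta> * k i) is)"
  have IH: "\<theta> * d \<le> Q - P" using Cons by (simp add: d_def P_def Q_def)
  have bi: "norm (F i) \<le> h i" "norm (F i - G i) \<le> k i" using Cons.prems by auto
  have h0: "0 \<le> h i" "0 \<le> k i" using bi norm_ge_zero order_trans by blast+
  have "norm (tens (map G is)) \<le> P"
    unfolding P_def using Cons.prems prod_list_map_mono[of "is" "\<lambda>i. norm (G i)" h]
    by (intro order_trans[OF norm_tens_le]) (auto simp: comp_def)
  then have G: "norm (F i - G i) * norm (tens (map G is)) \<le> k i * P" using bi h0 by (intro mult_mono) auto
  \<comment> \<open>Telescoping: the tail is exchanged behind \<open>F i\<close>, then the head in
    front of the exchanged tail.\<close>
  have "tens (map F (i # is)) - tens (map G (i # is))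
     = (tens (F i # map F is) - tens (F i # map G is)) + tens ((F i - G i) # map G is)"
    using linear_diff[OF linear_tens_at[of "[]" "map G is"], of "F i" "G i"] by simp
  then have "norm (tens (map F (i # is)) - tens (map G (i # is)))
      \<le> norm (tens (F i # map F is) - tens (F i # map G is)) + norm (tens ((F i - G i) # map G is))"
    by (metis norm_triangle_ineq)
  also have "\<dots> \<le> norm (F i) * d + norm (F i - G i) * norm (tens (map G is))"
    using norm_tens_cons_diff[of "map F is" "map G is" "F i"] norm_tens_append[of "[F i - G i]" "map G is"]
    by (simp add: d_def norm_single)
  also have "\<dots> \<le> h i * d + k i * P"
    using bi(1) G by (intro add_mono mult_right_mono) (auto simp: d_def)
  finally have "\<theta> * norm (tens (map F (i # is)) - tens (map G (i # is))) \<le> \<theta> * (h i * d + k i * P)"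
    using \<theta> by (intro mult_left_mono) auto
  also have "\<dots> = h i * (\<theta> * d) + \<theta> * k i * P" by (simp add: algebra_simps)
  also have "\<dots> \<le> h i * (Q - P) + \<theta> * k i * Q"
  proof -
    have "P \<le> Q" using IH \<theta> by (metis d_def diff_ge_0_iff_ge less_imp_le mult_nonneg_nonneg norm_ge_zero order_trans)
    then show ?thesis using IH h0 \<theta> by (intro add_mono mult_left_mono) auto
  qed
  also have "\<dots> = (h i + \<theta> * k i) * Q - h i * P" by (simp add: algebra_simps)
  finally show ?case by (simp add: P_def Q_def)
qed simp

abbreviation tens_along :: "nat \<Rightarrow> (real \<Rightarrow> 'w) \<Rightarrow> (nat \<Rightarrow> real) \<Rightarrow> 'e" where
  "tens_along m f t \<equiv> tens (map (\<lambda>i. f (t i)) [0..<m])"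

text \<open>With \<open>\<theta> = 1 / \<delta>\<close> the dominating function \<open>H\<close> has
  integral at most \<open>L1n f + L1n g + 1\<close>, so a factor \<delta> remains in front of a
  bound free of \<delta>. The separate positive \<delta> is kept because the L1 distance itself may
  be 0.\<close>

lemma nn_integral_tens_diff:
  assumes f: "nice lborel f" and g: "nice lborel g" and \<delta>: "L1n (\<lambda>t. f t - g t) \<le> \<delta>" "\<delta> > 0"
  shows "(\<integral>\<^sup>+t. norm (tens_along m f t - tens_along m g t) \<partial>simplex_measure m u)
     \<le> ennreal (\<delta> * ((L1n f + L1n g + 1) ^ m / fact m))"
proof -
  define h where "h t = norm (f t) + norm (g t)" for t
  define k where "k t = norm (f t - g t)" for t
  define H where "H t = h t + (1 / \<delta>) * k t" for t
  have int: "integrable lborel h" "integrable lborel k"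
    unfolding h_def k_def by (intro Bochner_Integration.integrable_add nice_norm_integrable nice_diff f g)+
  then have iH: "integrable lborel H" unfolding H_def by auto
  have H0: "0 \<le> H t" for t using \<delta> by (auto simp: H_def h_def k_def)
  have pt: "norm (tens_along m f t - tens_along m g t) \<le> \<delta> * (\<Prod>i<m. H (t i))" for t
  proof -
    have "(1 / \<delta>) * norm (tens_along m f t - tens_along m g t)
        \<le> prod_list (map (\<lambda>i. h (t i) + (1 / \<delta>) * k (t i)) [0..<m]) - prod_list (map (\<lambda>i. h (t i)) [0..<m])"
      using \<delta> by (intro tens_diff_bound) (auto simp: h_def k_def)
    also have "\<dots> \<le> (\<Prod>i<m. H (t i))"
      unfolding prod_list_upt by (auto simp: H_def h_def intro!: prod_nonneg)
    finally show ?thesis using \<delta> by (simp add: field_simps)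
  qed
  have "(\<integral>\<^sup>+t. norm (tens_along m f t - tens_along m g t) \<partial>simplex_measure m u)
      \<le> (\<integral>\<^sup>+t. ennreal \<delta> * ennreal (\<Prod>i<m. H (t i)) \<partial>simplex_measure m u)"
    using pt \<delta> H0 by (intro nn_integral_mono) (simp add: ennreal_mult[symmetric] prod_nonneg ennreal_leI)
  also have "\<dots> = ennreal \<delta> * (\<integral>\<^sup>+t. ennreal (\<Prod>i<m. H (t i)) \<partial>simplex_measure m u)"
  proof (rule nn_integral_cmult)
    show "(\<lambda>t. ennreal (\<Prod>i<m. H (t i))) \<in> borel_measurable (simplex_measure m u)"
      using integrable_simplex_prod[of "replicate m H" u] iH by (simp cong: prod.cong_simp)
  qed
  also have "\<dots> = ennreal (\<delta> * ((\<integral>s. indicator {0..u} s * H s \<partial>lborel) ^ m / fact m))"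
    by (simp only: nn_integral_simplex_power[OF iH H0] ennreal_mult'[OF less_imp_le[OF \<delta>(2)]])
  also have "\<dots> \<le> ennreal (\<delta> * ((L1n f + L1n g + 1) ^ m / fact m))"
  proof -
    have "(\<integral>s. indicator {0..u} s * H s \<partial>lborel) \<le> (\<integral>s. H s \<partial>lborel)"
      using iH H0 integrable_mult_indicator[OF _ iH, of "{0..u}"]
      by (intro integral_mono) (auto simp: indicator_def)
    also have "\<dots> = L1n f + L1n g + (1 / \<delta>) * L1n (\<lambda>t. f t - g t)"
      unfolding H_def h_def k_def L1n_def
      using nice_norm_integrable[OF f] nice_norm_integrable[OF g] nice_norm_integrable[OF nice_diff[OF f g]] by simp
    also have "\<dots> \<le> L1n f + L1n g + 1" using \<delta> by (simp add: field_simps)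
    finally have "(\<integral>s. indicator {0..u} s * H s \<partial>lborel) \<le> L1n f + L1n g + 1" .
    moreover have "0 \<le> (\<integral>s. indicator {0..u} s * H s \<partial>lborel)"
      using H0 by (intro integral_nonneg_AE) auto
    ultimately show ?thesis
      using \<delta> by (intro ennreal_leI mult_left_mono divide_right_mono power_mono) auto
  qed
  finally show ?thesis .
qed

text \<open>A simple function produces only finitely many words, so preimages are sorted by words
  and no measurability of \<open>tens\<close> is required.\<close>

lemma sbi_tens_along:
  assumes s: "sbi lborel s" shows "sbi (simplex_measure m u) (tens_along m s)"
proof
  define S where "S = simplex_measure m u"
  define X where "X = {ws. set ws \<subseteq> range s \<and> length ws = m}"
  have "finite (range s)" using sbi_simple[OF s] by (simp add: simple_function_def)
  then have X: "finite X" unfolding X_def by (rule finite_lists_length_eq)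
  have inX: "map (\<lambda>i. s (t i)) [0..<m] \<in> X" for t by (auto simp: X_def)
  have meas: "{t\<in>space S. map (\<lambda>i. s (t i)) [0..<m] = ws} \<in> sets S" if "ws \<in> X" for ws
  proof -
    have "{t\<in>space S. map (\<lambda>i. s (t i)) [0..<m] = ws} = {t\<in>space S. \<forall>i\<in>{..<m}. s (t i) = ws ! i}"
      using that by (auto simp: X_def list_eq_iff_nth_eq)
    also have "\<dots> \<in> sets S"
    proof (intro sets.sets_Collect_finite_All)
      fix i assume "i \<in> {..<m}"
      then have "(\<lambda>t. t i) \<in> measurable S lborel" unfolding S_def by (intro measurable_simplex_component) simp
      then have "(\<lambda>t. s (t i)) \<in> measurable S (count_space UNIV)"
        by (rule measurable_compose) (rule measurable_simple_function[OF sbi_simple[OF s]])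
      then have "(\<lambda>t. s (t i)) -` {ws ! i} \<inter> space S \<in> sets S" by (rule measurable_sets) simp
      then show "{t\<in>space S. s (t i) = ws ! i} \<in> sets S" by (simp add: vimage_def Int_def conj_commute)
    qed simp
    finally show ?thesis .
  qed
  show "simple_function (simplex_measure m u) (tens_along m s)"
    unfolding simple_function_def S_def[symmetric]
  proof (intro conjI ballI)
    show "finite (tens_along m s ` space S)"
      by (rule finite_subset[of _ "tens ` X"]) (use X inX in auto)
    fix y
    have "tens_along m s -` {y} \<inter> space S = (\<Union>ws\<in>{ws\<in>X. tens ws = y}. {t\<in>space S. map (\<lambda>i. s (t i)) [0..<m] = ws})"
      using inX by auto
    also have "\<dots> \<in> sets S" using X by (intro sets.finite_UN meas) auto
    finally show "tens_along m s -` {y} \<inter> space S \<in> sets S" .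
  qed
  show "emeasure (simplex_measure m u) {t\<in>space (simplex_measure m u). tens_along m s t \<noteq> 0} \<noteq> \<infinity>"
    using finite_measure.emeasure_finite[OF finite_simplex_measure] by simp
qed

lemma nice_tens_along:
  assumes f: "nice lborel f" shows "nice (simplex_measure m u) (tens_along m f)"
proof -
  obtain s where s: "\<And>k. sbi lborel (s k)" "\<And>x. (\<lambda>k. s k x) \<longlonglongrightarrow> f x"
     "(\<lambda>k. \<integral>\<^sup>+x. norm (f x - s k x) \<partial>lborel) \<longlonglongrightarrow> 0"
    using f unfolding nice_def by auto
  have L: "ennreal (L1n (\<lambda>t. f t - s k t)) = (\<integral>\<^sup>+x. norm (f x - s k x) \<partial>lborel)" for k
    unfolding L1n_def
    by (rule nn_integral_eq_integral[OF nice_norm_integrable[OF nice_diff[OF f nice_sbi[OF s(1)]]], symmetric]) auto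
  have L0: "(\<lambda>k. L1n (\<lambda>t. f t - s k t)) \<longlonglongrightarrow> 0"
    using s(3) ennreal_tendsto_0_iff[of "\<lambda>k. L1n (\<lambda>t. f t - s k t)"] L1n_nonneg unfolding L[symmetric] by blast
  have lim: "(\<lambda>k. \<integral>\<^sup>+t. norm (tens_along m f t - tens_along m (s k) t) \<partial>simplex_measure m u) \<longlonglongrightarrow> 0"
  proof (rule tendsto_sandwich[OF _ _ tendsto_const])
    \<comment> \<open>The summand \<open>1 / (k + 1)\<close> makes this bound positive, as
      \<open>nn_integral_tens_diff\<close> demands.\<close>
    define \<delta> where "\<delta> k = L1n (\<lambda>t. f t - s k t) + 1 / (real k + 1)" for k
    have \<delta>0: "\<delta> k > 0" for k using L1n_nonneg[of "\<lambda>t. f t - s k t"] by (auto simp: \<delta>_def add_nonneg_pos)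
    have \<delta>: "\<delta> \<longlonglongrightarrow> 0"
      unfolding \<delta>_def using tendsto_add[OF L0 LIMSEQ_inverse_real_of_nat] by (simp add: inverse_eq_divide add.commute)
    define B where "B k = \<delta> k * ((L1n f + (L1n f + \<delta> k) + 1) ^ m / fact m)" for k
    have "(\<lambda>k. B k) \<longlonglongrightarrow> 0 * ((L1n f + (L1n f + 0) + 1) ^ m / fact m)"
      unfolding B_def by (intro tendsto_intros \<delta>) auto
    then show "(\<lambda>k. ennreal (B k)) \<longlonglongrightarrow> 0" using tendsto_ennrealI[of B 0] by simp
    show "\<forall>\<^sub>F k in sequentially. (\<integral>\<^sup>+t. norm (tens_along m f t - tens_along m (s k) t) \<partial>simplex_measure m u) \<le> ennreal (B k)"
    proof (intro always_eventually allI)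
      fix k
      have le: "L1n (\<lambda>t. f t - s k t) \<le> \<delta> k" by (simp add: \<delta>_def)
      have "L1n (s k) \<le> L1n f + \<delta> k"
        using L1n_le[OF nice_sbi[OF s(1)[of k]] f] le L1n_minus_commute[of f "s k"] by linarith
      then have "\<delta> k * ((L1n f + L1n (s k) + 1) ^ m / fact m) \<le> B k"
        unfolding B_def using \<delta>0[of k] L1n_nonneg[of f] L1n_nonneg[of "s k"]
        by (intro mult_left_mono divide_right_mono power_mono) auto
      then show "(\<integral>\<^sup>+t. norm (tens_along m f t - tens_along m (s k) t) \<partial>simplex_measure m u) \<le> ennreal (B k)"
        using nn_integral_tens_diff[OF f nice_sbi[OF s(1)] le \<delta>0] ennreal_leI order_trans by blast
    qed
  qed auto
  have pt: "(\<lambda>k. tens_along m (s k) t) \<longlonglongrightarrow> tens_along m f t" for t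
  proof (rule metric_LIMSEQ_I)
    fix e :: real assume e: "e > 0"
    \<comment> \<open>In \<open>tens_diff_bound\<close> take \<open>norm (f (t i)) + 1\<close> for
      \<open>h\<close> and \<open>1 / \<theta>\<close> for \<open>k\<close>. Each factor becomes
      \<open>norm (f (t i)) + 2\<close>, the error is at most \<open>C / \<theta>\<close>, and
      \<theta> is chosen to push it below \<open>e\<close>.\<close>
    define C where "C = (\<Prod>i<m. norm (f (t i)) + 2)"
    define \<theta> where "\<theta> = (C + 1) / e"
    have C: "C \<ge> 0" unfolding C_def by (intro prod_nonneg) auto
    then have \<theta>: "\<theta> > 0" using e by (simp add: \<theta>_def)
    have "\<forall>i<m. \<exists>N. \<forall>k\<ge>N. norm (f (t i) - s k (t i)) < min 1 (1 / \<theta>)"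
    proof (intro allI impI)
      fix i
      have "(\<lambda>k. f (t i) - s k (t i)) \<longlonglongrightarrow> f (t i) - f (t i)" by (intro tendsto_intros s)
      then show "\<exists>N. \<forall>k\<ge>N. norm (f (t i) - s k (t i)) < min 1 (1 / \<theta>)"
        using LIMSEQ_D[of "\<lambda>k. f (t i) - s k (t i)" 0 "min 1 (1 / \<theta>)"] \<theta> by auto
    qed
    then obtain N where N: "\<And>i k. i < m \<Longrightarrow> k \<ge> N i \<Longrightarrow> norm (f (t i) - s k (t i)) < min 1 (1 / \<theta>)" by metis
    show "\<exists>no. \<forall>k\<ge>no. dist (tens_along m (s k) t) (tens_along m f t) < e"
    proof (intro exI allI impI)
      fix k assume "k \<ge> (\<Sum>i<m. N i)"
      then have k: "k \<ge> N i" if "i < m" for i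
        using that member_le_sum[of i "{..<m}" N] by auto
      have close: "norm (f (t i) - s k (t i)) \<le> 1 / \<theta>" "norm (s k (t i)) \<le> norm (f (t i)) + 1" if "i < m" for i
        using N[OF that k[OF that]] norm_triangle_ineq2[of "s k (t i)" "f (t i)"] by (auto simp: norm_minus_commute)
      have "\<theta> * norm (tens_along m f t - tens_along m (s k) t)
          \<le> prod_list (map (\<lambda>i. (norm (f (t i)) + 1) + \<theta> * (1 / \<theta>)) [0..<m]) - prod_list (map (\<lambda>i. norm (f (t i)) + 1) [0..<m])"
        using close by (intro tens_diff_bound[OF \<theta>]) auto
      also have "\<dots> \<le> C"
        unfolding prod_list_upt C_def using \<theta> by (auto simp: add.assoc intro!: prod_nonneg)
      finally have "norm (tens_along m f t - tens_along m (s k) t) \<le> C / \<theta>" using \<theta> by (simp add: field_simps)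
      also have "\<dots> < e" using C e by (simp add: \<theta>_def field_simps)
      finally show "dist (tens_along m (s k) t) (tens_along m f t) < e" by (simp add: dist_norm norm_minus_commute)
    qed
  qed
  show ?thesis unfolding nice_def using sbi_tens_along[OF s(1)] pt lim
    by (intro exI[of _ "\<lambda>k. tens_along m (s k)"]) auto
qed

section \<open>The signature as a function of the velocity\<close>

text \<open>The signature of the path on [0,1] with velocity \<open>f\<close>. In terms of
  velocities, dilation is multiplication of \<open>f\<close> by a scalar and continuity is an L1
  statement.\<close>

definition usig :: "(real \<Rightarrow> 'w) \<Rightarrow> nat \<Rightarrow> 'e" where
  "usig f m = bint (simplex_measure m 1) (tens_along m f)"

lemma norm_bint_diff_le:
  assumes "nice M F" "nice M G" "(\<integral>\<^sup>+t. norm (F t - G t) \<partial>M) \<le> ennreal b" "0 \<le> b"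
  shows "norm (bint M F - bint M G) \<le> b"
proof -
  have n: "nice M (\<lambda>t. F t - G t)" by (rule nice_diff[OF assms(1,2)])
  have "ennreal (\<integral>t. norm (F t - G t) \<partial>M) \<le> ennreal b"
    using assms(3) nn_integral_eq_integral[OF nice_norm_integrable[OF n]] by simp
  then have "(\<integral>t. norm (F t - G t) \<partial>M) \<le> b" using assms(4) by simp
  then show ?thesis using norm_bint_le[OF n] bint_diff[OF assms(1,2)] by simp
qed

lemma usig_diff:
  assumes f: "nice lborel f" and g: "nice lborel g" and \<delta>: "L1n (\<lambda>t. f t - g t) \<le> \<delta>" "\<delta> > 0"
  shows "norm (usig f m - usig g m) \<le> \<delta> * ((L1n f + L1n g + 1) ^ m / fact m)"
  unfolding usig_def using nn_integral_tens_diff[OF f g \<delta>, of m 1] \<delta> L1n_nonneg[of f] L1n_nonneg[of g]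
  by (intro norm_bint_diff_le nice_tens_along f g) auto

lemma usig_norm:
  assumes f: "nice lborel f" shows "norm (usig f m) \<le> L1n f ^ m / fact m"
proof -
  have i: "integrable lborel (\<lambda>t. norm (f t))" by (rule nice_norm_integrable[OF f])
  have "(\<integral>\<^sup>+t. norm (tens_along m f t - 0) \<partial>simplex_measure m 1)
      \<le> (\<integral>\<^sup>+t. ennreal (\<Prod>i<m. norm (f (t i))) \<partial>simplex_measure m 1)"
  proof (intro nn_integral_mono ennreal_leI)
    fix t
    show "norm (tens_along m f t - 0) \<le> (\<Prod>i<m. norm (f (t i)))"
      using norm_tens_le[of "map (\<lambda>i. f (t i)) [0..<m]"] by (simp add: comp_def prod_list_upt)
  qed
  also have "\<dots> = ennreal ((\<integral>s. indicator {0..1} s * norm (f s) \<partial>lborel) ^ m / fact m)"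
    by (rule nn_integral_simplex_power[OF i]) simp
  also have "\<dots> \<le> ennreal (L1n f ^ m / fact m)"
    unfolding L1n_def using i integrable_mult_indicator[OF _ i, of "{0..1}"]
    by (intro ennreal_leI divide_right_mono power_mono integral_mono integral_nonneg_AE) (auto simp: indicator_def)
  finally have "norm (usig f m - bint (simplex_measure m 1) (\<lambda>_. 0)) \<le> L1n f ^ m / fact m"
    unfolding usig_def using L1n_nonneg[of f] by (intro norm_bint_diff_le nice_tens_along f nice_zero) auto
  moreover have "bint (simplex_measure m 1) (\<lambda>_. 0 :: 'e) = 0"
    using bint_const_indicator[of "{}" "simplex_measure m 1" "0::'e"] by simp
  ultimately show ?thesis by simp
qed

lemma usig_scale:
  assumes f: "nice lborel f" shows "usig (\<lambda>t. c *\<^sub>R f t) = dilate c (usig f)"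
proof
  fix m
  show "usig (\<lambda>t. c *\<^sub>R f t) m = dilate c (usig f) m"
    unfolding usig_def dilate_def
    by (subst bint_scaleR[OF nice_tens_along[OF f], symmetric]) (simp add: tens_scale[of "[]", simplified])
qed

text \<open>For a simple velocity the integral is a finite combination of elementary tensors;
  \<open>usig_diff\<close> then gives membership in the closure.\<close>

lemma usig_in_power:
  assumes f: "nice lborel f" shows "usig f m \<in> tensor_power tens m"
  unfolding tensor_power_def closure_approachable
proof (intro allI impI)
  fix e :: real assume e: "e > 0"
  \<comment> \<open>This bounds the factor in \<open>usig_diff\<close> for all approximations within
    L1 distance 1, which is why \<delta> is at most 1.\<close>
  define K where "K = (L1n f + (L1n f + 1) + 1) ^ m / fact m"
  have K: "K \<ge> 0" using L1n_nonneg[of f] by (auto simp: K_def)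
  define \<delta> where "\<delta> = min 1 (e / (K + 1))"
  have \<delta>: "\<delta> > 0" "\<delta> \<le> 1" "\<delta> * K < e"
  proof -
    show "\<delta> > 0" "\<delta> \<le> 1" using e K by (auto simp: \<delta>_def)
    have "\<delta> * K \<le> e / (K + 1) * K" using K by (intro mult_right_mono) (auto simp: \<delta>_def)
    also have "\<dots> < e" using e K by (simp add: field_simps)
    finally show "\<delta> * K < e" .
  qed
  obtain s where s: "sbi lborel s" "L1n (\<lambda>t. f t - s t) < \<delta>" using nice_L1_approx[OF f \<delta>(1)] by blast
  have sk: "L1n s \<le> L1n f + 1"
    using L1n_le[OF nice_sbi[OF s(1)] f] s(2) L1n_minus_commute[of f s] \<delta>(2) by linarith
  have "norm (usig f m - usig s m) \<le> \<delta> * ((L1n f + L1n s + 1) ^ m / fact m)"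
    using s \<delta> by (intro usig_diff f nice_sbi) auto
  also have "\<dots> \<le> \<delta> * K"
    unfolding K_def using sk \<delta>(1) L1n_nonneg[of f] L1n_nonneg[of s]
    by (intro mult_left_mono divide_right_mono power_mono) auto
  finally have "dist (usig s m) (usig f m) < e" using \<delta> by (simp add: dist_norm norm_minus_commute)
  moreover have "usig s m \<in> span (tens ` words m)"
  proof -
    have b: "sbi (simplex_measure m 1) (tens_along m s)" by (rule sbi_tens_along[OF s(1)])
    have "has_banach_integral (simplex_measure m 1) (tens_along m s) (sint (simplex_measure m 1) (tens_along m s))"
      unfolding has_banach_integral_def using b sbi_measurable[OF b]
      by (intro conjI exI[of _ "\<lambda>_. tens_along m s"]) auto
    then have "usig s m = sint (simplex_measure m 1) (tens_along m s)"
      unfolding usig_def by (rule bint_eqI_has)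
    also have "\<dots> \<in> span (tens ` words m)"
      unfolding simple_bochner_integral_def
      by (intro span_sum span_scale) (auto intro!: span_base imageI)
    finally show ?thesis .
  qed
  ultimately show "\<exists>y\<in>span (tens ` words m). dist y (usig f m) < e" by blast
qed

lemma usig_0: "usig f 0 = tens []"
proof -
  define S where "S = simplex_measure 0 1"
  \<comment> \<open>For \<open>m = 0\<close> the product is empty and the formula gives mass 1 to
    the zero-dimensional simplex.\<close>
  have "(\<integral>\<^sup>+t. ennreal (\<Prod>i<(0::nat). (0::real)) \<partial>S) = ennreal 1"
    unfolding S_def using nn_integral_simplex_power[of "\<lambda>_. 0" 0 1] by simp
  then have e: "emeasure S (space S) = 1" by simp
  have "usig f 0 = bint S (\<lambda>t. indicator (space S) t *\<^sub>R tens [])"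
    unfolding usig_def S_def[symmetric] by (rule bint_cong) simp
  also have "\<dots> = measure S (space S) *\<^sub>R tens []" using e by (intro bint_const_indicator) auto
  also have "\<dots> = tens []" using e by (simp add: measure_def)
  finally show ?thesis .
qed

lemma usig_in_seqs1:
  assumes f: "nice lborel f" shows "usig f \<in> tensor_seqs1 tens"
proof -
  have "summable (\<lambda>m. (norm (usig f m))\<^sup>2)"
  proof (rule summable_comparison_test'[OF exp_series(1)])
    fix m
    have "(norm (usig f m))\<^sup>2 \<le> (L1n f ^ m / fact m)\<^sup>2" by (intro power_mono usig_norm f) auto
    also have "\<dots> \<le> ((L1n f)\<^sup>2) ^ m / fact m" by (rule power_div_fact_sq_le)
    finally show "norm ((norm (usig f m))\<^sup>2) \<le> ((L1n f)\<^sup>2) ^ m / fact m" by simp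
  qed
  then show ?thesis using usig_in_power[OF f] usig_0 by (auto simp: tensor_seqs1_def tensor_seqs_def)
qed

lemma usig_seq_norm_diff:
  assumes f: "nice lborel f" and g: "nice lborel g" and \<delta>: "L1n (\<lambda>t. f t - g t) \<le> \<delta>" "\<delta> > 0"
  shows "seq_norm (\<lambda>m. usig f m - usig g m) \<le> \<delta> * sqrt (exp ((L1n f + L1n g + 1)\<^sup>2))"
proof -
  define K where "K = L1n f + L1n g + 1"
  have le: "(norm (usig f m - usig g m))\<^sup>2 \<le> \<delta>\<^sup>2 * ((K\<^sup>2) ^ m / fact m)" for m
  proof -
    have "(norm (usig f m - usig g m))\<^sup>2 \<le> (\<delta> * (K ^ m / fact m))\<^sup>2"
      unfolding K_def by (intro power_mono usig_diff f g \<delta>) auto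
    also have "\<dots> \<le> \<delta>\<^sup>2 * ((K\<^sup>2) ^ m / fact m)"
      unfolding power_mult_distrib by (intro mult_left_mono power_div_fact_sq_le) auto
    finally show ?thesis .
  qed
  have sm: "summable (\<lambda>m. \<delta>\<^sup>2 * ((K\<^sup>2) ^ m / fact m))" by (intro summable_mult exp_series)
  have "(\<Sum>m. (norm (usig f m - usig g m))\<^sup>2) \<le> (\<Sum>m. \<delta>\<^sup>2 * ((K\<^sup>2) ^ m / fact m))"
    by (rule suminf_le[OF le summable_comparison_test'[OF sm] sm]) (use le in auto)
  also have "\<dots> = \<delta>\<^sup>2 * exp (K\<^sup>2)" 
    using suminf_mult[OF exp_series(1)[of "K\<^sup>2"], of "\<delta>\<^sup>2"] exp_series(2)[of "K\<^sup>2"] by simp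
  finally have "seq_norm (\<lambda>m. usig f m - usig g m) \<le> sqrt (\<delta>\<^sup>2 * exp (K\<^sup>2))"
    unfolding seq_norm_def by (rule real_sqrt_le_mono)
  also have "\<dots> = \<delta> * sqrt (exp (K\<^sup>2))" using \<delta> by (simp add: real_sqrt_mult)
  finally show ?thesis by (simp add: K_def)
qed

section \<open>Functionals attached to words of linear forms\<close>

text \<open>A choice of one continuous extension of the tensor product of the forms to the whole of
  \<open>'e\<close>; on the tensor power its values do not depend on the choice.\<close>

definition word_functional :: "('w \<Rightarrow> real) list \<Rightarrow> 'e \<Rightarrow> real" where
  "word_functional w = (SOME L. bounded_linear L \<and>
     (\<forall>ws\<in>words (length w). L (tens ws) = (\<Prod>i<length w. (w ! i) (ws ! i))))"

text \<open>\<open>universal\<close> provides a linear form that need not be continuous.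
  \<open>dual_tensor\<close> bounds it on the algebraic tensor power, and Hahn-Banach extends this
  restriction continuously.\<close>

lemma word_functional:
  assumes w: "\<forall>l\<in>set w. bounded_linear l"
  shows "bounded_linear (word_functional w)"
    and "length ws = length w \<Longrightarrow> word_functional w (tens ws) = (\<Prod>i<length w. (w ! i) (ws ! i))"
proof -
  define m where "m = length w"
  define B where "B ws = (\<Prod>i<m. (w ! i) (ws ! i))" for ws
  have wl: "linear (w ! i)" if "i < m" for i using w that by (simp add: m_def bounded_linear.linear)
  have "multilinear_on_words m B"
    unfolding multilinear_on_words_def
  proof (intro ballI allI impI)
    fix ws :: "'w list" and i assume ws: "ws \<in> words m" and i: "i < m"
    have "B (ws[i := x]) = (\<Prod>j\<in>{..<m} - {i}. (w ! j) (ws ! j)) * (w ! i) x" for x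
      unfolding B_def using i ws by (subst prod.remove[of _ i]) (auto simp: mult.commute intro!: prod.cong)
    then show "linear (\<lambda>x. B (ws[i := x]))"
      using linear_compose_scale_right[OF wl[OF i]] by (simp add: linear_iff algebra_simps linear_add[OF wl[OF i]] linear_scale[OF wl[OF i]])
  qed
  then obtain f :: "'e \<Rightarrow> real" where f: "linear f" "\<And>ws. ws \<in> words m \<Longrightarrow> f (tens ws) = B ws"
    using universal by blast
  have "\<exists>C. \<forall>A a. finite A \<and> A \<subseteq> words m \<longrightarrow>
          \<bar>\<Sum>u\<in>A. a u * (\<Prod>i<m. (w ! i) (u ! i))\<bar> \<le> C * norm (\<Sum>u\<in>A. a u *\<^sub>R tens u)"
    using w by (intro dual_tensor) (simp add: m_def)
  then obtain C where C: "\<And>A a. finite A \<Longrightarrow> A \<subseteq> words m \<Longrightarrow>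
      \<bar>\<Sum>u\<in>A. a u * B u\<bar> \<le> C * norm (\<Sum>u\<in>A. a u *\<^sub>R tens u)"
    unfolding B_def by blast
  have bound: "\<bar>f x\<bar> \<le> max C 0 * norm x" if x: "x \<in> span (tens ` words m)" for x
  proof -
    obtain T r where T: "finite T" "T \<subseteq> tens ` words m" "x = (\<Sum>a\<in>T. r a *\<^sub>R a)"
      using x unfolding span_explicit by blast
    \<comment> \<open>The representation from the span sums over tensors, while
      \<open>dual_tensor\<close> sums over words; one word is chosen for each tensor, and distinct
      tensors get distinct words.\<close>
    define A where "A = inv_into (words m) tens ` T"
    have inv: "inv_into (words m) tens a \<in> words m" "tens (inv_into (words m) tens a) = a" if "a \<in> T" for a
      using T(2) that inv_into_into f_inv_into_f by (metis subsetD)+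
    have inj: "inj_on (inv_into (words m) tens) T" by (rule inj_on_inv_into[OF T(2)])
    have A: "finite A" "A \<subseteq> words m" using T inv(1) by (auto simp: A_def)
    have x_eq: "x = (\<Sum>u\<in>A. r (tens u) *\<^sub>R tens u)"
      unfolding A_def T(3) using inv by (simp add: sum.reindex[OF inj])
    have "f x = (\<Sum>u\<in>A. r (tens u) * B u)"
      unfolding x_eq using f A(2) by (simp add: linear_sum linear_scale subset_iff)
    then have "\<bar>f x\<bar> \<le> C * norm x" using C[OF A, of "\<lambda>u. r (tens u)"] x_eq by simp
    also have "\<dots> \<le> max C 0 * norm x" by (intro mult_right_mono) auto
    finally show ?thesis .
  qed
  obtain L where L: "bounded_linear L" "\<And>x. x \<in> span (tens ` words m) \<Longrightarrow> L x = f x"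
    by (rule hahn_banach_extension[of "span (tens ` words m)" "max C 0" f])
       (use f bound in \<open>auto simp: linear_add linear_scale\<close>)
  have "\<exists>L. bounded_linear L \<and> (\<forall>ws\<in>words (length w). L (tens ws) = (\<Prod>i<length w. (w ! i) (ws ! i)))"
    using L f(2) by (intro exI[of _ L]) (auto simp: m_def B_def span_base)
  from someI_ex[OF this]
  show "bounded_linear (word_functional w)"
    and "length ws = length w \<Longrightarrow> word_functional w (tens ws) = (\<Prod>i<length w. (w ! i) (ws ! i))"
    unfolding word_functional_def by auto
qed

lemma word_functional_usig:
  assumes w: "\<forall>l\<in>set w. bounded_linear l" and f: "nice lborel f"
  shows "word_functional w (usig f (length w)) = iter_int (rev (map (\<lambda>l t. l (f t)) w)) 1"
proof -
  let ?gs = "map (\<lambda>l t. l (f t)) w"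
  have gs: "\<forall>g\<in>set ?gs. integrable lborel g"
    using nice_real(1)[OF nice_bounded_linear[OF _ f]] w by auto
  have "word_functional w (usig f (length w))
      = (\<integral>t. word_functional w (tens_along (length w) f t) \<partial>simplex_measure (length w) 1)"
    unfolding usig_def by (rule functional_bint(1)[OF word_functional(1)[OF w] nice_tens_along[OF f]])
  also have "\<dots> = (\<integral>t. (\<Prod>i<length ?gs. (?gs ! i) (t i)) \<partial>simplex_measure (length ?gs) 1)"
    by (intro Bochner_Integration.integral_cong) (auto simp: word_functional(2)[OF w] intro!: prod.cong)
  also have "\<dots> = iter_int (rev ?gs) 1" by (rule iter_int_eq_simplex[OF gs])
  finally show ?thesis .
qed

end

section \<open>Signatures of paths\<close>

lemma distr_lborel_scale:
  assumes "0 < T" shows "distr lborel lborel (\<lambda>t::real. t / T) = scale_measure (ennreal T) lborel"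
proof (rule measure_eqI)
  fix A :: "real set" assume "A \<in> sets (distr lborel lborel (\<lambda>t. t / T))"
  then have A: "A \<in> sets lborel" by simp
  have "distr lborel borel ((*) (1 / T)) = density lborel (\<lambda>_. ennreal T)"
    using lborel_distr_mult[of "1 / T"] assms by (simp add: inverse_eq_divide)
  then have "emeasure (distr lborel borel ((*) (1 / T))) A = ennreal T * emeasure lborel A"
    using A by (simp add: emeasure_density nn_integral_cmult_indicator)
  moreover have "distr lborel borel ((*) (1 / T)) = distr lborel lborel (\<lambda>t. t / T)"
    by (rule distr_cong) auto
  ultimately show "emeasure (distr lborel lborel (\<lambda>t. t / T)) A = emeasure (scale_measure (ennreal T) lborel) A"
    by simp
qed simp

lemma measurable_cube_scale: "(\<lambda>t. \<lambda>i\<in>{..<m}. t i / T) \<in> measurable (cube m) (cube m)"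
proof (rule measurable_restrict)
  fix i assume "i \<in> {..<m}"
  then have "(\<lambda>t. t i) \<in> measurable (cube m) lborel" by (rule measurable_component_singleton)
  then have "(\<lambda>t. t i) \<in> borel_measurable (cube m)" by simp
  then have "(\<lambda>t. t i / T) \<in> borel_measurable (cube m)" by (rule borel_measurable_divide) simp
  then show "(\<lambda>t. t i / T) \<in> measurable (cube m) lborel" by simp
qed

text \<open>The push-forward is divided by \<open>T^m\<close> first, so that the characterization of
  the product measure by its values on boxes applies.\<close>

lemma distr_cube_scale:
  assumes T: "0 < T"
  shows "distr (cube m) (cube m) (\<lambda>t. \<lambda>i\<in>{..<m}. t i / T) = scale_measure (ennreal (T ^ m)) (cube m)"
proof -
  define \<psi> where "\<psi> t = (\<lambda>i\<in>{..<m}. t i / T)" for t :: "nat \<Rightarrow> real"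
  have \<psi>: "\<psi> \<in> measurable (cube m) (cube m)"
    unfolding \<psi>_def by (rule measurable_cube_scale)
  define Q where "Q = scale_measure (ennreal (1 / T ^ m)) (distr (cube m) (cube m) \<psi>)"
  have "Q = cube m"
  proof (rule cube.PiM_eqI)
    show "sets Q = sets (cube m)" by (simp add: Q_def)
    fix A :: "nat \<Rightarrow> real set" assume A: "\<And>i. i \<in> {..<m} \<Longrightarrow> A i \<in> sets lborel"
    have B: "(\<lambda>t. t / T) -` A i \<in> sets lborel" if "i \<in> {..<m}" for i
      using measurable_sets[of "\<lambda>t. t / T" lborel lborel "A i"] A[OF that] by simp
    have e: "emeasure lborel ((\<lambda>t. t / T) -` A i) = ennreal T * emeasure lborel (A i)" if "i \<in> {..<m}" for i
    proof -
      have "emeasure (distr lborel lborel (\<lambda>t. t / T)) (A i) = ennreal T * emeasure lborel (A i)"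
        by (simp add: distr_lborel_scale[OF T])
      then show ?thesis using A[OF that] by (simp add: emeasure_distr)
    qed
    have box: "PiE {..<m} A \<in> sets (cube m)" using A by (intro sets_PiM_I_finite) auto
    have "\<psi> -` PiE {..<m} A \<inter> space (cube m) = PiE {..<m} (\<lambda>i. (\<lambda>t. t / T) -` A i)"
      by (auto simp: \<psi>_def space_PiM PiE_iff)
    then have "emeasure (distr (cube m) (cube m) \<psi>) (PiE {..<m} A) = emeasure (cube m) (PiE {..<m} (\<lambda>i. (\<lambda>t. t / T) -` A i))"
      using emeasure_distr[OF \<psi> box] by simp
    also have "\<dots> = (\<Prod>i<m. emeasure lborel ((\<lambda>t. t / T) -` A i))" using B by (intro cube.emeasure_PiM) auto
    also have "\<dots> = (\<Prod>i<m. ennreal T * emeasure lborel (A i))" using e by (intro prod.cong) auto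
    also have "\<dots> = ennreal (T ^ m) * (\<Prod>i<m. emeasure lborel (A i))"
      using T by (simp add: prod.distrib ennreal_power)
    finally have "emeasure Q (PiE {..<m} A) = (ennreal (1 / T ^ m) * ennreal (T ^ m)) * (\<Prod>i<m. emeasure lborel (A i))"
      by (simp add: Q_def mult.assoc)
    also have "ennreal (1 / T ^ m) * ennreal (T ^ m) = 1" using T by (simp flip: ennreal_mult)
    finally show "emeasure Q (PiE {..<m} A) = (\<Prod>i\<in>{..<m}. emeasure lborel (A i))" by simp
  qed simp
  then have "scale_measure (ennreal (T ^ m)) Q = scale_measure (ennreal (T ^ m)) (cube m)" by simp
  moreover have "scale_measure (ennreal (T ^ m)) Q = distr (cube m) (cube m) \<psi>"
  proof -
    have "ennreal (T ^ m) * ennreal (1 / T ^ m) = 1" using T by (simp flip: ennreal_mult)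
    then show ?thesis by (simp add: Q_def)
  qed
  ultimately show ?thesis by (simp add: \<psi>_def[abs_def])
qed

text \<open>The exceptional set of one coordinate is a slab. Its measure is a product with one
  factor 0, and in \<open>ennreal\<close> this survives the infinite factors.\<close>

lemma AE_cube_components:
  assumes "AE t in lborel. P t" shows "AE t in cube m. \<forall>i<m. P (t i)"
proof -
  obtain N where N: "N \<in> null_sets lborel" "{t\<in>space lborel. \<not> P t} \<subseteq> N" using AE_E[OF assms] by (metis null_setsI)
  have "AE t in cube m. P (t i)" if i: "i < m" for i
  proof (rule AE_I')
    define A where "A j = (if j = i then N else UNIV)" for j
    have A: "A j \<in> sets lborel" for j using N by (auto simp: A_def)
    have "emeasure (cube m) (PiE {..<m} A) = (\<Prod>j<m. emeasure lborel (A j))"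
      using A by (intro cube.emeasure_PiM) auto
    also have "\<dots> = 0" using i N by (intro prod_zero) (auto simp: A_def intro!: bexI[of _ i])
    finally show "PiE {..<m} A \<in> null_sets (cube m)"
      using A by (intro null_setsI sets_PiM_I_finite) auto
    show "{t\<in>space (cube m). \<not> P (t i)} \<subseteq> PiE {..<m} A"
      using N(2) i by (auto simp: A_def space_PiM PiE_iff extensional_def)
  qed
  then have "AE t in cube m. \<forall>i\<in>{..<m}. P (t i)" by (intro AE_finite_allI) auto
  then show ?thesis by (rule eventually_mono) auto
qed

lemma nice_scale_arg:
  fixes g :: "real \<Rightarrow> 'b::banach"
  assumes T: "0 < T" and g: "nice lborel g"
  shows "nice lborel (\<lambda>t. g (t / T))" "bint lborel (\<lambda>t. g (t / T)) = T *\<^sub>R bint lborel g"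
  using nice_distr[OF _ T distr_lborel_scale[OF T] g] by auto

lemma bint_simplex_measure:
  fixes h :: "(nat \<Rightarrow> real) \<Rightarrow> 'b::banach"
  assumes h: "nice (simplex_measure m u) h"
  shows "nice (cube m) (\<lambda>t. indicator (osimplex m u) t *\<^sub>R h t)"
    and "bint (simplex_measure m u) h = bint (cube m) (\<lambda>t. indicator (osimplex m u) t *\<^sub>R h t)"
proof -
  define A where "A = osimplex m u \<inter> space (cube m)"
  have A: "A \<in> sets (cube m)" unfolding A_def by (rule sets_simplex)
  have S: "simplex_measure m u = restrict_space (cube m) A"
  proof -
    have "(\<inter>) (osimplex m u) ` sets (cube m) = (\<inter>) A ` sets (cube m)"
      unfolding A_def by (rule image_cong[OF refl]) (use sets.sets_into_space in blast)
    moreover have "A \<inter> space (cube m) = osimplex m u \<inter> space (cube m)" by (auto simp: A_def)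
    ultimately show ?thesis by (simp only: simplex_measure_eq restrict_space_def)
  qed
  have ind: "indicator A t *\<^sub>R h t = indicator (osimplex m u) t *\<^sub>R h t" if "t \<in> space (cube m)" for t
    using that by (simp add: A_def indicator_def)
  have 1: "nice (cube m) (\<lambda>t. indicator A t *\<^sub>R h t)" using h unfolding S by (rule nice_unrestrict[OF _ A])
  then show "nice (cube m) (\<lambda>t. indicator (osimplex m u) t *\<^sub>R h t)"
    using nice_cong[of "cube m" "\<lambda>t. indicator A t *\<^sub>R h t" "\<lambda>t. indicator (osimplex m u) t *\<^sub>R h t"] ind by blast
  have "bint (simplex_measure m u) h = bint (restrict_space (cube m) A) (\<lambda>t. indicator A t *\<^sub>R h t)"
    unfolding S by (rule bint_cong) (simp add: space_restrict_space A_def)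
  also have "\<dots> = bint (cube m) (\<lambda>t. indicator A t *\<^sub>R (indicator A t *\<^sub>R h t))" by (rule nice_restrict(2)[OF 1 A])
  also have "\<dots> = bint (cube m) (\<lambda>t. indicator (osimplex m u) t *\<^sub>R h t)"
    by (rule bint_cong) (simp add: A_def indicator_def)
  finally show "bint (simplex_measure m u) h = bint (cube m) (\<lambda>t. indicator (osimplex m u) t *\<^sub>R h t)" .
qed

section \<open>Velocities on the unit interval\<close>

text \<open>A derivative need not be \<open>nice\<close>; it is exchanged for a \<open>nice\<close>
  version, extended by 0. The version found on the whole interval serves every upper limit, since
  the integral ignores null sets.\<close>

lemma path_velocity:
  fixes xd :: "real \<Rightarrow> 'v::banach"
  assumes T: "0 < T" and xd: "has_path_derivative (T, x) xd"
  obtains g where "nice lborel g" "\<And>t. t \<notin> {0..T} \<Longrightarrow> g t = 0" "AE t in lborel. t \<in> {0..T} \<longrightarrow> xd t = g t"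
    "\<And>t. t \<in> {0..T} \<Longrightarrow> x t = bint lborel (\<lambda>r. indicator {0..t} r *\<^sub>R g r)"
proof -
  have I: "has_banach_integral (restrict_space lborel {0..t}) xd (x t)" if "t \<in> {0..T}" for t
    using xd that by (simp add: has_path_derivative_def)
  obtain g0 where g0: "nice (restrict_space lborel {0..T}) g0" "AE t in restrict_space lborel {0..T}. xd t = g0 t"
    using has_banach_integral_version[OF I[of T]] T by auto
  define g where "g t = indicator {0..T} t *\<^sub>R g0 t" for t
  have g: "nice lborel g" unfolding g_def by (rule nice_unrestrict[OF g0(1)]) simp
  have ae: "AE t in lborel. t \<in> {0..T} \<longrightarrow> xd t = g t"
    using g0(2) by (subst (asm) AE_restrict_space_iff) (auto simp: g_def elim!: eventually_mono)
  have "x t = bint lborel (\<lambda>r. indicator {0..t} r *\<^sub>R g r)" if t: "t \<in> {0..T}" for t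
  proof -
    have "AE r in restrict_space lborel {0..t}. xd r = g r"
      by (subst AE_restrict_space_iff) (use ae t in \<open>auto elim!: eventually_mono\<close>)
    moreover have "has_banach_integral (restrict_space lborel {0..t}) g (bint (restrict_space lborel {0..t}) g)"
      by (intro nice_has_integral nice_restrict g) auto
    ultimately have "x t = bint (restrict_space lborel {0..t}) g" using has_banach_integral_AE_unique[OF I[OF t]] by blast
    then show ?thesis using nice_restrict(2)[OF g, of "{0..t}"] by simp
  qed
  then show ?thesis using that[OF g _ ae] by (simp add: g_def)
qed

lemma prim_rescaled:
  fixes g :: "real \<Rightarrow> 'v::banach"
  assumes T: "0 < T" and g: "nice lborel g"
  shows "nice lborel (\<lambda>s. T *\<^sub>R g (T * s))"
    "prim (\<lambda>s. T *\<^sub>R g (T * s)) s = bint lborel (\<lambda>r. indicator {0..T * s} r *\<^sub>R g r)"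
proof -
  have T': "0 < 1 / T" using T by simp
  have a: "g (T * s) = g (s / (1 / T))" for s by (simp add: mult.commute)
  show 1: "nice lborel (\<lambda>s. T *\<^sub>R g (T * s))" unfolding a by (intro nice_scaleR nice_scale_arg T' g)
  have i: "nice lborel (\<lambda>r. indicator {0..T * s} r *\<^sub>R g r)" using g by auto
  have "prim (\<lambda>s. T *\<^sub>R g (T * s)) s = bint lborel (\<lambda>t. T *\<^sub>R (\<lambda>r. indicator {0..T * s} r *\<^sub>R g r) (t / (1 / T)))"
    unfolding prim_def using T by (intro bint_cong) (auto simp: indicator_def field_simps zero_le_divide_iff zero_le_mult_iff)
  also have "\<dots> = T *\<^sub>R ((1 / T) *\<^sub>R bint lborel (\<lambda>r. indicator {0..T * s} r *\<^sub>R g r))"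
    by (subst bint_scaleR[OF nice_scale_arg(1)[OF T' i]]) (simp only: nice_scale_arg(2)[OF T' i])
  finally show "prim (\<lambda>s. T *\<^sub>R g (T * s)) s = bint lborel (\<lambda>r. indicator {0..T * s} r *\<^sub>R g r)" using T by simp
qed

text \<open>All variation sums of the difference vanish, and they converge to its L1 norm. This
  takes the place of Lebesgue differentiation.\<close>

lemma prim_eq_imp_L1n:
  fixes f g :: "real \<Rightarrow> 'v::banach"
  assumes f: "nice lborel f" "\<And>t. t \<notin> {0..1} \<Longrightarrow> f t = 0" and g: "nice lborel g" "\<And>t. t \<notin> {0..1} \<Longrightarrow> g t = 0"
    and eq: "\<And>s. s \<in> {0..1} \<Longrightarrow> prim f s = prim g s"
  shows "L1n (\<lambda>t. f t - g t) = 0"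
proof -
  have n: "nice lborel (\<lambda>t. f t - g t)" by (intro nice_diff f g)
  have "step_approx (\<lambda>t. f t - g t)" using f(2) g(2) by (intro nice_step_approx n) auto
  then have lim: "(\<lambda>n. dysum n (prim (\<lambda>t. f t - g t))) \<longlonglongrightarrow> L1n (\<lambda>t. f t - g t)" by (rule dysum_tendsto)
  have "dysum n (prim (\<lambda>t. f t - g t)) = 0" for n
    unfolding dysum_def
  proof (rule sum.neutral, safe)
    fix j :: nat assume "j < 2 ^ n"
    then have "real j + 1 \<le> 2 ^ n" by (metis Suc_leI add.commute of_nat_Suc of_nat_le_iff of_nat_numeral of_nat_power)
    moreover from this have "real j \<le> 2 ^ n" by linarith
    ultimately have "(real j + 1) / 2 ^ n \<in> {0..1}" "real j / 2 ^ n \<in> {0..1}"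
      by (simp_all del: of_nat_le_iff of_nat_le_numeral_power_cancel_iff)
    then show "norm (prim (\<lambda>t. f t - g t) ((real j + 1) / 2 ^ n) - prim (\<lambda>t. f t - g t) (real j / 2 ^ n)) = 0"
      using eq by (simp add: prim_diff[OF f(1) g(1)])
  qed
  then show ?thesis using lim by (simp add: LIMSEQ_const_iff)
qed

lemma C1_velocity_exists:
  fixes x :: "'v::banach path"
  assumes "x \<in> C1_paths"
  shows "\<exists>f. nice lborel f \<and> (\<forall>t. t \<notin> {0..1} \<longrightarrow> f t = 0) \<and> (\<forall>s\<in>{0..1}. snd x (fst x * s) = prim f s)"
proof -
  obtain T p where x: "x = (T, p)" by force
  obtain xd where T: "0 < T" and xd: "has_path_derivative (T, p) xd" using assms by (auto simp: C1_paths_def x)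
  obtain g where g: "nice lborel g" "\<And>t. t \<notin> {0..T} \<Longrightarrow> g t = 0"
    "\<And>t. t \<in> {0..T} \<Longrightarrow> p t = bint lborel (\<lambda>r. indicator {0..t} r *\<^sub>R g r)"
    using path_velocity[OF T xd] by metis
  show ?thesis
  proof (intro exI conjI allI impI ballI)
    show "nice lborel (\<lambda>s. T *\<^sub>R g (T * s))" by (rule prim_rescaled(1)[OF T g(1)])
    show "T *\<^sub>R g (T * t) = 0" if "t \<notin> {0..1}" for t
      using that g(2)[of "T * t"] T by (auto simp: zero_le_mult_iff)
    show "snd x (fst x * s) = prim (\<lambda>s. T *\<^sub>R g (T * s)) s" if "s \<in> {0..1}" for s
      using that T g(3)[of "T * s"] prim_rescaled(2)[OF T g(1), of s] by (simp add: x mult_left_le)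
  qed
qed

text \<open>All paths are reparametrized linearly to \<open>[0,1]\<close>, so the velocity carries a factor \<open>fst x\<close>.\<close>

definition velocity :: "'v::banach path \<Rightarrow> real \<Rightarrow> 'v" where
  "velocity x = (SOME f. nice lborel f \<and> (\<forall>t. t \<notin> {0..1} \<longrightarrow> f t = 0) \<and> (\<forall>s\<in>{0..1}. snd x (fst x * s) = prim f s))"

lemma velocity:
  assumes "x \<in> C1_paths"
  shows "nice lborel (velocity x)" "t \<notin> {0..1} \<Longrightarrow> velocity x t = 0" "s \<in> {0..1} \<Longrightarrow> snd x (fst x * s) = prim (velocity x) s"
  using someI_ex[OF C1_velocity_exists[OF assms]] unfolding velocity_def[symmetric] by auto

text \<open>After linear reparametrization time has the constant velocity \<open>T\<close>; the
  indicator makes it integrable over the line.\<close>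

definition augment :: "real \<Rightarrow> (real \<Rightarrow> 'v::real_normed_vector) \<Rightarrow> real \<Rightarrow> 'v \<times> real" where
  "augment T f s = (f s, indicator {0..1} s * T)"

lemma nice_augment: "nice lborel f \<Longrightarrow> nice lborel (augment T f)"
  unfolding augment_def using nice_const_indicator[of "{0..1::real}" lborel T] by (intro nice_Pair) auto

lemma prim_augment:
  assumes f: "nice lborel f" and s: "s \<in> {0..1}" shows "prim (augment T f) s = (prim f s, T * s)"
proof -
  have n: "nice lborel (\<lambda>t. indicator {0..s} t *\<^sub>R augment T f t)" by (intro nice_ind nice_augment f) simp
  have "fst (prim (augment T f) s) = prim f s"
    unfolding prim_def bint_bounded_linear[OF bounded_linear_fst n] by (rule bint_cong) (simp add: augment_def)
  moreover have "snd (prim (augment T f) s) = bint lborel (\<lambda>t. indicator {0..s} t *\<^sub>R T)"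
    unfolding prim_def bint_bounded_linear[OF bounded_linear_snd n]
    using s by (intro bint_cong) (auto simp: augment_def indicator_def)
  moreover have "bint lborel (\<lambda>t. indicator {0..s} t *\<^sub>R T) = T * s"
    using s by (subst bint_const_indicator) auto
  ultimately show ?thesis by (simp add: prod_eq_iff)
qed

context admissible_tensor_powers
begin

lemma usig_cong_L1n:
  assumes f: "nice lborel f" and g: "nice lborel g" and eq: "L1n (\<lambda>t. f t - g t) = 0"
  shows "usig f m = usig g m"
proof -
  define K where "K = (L1n f + L1n g + 1) ^ m / fact m"
  have K: "K \<ge> 0" using L1n_nonneg[of f] L1n_nonneg[of g] by (simp add: K_def)
  have "norm (usig f m - usig g m) \<le> \<delta>" if "\<delta> > 0" for \<delta>
  proof -
    have "norm (usig f m - usig g m) \<le> \<delta> / (K + 1) * K"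
      unfolding K_def using eq K that by (intro usig_diff f g) (auto simp: K_def)
    also have "\<dots> \<le> \<delta>" using K that by (simp add: field_simps)
    finally show ?thesis .
  qed
  then have "norm (usig f m - usig g m) \<le> 0" using field_le_epsilon[of _ 0] by (metis add_0)
  then show ?thesis by simp
qed

text \<open>The factor \<open>(1 / T) ^ m\<close> from multilinearity cancels the Jacobian
  \<open>T ^ m\<close> of the scaled cube.\<close>

lemma bint_tens_along_rescale:
  assumes T: "0 < T" and g: "nice lborel g"
  shows "bint (simplex_measure m T) (tens_along m g) = usig (\<lambda>s. T *\<^sub>R g (T * s)) m"
proof -
  define f where "f s = T *\<^sub>R g (T * s)" for s
  have f: "nice lborel f" unfolding f_def by (rule prim_rescaled(1)[OF T g])
  have gf: "g t = (1 / T) *\<^sub>R f (t / T)" for t using T by (simp add: f_def)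
  define G where "G t = indicator (osimplex m 1) t *\<^sub>R tens_along m f t" for t
  have nG: "nice (cube m) G" unfolding G_def by (rule bint_simplex_measure(1)[OF nice_tens_along[OF f]])
  define \<psi> where "\<psi> t = (\<lambda>i\<in>{..<m}. t i / T)" for t :: "nat \<Rightarrow> real"
  have \<psi>: "\<psi> \<in> measurable (cube m) (cube m)" unfolding \<psi>_def by (rule measurable_cube_scale)
  have iff: "\<psi> t \<in> osimplex m 1 \<longleftrightarrow> t \<in> osimplex m T" for t
    using T by (auto simp: \<psi>_def osimplex_def monotone_on_def image_subset_iff zero_le_divide_iff divide_le_cancel)
  have G\<psi>: "indicator (osimplex m T) t *\<^sub>R tens_along m g t = (1 / T) ^ m *\<^sub>R G (\<psi> t)" for t
  proof -
    have map_eq: "map (\<lambda>i. g (t i)) [0..<m] = map (\<lambda>i. (1 / T) *\<^sub>R f (t i / T)) [0..<m]" by (simp only: gf)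
    have 1: "tens_along m g t = (1 / T) ^ m *\<^sub>R tens (map (\<lambda>i. f (t i / T)) [0..<m])"
      unfolding map_eq using tens_scale[of "[]" "1 / T" "\<lambda>i. f (t i / T)" "[0..<m]"] by simp
    have 2: "map (\<lambda>i. f (\<psi> t i)) [0..<m] = map (\<lambda>i. f (t i / T)) [0..<m]" by (simp add: \<psi>_def)
    show ?thesis unfolding G_def 1 2 using iff[of t] by (cases "t \<in> osimplex m T") simp_all
  qed
  have "bint (simplex_measure m T) (tens_along m g) = bint (cube m) (\<lambda>t. (1 / T) ^ m *\<^sub>R G (\<psi> t))"
    unfolding bint_simplex_measure(2)[OF nice_tens_along[OF g]] G\<psi> ..
  also have "\<dots> = (1 / T) ^ m *\<^sub>R (T ^ m *\<^sub>R bint (cube m) G)"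
    using nice_distr[OF \<psi> _ distr_cube_scale[OF T, of m, folded \<psi>_def] nG] T by (simp add: bint_scaleR)
  also have "\<dots> = bint (cube m) G" using T by (simp add: power_one_over)
  also have "\<dots> = usig f m" unfolding usig_def G_def by (rule bint_simplex_measure(2)[OF nice_tens_along[OF f], symmetric])
  finally show ?thesis by (simp add: f_def[abs_def])
qed

text \<open>\<open>signature\<close> is a definite description over all derivatives. A rescaling of
  \<open>f\<close> is one witness. Any other derivative has a \<open>nice\<close> version with the
  same primitive, so its rescaling is at L1 distance 0 from \<open>f\<close> and has the same
  \<open>usig\<close>.\<close>

lemma signature_eq_usig:
  assumes T: "0 < T" and f: "nice lborel f" "\<And>t. t \<notin> {0..1} \<Longrightarrow> f t = 0"
    and q: "\<And>s. s \<in> {0..1} \<Longrightarrow> q (T * s) = prim f s"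
  shows "signature tens (T, q) m = usig f m"
  unfolding signature_def
proof (rule the_equality)
  define xd where "xd t = (1 / T) *\<^sub>R f (t / T)" for t
  have nxd: "nice lborel xd" unfolding xd_def by (intro nice_scaleR nice_scale_arg T f)
  have f_xd: "(\<lambda>s. T *\<^sub>R xd (T * s)) = f" using T by (auto simp: xd_def)
  have d: "has_path_derivative (T, q) xd"
    unfolding has_path_derivative_def
  proof
    fix t assume t: "t \<in> {0..fst (T, q)}"
    then have s: "t / T \<in> {0..1}" using T by (auto simp: field_simps)
    have "q t = prim f (t / T)" using q[OF s] T by simp
    also have "\<dots> = bint lborel (\<lambda>r. indicator {0..t} r *\<^sub>R xd r)"
      using prim_rescaled(2)[OF T nxd, of "t / T"] T by (simp add: f_xd)
    also have "\<dots> = bint (restrict_space lborel {0..t}) xd" using nice_restrict(2)[OF nxd, of "{0..t}"] by simp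
    finally show "has_banach_integral (restrict_space lborel {0..t}) xd (snd (T, q) t)"
      using nice_has_integral[OF nice_restrict(1)[OF nxd, of "{0..t}"]] by simp
  qed
  have "has_banach_integral (simplex_measure m T) (tens_along m xd) (usig f m)"
    using nice_has_integral[OF nice_tens_along[OF nxd, of m T]] bint_tens_along_rescale[OF T nxd, of m] by (simp add: f_xd)
  with d show "\<exists>xd. has_path_derivative (T, q) xd \<and>
     has_banach_integral (simplex_measure m (fst (T, q))) (\<lambda>t. tens (map (\<lambda>i. xd (t i)) [0..<m])) (usig f m)" by auto
next
  fix I assume "\<exists>xd. has_path_derivative (T, q) xd \<and>
     has_banach_integral (simplex_measure m (fst (T, q))) (\<lambda>t. tens (map (\<lambda>i. xd (t i)) [0..<m])) I"
  then obtain xd where xd: "has_path_derivative (T, q) xd" and I: "has_banach_integral (simplex_measure m T) (tens_along m xd) I" by auto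
  obtain g where g: "nice lborel g" "\<And>t. t \<notin> {0..T} \<Longrightarrow> g t = 0" "AE t in lborel. t \<in> {0..T} \<longrightarrow> xd t = g t"
    "\<And>t. t \<in> {0..T} \<Longrightarrow> q t = bint lborel (\<lambda>r. indicator {0..t} r *\<^sub>R g r)"
    by (rule path_velocity[OF T xd]) blast
  have "AE t in cube m. \<forall>i<m. t i \<in> {0..T} \<longrightarrow> xd (t i) = g (t i)" by (rule AE_cube_components[OF g(3)])
  then have ae: "AE t in simplex_measure m T. tens_along m xd t = tens_along m g t"
    unfolding simplex_measure_eq
  proof (subst AE_restrict_space_iff[OF sets_simplex], eventually_elim)
    case (elim t)
    show ?case
    proof
      assume t: "t \<in> osimplex m T"
      have "map (\<lambda>i. xd (t i)) [0..<m] = map (\<lambda>i. g (t i)) [0..<m]"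
        using elim t by (auto simp: osimplex_def image_subset_iff)
      then show "tens_along m xd t = tens_along m g t" by (rule arg_cong[where f = tens])
    qed
  qed
  define f' where "f' s = T *\<^sub>R g (T * s)" for s
  have f': "nice lborel f'" "\<And>t. t \<notin> {0..1} \<Longrightarrow> f' t = 0"
    using prim_rescaled(1)[OF T g(1)] g(2) T by (auto simp: f'_def[abs_def] zero_le_mult_iff)
  have "I = bint (simplex_measure m T) (tens_along m g)"
    by (rule has_banach_integral_AE_unique[OF I nice_has_integral[OF nice_tens_along[OF g(1)]] ae])
  also have "\<dots> = usig f' m" unfolding f'_def by (rule bint_tens_along_rescale[OF T g(1)])
  also have "\<dots> = usig f m"
  proof (intro usig_cong_L1n prim_eq_imp_L1n f f')
    fix s :: real assume s: "s \<in> {0..1}"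
    have "prim f' s = q (T * s)"
      unfolding f'_def prim_rescaled(2)[OF T g(1)] using s T by (intro g(4)[symmetric]) (simp add: mult_left_le)
    then show "prim f' s = prim f s" using q[OF s] by simp
  qed auto
  finally show "I = usig f m" .
qed

end

lemma signature_time_augment:
  fixes tens :: "('v::banach \<times> real) list \<Rightarrow> 'e::banach"
  assumes "admissible_tensor_powers tens" and x: "x \<in> C1_paths"
  shows "signature tens (time_augment x) = admissible_tensor_powers.usig tens (augment (fst x) (velocity x))"
proof
  interpret admissible_tensor_powers tens by fact
  fix m
  have T: "0 < fst x" using x by (auto simp: C1_paths_def)
  have "signature tens (fst x, snd (time_augment x)) m = usig (augment (fst x) (velocity x)) m"
  proof (rule signature_eq_usig[OF T nice_augment[OF velocity(1)[OF x]]])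
    show "augment (fst x) (velocity x) t = 0" if "t \<notin> {0..1}" for t
      using velocity(2)[OF x that] that by (simp add: augment_def zero_prod_def)
    show "snd (time_augment x) (fst x * s) = prim (augment (fst x) (velocity x)) s" if s: "s \<in> {0..1}" for s
      using velocity(3)[OF x s] s T by (simp add: prim_augment[OF velocity(1)[OF x] s] time_augment_def mult_left_le)
  qed
  then show "signature tens (time_augment x) m = usig (augment (fst x) (velocity x)) m"
    by (simp add: time_augment_def)
qed

section \<open>The path metric\<close>

text \<open>\<open>total_variation\<close> is a supremum of reals, hence a junk value if the variation is infinite.\<close>

definition tvb :: "real \<Rightarrow> real \<Rightarrow> (real \<Rightarrow> 'b::real_normed_vector) \<Rightarrow> real \<Rightarrow> bool" where
  "tvb a b F C \<longleftrightarrow> (\<forall>n t. mono_on {..n} t \<longrightarrow> t ` {..n} \<subseteq> {a..b} \<longrightarrow>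
     (\<Sum>i<n. norm (F (t (Suc i)) - F (t i))) \<le> C)"

lemma tvbD: "tvb a b F C \<Longrightarrow> mono_on {..n} t \<Longrightarrow> t ` {..n} \<subseteq> {a..b} \<Longrightarrow>
    (\<Sum>i<n. norm (F (t (Suc i)) - F (t i))) \<le> C"
  by (auto simp: tvb_def)

lemma tvb_mono: "tvb a b F C \<Longrightarrow> C \<le> C' \<Longrightarrow> tvb a b F C'"
  unfolding tvb_def by (meson order_trans)

lemma tvb_triangle:
  assumes F: "tvb a b F C" and G: "tvb a b G C'"
    and le: "\<And>s t. s \<in> {a..b} \<Longrightarrow> t \<in> {a..b} \<Longrightarrow> s \<le> t \<Longrightarrow> norm (H t - H s) \<le> norm (F t - F s) + norm (G t - G s)"
  shows "tvb a b H (C + C')"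
  unfolding tvb_def
proof (intro allI impI)
  fix n and t :: "nat \<Rightarrow> real" assume t: "mono_on {..n} t" "t ` {..n} \<subseteq> {a..b}"
  have "(\<Sum>i<n. norm (H (t (Suc i)) - H (t i))) \<le> (\<Sum>i<n. norm (F (t (Suc i)) - F (t i)) + norm (G (t (Suc i)) - G (t i)))"
  proof (rule sum_mono)
    fix i assume "i \<in> {..<n}"
    then show "norm (H (t (Suc i)) - H (t i)) \<le> norm (F (t (Suc i)) - F (t i)) + norm (G (t (Suc i)) - G (t i))"
      using t by (intro le) (auto intro: mono_onD simp: image_subset_iff)
  qed
  then show "(\<Sum>i<n. norm (H (t (Suc i)) - H (t i))) \<le> C + C'"
    using tvbD[OF F t] tvbD[OF G t] by (simp add: sum.distrib)
qed

lemma tvb_add: "tvb a b F C \<Longrightarrow> tvb a b G C' \<Longrightarrow> tvb a b (\<lambda>s. F s + G s) (C + C')"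
  by (erule tvb_triangle, assumption) (metis (no_types) add_diff_add norm_triangle_ineq)

lemma tvb_diff: "tvb a b F C \<Longrightarrow> tvb a b G C' \<Longrightarrow> tvb a b (\<lambda>s. F s - G s) (C + C')"
proof (erule tvb_triangle, assumption)
  fix s t show "norm (F t - G t - (F s - G s)) \<le> norm (F t - F s) + norm (G t - G s)"
    using norm_triangle_ineq4[of "F t - F s" "G t - G s"] by (simp add: algebra_simps)
qed

lemma tvb_zero: "tvb a b (\<lambda>_. 0) 0"
  by (simp add: tvb_def)

lemma tvb_image:
  assumes F: "tvb a b F C" and K: "0 \<le> K"
    and le: "\<And>s t. s \<in> {a..b} \<Longrightarrow> t \<in> {a..b} \<Longrightarrow> s \<le> t \<Longrightarrow> norm (H t - H s) \<le> K * norm (F t - F s)"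
  shows "tvb a b H (K * C)"
  unfolding tvb_def
proof (intro allI impI)
  fix n and t :: "nat \<Rightarrow> real" assume t: "mono_on {..n} t" "t ` {..n} \<subseteq> {a..b}"
  have "(\<Sum>i<n. norm (H (t (Suc i)) - H (t i))) \<le> (\<Sum>i<n. K * norm (F (t (Suc i)) - F (t i)))"
  proof (rule sum_mono)
    fix i assume "i \<in> {..<n}"
    then show "norm (H (t (Suc i)) - H (t i)) \<le> K * norm (F (t (Suc i)) - F (t i))"
      using t by (intro le) (auto intro: mono_onD simp: image_subset_iff)
  qed
  also have "\<dots> \<le> K * C" unfolding sum_distrib_left[symmetric] using tvbD[OF F t] K by (rule mult_left_mono)
  finally show "(\<Sum>i<n. norm (H (t (Suc i)) - H (t i))) \<le> K * C" .
qed

lemma tvb_cong: "tvb a b F C \<Longrightarrow> (\<And>s. s \<in> {a..b} \<Longrightarrow> F s = G s) \<Longrightarrow> tvb a b G C"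
  using tvb_image[of a b F C 1 G] by simp

lemma tvb_reparam:
  assumes F: "tvb c d F C" and \<sigma>: "mono_on {a..b} \<sigma>" "\<sigma> ` {a..b} \<subseteq> {c..d}"
  shows "tvb a b (\<lambda>s. F (\<sigma> s)) C"
  unfolding tvb_def
proof (intro allI impI)
  fix n and t :: "nat \<Rightarrow> real" assume t: "mono_on {..n} t" "t ` {..n} \<subseteq> {a..b}"
  have "mono_on {..n} (\<lambda>i. \<sigma> (t i))"
  proof (rule mono_onI)
    fix i j assume ij: "i \<in> {..n}" "j \<in> {..n}" "i \<le> j"
    then show "\<sigma> (t i) \<le> \<sigma> (t j)" using t(2) by (intro mono_onD[OF \<sigma>(1)] mono_onD[OF t(1)]) (auto simp: image_subset_iff)
  qed
  moreover have "(\<lambda>i. \<sigma> (t i)) ` {..n} \<subseteq> {c..d}" using t(2) \<sigma>(2) by blast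
  ultimately show "(\<Sum>i<n. norm (F (\<sigma> (t (Suc i))) - F (\<sigma> (t i)))) \<le> C" by (rule tvbD[OF F])
qed

lemma tvb_increment:
  assumes F: "tvb a b F C" and st: "s \<in> {a..b}" "t \<in> {a..b}" "s \<le> t"
  shows "norm (F t - F s) \<le> C"
proof -
  define r where "r i = (if i = 0 then s else t)" for i :: nat
  have "(\<Sum>i<1. norm (F (r (Suc i)) - F (r i))) \<le> C"
    using st by (intro tvbD[OF F]) (auto simp: r_def monotone_on_def)
  then show ?thesis by (simp add: r_def)
qed

lemma tvb_real_mono:
  fixes F :: "real \<Rightarrow> real"
  assumes m: "\<And>s t. s \<in> {a..b} \<Longrightarrow> t \<in> {a..b} \<Longrightarrow> s \<le> t \<Longrightarrow> F s \<le> F t"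
    and c: "\<And>s. s \<in> {a..b} \<Longrightarrow> F s \<in> {l..l + C}"
  shows "tvb a b F C"
  unfolding tvb_def
proof (intro allI impI)
  fix n and t :: "nat \<Rightarrow> real" assume t: "mono_on {..n} t" "t ` {..n} \<subseteq> {a..b}"
  have "(\<Sum>i<n. norm (F (t (Suc i)) - F (t i))) = (\<Sum>i<n. F (t (Suc i)) - F (t i))"
  proof (rule sum.cong[OF refl])
    fix i assume "i \<in> {..<n}"
    then have "F (t i) \<le> F (t (Suc i))" using t by (intro m) (auto intro: mono_onD simp: image_subset_iff)
    then show "norm (F (t (Suc i)) - F (t i)) = F (t (Suc i)) - F (t i)" by simp
  qed
  also have "\<dots> = F (t n) - F (t 0)" by (rule sum_lessThan_telescope)
  also have "\<dots> \<le> C" using c[of "t n"] c[of "t 0"] t(2) by (auto simp: image_subset_iff)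
  finally show "(\<Sum>i<n. norm (F (t (Suc i)) - F (t i))) \<le> C" .
qed

lemma tvb_prim: "nice lborel f \<Longrightarrow> tvb 0 1 (prim f) (L1n f)"
  unfolding tvb_def by (auto intro!: sum_norm_increments_prim_le simp: image_subset_iff)

lemma dysum_le_tvb:
  assumes "tvb 0 1 F C" shows "dysum n F \<le> C"
proof -
  have "(\<Sum>j<2^n. norm (F (real (Suc j) / 2 ^ n) - F (real j / 2 ^ n))) \<le> C"
    by (rule tvbD[OF assms]) (auto simp: monotone_on_def divide_right_mono)
  then show ?thesis by (simp add: dysum_def add.commute)
qed

text \<open>The converse of \<open>tvb_prim\<close>, by convergence of the dyadic variation
  sums.\<close>

lemma L1n_le_tvb:
  fixes f :: "real \<Rightarrow> 'v::banach"
  assumes f: "nice lborel f" "\<And>t. t \<notin> {0..1} \<Longrightarrow> f t = 0" and tv: "tvb 0 1 (prim f) C"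
  shows "L1n f \<le> C"
  by (rule LIMSEQ_le_const2[OF dysum_tendsto[OF nice_step_approx[OF f]]]) (use dysum_le_tvb[OF tv] in auto)

lemma total_variation_le:
  assumes "a \<le> b" "tvb a b F C" shows "total_variation a b F \<le> C"
  unfolding total_variation_def
proof (rule cSup_least)
  have "(\<Sum>i<0. norm (F ((\<lambda>_. a) (Suc i)) - F ((\<lambda>_. a) i))) \<in>
    {\<Sum>i<n. norm (F (t (Suc i)) - F (t i)) | n t. mono_on {..n} t \<and> t ` {..n} \<subseteq> {a..b}}"
    using assms(1) by (intro CollectI exI[of _ 0] exI[of _ "\<lambda>_::nat. a"]) (auto simp: monotone_on_def)
  then show "{\<Sum>i<n. norm (F (t (Suc i)) - F (t i)) | n t. mono_on {..n} t \<and> t ` {..n} \<subseteq> {a..b}} \<noteq> {}" by blast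
qed (use assms(2) in \<open>auto simp: tvb_def\<close>)

lemma tvb_total_variation:
  assumes "tvb a b F C" shows "tvb a b F (total_variation a b F)"
  unfolding tvb_def total_variation_def
proof (intro allI impI cSup_upper)
  show "bdd_above {\<Sum>i<n. norm (F (t (Suc i)) - F (t i)) | n t. mono_on {..n} t \<and> t ` {..n} \<subseteq> {a..b}}"
    by (rule bdd_aboveI[of _ C]) (use assms in \<open>auto simp: tvb_def\<close>)
qed blast

lemma total_variation_nonneg:
  assumes "a \<le> b" "tvb a b F C" shows "0 \<le> total_variation a b F"
  using tvbD[OF tvb_total_variation[OF assms(2)], of 0 "\<lambda>_. a"] assms(1) by (auto simp: monotone_on_def)

section \<open>Time changes and the infimum metric\<close>

abbreviation gpath :: "'v::banach path \<Rightarrow> real \<Rightarrow> 'v \<times> real" where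
  "gpath x \<equiv> snd (time_augment x)"

lemma C1_pos: "x \<in> C1_paths \<Longrightarrow> 0 < fst x"
  by (auto simp: C1_paths_def)

lemma gpath_eq_prim:
  assumes x: "x \<in> C1_paths" and t: "t \<in> {0..fst x}"
  shows "gpath x t = prim (augment (fst x) (velocity x)) (t / fst x)"
    and "gpath x t = (prim (velocity x) (t / fst x), t)"
proof -
  have s: "t / fst x \<in> {0..1}" using C1_pos[OF x] t by (auto simp: field_simps)
  show 1: "gpath x t = (prim (velocity x) (t / fst x), t)"
    using velocity(3)[OF x s] C1_pos[OF x] t by (simp add: time_augment_def)
  then show "gpath x t = prim (augment (fst x) (velocity x)) (t / fst x)"
    using C1_pos[OF x] by (simp add: prim_augment[OF velocity(1)[OF x] s])
qed

lemma tvb_gpath: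
  assumes x: "x \<in> C1_paths" shows "tvb 0 (fst x) (gpath x) (L1n (augment (fst x) (velocity x)))"
proof (rule tvb_cong)
  show "tvb 0 (fst x) (\<lambda>t. prim (augment (fst x) (velocity x)) (t / fst x)) (L1n (augment (fst x) (velocity x)))"
    using C1_pos[OF x] by (intro tvb_reparam[OF tvb_prim[OF nice_augment[OF velocity(1)[OF x]]]])
      (auto simp: monotone_on_def divide_right_mono)
qed (use gpath_eq_prim(1)[OF x] in simp)

lemma incr_bij_facts:
  assumes "\<tau> \<in> increasing_bijections S T" "0 \<le> S" "0 \<le> T"
  shows "mono_on {0..S} \<tau>" "\<tau> ` {0..S} = {0..T}" "\<tau> 0 = 0" "\<tau> S = T"
proof -
  have sm: "strict_mono_on {0..S} \<tau>" and bij: "bij_betw \<tau> {0..S} {0..T}"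
    using assms(1) by (auto simp: increasing_bijections_def)
  show mono: "mono_on {0..S} \<tau>" using sm by (rule strict_mono_on_imp_mono_on)
  show im: "\<tau> ` {0..S} = {0..T}" using bij by (simp add: bij_betw_def)
  obtain s where s: "s \<in> {0..S}" "\<tau> s = 0" using im assms(3) by (metis atLeastAtMost_iff image_iff order_refl)
  obtain r where r: "r \<in> {0..S}" "\<tau> r = T" using im assms(3) by (metis atLeastAtMost_iff image_iff order_refl)
  have "\<tau> 0 \<in> {0..T}" "\<tau> S \<in> {0..T}" using im assms(2) by (metis atLeastAtMost_iff imageI order_refl)+
  moreover have "\<tau> 0 \<le> \<tau> s" using s(1) assms(2) by (intro mono_onD[OF mono]) auto
  moreover have "\<tau> r \<le> \<tau> S" using r(1) assms(2) by (intro mono_onD[OF mono]) auto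
  ultimately show "\<tau> 0 = 0" "\<tau> S = T" using s r by auto
qed

lemma incr_bij_compose:
  assumes \<tau>: "\<tau> \<in> increasing_bijections S T" and \<sigma>: "\<sigma> \<in> increasing_bijections T U"
  shows "\<sigma> \<circ> \<tau> \<in> increasing_bijections S U"
proof -
  have bij: "bij_betw \<tau> {0..S} {0..T}" "bij_betw \<sigma> {0..T} {0..U}"
    and sm: "strict_mono_on {0..S} \<tau>" "strict_mono_on {0..T} \<sigma>"
    using assms by (auto simp: increasing_bijections_def)
  have "strict_mono_on {0..S} (\<sigma> \<circ> \<tau>)"
  proof (rule strict_mono_onI)
    fix r s assume rs: "r \<in> {0..S}" "s \<in> {0..S}" "r < s"
    have "\<tau> r \<in> {0..T}" "\<tau> s \<in> {0..T}" using bij(1) rs by (auto simp: bij_betw_def)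
    then show "(\<sigma> \<circ> \<tau>) r < (\<sigma> \<circ> \<tau>) s"
      using strict_mono_onD[OF sm(2)] strict_mono_onD[OF sm(1) rs] by simp
  qed
  then show ?thesis using bij_betw_trans[OF bij] by (simp add: increasing_bijections_def)
qed

lemma incr_bij_inverse:
  assumes "\<tau> \<in> increasing_bijections S T" shows "inv_into {0..S} \<tau> \<in> increasing_bijections T S"
proof -
  have sm: "strict_mono_on {0..S} \<tau>" and bij: "bij_betw \<tau> {0..S} {0..T}"
    using assms(1) by (auto simp: increasing_bijections_def)
  have "strict_mono_on {0..T} (inv_into {0..S} \<tau>)"
  proof (rule strict_mono_onI)
    fix r s assume rs: "r \<in> {0..T}" "s \<in> {0..T}" "r < s"
    define a b where "a = inv_into {0..S} \<tau> r" and "b = inv_into {0..S} \<tau> s"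
    have ab: "a \<in> {0..S}" "b \<in> {0..S}" "\<tau> a = r" "\<tau> b = s"
      using rs bij by (auto simp: a_def b_def bij_betw_def inv_into_into f_inv_into_f simp del: atLeastAtMost_iff)
    show "a < b"
    proof (rule ccontr)
      assume "\<not> a < b"
      then have "\<tau> b \<le> \<tau> a" using ab by (intro mono_onD[OF strict_mono_on_imp_mono_on[OF sm]]) auto
      then show False using ab rs by simp
    qed
  qed
  then show ?thesis using bij_betw_inv_into[OF bij] by (simp add: increasing_bijections_def)
qed

lemma incr_bij_linear:
  assumes "0 < S" "0 < T" shows "(\<lambda>t. t * T / S) \<in> increasing_bijections S T"
proof -
  have "bij_betw (\<lambda>t. t * T / S) {0..S} {0..T}"
    by (rule bij_betw_byWitness[where f' = "\<lambda>t. t * S / T"])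
       (use assms in \<open>auto simp: field_simps image_subset_iff mult_right_mono\<close>)
  moreover have "strict_mono_on {0..S} (\<lambda>t. t * T / S)"
    using assms by (auto simp: strict_mono_on_def divide_strict_right_mono)
  ultimately show ?thesis by (simp add: increasing_bijections_def)
qed

definition tv_gap :: "'v::banach path \<Rightarrow> 'v path \<Rightarrow> (real \<Rightarrow> real) \<Rightarrow> real" where
  "tv_gap x y \<tau> = total_variation 0 (fst x) (\<lambda>t. gpath x t - gpath y (\<tau> t))"

lemma path_dist_eq:
  "x \<in> C1_paths \<Longrightarrow> y \<in> C1_paths \<Longrightarrow>
    path_dist x y = (INF \<tau>\<in>increasing_bijections (fst x) (fst y). tv_gap x y \<tau>)"
  by (simp add: path_dist_def tv_gap_def)

context
  fixes x y :: "'v::banach path"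
  assumes x: "x \<in> C1_paths" and y: "y \<in> C1_paths"
begin

lemma tvb_gap:
  assumes \<tau>: "\<tau> \<in> increasing_bijections (fst x) (fst y)"
  shows "tvb 0 (fst x) (\<lambda>t. gpath x t - gpath y (\<tau> t)) (tv_gap x y \<tau>)"
  unfolding tv_gap_def
  using incr_bij_facts[OF \<tau>] C1_pos[OF x] C1_pos[OF y]
  by (intro tvb_total_variation[OF tvb_diff[OF tvb_gpath[OF x] tvb_reparam[OF tvb_gpath[OF y]]]]) auto

lemma tv_gap_nonneg:
  assumes \<tau>: "\<tau> \<in> increasing_bijections (fst x) (fst y)" shows "0 \<le> tv_gap x y \<tau>"
  unfolding tv_gap_def using C1_pos[OF x] tvb_gap[OF \<tau>] by (intro total_variation_nonneg) auto

lemma path_dist_nonneg: "0 \<le> path_dist x y"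
  unfolding path_dist_eq[OF x y]
  using incr_bij_linear[OF C1_pos[OF x] C1_pos[OF y]] tv_gap_nonneg by (intro cINF_greatest) auto

lemma path_dist_le_gap:
  assumes \<tau>: "\<tau> \<in> increasing_bijections (fst x) (fst y)" shows "path_dist x y \<le> tv_gap x y \<tau>"
  unfolding path_dist_eq[OF x y]
  by (rule cINF_lower[OF _ \<tau>]) (auto intro!: bdd_belowI[of _ 0] tv_gap_nonneg)

lemma path_dist_less_obtain:
  assumes "path_dist x y < c"
  obtains \<tau> where "\<tau> \<in> increasing_bijections (fst x) (fst y)"
    "tvb 0 (fst x) (\<lambda>t. gpath x t - gpath y (\<tau> t)) c"
proof -
  have "(INF \<tau>\<in>increasing_bijections (fst x) (fst y). tv_gap x y \<tau>) < c"
    using assms by (simp add: path_dist_eq[OF x y])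
  then obtain \<tau> where \<tau>: "\<tau> \<in> increasing_bijections (fst x) (fst y)" "tv_gap x y \<tau> < c"
    using incr_bij_linear[OF C1_pos[OF x] C1_pos[OF y]]
    by (subst (asm) cINF_less_iff) (auto intro!: bdd_belowI[of _ 0] tv_gap_nonneg)
  from tvb_mono[OF tvb_gap[OF \<tau>(1)] less_imp_le[OF \<tau>(2)]] show ?thesis by (rule that[OF \<tau>(1)])
qed

lemma path_dist_leI:
  assumes \<tau>: "\<tau> \<in> increasing_bijections (fst x) (fst y)"
    and "tvb 0 (fst x) (\<lambda>t. gpath x t - gpath y (\<tau> t)) c"
  shows "path_dist x y \<le> c"
  using path_dist_le_gap[OF \<tau>] total_variation_le[OF _ assms(2)] C1_pos[OF x] by (simp add: tv_gap_def)

end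

text \<open>Reparametrizing by the inverse time change turns the gap, up to sign, into the gap in
  the other order, with the same variation bound.\<close>

lemma path_dist_sym_le:
  fixes x y :: "'v::banach path"
  assumes x: "x \<in> C1_paths" and y: "y \<in> C1_paths" shows "path_dist y x \<le> path_dist x y"
proof (rule field_le_epsilon)
  fix e :: real assume "0 < e"
  then have "path_dist x y < path_dist x y + e" by simp
  then obtain \<tau> where \<tau>: "\<tau> \<in> increasing_bijections (fst x) (fst y)"
    and tv: "tvb 0 (fst x) (\<lambda>t. gpath x t - gpath y (\<tau> t)) (path_dist x y + e)"
    using path_dist_less_obtain[OF x y] by metis
  define \<sigma> where "\<sigma> = inv_into {0..fst x} \<tau>"
  have \<sigma>: "\<sigma> \<in> increasing_bijections (fst y) (fst x)" unfolding \<sigma>_def by (rule incr_bij_inverse[OF \<tau>])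
  have inv: "\<tau> (\<sigma> s) = s" if "s \<in> {0..fst y}" for s
    using \<tau> that unfolding \<sigma>_def increasing_bijections_def by (auto simp: bij_betw_def f_inv_into_f simp del: atLeastAtMost_iff)
  have "tvb 0 (fst y) (\<lambda>s. gpath x (\<sigma> s) - gpath y (\<tau> (\<sigma> s))) (path_dist x y + e)"
    using incr_bij_facts[OF \<sigma>] C1_pos[OF x] C1_pos[OF y] by (intro tvb_reparam[OF tv]) auto
  from tvb_image[OF this, of 1 "\<lambda>s. gpath y s - gpath x (\<sigma> s)"]
  have "tvb 0 (fst y) (\<lambda>s. gpath y s - gpath x (\<sigma> s)) (path_dist x y + e)"
  proof -
    have "norm (gpath y t - gpath x (\<sigma> t) - (gpath y s - gpath x (\<sigma> s)))
        \<le> 1 * norm (gpath x (\<sigma> t) - gpath y (\<tau> (\<sigma> t)) - (gpath x (\<sigma> s) - gpath y (\<tau> (\<sigma> s))))"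
      if "s \<in> {0..fst y}" "t \<in> {0..fst y}" for s t
      using that inv norm_minus_commute[of "gpath y t - gpath x (\<sigma> t)" "gpath y s - gpath x (\<sigma> s)"]
      by (simp add: algebra_simps)
    then show ?thesis
      using tvb_image[OF \<open>tvb 0 (fst y) (\<lambda>s. gpath x (\<sigma> s) - gpath y (\<tau> (\<sigma> s))) (path_dist x y + e)\<close>, of 1 "\<lambda>s. gpath y s - gpath x (\<sigma> s)"]
      by simp
  qed
  then show "path_dist y x \<le> path_dist x y + e" by (rule path_dist_leI[OF y x \<sigma>])
qed

lemma path_dist_triangle:
  fixes x y z :: "'v::banach path"
  assumes x: "x \<in> C1_paths" and y: "y \<in> C1_paths" and z: "z \<in> C1_paths"
  shows "path_dist x z \<le> path_dist x y + path_dist y z"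
proof (rule field_le_epsilon)
  fix e :: real assume "0 < e"
  then have e: "path_dist x y < path_dist x y + e / 2" "path_dist y z < path_dist y z + e / 2" by auto
  obtain \<tau> where \<tau>: "\<tau> \<in> increasing_bijections (fst x) (fst y)"
    and tv1: "tvb 0 (fst x) (\<lambda>t. gpath x t - gpath y (\<tau> t)) (path_dist x y + e / 2)"
    using path_dist_less_obtain[OF x y e(1)] by metis
  obtain \<sigma> where \<sigma>: "\<sigma> \<in> increasing_bijections (fst y) (fst z)"
    and tv2: "tvb 0 (fst y) (\<lambda>t. gpath y t - gpath z (\<sigma> t)) (path_dist y z + e / 2)"
    using path_dist_less_obtain[OF y z e(2)] by metis
  have "tvb 0 (fst x) (\<lambda>t. gpath y (\<tau> t) - gpath z (\<sigma> (\<tau> t))) (path_dist y z + e / 2)"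
    using incr_bij_facts[OF \<tau>] C1_pos[OF x] C1_pos[OF y] by (intro tvb_reparam[OF tv2]) auto
  from tvb_add[OF tv1 this]
  have "tvb 0 (fst x) (\<lambda>t. gpath x t - gpath z ((\<sigma> \<circ> \<tau>) t)) (path_dist x y + path_dist y z + e)"
    by (simp add: algebra_simps)
  then show "path_dist x z \<le> path_dist x y + path_dist y z + e"
    by (rule path_dist_leI[OF x z incr_bij_compose[OF \<tau> \<sigma>]])
qed

text \<open>Both time-augmented paths start at the origin and the time change fixes 0, so a
  variation bound on the gap is also a bound on its size.\<close>

lemma gpath_close:
  fixes x y :: "'v::banach path"
  assumes x: "x \<in> C1_paths" and y: "y \<in> C1_paths" and \<tau>: "\<tau> \<in> increasing_bijections (fst x) (fst y)"
    and tv: "tvb 0 (fst x) (\<lambda>t. gpath x t - gpath y (\<tau> t)) c" and t: "t \<in> {0..fst x}"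
  shows "norm (snd x t - snd y (\<tau> t)) \<le> c" "\<bar>t - \<tau> t\<bar> \<le> c" "\<tau> t \<in> {0..fst y}"
proof -
  note f = incr_bij_facts[OF \<tau> less_imp_le[OF C1_pos[OF x]] less_imp_le[OF C1_pos[OF y]]]
  show t': "\<tau> t \<in> {0..fst y}" using f(2) t by blast
  have "gpath x 0 - gpath y (\<tau> 0) = 0"
    using gpath_eq_prim(2)[OF x, of 0] gpath_eq_prim(2)[OF y, of 0] C1_pos[OF x] C1_pos[OF y]
    by (simp add: f(3) prim_0[OF velocity(1)[OF x]] prim_0[OF velocity(1)[OF y]])
  moreover have "norm (gpath x t - gpath y (\<tau> t) - (gpath x 0 - gpath y (\<tau> 0))) \<le> c"
    using t by (intro tvb_increment[OF tv]) auto
  ultimately have "norm (gpath x t - gpath y (\<tau> t)) \<le> c" by simp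
  moreover have "gpath x t - gpath y (\<tau> t) = (snd x t - snd y (\<tau> t), t - \<tau> t)"
    using t t' by (simp add: time_augment_def)
  ultimately show "norm (snd x t - snd y (\<tau> t)) \<le> c" "\<bar>t - \<tau> t\<bar> \<le> c"
    using norm_fst_le[of "snd x t - snd y (\<tau> t)" "t - \<tau> t"] norm_snd_le[of "t - \<tau> t" "snd x t - snd y (\<tau> t)"]
    by (auto intro: order_trans)
qed

section \<open>Comparison with the L1 distance of velocities\<close>

text \<open>The distance that belongs to the linear time change, without an infimum. It need not
  equal \<open>path_dist\<close>, but it has the same neighbourhoods.\<close>

definition vdist :: "'v::banach path \<Rightarrow> 'v path \<Rightarrow> real" where
  "vdist x y = \<bar>fst x - fst y\<bar> + L1n (\<lambda>t. velocity x t - velocity y t)"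

text \<open>The linear time change is one candidate. Under it the gap is the primitive of the
  velocity difference, paired with a linear function of slope \<open>fst x - fst y\<close>.\<close>

lemma path_dist_le_vdist:
  fixes x y :: "'v::banach path"
  assumes x: "x \<in> C1_paths" and y: "y \<in> C1_paths" shows "path_dist x y \<le> vdist x y"
proof (rule path_dist_leI[OF x y incr_bij_linear[OF C1_pos[OF x] C1_pos[OF y]]])
  have Tx: "0 < fst x" and Ty: "0 < fst y" by (simp_all add: C1_pos x y)
  have n: "nice lborel (\<lambda>t. velocity x t - velocity y t)" by (intro nice_diff velocity x y)
  define H where "H s = prim (\<lambda>t. velocity x t - velocity y t) s" for s
  have "tvb 0 1 (\<lambda>s. (H s, 0::real)) (1 * L1n (\<lambda>t. velocity x t - velocity y t))"
    by (rule tvb_image[OF tvb_prim[OF n]]) (auto simp: H_def norm_Pair)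
  moreover have "tvb 0 1 (\<lambda>s. (0::'v, (fst x - fst y) * s)) (\<bar>fst x - fst y\<bar> * 1)"
  proof (rule tvb_image)
    show "tvb 0 1 (\<lambda>s::real. s) 1" by (rule tvb_real_mono[where l = 0]) auto
  qed (auto simp: norm_Pair right_diff_distrib[symmetric] abs_mult)
  ultimately have "tvb 0 1 (\<lambda>s. (0::'v, (fst x - fst y) * s) + (H s, 0)) (\<bar>fst x - fst y\<bar> * 1 + 1 * L1n (\<lambda>t. velocity x t - velocity y t))"
    by (intro tvb_add)
  then have tv: "tvb 0 1 (\<lambda>s. (H s, (fst x - fst y) * s)) (vdist x y)" by (simp add: vdist_def)
  have "tvb 0 (fst x) (\<lambda>t. (H (t / fst x), (fst x - fst y) * (t / fst x))) (vdist x y)"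
    by (rule tvb_reparam[OF tv]) (use Tx in \<open>auto simp: monotone_on_def divide_right_mono\<close>)
  then show "tvb 0 (fst x) (\<lambda>t. gpath x t - gpath y (t * fst y / fst x)) (vdist x y)"
  proof (rule tvb_cong)
    fix t assume t: "t \<in> {0..fst x}"
    then have t': "t * fst y / fst x \<in> {0..fst y}" using Tx Ty by (auto simp: field_simps mult_right_mono)
    show "(H (t / fst x), (fst x - fst y) * (t / fst x)) = gpath x t - gpath y (t * fst y / fst x)"
      using Tx Ty gpath_eq_prim(2)[OF x t] gpath_eq_prim(2)[OF y t']
      by (simp add: H_def prim_diff[OF velocity(1)[OF x] velocity(1)[OF y]] field_simps)
  qed
qed

lemma vdist_self: "vdist x x = 0"
  by (simp add: vdist_def L1n_def)

text \<open>The time component keeps a nearly optimal time change within \<open>c\<close> of the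
  identity, so continuity of \<open>y\<close> gives equality of values; outside the interval both
  paths are undefined by extensionality.\<close>

lemma path_dist_zero_iff:
  fixes x y :: "'v::banach path"
  assumes x: "x \<in> C1_paths" and y: "y \<in> C1_paths" shows "path_dist x y = 0 \<longleftrightarrow> x = y"
proof
  assume "x = y"
  then show "path_dist x y = 0" using path_dist_le_vdist[OF x x] vdist_self[of x] path_dist_nonneg[OF x x] by simp
next
  assume zero: "path_dist x y = 0"
  have Tx: "0 < fst x" and Ty: "0 < fst y" by (simp_all add: C1_pos x y)
  have "\<bar>fst x - fst y\<bar> \<le> e" if e: "e > 0" for e
  proof -
    obtain \<tau> where \<tau>: "\<tau> \<in> increasing_bijections (fst x) (fst y)" "tvb 0 (fst x) (\<lambda>t. gpath x t - gpath y (\<tau> t)) e"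
      using path_dist_less_obtain[OF x y, of e] zero e by metis
    show ?thesis using gpath_close(2)[OF x y \<tau>, of "fst x"] incr_bij_facts(4)[OF \<tau>(1)] Tx Ty by auto
  qed
  then have T: "fst x = fst y" using field_le_epsilon[of "\<bar>fst x - fst y\<bar>" 0] by auto
  have "snd x t = snd y t" for t
  proof (cases "t \<in> {0..fst x}")
    case True
    have cont: "continuous_on {0..fst y} (snd y)" using y by (auto simp: C1_paths_def)
    have "dist (snd x t) (snd y t) \<le> e" if e: "e > 0" for e
    proof -
      obtain d where d: "d > 0" "\<And>s. s \<in> {0..fst y} \<Longrightarrow> dist s t < d \<Longrightarrow> dist (snd y s) (snd y t) < e / 2"
        using cont True e unfolding continuous_on_iff T by (metis half_gt_zero)
      define c where "c = min (d / 2) (e / 2)"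
      have c: "c > 0" using d e by (simp add: c_def)
      obtain \<tau> where \<tau>: "\<tau> \<in> increasing_bijections (fst x) (fst y)" "tvb 0 (fst x) (\<lambda>t. gpath x t - gpath y (\<tau> t)) c"
        using path_dist_less_obtain[OF x y, of c] zero c by metis
      note g = gpath_close[OF x y \<tau> True]
      have "dist (snd y (\<tau> t)) (snd y t) < e / 2" using g(2,3) d by (intro d(2)) (auto simp: dist_norm c_def abs_minus_commute)
      moreover have "dist (snd x t) (snd y (\<tau> t)) \<le> e / 2" using g(1) by (simp add: dist_norm c_def)
      ultimately show ?thesis using dist_triangle[of "snd x t" "snd y t" "snd y (\<tau> t)"] by linarith
    qed
    then have "dist (snd x t) (snd y t) \<le> 0" using field_le_epsilon[of _ 0] by (metis add_0)
    then show ?thesis by simp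
  next
    case False
    then show ?thesis using x y T by (auto simp: C1_paths_def extensional_def)
  qed
  then show "x = y" using T by (simp add: prod_eq_iff fun_eq_iff)
qed

lemma path_dist_commute: "x \<in> C1_paths \<Longrightarrow> y \<in> C1_paths \<Longrightarrow> path_dist x y = path_dist y x"
  using path_dist_sym_le by (metis order_antisym)

lemma path_metric_space: "Metric_space (C1_paths :: 'v::banach path set) path_dist"
proof
  fix x y z :: "'v path"
  have outside: "path_dist x y = 0" "path_dist y x = 0" if "\<not> (x \<in> C1_paths \<and> y \<in> C1_paths)"
    using that by (auto simp: path_dist_def)
  show "0 \<le> path_dist x y"
    using path_dist_nonneg outside(1) by (metis order_refl)
  show "path_dist x y = path_dist y x"
    using path_dist_commute outside by metis
qed (use path_dist_zero_iff path_dist_triangle in auto)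

text \<open>The map \<open>max u a\<close> has its only kink at \<open>a\<close>. If all four points
  are on one side, the left side is 0 or the plain increment of the difference. If the kink is
  crossed or separates the two pairs, the excess arises within \<eta> of \<open>a\<close> and is
  charged to the increments of the clamp \<open>k\<close>.\<close>

lemma max_increment_bound:
  fixes r1 r2 l1 l2 a \<eta> :: real
  assumes mono: "r1 \<le> r2" "l1 \<le> l2" and c: "\<bar>r1 - l1\<bar> \<le> \<eta>" "\<bar>r2 - l2\<bar> \<le> \<eta>"
    and k_def: "\<And>u. k u = min (max u (a - \<eta>)) (a + \<eta>)"
  shows "\<bar>(max r2 a - max l2 a) - (max r1 a - max l1 a)\<bar> \<le> \<bar>(r2 - l2) - (r1 - l1)\<bar> + ((k r2 - k r1) + (k l2 - k l1))"
proof -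
  have \<eta>: "0 \<le> \<eta>" using c by linarith
  have kid: "k u = u" if "a - \<eta> \<le> u" "u \<le> a + \<eta>" for u using that by (simp add: k_def)
  have klow: "k u = a - \<eta>" if "u \<le> a - \<eta>" for u using that \<eta> by (simp add: k_def)
  have kle: "k u \<le> a" if "u \<le> a" for u using that \<eta> by (simp add: k_def)
  have kge: "a \<le> k u" if "a \<le> u" for u using that \<eta> by (simp add: k_def)
  have km: "k r1 \<le> k r2" "k l1 \<le> k l2" using mono by (auto simp: k_def)
  \<comment> \<open>The pair \<open>r\<close> crosses the kink. The points are quantified again so
    that the case of \<open>l\<close> crossing follows by exchanging the two pairs.\<close>
  have cross: "\<bar>(max r2 a - max l2 a) - (max r1 a - max l1 a)\<bar> \<le> \<bar>(r2 - l2) - (r1 - l1)\<bar> + ((k r2 - k r1) + (k l2 - k l1))"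
    if r: "r1 \<le> a" "a \<le> r2" and mono: "r1 \<le> r2" "l1 \<le> l2" and c: "\<bar>r1 - l1\<bar> \<le> \<eta>" "\<bar>r2 - l2\<bar> \<le> \<eta>"
      and km: "k r1 \<le> k r2" "k l1 \<le> k l2" for r1 r2 l1 l2
  proof -
    consider "l2 \<le> a" | "a \<le> l1" | "l1 \<le> a" "a \<le> l2" by linarith
    then show ?thesis
    proof cases
      case 1
      have "k r2 = r2" by (rule kid) (use 1 c r \<eta> in linarith)+
      moreover have "max r1 a = a" "max l1 a = a" "max r2 a = r2" "max l2 a = a" using 1 r mono by auto
      ultimately show ?thesis using kle[OF r(1)] km r by simp
    next
      case 2
      have "k r1 = r1" by (rule kid) (use 2 c r \<eta> in linarith)+
      moreover have "max r1 a = a" "max l1 a = l1" "max r2 a = r2" "max l2 a = l2" using 2 r mono by auto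
      ultimately show ?thesis using kge[OF r(2)] km r by simp
    next
      case 3
      have m: "max r1 a = a" "max l1 a = a" "max r2 a = r2" "max l2 a = l2" using 3 r mono by auto
      have kk: "a \<le> k r2" "a \<le> k l2" using r 3 kge by auto
      consider "r1 \<le> a - \<eta>" | "l1 \<le> a - \<eta>" | "a - \<eta> \<le> r1" "a - \<eta> \<le> l1" by linarith
      then show ?thesis
      proof cases
        case 1
        then show ?thesis unfolding m using klow[OF 1] kk km c by simp
      next
        case 2
        then show ?thesis unfolding m using klow[OF 2] kk km c by simp
      next
        case bb: 3
        have "k r1 = r1" "k l1 = l1" using bb r 3 \<eta> by (auto intro!: kid)
        moreover have "\<bar>r1 - l1\<bar> \<le> (a - r1) + (a - l1)" using r 3 by linarith
        ultimately show ?thesis unfolding m using kk by simp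
      qed
    qed
  qed
  consider "a \<le> r1" "a \<le> l1" | "r2 \<le> a" "l2 \<le> a" | "r1 \<le> a" "a \<le> r2" | "l1 \<le> a" "a \<le> l2"
    | "a \<le> r1" "l2 \<le> a" | "a \<le> l1" "r2 \<le> a" by linarith
  then show ?thesis
  proof cases
    case 1
    then have "max r1 a = r1" "max l1 a = l1" "max r2 a = r2" "max l2 a = l2" using mono by auto
    then show ?thesis using km by simp
  next
    case 2
    then have "max r1 a = a" "max l1 a = a" "max r2 a = a" "max l2 a = a" using mono by auto
    then show ?thesis using km by simp
  next
    case 3
    then show ?thesis using cross[OF 3 mono c km] by simp
  next
    case 4
    have "\<bar>l1 - r1\<bar> \<le> \<eta>" "\<bar>l2 - r2\<bar> \<le> \<eta>" using c by (auto simp: abs_minus_commute)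
    note cross[OF 4 mono(2,1) this km(2,1)]
    moreover have "\<bar>(l2 - r2) - (l1 - r1)\<bar> = \<bar>(r2 - l2) - (r1 - l1)\<bar>" by linarith
    moreover have "\<bar>(max l2 a - max r2 a) - (max l1 a - max r1 a)\<bar> = \<bar>(max r2 a - max l2 a) - (max r1 a - max l1 a)\<bar>" by linarith
    ultimately show ?thesis by linarith
  next
    case 5
    have "k r1 = r1" "k r2 = r2" "k l1 = l1" "k l2 = l2" using 5 c mono \<eta> by (auto intro!: kid)
    moreover have "max r1 a = r1" "max l1 a = a" "max r2 a = r2" "max l2 a = a" using 5 mono by auto
    ultimately show ?thesis using mono by simp
  next
    case 6
    have "k r1 = r1" "k r2 = r2" "k l1 = l1" "k l2 = l2" using 6 c mono \<eta> by (auto intro!: kid)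
    moreover have "max r1 a = a" "max l1 a = l1" "max r2 a = a" "max l2 a = l2" using 6 mono by auto
    ultimately show ?thesis using mono by simp
  qed
qed
text \<open>The constant 5 is 1 for the variation of \<open>\<beta> s - s\<close> plus 2 for each of
  the clamps of \<beta> and of the identity, which are monotone with range in an interval of length
  \<open>2 * \<eta>\<close>.\<close>

lemma tvb_max_diff:
  fixes \<beta> :: "real \<Rightarrow> real"
  assumes \<beta>: "mono_on {0..1} \<beta>" and tv: "tvb 0 1 (\<lambda>s. \<beta> s - s) \<eta>" and cl: "\<And>s. s \<in> {0..1} \<Longrightarrow> \<bar>\<beta> s - s\<bar> \<le> \<eta>"
  shows "tvb 0 1 (\<lambda>s. max (\<beta> s) a - max s a) (5 * \<eta>)"
proof -
  have \<eta>: "0 \<le> \<eta>" using cl[of 0] by auto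
  define k where "k u = min (max u (a - \<eta>)) (a + \<eta>)" for u
  have k_mono: "k u \<le> k v" if "u \<le> v" for u v using that by (auto simp: k_def)
  have k_range: "k u \<in> {a - \<eta>..a - \<eta> + 2 * \<eta>}" for u using \<eta> by (auto simp: k_def)
  have 1: "tvb 0 1 (\<lambda>s. k (\<beta> s)) (2 * \<eta>)"
    by (rule tvb_real_mono[where l = "a - \<eta>"]) (use \<beta> k_range in \<open>auto intro!: k_mono dest: mono_onD simp del: atLeastAtMost_iff\<close>)
  have 2: "tvb 0 1 k (2 * \<eta>)"
    by (rule tvb_real_mono[where l = "a - \<eta>"]) (use k_range in \<open>auto intro!: k_mono simp del: atLeastAtMost_iff\<close>)
  have 3: "tvb 0 1 (\<lambda>s. k (\<beta> s) + k s) (2 * \<eta> + 2 * \<eta>)" by (rule tvb_add[OF 1 2])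
  have "tvb 0 1 (\<lambda>s. max (\<beta> s) a - max s a) (\<eta> + (2 * \<eta> + 2 * \<eta>))"
  proof (rule tvb_triangle[OF tv 3])
    fix s t :: real assume st: "s \<in> {0..1}" "t \<in> {0..1}" "s \<le> t"
    have b: "\<beta> s \<le> \<beta> t" using mono_onD[OF \<beta> st] .
    have "\<bar>(max (\<beta> t) a - max t a) - (max (\<beta> s) a - max s a)\<bar> \<le> \<bar>(\<beta> t - t) - (\<beta> s - s)\<bar>
        + ((k (\<beta> t) - k (\<beta> s)) + (k t - k s))"
      by (rule max_increment_bound[OF b st(3) cl[OF st(1)] cl[OF st(2)] k_def])
    moreover have "(k (\<beta> t) - k (\<beta> s)) + (k t - k s) \<le> \<bar>k (\<beta> t) + k t - (k (\<beta> s) + k s)\<bar>" by linarith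
    ultimately show "norm (max (\<beta> t) a - max t a - (max (\<beta> s) a - max s a)) \<le> norm (\<beta> t - t - (\<beta> s - s)) + norm (k (\<beta> t) + k t - (k (\<beta> s) + k s))"
      by simp
  qed
  then show ?thesis by simp
qed

lemma bint_sum: "finite I \<Longrightarrow> (\<And>i. i \<in> I \<Longrightarrow> nice M (f i)) \<Longrightarrow> bint M (\<lambda>x. \<Sum>i\<in>I. f i x) = (\<Sum>i\<in>I. bint M (f i) :: 'b::banach)"
proof (induction I rule: finite_induct)
  case empty
  then show ?case using bint_const_indicator[of "{}" M "0::'b"] by simp
next
  case (insert i I) then show ?case by (simp add: bint_add nice_sum)
qed

text \<open>For a cell with ends \<open>a\<close> and \<open>b\<close>, the length of its part below
  \<open>s\<close> is \<open>max s a - max s b + (b - a)\<close>. The primitive thus becomes a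
  combination of functions with one kink each, to which \<open>tvb_max_diff\<close> applies.\<close>

lemma prim_step:
  fixes c :: "nat \<Rightarrow> 'v::banach"
  assumes s: "s \<in> {0..1}"
  shows "prim (step n c) s = (\<Sum>j<2^n. (max s (real j / 2 ^ n) - max s ((real j + 1) / 2 ^ n) + 1 / 2 ^ n) *\<^sub>R c j)"
proof -
  define A where "A j = {0..s} \<inter> {real j / 2 ^ n..<(real j + 1) / 2 ^ n}" for j
  have A: "A j \<in> sets lborel" for j by (simp add: A_def)
  have fin: "emeasure lborel (A j) < \<infinity>" for j
    by (rule le_less_trans[OF emeasure_mono[of _ "{0..s}"]]) (use s in \<open>auto simp: A_def\<close>)
  have m: "measure lborel (A j) = max s (real j / 2 ^ n) - max s ((real j + 1) / 2 ^ n) + 1 / 2 ^ n" for j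
  proof -
    define a b where "a = real j / 2 ^ n" and "b = (real j + 1) / 2 ^ n"
    have ab: "0 \<le> a" "a < b" "b - a = 1 / 2 ^ n"
      by (auto simp: a_def b_def divide_strict_right_mono diff_divide_distrib[symmetric])
    consider "s < a" | "a \<le> s" "s < b" | "b \<le> s" by linarith
    then show ?thesis
    proof cases
      case 1
      then have "A j = {}" by (auto simp: A_def a_def)
      then show ?thesis using 1 ab by (simp add: a_def[symmetric] b_def[symmetric])
    next
      case 2
      then have "A j = {a..s}" using ab by (auto simp: A_def a_def[symmetric] b_def[symmetric])
      then show ?thesis using 2 ab by (simp add: a_def[symmetric] b_def[symmetric])
    next
      case 3
      then have "A j = {a..<b}" using ab by (auto simp: A_def a_def[symmetric] b_def[symmetric])
      then show ?thesis using 3 ab by (simp add: a_def[symmetric] b_def[symmetric])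
    qed
  qed
  have "prim (step n c) s = bint lborel (\<lambda>t. \<Sum>j<2^n. indicator (A j) t *\<^sub>R c j)"
    unfolding prim_def
  proof (rule bint_cong)
    fix t
    show "indicator {0..s} t *\<^sub>R step n c t = (\<Sum>j<2^n. indicator (A j) t *\<^sub>R c j)"
      unfolding step_eq_sum scaleR_sum_right by (rule sum.cong) (auto simp: A_def indicator_def)
  qed
  also have "\<dots> = (\<Sum>j<2^n. measure lborel (A j) *\<^sub>R c j)"
    by (subst bint_sum) (auto intro!: nice_const_indicator A fin sum.cong simp: bint_const_indicator[OF A fin])
  finally show ?thesis by (simp add: m)
qed

lemma tvb_sum: "finite I \<Longrightarrow> (\<And>i. i \<in> I \<Longrightarrow> tvb a b (F i) (C i)) \<Longrightarrow> tvb a b (\<lambda>s. \<Sum>i\<in>I. F i s) (\<Sum>i\<in>I. C i)"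
  by (induction I rule: finite_induct) (auto intro: tvb_zero tvb_add)

text \<open>The additive constants of \<open>prim_step\<close> cancel; each cell contributes two
  kinks at \<open>5 * \<eta>\<close>, hence the 10.\<close>

lemma tvb_prim_step_reparam:
  fixes c :: "nat \<Rightarrow> 'v::banach"
  assumes \<beta>: "mono_on {0..1} \<beta>" "\<beta> ` {0..1} \<subseteq> {0..1}" and tv: "tvb 0 1 (\<lambda>s. \<beta> s - s) \<eta>"
    and cl: "\<And>s. s \<in> {0..1} \<Longrightarrow> \<bar>\<beta> s - s\<bar> \<le> \<eta>"
  shows "tvb 0 1 (\<lambda>s. prim (step n c) (\<beta> s) - prim (step n c) s) (10 * \<eta> * (\<Sum>j<2^n. norm (c j)))"
proof -
  define E where "E a s = max (\<beta> s) a - max s a" for a s :: real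
  have E: "tvb 0 1 (E a) (5 * \<eta>)" for a unfolding E_def by (rule tvb_max_diff[OF \<beta>(1) tv cl])
  define H where "H j s = (E (real j / 2 ^ n) s - E ((real j + 1) / 2 ^ n) s) *\<^sub>R c j" for j s
  have "tvb 0 1 (H j) (norm (c j) * (10 * \<eta>))" for j
  proof (rule tvb_image)
    show "tvb 0 1 (\<lambda>s. E (real j / 2 ^ n) s - E ((real j + 1) / 2 ^ n) s) (10 * \<eta>)"
      using tvb_diff[OF E E] by simp
  qed (auto simp: H_def scaleR_diff_left[symmetric] mult.commute)
  then have "tvb 0 1 (\<lambda>s. \<Sum>j<2^n. H j s) (\<Sum>j<2^n. norm (c j) * (10 * \<eta>))" by (intro tvb_sum) auto
  moreover have "(\<Sum>j<2^n. norm (c j) * (10 * \<eta>)) = 10 * \<eta> * (\<Sum>j<2^n. norm (c j))"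
    by (simp add: sum_distrib_right[symmetric])
  ultimately have "tvb 0 1 (\<lambda>s. \<Sum>j<2^n. H j s) (10 * \<eta> * (\<Sum>j<2^n. norm (c j)))" by simp
  then show ?thesis
  proof (rule tvb_cong)
    fix s :: real assume s: "s \<in> {0..1}"
    then have "\<beta> s \<in> {0..1}" using \<beta>(2) by blast
    then show "(\<Sum>j<2^n. H j s) = prim (step n c) (\<beta> s) - prim (step n c) s"
      using s by (simp add: prim_step H_def E_def sum_subtractf[symmetric] scaleR_diff_left[symmetric] algebra_simps)
  qed
qed

text \<open>The time change comparing two nearby paths need not be absolutely continuous. It is therefore
  applied only to a piecewise linear approximation of the fixed path.\<close>

lemma vdist_small:
  fixes x :: "'v::banach path"
  assumes x: "x \<in> C1_paths" and e: "\<epsilon> > 0"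
  obtains \<delta> where "\<delta> > 0" "\<And>y. y \<in> C1_paths \<Longrightarrow> path_dist x y < \<delta> \<Longrightarrow> vdist x y < \<epsilon>"
proof -
  define f where "f = velocity x"
  define T where "T = fst x"
  have T: "0 < T" using C1_pos[OF x] by (simp add: T_def)
  have nf: "nice lborel f" and f0: "\<And>t. t \<notin> {0..1} \<Longrightarrow> f t = 0" using velocity[OF x] by (auto simp: f_def)
  obtain n c where c: "L1n (\<lambda>t. f t - step n c t) < \<epsilon> / 8"
    using nice_step_approx[OF nf f0] e unfolding step_approx_def by (meson divide_pos_pos zero_less_numeral)
  define M where "M = (\<Sum>j<2^n. norm (c j))"
  have M: "M \<ge> 0" unfolding M_def by (rule sum_nonneg) auto
  \<comment> \<open>The terms proportional to \<delta> below are \<delta> for the durations,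
    \<delta> for the gap and \<open>10 * \<eta> * M\<close> with
    \<open>\<eta> = 2 * \<delta> / T\<close> for the reparametrized step function.\<close>
  define K where "K = 2 + 20 * M / T"
  have K: "K \<ge> 2" using M T by (simp add: K_def)
  define \<delta> where "\<delta> = \<epsilon> / (2 * K)"
  have \<delta>: "\<delta> > 0" "\<delta> * K = \<epsilon> / 2" using e K by (auto simp: \<delta>_def)
  have "vdist x y < \<epsilon>" if y: "y \<in> C1_paths" and close: "path_dist x y < \<delta>" for y
  proof -
    define S where "S = fst y"
    define g where "g = velocity y"
    have S: "0 < S" using C1_pos[OF y] by (simp add: S_def)
    have ng: "nice lborel g" and g0: "\<And>t. t \<notin> {0..1} \<Longrightarrow> g t = 0" using velocity[OF y] by (auto simp: g_def)
    \<comment> \<open>The order is exchanged so that the time change acts on the fixed path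
      \<open>x\<close>, for which a step approximation is at hand.\<close>
    have "path_dist y x < \<delta>" using close path_dist_commute[OF x y] by simp
    then obtain \<tau> where \<tau>: "\<tau> \<in> increasing_bijections S T" and tv: "tvb 0 S (\<lambda>t. gpath y t - gpath x (\<tau> t)) \<delta>"
      using path_dist_less_obtain[OF y x] by (metis S_def T_def)
    note \<tau>f = incr_bij_facts[OF \<tau> less_imp_le[OF S] less_imp_le[OF T]]
    define \<beta> where "\<beta> s = \<tau> (S * s) / T" for s
    have Ss: "S * s \<in> {0..S}" if "s \<in> {0..1}" for s using S that by (auto simp: mult_left_le)
    have \<tau>s: "\<tau> (S * s) \<in> {0..T}" if "s \<in> {0..1}" for s using Ss[OF that] \<tau>f(2) by blast
    have \<beta>m: "mono_on {0..1} \<beta>"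
    proof (rule mono_onI)
      fix r s :: real assume rs: "r \<in> {0..1}" "s \<in> {0..1}" "r \<le> s"
      have "\<tau> (S * r) \<le> \<tau> (S * s)" using rs S Ss by (intro mono_onD[OF \<tau>f(1)]) auto
      then show "\<beta> r \<le> \<beta> s" using T by (simp add: \<beta>_def divide_right_mono)
    qed
    have \<beta>r: "\<beta> s \<in> {0..1}" if "s \<in> {0..1}" for s using \<tau>s[OF that] T by (auto simp: \<beta>_def)
    have \<beta>im: "\<beta> ` {0..1} \<subseteq> {0..1}" using \<beta>r by blast
    have \<beta>01: "\<beta> 0 = 0" "\<beta> 1 = 1" using \<tau>f T by (auto simp: \<beta>_def)
    have gap: "gpath y (S * s) - gpath x (\<tau> (S * s)) = (prim g s - prim f (\<beta> s), S * s - T * \<beta> s)"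
      if s: "s \<in> {0..1}" for s
      using gpath_eq_prim(2)[OF y, folded S_def, OF Ss[OF s]] gpath_eq_prim(2)[OF x, folded T_def, OF \<tau>s[OF s]] S T
      by (simp add: \<beta>_def f_def g_def)
    have "tvb 0 1 (\<lambda>s. gpath y (S * s) - gpath x (\<tau> (S * s))) \<delta>"
      by (rule tvb_reparam[OF tv]) (use S Ss in \<open>auto simp: monotone_on_def simp del: atLeastAtMost_iff\<close>)
    then have tv2: "tvb 0 1 (\<lambda>s. (prim g s - prim f (\<beta> s), S * s - T * \<beta> s)) \<delta>"
      by (rule tvb_cong) (rule gap)
    have tvF: "tvb 0 1 (\<lambda>s. prim g s - prim f (\<beta> s)) (1 * \<delta>)"
      by (rule tvb_image[OF tv2]) (auto simp: norm_Pair real_le_rsqrt)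
    have tvT: "tvb 0 1 (\<lambda>s. S * s - T * \<beta> s) (1 * \<delta>)"
      by (rule tvb_image[OF tv2]) (auto simp: norm_Pair real_le_rsqrt)
    have ST: "\<bar>S - T\<bar> \<le> \<delta>" using tvb_increment[OF tvT, of 0 1] \<beta>01 by simp
    \<comment> \<open>The variations of \<open>S * s - T * \<beta> s\<close> and of
      \<open>(S - T) * s\<close> are at most \<delta> each; their difference is \<open>T\<close>
      times \<open>s - \<beta> s\<close>.\<close>
    define \<eta> where "\<eta> = 2 * \<delta> / T"
    have "tvb 0 1 (\<lambda>s. (S - T) * s) (\<bar>S - T\<bar> * 1)"
    proof (rule tvb_image)
      show "tvb 0 1 (\<lambda>s::real. s) 1" by (rule tvb_real_mono[where l = 0]) auto
    qed (auto simp: right_diff_distrib[symmetric] abs_mult)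
    then have "tvb 0 1 (\<lambda>s. (S - T) * s) \<delta>" by (rule tvb_mono) (use ST in simp)
    from tvb_diff[OF tvT this] have "tvb 0 1 (\<lambda>s. S * s - T * \<beta> s - (S - T) * s) (2 * \<delta>)" by simp
    then have "tvb 0 1 (\<lambda>s. \<beta> s - s) ((1 / T) * (2 * \<delta>))"
    proof (rule tvb_image)
      fix s t
      have "\<beta> t - t - (\<beta> s - s) = - (1 / T) * (S * t - T * \<beta> t - (S - T) * t - (S * s - T * \<beta> s - (S - T) * s))"
        using T by (simp add: field_simps)
      then have "\<bar>\<beta> t - t - (\<beta> s - s)\<bar> = \<bar>- (1 / T)\<bar> * \<bar>S * t - T * \<beta> t - (S - T) * t - (S * s - T * \<beta> s - (S - T) * s)\<bar>"
        by (simp only: abs_mult)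
      then show "norm (\<beta> t - t - (\<beta> s - s)) \<le> 1 / T * norm (S * t - T * \<beta> t - (S - T) * t - (S * s - T * \<beta> s - (S - T) * s))"
        using T by simp
    qed (use T in simp)
    then have tv\<beta>: "tvb 0 1 (\<lambda>s. \<beta> s - s) \<eta>" by (simp add: \<eta>_def)
    have cl: "\<bar>\<beta> s - s\<bar> \<le> \<eta>" if "s \<in> {0..1}" for s
      using tvb_increment[OF tv\<beta>, of 0 s] that \<beta>01 by simp
    have tvG: "tvb 0 1 (\<lambda>s. prim (step n c) (\<beta> s) - prim (step n c) s) (10 * \<eta> * M)"
      unfolding M_def by (rule tvb_prim_step_reparam[OF \<beta>m \<beta>im tv\<beta> cl])
    have tvR: "tvb 0 1 (prim (\<lambda>t. f t - step n c t)) (\<epsilon> / 8)"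
      by (rule tvb_mono[OF tvb_prim]) (use c in \<open>auto intro: nice_diff nf nice_step\<close>)
    have tvR\<beta>: "tvb 0 1 (\<lambda>s. prim (\<lambda>t. f t - step n c t) (\<beta> s)) (\<epsilon> / 8)"
      by (rule tvb_reparam[OF tvR \<beta>m \<beta>im])
    \<comment> \<open>The primitive of \<open>g - f\<close> is split into the gap along \<beta>, the
      effect of \<beta> on the small remainder of \<open>f\<close>, which costs its variation twice,
      and the effect of \<beta> on the step function.\<close>
    have "tvb 0 1 (\<lambda>s. (prim g s - prim f (\<beta> s)) + ((prim (\<lambda>t. f t - step n c t) (\<beta> s) - prim (\<lambda>t. f t - step n c t) s)
        + (prim (step n c) (\<beta> s) - prim (step n c) s))) (1 * \<delta> + ((\<epsilon> / 8 + \<epsilon> / 8) + 10 * \<eta> * M))"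
      by (intro tvb_add tvb_diff tvF tvR tvR\<beta> tvG)
    moreover have "(\<lambda>s. (prim g s - prim f (\<beta> s)) + ((prim (\<lambda>t. f t - step n c t) (\<beta> s) - prim (\<lambda>t. f t - step n c t) s)
        + (prim (step n c) (\<beta> s) - prim (step n c) s))) = prim (\<lambda>t. g t - f t)"
      by (rule ext) (simp add: prim_diff nf ng nice_step)
    ultimately have "L1n (\<lambda>t. g t - f t) \<le> \<delta> + (\<epsilon> / 4 + 10 * \<eta> * M)"
      using f0 g0 by (intro L1n_le_tvb nice_diff ng nf) auto
    then have "vdist x y \<le> \<delta> + (\<delta> + (\<epsilon> / 4 + 10 * \<eta> * M))"
      using ST L1n_minus_commute[of f g] by (simp add: vdist_def f_def g_def S_def T_def abs_minus_commute)
    also have "\<dots> = \<delta> * K + \<epsilon> / 4" by (simp add: K_def \<eta>_def field_simps)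
    also have "\<dots> < \<epsilon>" using \<delta> e by simp
    finally show ?thesis .
  qed
  then show ?thesis using that \<delta>(1) by blast
qed

text \<open>Openness and continuity can from here on be checked with the linear time change
  alone.\<close>

lemma open_path_iff:
  "openin (Metric_space.mtopology C1_paths path_dist) U \<longleftrightarrow>
    U \<subseteq> C1_paths \<and> (\<forall>x\<in>U. \<exists>\<epsilon>>0. \<forall>y\<in>C1_paths. vdist x y < \<epsilon> \<longrightarrow> y \<in> U)"
proof -
  interpret Metric_space C1_paths path_dist by (rule path_metric_space)
  show ?thesis
  proof
    assume "openin mtopology U"
    then have U: "U \<subseteq> C1_paths" and o: "\<And>x. x \<in> U \<Longrightarrow> \<exists>r>0. mball x r \<subseteq> U" by (auto simp: openin_mtopology)
    show "U \<subseteq> C1_paths \<and> (\<forall>x\<in>U. \<exists>\<epsilon>>0. \<forall>y\<in>C1_paths. vdist x y < \<epsilon> \<longrightarrow> y \<in> U)"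
    proof (intro conjI U ballI)
      fix x assume xU: "x \<in> U"
      then obtain r where "r > 0" "mball x r \<subseteq> U" using o by blast
      then show "\<exists>\<epsilon>>0. \<forall>y\<in>C1_paths. vdist x y < \<epsilon> \<longrightarrow> y \<in> U"
      proof (intro exI[of _ r] conjI ballI impI)
        fix y :: "'a path" assume y: "y \<in> C1_paths" "vdist x y < r"
        have x: "x \<in> C1_paths" using xU U by blast
        have "path_dist x y < r" using path_dist_le_vdist[OF x y(1)] y(2) by linarith
        then show "y \<in> U" using \<open>mball x r \<subseteq> U\<close> x y(1) by auto
      qed
    qed
  next
    assume *: "U \<subseteq> C1_paths \<and> (\<forall>x\<in>U. \<exists>\<epsilon>>0. \<forall>y\<in>C1_paths. vdist x y < \<epsilon> \<longrightarrow> y \<in> U)"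
    have "\<exists>r>0. mball x r \<subseteq> U" if xU: "x \<in> U" for x
    proof -
      obtain \<epsilon> where e: "\<epsilon> > 0" "\<And>y. y \<in> C1_paths \<Longrightarrow> vdist x y < \<epsilon> \<Longrightarrow> y \<in> U" using * xU by blast
      have x: "x \<in> C1_paths" using * xU by blast
      obtain \<delta> where "\<delta> > 0" "\<And>y. y \<in> C1_paths \<Longrightarrow> path_dist x y < \<delta> \<Longrightarrow> vdist x y < \<epsilon>"
        using vdist_small[OF x e(1)] by blast
      then show ?thesis using e(2) by (intro exI[of _ \<delta>]) (auto simp: mball_def)
    qed
    then show "openin mtopology U" using * by (auto simp: openin_mtopology)
  qed
qed

lemma sets_path_borel: "sets path_borel = sigma_sets C1_paths {U. openin (Metric_space.mtopology C1_paths path_dist) U}"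
  unfolding path_borel_def by (rule sets_measure_of) (auto simp: open_path_iff)

lemma space_path_borel: "space path_borel = C1_paths"
  unfolding path_borel_def by (rule space_measure_of) (auto simp: open_path_iff)

lemma path_borel_measurableI:
  fixes h :: "'v::banach path \<Rightarrow> real"
  assumes "\<And>x \<epsilon>. x \<in> C1_paths \<Longrightarrow> \<epsilon> > 0 \<Longrightarrow> \<exists>\<delta>>0. \<forall>y\<in>C1_paths. vdist x y < \<delta> \<longrightarrow> \<bar>h y - h x\<bar> < \<epsilon>"
  shows "h \<in> borel_measurable path_borel"
proof (rule borel_measurableI)
  fix S :: "real set" assume S: "open S"
  have "openin (Metric_space.mtopology C1_paths path_dist) (h -` S \<inter> C1_paths)"
    unfolding open_path_iff
  proof (intro conjI ballI)
    fix x assume x: "x \<in> h -` S \<inter> C1_paths"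
    then obtain \<epsilon> where e: "\<epsilon> > 0" "\<And>r. dist r (h x) < \<epsilon> \<Longrightarrow> r \<in> S" using S unfolding open_dist by blast
    obtain \<delta> where "\<delta> > 0" "\<And>y. y \<in> C1_paths \<Longrightarrow> vdist x y < \<delta> \<Longrightarrow> \<bar>h y - h x\<bar> < \<epsilon>" using assms[of x \<epsilon>] x e(1) by blast
    then show "\<exists>\<epsilon>>0. \<forall>y\<in>C1_paths. vdist x y < \<epsilon> \<longrightarrow> y \<in> h -` S \<inter> C1_paths"
      using e(2) by (intro exI[of _ \<delta>]) (auto simp: dist_real_def)
  qed auto
  then show "h -` S \<inter> space path_borel \<in> sets path_borel"
    unfolding sets_path_borel space_path_borel by auto
qed

section \<open>Tensor normalization\<close>

lemma seq_norm_component: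
  assumes "summable (\<lambda>m. (norm (u m))\<^sup>2)" shows "norm (u m) \<le> seq_norm u"
proof -
  have "(norm (u m))\<^sup>2 = (\<Sum>i\<in>{m}. (norm (u i))\<^sup>2)" by simp
  also have "\<dots> \<le> (\<Sum>i. (norm (u i))\<^sup>2)" by (rule sum_le_suminf[OF assms]) auto
  finally have "(norm (u m))\<^sup>2 \<le> (\<Sum>i. (norm (u i))\<^sup>2)" .
  then show ?thesis unfolding seq_norm_def by (rule real_le_rsqrt)
qed

lemma summable_norm_diff_sq:
  assumes u: "summable (\<lambda>m. (norm (u m))\<^sup>2)" and v: "summable (\<lambda>m. (norm (v m))\<^sup>2)"
  shows "summable (\<lambda>m. (norm (u m - v m))\<^sup>2)"
proof (rule summable_comparison_test')
  show "summable (\<lambda>m. 2 * (norm (u m))\<^sup>2 + 2 * (norm (v m))\<^sup>2)" by (intro summable_add summable_mult u v)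
  fix m
  have "(norm (u m - v m))\<^sup>2 \<le> (norm (u m) + norm (v m))\<^sup>2" by (intro power_mono norm_triangle_ineq4) auto
  also have "\<dots> \<le> 2 * (norm (u m))\<^sup>2 + 2 * (norm (v m))\<^sup>2"
    using zero_le_power2[of "norm (u m) - norm (v m)"] by (simp add: power2_eq_square algebra_simps)
  finally show "norm ((norm (u m - v m))\<^sup>2) \<le> 2 * (norm (u m))\<^sup>2 + 2 * (norm (v m))\<^sup>2" by simp
qed

lemma seqs1_summable: "t \<in> tensor_seqs1 tens \<Longrightarrow> summable (\<lambda>m. (norm (t m))\<^sup>2)"
  by (simp add: tensor_seqs1_def tensor_seqs_def)

lemma seqs1_diff_component:
  "s \<in> tensor_seqs1 tens \<Longrightarrow> t \<in> tensor_seqs1 tens \<Longrightarrow> norm (s m - t m) \<le> seq_norm (\<lambda>m. s m - t m)"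
  using seq_norm_component[of "\<lambda>m. s m - t m"] summable_norm_diff_sq[OF seqs1_summable seqs1_summable] by blast

lemma augment_scale: "augment (c * T) (\<lambda>t. c *\<^sub>R f t) = (\<lambda>t. c *\<^sub>R augment T f t)"
  by (auto simp: augment_def)

lemma L1n_augment_diff:
  assumes f: "nice lborel f" and g: "nice lborel g"
  shows "L1n (\<lambda>t. augment T f t - augment S g t) \<le> \<bar>T - S\<bar> + L1n (\<lambda>t. f t - g t)"
proof -
  have "L1n (\<lambda>t. augment T f t - augment S g t) \<le> (\<integral>t. norm (f t - g t) + indicator {0..1} t * \<bar>T - S\<bar> \<partial>lborel)"
    unfolding L1n_def
  proof (intro integral_mono nice_norm_integrable nice_diff nice_augment f g Bochner_Integration.integrable_add)
    show "integrable lborel (\<lambda>t. indicator {0..1::real} t * \<bar>T - S\<bar>)" by simp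
    fix t
    have "norm (augment T f t - augment S g t) \<le> norm (f t - g t) + norm (indicator {0..1} t * T - indicator {0..1} t * S)"
      unfolding augment_def using norm_Pair_le[of "f t - g t" "indicator {0..1} t * T - indicator {0..1} t * S"] by simp
    also have "norm (indicator {0..1} t * T - indicator {0..1} t * S) = indicator {0..1} t * \<bar>T - S\<bar>"
      by (auto simp: indicator_def)
    finally show "norm (augment T f t - augment S g t) \<le> norm (f t - g t) + indicator {0..1} t * \<bar>T - S\<bar>" .
  qed
  also have "\<dots> = L1n (\<lambda>t. f t - g t) + \<bar>T - S\<bar>"
    unfolding L1n_def using nice_norm_integrable[OF nice_diff[OF f g]] by simp
  finally show ?thesis by simp
qed

locale tensor_normalized = admissible_tensor_powers tens
  for tens :: "('v::banach \<times> real) list \<Rightarrow> 'e::banach" +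
  fixes \<Lambda> :: "(nat \<Rightarrow> 'e) \<Rightarrow> nat \<Rightarrow> 'e"
  assumes normalization: "tensor_normalization tens \<Lambda>"
begin

abbreviation "seqs1 \<equiv> tensor_seqs1 tens"

lemma Lambda_seqs1: "t \<in> seqs1 \<Longrightarrow> \<Lambda> t \<in> seqs1"
  using normalization unfolding tensor_normalization_def by blast

lemma Lambda_bounded: obtains R where "\<And>t. t \<in> seqs1 \<Longrightarrow> seq_norm (\<Lambda> t) \<le> R"
  using normalization unfolding tensor_normalization_def by blast

lemma Lambda_inj: "s \<in> seqs1 \<Longrightarrow> t \<in> seqs1 \<Longrightarrow> \<Lambda> s = \<Lambda> t \<Longrightarrow> s = t"
  using normalization unfolding tensor_normalization_def inj_on_def by blast

lemma Lambda_continuous: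
  assumes "t \<in> seqs1" "\<epsilon> > 0"
  obtains \<delta> where "\<delta> > 0" "\<And>s. s \<in> seqs1 \<Longrightarrow> seq_norm (\<lambda>m. s m - t m) < \<delta> \<Longrightarrow> seq_norm (\<lambda>m. \<Lambda> s m - \<Lambda> t m) < \<epsilon>"
proof -
  have "\<forall>t\<in>seqs1. \<forall>\<epsilon>>0. \<exists>\<delta>>0. \<forall>s\<in>seqs1.
        seq_norm (\<lambda>m. s m - t m) < \<delta> \<longrightarrow> seq_norm (\<lambda>m. \<Lambda> s m - \<Lambda> t m) < \<epsilon>"
    using normalization unfolding tensor_normalization_def by (elim conjE)
  then show ?thesis using assms that by blast
qed

text \<open>A choice is made because \<Lambda> does not determine the factor where all components of
  positive degree vanish.\<close>

definition lam :: "(nat \<Rightarrow> 'e) \<Rightarrow> real" where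
  "lam = (SOME lam. \<forall>t\<in>seqs1. lam t > 0 \<and> \<Lambda> t = dilate (lam t) t)"

lemma lam: "t \<in> seqs1 \<Longrightarrow> lam t > 0" "t \<in> seqs1 \<Longrightarrow> \<Lambda> t = dilate (lam t) t"
proof -
  have "\<exists>lam. \<forall>t\<in>seqs1. lam t > (0::real) \<and> \<Lambda> t = dilate (lam t) t"
    using normalization unfolding tensor_normalization_def by blast
  from someI_ex[OF this] show "t \<in> seqs1 \<Longrightarrow> lam t > 0" "t \<in> seqs1 \<Longrightarrow> \<Lambda> t = dilate (lam t) t"
    unfolding lam_def[symmetric] by auto
qed

definition sg :: "real \<Rightarrow> (real \<Rightarrow> 'v) \<Rightarrow> nat \<Rightarrow> 'e" where
  "sg T f = usig (augment T f)"

lemma sg_seqs1: "nice lborel f \<Longrightarrow> sg T f \<in> seqs1"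
  unfolding sg_def by (intro usig_in_seqs1 nice_augment)

lemma sg_scale: "nice lborel f \<Longrightarrow> sg (c * T) (\<lambda>t. c *\<^sub>R f t) = dilate c (sg T f)"
  unfolding sg_def augment_scale by (intro usig_scale nice_augment)

text \<open>On signatures this is the total time, and it is homogeneous under \<open>dilate\<close>;
  on the normalized signature it therefore reads off the scale times the total time.\<close>

definition time_part :: "(nat \<Rightarrow> 'e) \<Rightarrow> real" where
  "time_part t = word_functional [snd] (t 1)"

lemma bl_snd: "\<forall>l\<in>set [snd :: 'v \<times> real \<Rightarrow> real]. bounded_linear l"
  by (simp add: bounded_linear_snd)

lemma time_part_dilate: "time_part (dilate c t) = c * time_part t"
  using word_functional(1)[OF bl_snd]
  by (simp add: time_part_def dilate_def bounded_linear.linear linear_scale)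

lemma time_part_sg: "nice lborel f \<Longrightarrow> time_part (sg T f) = T"
  using word_functional_usig[OF bl_snd nice_augment, of f T]
  by (simp add: time_part_def sg_def augment_def mult.assoc[symmetric] indicator_times[symmetric] indicator_inter_arith[symmetric])

lemma sg_continuous:
  assumes f: "nice lborel f" and e: "\<epsilon> > 0"
  obtains \<delta> where "\<delta> > 0"
    "\<And>S g. nice lborel g \<Longrightarrow> \<bar>T - S\<bar> + L1n (\<lambda>t. f t - g t) < \<delta> \<Longrightarrow> seq_norm (\<lambda>m. sg S g m - sg T f m) < \<epsilon>"
proof -
  define A where "A = L1n (augment T f)"
  \<comment> \<open>Within L1 distance 1 the sum in \<open>usig_seq_norm_diff\<close> is at most
    \<open>(A + 1) + A + 1\<close>.\<close>
  define B where "B = sqrt (exp ((2 * A + 2)\<^sup>2))"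
  have A: "0 \<le> A" by (simp add: A_def L1n_nonneg)
  have B: "B > 0" by (simp add: B_def)
  define \<delta> where "\<delta> = min 1 (\<epsilon> / (2 * B))"
  have \<delta>: "\<delta> > 0" "\<delta> \<le> 1" "\<delta> * B < \<epsilon>"
  proof -
    show "\<delta> > 0" "\<delta> \<le> 1" using e B by (auto simp: \<delta>_def)
    have "\<delta> * B \<le> \<epsilon> / (2 * B) * B" using B by (intro mult_right_mono) (auto simp: \<delta>_def)
    also have "\<dots> < \<epsilon>" using B e by simp
    finally show "\<delta> * B < \<epsilon>" .
  qed
  have "seq_norm (\<lambda>m. sg S g m - sg T f m) < \<epsilon>" if g: "nice lborel g" and close: "\<bar>T - S\<bar> + L1n (\<lambda>t. f t - g t) < \<delta>" for S g
  proof -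
    have d: "L1n (\<lambda>t. augment S g t - augment T f t) \<le> \<delta>"
      using L1n_augment_diff[OF g f, of S T] close L1n_minus_commute[of f g] by (simp add: abs_minus_commute)
    have "L1n (augment S g) \<le> A + 1"
      using L1n_le[OF nice_augment[OF g, of S] nice_augment[OF f, of T]] d \<delta>(2) by (simp add: A_def)
    then have "(L1n (augment S g) + L1n (augment T f) + 1)\<^sup>2 \<le> (2 * A + 2)\<^sup>2"
      using L1n_nonneg[of "augment S g"] A by (intro power_mono) (auto simp: A_def)
    then have "\<delta> * sqrt (exp ((L1n (augment S g) + L1n (augment T f) + 1)\<^sup>2)) \<le> \<delta> * B"
      unfolding B_def using \<delta>(1) by (intro mult_left_mono real_sqrt_le_mono) auto
    then show ?thesis
      using usig_seq_norm_diff[OF nice_augment[OF g] nice_augment[OF f] d \<delta>(1)] \<delta>(3) by (simp add: sg_def)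
  qed
  then show ?thesis using that \<delta>(1) by blast
qed

lemma Lambda_sg_continuous:
  assumes f: "nice lborel f" and e: "\<epsilon> > 0"
  obtains \<delta> where "\<delta> > 0"
    "\<And>S g m. nice lborel g \<Longrightarrow> \<bar>T - S\<bar> + L1n (\<lambda>t. f t - g t) < \<delta> \<Longrightarrow> norm (\<Lambda> (sg S g) m - \<Lambda> (sg T f) m) < \<epsilon>"
proof -
  obtain \<delta>1 where \<delta>1: "\<delta>1 > 0" "\<And>s. s \<in> seqs1 \<Longrightarrow> seq_norm (\<lambda>m. s m - sg T f m) < \<delta>1 \<Longrightarrow> seq_norm (\<lambda>m. \<Lambda> s m - \<Lambda> (sg T f) m) < \<epsilon>"
    using Lambda_continuous[OF sg_seqs1[OF f] e] by blast
  obtain \<delta> where \<delta>: "\<delta> > 0" "\<And>S g. nice lborel g \<Longrightarrow> \<bar>T - S\<bar> + L1n (\<lambda>t. f t - g t) < \<delta> \<Longrightarrow> seq_norm (\<lambda>m. sg S g m - sg T f m) < \<delta>1"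
    using sg_continuous[OF f \<delta>1(1)] by blast
  have "norm (\<Lambda> (sg S g) m - \<Lambda> (sg T f) m) < \<epsilon>" if g: "nice lborel g" and "\<bar>T - S\<bar> + L1n (\<lambda>t. f t - g t) < \<delta>" for S g m
    using seqs1_diff_component[OF Lambda_seqs1[OF sg_seqs1[OF g, of S]] Lambda_seqs1[OF sg_seqs1[OF f, of T]], of m]
      \<delta>1(2)[OF sg_seqs1[OF g] \<delta>(2)[OF that]] by linarith
  then show ?thesis using that \<delta>(1) by blast
qed

definition lam_of :: "real \<Rightarrow> (real \<Rightarrow> 'v) \<Rightarrow> real" where
  "lam_of T f = lam (sg T f)"

lemma lam_of_pos: "nice lborel f \<Longrightarrow> 0 < lam_of T f"
  unfolding lam_of_def by (intro lam sg_seqs1)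

lemma Lambda_sg: "nice lborel f \<Longrightarrow> \<Lambda> (sg T f) = dilate (lam_of T f) (sg T f)"
  unfolding lam_of_def by (intro lam sg_seqs1)

lemma time_part_Lambda_sg: "nice lborel f \<Longrightarrow> time_part (\<Lambda> (sg T f)) = lam_of T f * T"
  by (simp add: Lambda_sg time_part_dilate time_part_sg)

text \<open>Continuity is assumed of \<Lambda> and not of the scale, so first the product of scale
  and total time, a coordinate of \<Lambda>, is shown to be continuous. This includes total time
  0.\<close>

lemma time_part_Lambda_continuous:
  assumes f: "nice lborel f" and e: "\<epsilon> > 0"
  obtains \<delta> where "\<delta> > 0"
    "\<And>S g. nice lborel g \<Longrightarrow> \<bar>T - S\<bar> + L1n (\<lambda>t. f t - g t) < \<delta> \<Longrightarrow> \<bar>lam_of S g * S - lam_of T f * T\<bar> < \<epsilon>"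
proof -
  interpret bounded_linear "word_functional [snd]" by (rule word_functional(1)[OF bl_snd])
  obtain K where K: "K > 0" "\<And>v. norm (word_functional [snd] v) \<le> norm v * K" using pos_bounded by blast
  obtain \<delta> where \<delta>: "\<delta> > 0"
    "\<And>S g m. nice lborel g \<Longrightarrow> \<bar>T - S\<bar> + L1n (\<lambda>t. f t - g t) < \<delta> \<Longrightarrow> norm (\<Lambda> (sg S g) m - \<Lambda> (sg T f) m) < \<epsilon> / K"
    using Lambda_sg_continuous[OF f divide_pos_pos[OF e K(1)]] by blast
  have "\<bar>lam_of S g * S - lam_of T f * T\<bar> < \<epsilon>" if g: "nice lborel g" and "\<bar>T - S\<bar> + L1n (\<lambda>t. f t - g t) < \<delta>" for S g
  proof -
    have "\<bar>lam_of S g * S - lam_of T f * T\<bar> = norm (word_functional [snd] (\<Lambda> (sg S g) 1 - \<Lambda> (sg T f) 1))"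
      using time_part_Lambda_sg[OF g, of S] time_part_Lambda_sg[OF f, of T] by (simp add: time_part_def diff)
    also have "\<dots> \<le> norm (\<Lambda> (sg S g) 1 - \<Lambda> (sg T f) 1) * K" by (rule K)
    also have "\<dots> < \<epsilon>" using \<delta>(2)[OF that, of 1] K(1) by (simp add: field_simps)
    finally show ?thesis .
  qed
  then show ?thesis using that \<delta>(1) by blast
qed

lemma lam_of_continuous:
  assumes f: "nice lborel f" and T: "T > 0" and e: "\<epsilon> > 0"
  obtains \<delta> where "\<delta> > 0"
    "\<And>S g. nice lborel g \<Longrightarrow> \<bar>T - S\<bar> + L1n (\<lambda>t. f t - g t) < \<delta> \<Longrightarrow> \<bar>lam_of S g - lam_of T f\<bar> < \<epsilon>"
proof -
  define l where "l = lam_of T f"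
  have l: "l > 0" unfolding l_def by (rule lam_of_pos[OF f])
  define P where "P = 1 + l"
  have P: "P > 0" using l by (simp add: P_def)
  \<comment> \<open>The factor \<open>P\<close> collects the errors \<eta> and
    \<open>l * \<eta>\<close>; the 4 leaves room for \<open>S > T / 2\<close> and for a strict
    inequality.\<close>
  define \<eta> where "\<eta> = \<epsilon> * T / (4 * P)"
  have "\<eta> > 0" "\<eta> * P = \<epsilon> * T / 4" using e T P by (auto simp: \<eta>_def)
  then have \<eta>: "\<eta> > 0" "\<eta> * (1 + l) = \<epsilon> * T / 4" by (simp_all add: P_def)
  obtain \<delta>1 where \<delta>1: "\<delta>1 > 0"
    "\<And>S g. nice lborel g \<Longrightarrow> \<bar>T - S\<bar> + L1n (\<lambda>t. f t - g t) < \<delta>1 \<Longrightarrow> \<bar>lam_of S g * S - lam_of T f * T\<bar> < \<eta>"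
    using time_part_Lambda_continuous[OF f \<eta>(1)] by blast
  define \<delta> where "\<delta> = min \<delta>1 (min \<eta> (T / 2))"
  have "\<bar>lam_of S g - lam_of T f\<bar> < \<epsilon>" if g: "nice lborel g" and close: "\<bar>T - S\<bar> + L1n (\<lambda>t. f t - g t) < \<delta>" for S g
  proof -
    have TS: "\<bar>T - S\<bar> < \<eta>" "\<bar>T - S\<bar> < T / 2" and c1: "\<bar>T - S\<bar> + L1n (\<lambda>t. f t - g t) < \<delta>1"
      using close L1n_nonneg[of "\<lambda>t. f t - g t"] by (auto simp: \<delta>_def)
    have S: "S > T / 2" using TS(2) by linarith
    have "\<bar>lam_of S g - l\<bar> * S = \<bar>(lam_of S g - l) * S\<bar>" using S T by (simp add: abs_mult)
    also have "(lam_of S g - l) * S = (lam_of S g * S - l * T) + l * (T - S)" by (simp add: algebra_simps)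
    also have "\<bar>\<dots>\<bar> \<le> \<bar>lam_of S g * S - l * T\<bar> + \<bar>l * (T - S)\<bar>" by (rule abs_triangle_ineq)
    also have "\<bar>l * (T - S)\<bar> = l * \<bar>T - S\<bar>" using l by (simp add: abs_mult)
    also have "\<bar>lam_of S g * S - l * T\<bar> + l * \<bar>T - S\<bar> \<le> \<eta> + l * \<eta>"
      using \<delta>1(2)[OF g c1] TS(1) l by (intro add_mono mult_left_mono) (auto simp: l_def)
    also have "\<dots> = \<epsilon> * T / 4" using \<eta>(2) by (simp add: algebra_simps)
    finally have "\<bar>lam_of S g - l\<bar> * S \<le> \<epsilon> * T / 4" .
    moreover have "\<bar>lam_of S g - l\<bar> * (T / 2) \<le> \<bar>lam_of S g - l\<bar> * S" using S by (intro mult_left_mono) auto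
    ultimately have "\<bar>lam_of S g - l\<bar> * T \<le> (\<epsilon> / 2) * T" by (simp add: field_simps)
    then have "\<bar>lam_of S g - l\<bar> \<le> \<epsilon> / 2" using T by simp
    then show ?thesis using e by (simp add: l_def)
  qed
  moreover have "\<delta> > 0" using \<delta>1(1) \<eta>(1) T by (simp add: \<delta>_def)
  ultimately show ?thesis using that by blast
qed

section \<open>Dilations along a ray\<close>

context
  fixes T :: real and f :: "real \<Rightarrow> 'v"
  assumes T: "T > 0" and f: "nice lborel f"
begin

text \<open>The total dilation: \<Lambda> maps the \<open>c\<close>-dilate of \<open>sg T f\<close>
  to its \<open>kappa c\<close>-dilate.\<close>

definition kappa :: "real \<Rightarrow> real" where
  "kappa c = c * lam_of (c * T) (\<lambda>t. c *\<^sub>R f t)"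

lemma scaled_distance: "\<bar>c * T - d * T\<bar> + L1n (\<lambda>t. c *\<^sub>R f t - d *\<^sub>R f t) = \<bar>c - d\<bar> * (T + L1n f)"
proof -
  have "L1n (\<lambda>t. c *\<^sub>R f t - d *\<^sub>R f t) = \<bar>c - d\<bar> * L1n f"
    by (simp add: scaleR_diff_left[symmetric] L1n_scaleR)
  moreover have "\<bar>c * T - d * T\<bar> = \<bar>c - d\<bar> * T" using T by (simp add: left_diff_distrib[symmetric] abs_mult)
  ultimately show ?thesis by (simp add: algebra_simps)
qed

lemma kappa_Lambda: "\<Lambda> (sg (c * T) (\<lambda>t. c *\<^sub>R f t)) = dilate (kappa c) (sg T f)"
  using Lambda_sg[OF nice_scaleR[OF f], of "c * T" c] sg_scale[OF f, of c T]
  by (auto simp: dilate_def kappa_def power_mult_distrib mult.commute)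

text \<open>Equal values give equal normalized signatures, \<Lambda> is injective, and total times
  \<open>c * T\<close> differ for different \<open>c\<close> because \<open>T > 0\<close>.\<close>

lemma kappa_inj: "kappa c = kappa d \<Longrightarrow> c = d"
proof -
  assume "kappa c = kappa d"
  then have "\<Lambda> (sg (c * T) (\<lambda>t. c *\<^sub>R f t)) = \<Lambda> (sg (d * T) (\<lambda>t. d *\<^sub>R f t))" by (simp add: kappa_Lambda)
  then have "sg (c * T) (\<lambda>t. c *\<^sub>R f t) = sg (d * T) (\<lambda>t. d *\<^sub>R f t)"
    by (rule Lambda_inj[OF sg_seqs1[OF nice_scaleR[OF f]] sg_seqs1[OF nice_scaleR[OF f]]])
  then have "c * T = d * T" by (metis time_part_sg nice_scaleR[OF f])
  then show "c = d" using T by simp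
qed

lemma kappa_pos: "c > 0 \<Longrightarrow> kappa c > 0"
  unfolding kappa_def by (intro mult_pos_pos lam_of_pos nice_scaleR f)

lemma kappa_continuous: "continuous_on {0<..} kappa"
proof -
  have "continuous_on {0<..} (\<lambda>c. lam_of (c * T) (\<lambda>t. c *\<^sub>R f t))"
    unfolding continuous_on_iff
  proof (intro ballI allI impI)
    fix c e :: real assume c: "c \<in> {0<..}" and e: "e > 0"
    then have cT: "c * T > 0" using T by simp
    obtain \<delta> where \<delta>: "\<delta> > 0" "\<And>S g. nice lborel g \<Longrightarrow> \<bar>c * T - S\<bar> + L1n (\<lambda>t. c *\<^sub>R f t - g t) < \<delta> \<Longrightarrow>
        \<bar>lam_of S g - lam_of (c * T) (\<lambda>t. c *\<^sub>R f t)\<bar> < e"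
      using lam_of_continuous[OF nice_scaleR[OF f, of c] cT e] by blast
    have K: "T + L1n f > 0" using T L1n_nonneg[of f] by linarith
    show "\<exists>d>0. \<forall>x'\<in>{0<..}. dist x' c < d \<longrightarrow> dist (lam_of (x' * T) (\<lambda>t. x' *\<^sub>R f t)) (lam_of (c * T) (\<lambda>t. c *\<^sub>R f t)) < e"
    proof (intro exI conjI ballI impI)
      show "\<delta> / (T + L1n f) > 0" using \<delta>(1) K by simp
      fix d assume "d \<in> {0<..}" "dist d c < \<delta> / (T + L1n f)"
      then have "\<bar>c - d\<bar> * (T + L1n f) < \<delta>" using K by (simp add: dist_real_def field_simps abs_minus_commute)
      then show "dist (lam_of (d * T) (\<lambda>t. d *\<^sub>R f t)) (lam_of (c * T) (\<lambda>t. c *\<^sub>R f t)) < e"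
        using \<delta>(2)[OF nice_scaleR[OF f, of d], of "d * T"] by (simp add: scaled_distance dist_real_def)
    qed
  qed
  then show ?thesis unfolding kappa_def by (intro continuous_intros)
qed

text \<open>As \<open>c\<close> tends to 0 the state tends to the zero state, where scale times
  total time is 0. Continuity of that product holds there too, although continuity of the scale is
  only known for positive total time.\<close>

lemma kappa_small:
  assumes e: "\<epsilon> > 0" and b: "b > 0"
  obtains c where "0 < c" "c < b" "kappa c < \<epsilon>"
proof -
  obtain \<delta> where \<delta>: "\<delta> > 0" "\<And>S g. nice lborel g \<Longrightarrow> \<bar>0 * T - S\<bar> + L1n (\<lambda>t. 0 *\<^sub>R f t - g t) < \<delta> \<Longrightarrow>
      \<bar>lam_of S g * S - lam_of (0 * T) (\<lambda>t. 0 *\<^sub>R f t) * (0 * T)\<bar> < \<epsilon> * T"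
    using time_part_Lambda_continuous[OF nice_scaleR[OF f, of 0] mult_pos_pos[OF e T], of "0 * T"] by blast
  define K where "K = T + L1n f"
  have K: "K > 0" using T L1n_nonneg[of f] by (simp add: K_def)
  define c where "c = min (b / 2) (\<delta> / (2 * K))"
  have "\<delta> / (2 * K) > 0" using \<delta>(1) K by simp
  then have c: "c > 0" "c < b" using b by (auto simp: c_def)
  have "c * K \<le> \<delta> / (2 * K) * K"
    using K by (intro mult_right_mono) (auto simp: c_def)
  also have "\<dots> < \<delta>" using K \<delta>(1) by simp
  finally have "\<bar>0 - c\<bar> * (T + L1n f) < \<delta>" using c by (simp add: K_def)
  then have "\<bar>lam_of (c * T) (\<lambda>t. c *\<^sub>R f t) * (c * T)\<bar> < \<epsilon> * T"
    using \<delta>(2)[OF nice_scaleR[OF f, of c], of "c * T"] unfolding scaled_distance by simp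
  then have "kappa c * T < \<epsilon> * T" by (simp add: kappa_def mult_ac)
  then show ?thesis using that c T by simp
qed

text \<open>A continuous injective function on a half-line is monotone, and small values near 0
  decide the direction: otherwise the intermediate value theorem on [c,a] would attain
  \<open>kappa b\<close> a second time.\<close>

lemma kappa_strict_mono:
  assumes "0 < a" "a < b" shows "kappa a < kappa b"
proof (rule ccontr)
  assume "\<not> kappa a < kappa b"
  then have less: "kappa b < kappa a" using kappa_inj assms by (metis less_irrefl linorder_neqE_linordered_idom)
  obtain c where c: "0 < c" "c < a" "kappa c < kappa b"
    using kappa_small[of "kappa b" a] kappa_pos[of b] assms by (metis less_trans)
  have "\<exists>d\<ge>c. d \<le> a \<and> kappa d = kappa b"
    using c less by (intro IVT' continuous_on_subset[OF kappa_continuous]) auto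
  then show False using kappa_inj assms by force
qed

end

section \<open>Recovering a path from its scaled version\<close>

definition lamx :: "'v path \<Rightarrow> real" where
  "lamx x = lam_of (fst x) (velocity x)"

text \<open>The \<open>vdist\<close> formula for scaled paths. The normalized signature is the
  signature of the scaled path, so this is the distance that the coordinates can control.\<close>

definition edist :: "'v path \<Rightarrow> 'v path \<Rightarrow> real" where
  "edist x y = \<bar>lamx x * fst x - lamx y * fst y\<bar> + L1n (\<lambda>t. lamx x *\<^sub>R velocity x t - lamx y *\<^sub>R velocity y t)"

lemma lamx_pos: "x \<in> C1_paths \<Longrightarrow> 0 < lamx x"
  unfolding lamx_def by (intro lam_of_pos velocity)

lemma normalized_signature_eq:
  assumes x: "x \<in> C1_paths"
  shows "normalized_signature tens \<Lambda> x = \<Lambda> (sg (fst x) (velocity x))"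
    and "normalized_signature tens \<Lambda> x = sg (lamx x * fst x) (\<lambda>t. lamx x *\<^sub>R velocity x t)"
proof -
  show 1: "normalized_signature tens \<Lambda> x = \<Lambda> (sg (fst x) (velocity x))"
    unfolding normalized_signature_def sg_def
    using signature_time_augment[OF admissible_tensor_powers_axioms x] by simp
  show "normalized_signature tens \<Lambda> x = sg (lamx x * fst x) (\<lambda>t. lamx x *\<^sub>R velocity x t)"
    unfolding 1 Lambda_sg[OF velocity(1)[OF x]] sg_scale[OF velocity(1)[OF x]] lamx_def ..
qed

text \<open>Put \<open>l = lamx x\<close>. Then \<open>kappa 1 = l\<close>, and
  \<open>kappa (l / a)\<close> is \<open>l / a\<close> times the scale on the left. Monotonicity of
  \<open>kappa\<close> turns the comparison with \<open>a\<close> into the comparison of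
  \<open>l / a\<close> with 1. The left side depends on the scaled path alone.\<close>

lemma scaled_state_lam:
  assumes x: "x \<in> C1_paths" and a: "a > 0"
  shows "lam_of (lamx x / a * fst x) (\<lambda>t. (lamx x / a) *\<^sub>R velocity x t) > a \<longleftrightarrow> lamx x > a"
    and "lam_of (lamx x / a * fst x) (\<lambda>t. (lamx x / a) *\<^sub>R velocity x t) < a \<longleftrightarrow> lamx x < a"
proof -
  note T = C1_pos[OF x] and f = velocity(1)[OF x]
  define k where "k = kappa (fst x) (velocity x)"
  define l where "l = lamx x"
  define m where "m = lam_of (l / a * fst x) (\<lambda>t. (l / a) *\<^sub>R velocity x t)"
  have l: "l > 0" unfolding l_def by (rule lamx_pos[OF x])
  have k1: "k 1 = l" using kappa_def[OF T f, of 1] by (simp add: k_def l_def lamx_def)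
  have kla: "k (l / a) = l / a * m" unfolding k_def m_def by (rule kappa_def[OF T f])
  have mono: "k c < k d \<longleftrightarrow> c < d" if "0 < c" "0 < d" for c d
    using kappa_strict_mono[OF T f] that unfolding k_def by (metis less_asym linorder_neqE_linordered_idom)
  have "m > a \<longleftrightarrow> l / a * m > l" using l a by (simp add: field_simps)
  also have "\<dots> \<longleftrightarrow> k (l / a) > k 1" by (simp add: k1 kla)
  also have "\<dots> \<longleftrightarrow> l / a > 1" using mono[of 1 "l / a"] l a by simp
  also have "\<dots> \<longleftrightarrow> l > a" using a by (simp add: field_simps)
  finally show "lam_of (lamx x / a * fst x) (\<lambda>t. (lamx x / a) *\<^sub>R velocity x t) > a \<longleftrightarrow> lamx x > a"
    by (simp add: m_def l_def)
  have "m < a \<longleftrightarrow> l / a * m < l" using l a by (simp add: field_simps)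
  also have "\<dots> \<longleftrightarrow> k (l / a) < k 1" by (simp add: k1 kla)
  also have "\<dots> \<longleftrightarrow> l / a < 1" using mono[of "l / a" 1] l a by simp
  also have "\<dots> \<longleftrightarrow> l < a" using a by (simp add: field_simps)
  finally show "lam_of (lamx x / a * fst x) (\<lambda>t. (lamx x / a) *\<^sub>R velocity x t) < a \<longleftrightarrow> lamx x < a"
    by (simp add: m_def l_def)
qed

lemma scaled_edist:
  assumes a: "a > 0"
  shows "\<bar>lamx x / a * fst x - lamx y / a * fst y\<bar> + L1n (\<lambda>t. (lamx x / a) *\<^sub>R velocity x t - (lamx y / a) *\<^sub>R velocity y t)
    = edist x y / a"
proof -
  have "lamx x / a * fst x - lamx y / a * fst y = (1 / a) * (lamx x * fst x - lamx y * fst y)"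
    by (simp add: algebra_simps)
  then have 1: "\<bar>lamx x / a * fst x - lamx y / a * fst y\<bar> = \<bar>lamx x * fst x - lamx y * fst y\<bar> / a"
    using a by (simp add: abs_mult)
  have "(lamx x / a) *\<^sub>R velocity x t - (lamx y / a) *\<^sub>R velocity y t = (1 / a) *\<^sub>R (lamx x *\<^sub>R velocity x t - lamx y *\<^sub>R velocity y t)" for t
    by (simp add: algebra_simps)
  then have 2: "L1n (\<lambda>t. (lamx x / a) *\<^sub>R velocity x t - (lamx y / a) *\<^sub>R velocity y t)
      = L1n (\<lambda>t. lamx x *\<^sub>R velocity x t - lamx y *\<^sub>R velocity y t) / a"
    using a by (simp only: L1n_scaleR) simp
  show ?thesis unfolding edist_def 1 2 by (simp add: add_divide_distrib)
qed

text \<open>The scale \<open>\<lambda>\<close> of a path can be recovered continuously from its normalized signature,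
  because \<open>\<kappa>(c) = c \<lambda>(\<delta>\<^sub>c t)\<close> is strictly increasing along each ray \<open>\<delta>\<^sub>c t\<close>.\<close>

lemma lamx_locally_bounded:
  assumes x: "x \<in> C1_paths" and a: "a > 0"
  shows "lamx x > a \<Longrightarrow> \<exists>\<delta>>0. \<forall>y\<in>C1_paths. edist x y < \<delta> \<longrightarrow> lamx y > a"
    and "lamx x < a \<Longrightarrow> \<exists>\<delta>>0. \<forall>y\<in>C1_paths. edist x y < \<delta> \<longrightarrow> lamx y < a"
proof -
  \<comment> \<open>This depends on \<open>x\<close> only through the scaled total time and the
    scaled velocity, hence is continuous for \<open>edist\<close>, and it lies on the same side of
    \<open>a\<close> as \<open>lamx x\<close>.\<close>
  define L where "L x = lam_of (lamx x / a * fst x) (\<lambda>t. (lamx x / a) *\<^sub>R velocity x t)" for x :: "'v path"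
  have T: "lamx x / a * fst x > 0" using lamx_pos[OF x] C1_pos[OF x] a by simp
  have cont: "\<exists>\<delta>>0. \<forall>y\<in>C1_paths. edist x y < \<delta> \<longrightarrow> \<bar>L y - L x\<bar> < e" if e: "e > 0" for e
  proof -
    obtain \<delta> where \<delta>: "\<delta> > 0" "\<And>S g. nice lborel g \<Longrightarrow>
        \<bar>lamx x / a * fst x - S\<bar> + L1n (\<lambda>t. (lamx x / a) *\<^sub>R velocity x t - g t) < \<delta> \<Longrightarrow>
        \<bar>lam_of S g - lam_of (lamx x / a * fst x) (\<lambda>t. (lamx x / a) *\<^sub>R velocity x t)\<bar> < e"
      using lam_of_continuous[OF nice_scaleR[OF velocity(1)[OF x], of "lamx x / a"] T e] by blast
    show ?thesis
    proof (intro exI[of _ "a * \<delta>"] conjI ballI impI)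
      show "a * \<delta> > 0" using a \<delta>(1) by simp
      fix y :: "'v path" assume y: "y \<in> C1_paths" and "edist x y < a * \<delta>"
      then have "edist x y / a < \<delta>" using a by (simp add: field_simps)
      then show "\<bar>L y - L x\<bar> < e"
        unfolding L_def by (intro \<delta>(2) nice_scaleR velocity(1)[OF y]) (simp only: scaled_edist[OF a])
    qed
  qed
  note st = scaled_state_lam[OF _ a, folded L_def]
  show "\<exists>\<delta>>0. \<forall>y\<in>C1_paths. edist x y < \<delta> \<longrightarrow> lamx y > a" if "lamx x > a"
  proof -
    have "L x - a > 0" using that st(1)[OF x] by simp
    then obtain \<delta> where \<delta>: "\<delta> > 0" "\<And>y. y \<in> C1_paths \<Longrightarrow> edist x y < \<delta> \<Longrightarrow> \<bar>L y - L x\<bar> < L x - a" using cont by blast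
    have "lamx y > a" if "y \<in> C1_paths" "edist x y < \<delta>" for y
      using \<delta>(2)[OF that] st(1)[OF that(1)] by linarith
    then show ?thesis using \<delta>(1) by blast
  qed
  show "\<exists>\<delta>>0. \<forall>y\<in>C1_paths. edist x y < \<delta> \<longrightarrow> lamx y < a" if "lamx x < a"
  proof -
    have "a - L x > 0" using that st(2)[OF x] by simp
    then obtain \<delta> where \<delta>: "\<delta> > 0" "\<And>y. y \<in> C1_paths \<Longrightarrow> edist x y < \<delta> \<Longrightarrow> \<bar>L y - L x\<bar> < a - L x" using cont by blast
    have "lamx y < a" if "y \<in> C1_paths" "edist x y < \<delta>" for y
      using \<delta>(2)[OF that] st(2)[OF that(1)] by linarith
    then show ?thesis using \<delta>(1) by blast
  qed
qed

text \<open>With scales \<open>l\<close> of \<open>x\<close> and \<open>k\<close> of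
  \<open>y\<close>, split \<open>k (x - y)\<close> as \<open>(l x - k y) + (k - l) x\<close>, for
  durations and velocities alike.\<close>

lemma vdist_le_edist:
  assumes x: "x \<in> C1_paths" and y: "y \<in> C1_paths"
  shows "lamx y * vdist x y \<le> edist x y + \<bar>lamx x - lamx y\<bar> * (fst x + L1n (velocity x))"
proof -
  define l k where "l = lamx x" and "k = lamx y"
  have k: "k > 0" unfolding k_def by (rule lamx_pos[OF y])
  note nx = velocity(1)[OF x] and ny = velocity(1)[OF y]
  have "k * (fst x - fst y) = (l * fst x - k * fst y) + (k - l) * fst x" by (simp add: algebra_simps)
  then have "\<bar>k * (fst x - fst y)\<bar> \<le> \<bar>l * fst x - k * fst y\<bar> + \<bar>(k - l) * fst x\<bar>" by (metis abs_triangle_ineq)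
  then have 1: "k * \<bar>fst x - fst y\<bar> \<le> \<bar>l * fst x - k * fst y\<bar> + \<bar>l - k\<bar> * fst x"
    using k C1_pos[OF x] by (simp add: abs_mult abs_minus_commute)
  have "k * L1n (\<lambda>t. velocity x t - velocity y t) = L1n (\<lambda>t. k *\<^sub>R (velocity x t - velocity y t))"
    using k by (simp add: L1n_scaleR)
  also have "(\<lambda>t. k *\<^sub>R (velocity x t - velocity y t))
      = (\<lambda>t. (l *\<^sub>R velocity x t - k *\<^sub>R velocity y t) + (k - l) *\<^sub>R velocity x t)"
    by (rule ext) (simp add: algebra_simps)
  also have "L1n \<dots> \<le> L1n (\<lambda>t. l *\<^sub>R velocity x t - k *\<^sub>R velocity y t) + L1n (\<lambda>t. (k - l) *\<^sub>R velocity x t)"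
    by (intro L1n_add_le nice_diff nice_scaleR nx ny)
  finally have 2: "k * L1n (\<lambda>t. velocity x t - velocity y t)
      \<le> L1n (\<lambda>t. l *\<^sub>R velocity x t - k *\<^sub>R velocity y t) + \<bar>l - k\<bar> * L1n (velocity x)"
    by (simp add: L1n_scaleR abs_minus_commute)
  show ?thesis
    using 1 2 unfolding vdist_def edist_def l_def[symmetric] k_def[symmetric] by (simp add: algebra_simps)
qed

lemma edist_controls_vdist:
  assumes x: "x \<in> C1_paths" and e: "\<epsilon> > 0"
  obtains \<delta> where "\<delta> > 0" "\<And>y. y \<in> C1_paths \<Longrightarrow> edist x y < \<delta> \<Longrightarrow> vdist x y < \<epsilon>"
proof -
  define l where "l = lamx x"
  have l: "l > 0" unfolding l_def by (rule lamx_pos[OF x])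
  define K where "K = fst x + L1n (velocity x)"
  have K: "K > 0" using C1_pos[OF x] L1n_nonneg[of "velocity x"] by (simp add: K_def)
  \<comment> \<open>The first bound keeps the scale of \<open>y\<close> above \<open>l / 2\<close>;
    the second makes the error from different scales at most
    \<open>\<epsilon> * l / 8\<close>.\<close>
  define \<eta> where "\<eta> = min (l / 2) (\<epsilon> * l / (8 * K))"
  have \<eta>: "\<eta> > 0" "\<eta> \<le> l / 2" "\<eta> * K \<le> \<epsilon> * l / 8"
  proof -
    show "\<eta> > 0" "\<eta> \<le> l / 2" using l e K by (auto simp: \<eta>_def)
    have "\<eta> * K \<le> \<epsilon> * l / (8 * K) * K" using K by (intro mult_right_mono) (auto simp: \<eta>_def)
    also have "\<dots> = \<epsilon> * l / 8" using K by simp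
    finally show "\<eta> * K \<le> \<epsilon> * l / 8" .
  qed
  have lo: "l - \<eta> > 0" using \<eta> l by linarith
  obtain \<delta>1 where \<delta>1: "\<delta>1 > 0" "\<And>y. y \<in> C1_paths \<Longrightarrow> edist x y < \<delta>1 \<Longrightarrow> lamx y > l - \<eta>"
    using lamx_locally_bounded(1)[OF x lo] \<eta>(1) by (auto simp: l_def)
  obtain \<delta>2 where \<delta>2: "\<delta>2 > 0" "\<And>y. y \<in> C1_paths \<Longrightarrow> edist x y < \<delta>2 \<Longrightarrow> lamx y < l + \<eta>"
    using lamx_locally_bounded(2)[OF x, of "l + \<eta>"] \<eta>(1) l by (auto simp: l_def)
  define \<delta> where "\<delta> = min (min \<delta>1 \<delta>2) (\<epsilon> * l / 8)"
  have "vdist x y < \<epsilon>" if y: "y \<in> C1_paths" and d: "edist x y < \<delta>" for y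
  proof -
    have b: "lamx y > l - \<eta>" "lamx y < l + \<eta>" using \<delta>1(2)[OF y] \<delta>2(2)[OF y] d by (auto simp: \<delta>_def)
    then have diff: "\<bar>l - lamx y\<bar> \<le> \<eta>" and low: "l / 2 \<le> lamx y" using \<eta>(2) by auto
    have v: "0 \<le> vdist x y" by (simp add: vdist_def L1n_nonneg)
    have "l / 2 * vdist x y \<le> lamx y * vdist x y" using low v by (rule mult_right_mono)
    also have "\<dots> \<le> edist x y + \<bar>l - lamx y\<bar> * K"
      using vdist_le_edist[OF x y] by (simp add: l_def K_def)
    also have "\<dots> \<le> \<epsilon> * l / 8 + \<epsilon> * l / 8"
      using d \<eta>(3) mult_right_mono[OF diff less_imp_le[OF K]] by (intro add_mono) (auto simp: \<delta>_def)
    also have "\<dots> < l / 2 * \<epsilon>" using e l by simp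
    finally show ?thesis using l by simp
  qed
  moreover have "\<delta> > 0" using \<delta>1(1) \<delta>2(1) e l by (simp add: \<delta>_def)
  ultimately show ?thesis using that by blast
qed

end

section \<open>Laws of paths\<close>

text \<open>On a separable set the norm is the supremum of countably many functionals, each norming
  one point of a dense set.\<close>

lemma borel_measurable_norm_functionals:
  fixes g :: "'a \<Rightarrow> 'b::real_normed_vector"
  assumes meas: "\<And>l. bounded_linear l \<Longrightarrow> (\<lambda>x. l (g x) :: real) \<in> borel_measurable M"
    and Q: "countable Q" and g: "\<And>x. x \<in> space M \<Longrightarrow> g x \<in> closure Q"
  shows "(\<lambda>x. norm (g x)) \<in> borel_measurable M"
proof (rule borel_measurable_iff_greater[THEN iffD2, rule_format])
  fix a :: real
  have "\<exists>L. bounded_linear L \<and> L q = norm q \<and> (\<forall>x. \<bar>L x\<bar> \<le> norm x)" for q :: 'b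
    using norming_functional by metis
  then obtain L :: "'b \<Rightarrow> 'b \<Rightarrow> real" where
    L: "\<And>q. bounded_linear (L q)" "\<And>q. L q q = norm q" "\<And>q x. \<bar>L q x\<bar> \<le> norm x" by metis
  have "{x\<in>space M. a < norm (g x)} = (\<Union>q\<in>Q. {x\<in>space M. a < L q (g x)})"
  proof (intro equalityI subsetI)
    fix x assume "x \<in> {x\<in>space M. a < norm (g x)}"
    then have x: "x \<in> space M" and ax: "a < norm (g x)" by auto
    define e where "e = (norm (g x) - a) / 2"
    have e: "e > 0" using ax by (simp add: e_def)
    obtain q where q: "q \<in> Q" "dist q (g x) < e" using g[OF x] e unfolding closure_approachable by blast
    have d: "norm (q - g x) < e" using q(2) by (simp add: dist_norm)
    have "norm (g x) - e < norm q" using d norm_triangle_ineq2[of "g x" q] by (simp add: norm_minus_commute)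
    moreover have "L q q - L q (g x) \<le> norm (q - g x)"
      using L(3)[of q "q - g x"] linear_diff[OF bounded_linear.linear[OF L(1)[of q]], of q "g x"] by simp
    ultimately have "a < L q (g x)" using d L(2)[of q] by (simp add: e_def field_simps)
    then show "x \<in> (\<Union>q\<in>Q. {x\<in>space M. a < L q (g x)})" using q x by blast
  next
    fix x assume "x \<in> (\<Union>q\<in>Q. {x\<in>space M. a < L q (g x)})"
    then obtain q where "x \<in> space M" "a < L q (g x)" by blast
    then show "x \<in> {x\<in>space M. a < norm (g x)}" using L(3)[of q "g x"] by auto
  qed
  moreover have "{x\<in>space M. a < L q (g x)} \<in> sets M" for q
    using meas[OF L(1)[of q]] by measurable
  ultimately show "{x\<in>space M. a < norm (g x)} \<in> sets M" by (simp only:) (rule sets.countable_UN''[OF Q])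
qed

text \<open>Provides one countable set whose closure contains all scaled increments of paths with
  values in the closure of \<open>Q\<close>.\<close>

lemma closure_scaled_differences:
  fixes Q :: "'b::real_normed_vector set"
  assumes "a \<in> closure Q" "b \<in> closure Q"
  shows "c *\<^sub>R (a - b) \<in> closure {r *\<^sub>R (p - q) | r p q. r \<in> \<rat> \<and> p \<in> Q \<and> q \<in> Q}"
proof -
  have "c \<in> closure \<rat>" by (simp add: Rats_closure_real)
  obtain r where r: "\<And>n. r n \<in> \<rat>" "r \<longlonglongrightarrow> c" using \<open>c \<in> closure \<rat>\<close> unfolding closure_sequential by blast
  obtain p where p: "\<And>n. p n \<in> Q" "p \<longlonglongrightarrow> a" using assms(1) unfolding closure_sequential by blast
  obtain q where q: "\<And>n. q n \<in> Q" "q \<longlonglongrightarrow> b" using assms(2) unfolding closure_sequential by blast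
  have "(\<lambda>n. r n *\<^sub>R (p n - q n)) \<longlonglongrightarrow> c *\<^sub>R (a - b)" by (intro tendsto_intros r p q)
  then show ?thesis
    unfolding closure_sequential using r(1) p(1) q(1) by (intro exI[of _ "\<lambda>n. r n *\<^sub>R (p n - q n)"]) blast
qed

lemma countable_scaled_differences:
  assumes "countable Q" shows "countable {r *\<^sub>R (p - q) | r p q. r \<in> (\<rat> :: real set) \<and> p \<in> Q \<and> q \<in> (Q :: 'b::real_normed_vector set)}"
proof -
  have "{r *\<^sub>R (p - q) | r p q. r \<in> \<rat> \<and> p \<in> Q \<and> q \<in> Q} = (\<lambda>(r, p, q). r *\<^sub>R (p - q)) ` (\<rat> \<times> Q \<times> Q)" by force
  then show ?thesis using assms countable_rat by (auto intro!: countable_image countable_SIGMA)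
qed

context tensor_normalized
begin

section \<open>Coordinates of the normalized signature and their algebra\<close>

definition scaled_velocity :: "'v path \<Rightarrow> real \<Rightarrow> 'v" where
  "scaled_velocity x t = lamx x *\<^sub>R velocity x t"

text \<open>The default 0 outside \<open>C1_paths\<close> makes the state \<open>nice\<close> for
  every argument, so the shuffle relation for \<open>coord\<close> holds without a membership
  assumption.\<close>

definition scaled_state :: "'v path \<Rightarrow> real \<Rightarrow> 'v \<times> real" where
  "scaled_state x = (if x \<in> C1_paths then augment (lamx x * fst x) (scaled_velocity x) else (\<lambda>_. 0))"

text \<open>The first function in \<open>iter_int\<close> belongs to the latest time, the first factor of a tensor to
  the earliest one.\<close>

definition coord :: "('v \<times> real \<Rightarrow> real) list \<Rightarrow> 'v path \<Rightarrow> real" where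
  "coord w x = iter_int (rev (map (\<lambda>l t. l (scaled_state x t)) w)) 1"

abbreviation bl_word :: "('v \<times> real \<Rightarrow> real) list \<Rightarrow> bool" where
  "bl_word w \<equiv> (\<forall>l\<in>set w. bounded_linear l)"

lemma nice_scaled_velocity: "x \<in> C1_paths \<Longrightarrow> nice lborel (scaled_velocity x)"
  unfolding scaled_velocity_def by (intro nice_scaleR velocity)

lemma nice_scaled_state: "nice lborel (scaled_state x)"
  by (auto simp: scaled_state_def intro: nice_augment nice_scaled_velocity nice_zero)

lemma coord_eq:
  assumes w: "bl_word w" and x: "x \<in> C1_paths"
  shows "coord w x = word_functional w (normalized_signature tens \<Lambda> x (length w))"
proof -
  have "scaled_velocity x = (\<lambda>t. lamx x *\<^sub>R velocity x t)" by (rule ext) (simp add: scaled_velocity_def)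
  then show ?thesis
    using word_functional_usig[OF w nice_augment[OF nice_scaled_velocity[OF x]], of "lamx x * fst x"] x
    by (simp add: coord_def scaled_state_def normalized_signature_eq(2)[OF x] sg_def)
qed

lemma coord_Nil: "coord [] x = 1"
  by (simp add: coord_def)

lemma coord_mult:
  assumes v: "bl_word v" and w: "bl_word w"
  shows "coord v x * coord w x = (\<Sum>z\<leftarrow>shuffle_words (rev v) (rev w). coord (rev z) x)"
proof -
  define \<phi> where "\<phi> l t = l (scaled_state x t)" for l :: "'v \<times> real \<Rightarrow> real" and t
  have c: "coord u x = iter_int (map \<phi> (rev u)) 1" for u by (simp add: coord_def \<phi>_def[abs_def] rev_map)
  have int: "\<forall>g\<in>set (map \<phi> (rev u)). integrable lborel g" if "bl_word u" for u
    using that nice_real(1)[OF nice_bounded_linear[OF _ nice_scaled_state]] by (auto simp: \<phi>_def[abs_def])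
  show ?thesis
    unfolding c iter_int_mult[OF int[OF v] int[OF w]] shuffle_words_map by (simp add: comp_def)
qed

lemma coord_continuous:
  assumes w: "bl_word w" shows "coord w \<in> borel_measurable path_borel"
proof (rule path_borel_measurableI)
  fix x :: "'v path" and \<epsilon> :: real assume x: "x \<in> C1_paths" and e: "\<epsilon> > 0"
  interpret L: bounded_linear "word_functional w" by (rule word_functional(1)[OF w])
  obtain K where K: "K > 0" "\<And>v. norm (word_functional w v) \<le> norm v * K" using L.pos_bounded by blast
  obtain \<delta> where \<delta>: "\<delta> > 0" "\<And>S g m. nice lborel g \<Longrightarrow> \<bar>fst x - S\<bar> + L1n (\<lambda>t. velocity x t - g t) < \<delta> \<Longrightarrow>
      norm (\<Lambda> (sg S g) m - \<Lambda> (sg (fst x) (velocity x)) m) < \<epsilon> / K"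
    using Lambda_sg_continuous[OF velocity(1)[OF x] divide_pos_pos[OF e K(1)]] by blast
  have "\<bar>coord w y - coord w x\<bar> < \<epsilon>" if y: "y \<in> C1_paths" and d: "vdist x y < \<delta>" for y
  proof -
    let ?n = "length w"
    have "\<bar>coord w y - coord w x\<bar> = norm (word_functional w (\<Lambda> (sg (fst y) (velocity y)) ?n - \<Lambda> (sg (fst x) (velocity x)) ?n))"
      unfolding coord_eq[OF w x] coord_eq[OF w y] normalized_signature_eq(1)[OF x] normalized_signature_eq(1)[OF y] L.diff by simp
    also have "\<dots> \<le> norm (\<Lambda> (sg (fst y) (velocity y)) ?n - \<Lambda> (sg (fst x) (velocity x)) ?n) * K" by (rule K)
    also have "\<dots> < \<epsilon>"
      using \<delta>(2)[OF velocity(1)[OF y], of "fst y" ?n] d K(1) by (simp add: vdist_def field_simps)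
    finally show ?thesis .
  qed
  then show "\<exists>\<delta>>0. \<forall>y\<in>C1_paths. vdist x y < \<delta> \<longrightarrow> \<bar>coord w y - coord w x\<bar> < \<epsilon>" using \<delta>(1) by blast
qed

text \<open>Here the bounded range of \<Lambda> enters.\<close>

lemma coord_bounded:
  assumes w: "bl_word w" shows "\<exists>B. \<forall>x\<in>C1_paths. \<bar>coord w x\<bar> \<le> B"
proof -
  interpret L: bounded_linear "word_functional w" by (rule word_functional(1)[OF w])
  obtain K where K: "K > 0" "\<And>v. norm (word_functional w v) \<le> norm v * K" using L.pos_bounded by blast
  obtain R where R: "\<And>t. t \<in> seqs1 \<Longrightarrow> seq_norm (\<Lambda> t) \<le> R" using Lambda_bounded by blast
  have "\<bar>coord w x\<bar> \<le> R * K" if x: "x \<in> C1_paths" for x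
  proof -
    have s: "sg (fst x) (velocity x) \<in> seqs1" by (rule sg_seqs1[OF velocity(1)[OF x]])
    have "\<bar>coord w x\<bar> \<le> norm (\<Lambda> (sg (fst x) (velocity x)) (length w)) * K"
      using K(2) unfolding coord_eq[OF w x] normalized_signature_eq(1)[OF x] by simp
    also have "\<dots> \<le> R * K"
      using seq_norm_component[OF seqs1_summable[OF Lambda_seqs1[OF s]], of "length w"] R[OF s] K(1)
      by (intro mult_right_mono) auto
    finally show ?thesis .
  qed
  then show ?thesis by blast
qed

text \<open>Linear combinations only: agreement of expectations extends to them by linearity, and
  closure under products is a consequence of the shuffle relation.\<close>

inductive_set coord_algebra :: "('v path \<Rightarrow> real) set" where
  coord: "bl_word w \<Longrightarrow> (\<lambda>x. c * coord w x) \<in> coord_algebra"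
| add: "f \<in> coord_algebra \<Longrightarrow> g \<in> coord_algebra \<Longrightarrow> (\<lambda>x. f x + g x) \<in> coord_algebra"

lemma coord_algebra_const: "(\<lambda>_. c) \<in> coord_algebra"
  using coord[of "[]" c] by (simp add: coord_Nil)

lemma coord_algebra_sum_list:
  "(\<And>z. z \<in> set zs \<Longrightarrow> f z \<in> coord_algebra) \<Longrightarrow> (\<lambda>x. \<Sum>z\<leftarrow>zs. f z x) \<in> coord_algebra"
  by (induction zs) (auto intro: coord_algebra_const add)

lemma coord_algebra_mult:
  assumes f: "f \<in> coord_algebra" and g: "g \<in> coord_algebra" shows "(\<lambda>x. f x * g x) \<in> coord_algebra"
  using f
proof induction
  case (coord v c)
  from g show ?case
  proof induction
    case (coord w d)
    have "(\<lambda>x. \<Sum>z\<leftarrow>shuffle_words (rev v) (rev w). (c * d) * coord (rev z) x) \<in> coord_algebra"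
    proof (rule coord_algebra_sum_list)
      fix z assume "z \<in> set (shuffle_words (rev v) (rev w))"
      then have "bl_word (rev z)" using shuffle_words_props[of z "rev v" "rev w"] coord \<open>bl_word v\<close> by auto
      then show "(\<lambda>x. c * d * coord (rev z) x) \<in> coord_algebra" by (rule coord_algebra.coord)
    qed
    moreover have "(\<lambda>x. c * coord v x * (d * coord w x)) = (\<lambda>x. \<Sum>z\<leftarrow>shuffle_words (rev v) (rev w). (c * d) * coord (rev z) x)"
    proof (rule ext)
      fix x
      have "c * coord v x * (d * coord w x) = (c * d) * (coord v x * coord w x)" by simp
      also have "\<dots> = (\<Sum>z\<leftarrow>shuffle_words (rev v) (rev w). (c * d) * coord (rev z) x)"
        unfolding coord_mult[OF \<open>bl_word v\<close> coord] by (simp add: sum_list_const_mult)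
      finally show "c * coord v x * (d * coord w x) = \<dots>" .
    qed
    ultimately show ?case by simp
  next
    case (add f1 f2)
    from coord_algebra.add[OF add.IH] show ?case by (simp add: distrib_left)
  qed
next
  case (add f1 f2)
  from coord_algebra.add[OF add.IH] show ?case by (simp add: distrib_right)
qed

definition coord_sets :: "'v path measure" where
  "coord_sets = sigma C1_paths {{x\<in>C1_paths. f x > a} | f a. f \<in> coord_algebra}"

lemma space_coord_sets: "space coord_sets = C1_paths"
  unfolding coord_sets_def by (rule space_measure_of) auto

lemma sets_coord_sets: "sets coord_sets = sigma_sets C1_paths {{x\<in>C1_paths. f x > a} | f a. f \<in> coord_algebra}"
  unfolding coord_sets_def by (rule sets_measure_of) auto

lemma coord_sets_measurable: "bl_word w \<Longrightarrow> coord w \<in> borel_measurable coord_sets"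
proof (rule borel_measurable_iff_greater[THEN iffD2, rule_format])
  fix a assume "bl_word w"
  then have "coord w \<in> coord_algebra" using coord[of w 1] by simp
  then show "{x\<in>space coord_sets. a < coord w x} \<in> sets coord_sets"
    unfolding space_coord_sets sets_coord_sets by (intro sigma_sets.Basic) blast
qed

section \<open>Moments and positions as functions of the coordinates\<close>

lemma coord_time:
  assumes x: "x \<in> C1_paths" shows "coord [snd] x = lamx x * fst x"
  using x by (simp add: coord_def scaled_state_def augment_def mult.assoc[symmetric] indicator_times[symmetric] indicator_inter_arith[symmetric])

text \<open>With the space letter at the latest time \<open>s\<close>, the \<open>k\<close> time
  letters integrate to \<open>(s * \<tau>) ^ k / fact k\<close>, where \<tau> is the scaled total
  time; a moment of the velocity remains.\<close>

lemma coord_moment: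
  fixes l :: "'v \<Rightarrow> real"
  assumes l: "bounded_linear l" and x: "x \<in> C1_paths"
  shows "coord (replicate k snd @ [\<lambda>p. l (fst p)]) x
    = (lamx x * fst x) ^ k / fact k * (\<integral>s. indicator {0..1} s * (l (scaled_velocity x s) * s ^ k) \<partial>lborel)"
proof -
  define \<tau> where "\<tau> = lamx x * fst x"
  have time: "(\<lambda>t. snd (scaled_state x t)) = (\<lambda>t. indicator {0..1} t * \<tau>)"
    using x by (auto simp: scaled_state_def augment_def \<tau>_def)
  have int: "integrable lborel (\<lambda>t. indicator {0..1::real} t * \<tau>)" by simp
  have I: "(\<integral>r. indicator {0..s} r * (indicator {0..1} r * \<tau>) \<partial>lborel) = s * \<tau>" if s: "s \<in> {0..1}" for s :: real
  proof -
    have "(\<integral>r. indicator {0..s} r * (indicator {0..1} r * \<tau>) \<partial>lborel) = (\<integral>r. indicator {0..s} r * \<tau> \<partial>lborel)"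
      using s by (intro Bochner_Integration.integral_cong) (auto simp: indicator_def)
    then show ?thesis using s by simp
  qed
  have "coord (replicate k snd @ [\<lambda>p. l (fst p)]) x
      = iter_int ((\<lambda>t. l (fst (scaled_state x t))) # replicate k (\<lambda>t. indicator {0..1} t * \<tau>)) 1"
    by (simp add: coord_def time[symmetric] del: iter_int.simps)
  also have "\<dots> = (\<integral>s. indicator {0..1} s * (l (scaled_velocity x s) * ((\<integral>r. indicator {0..s} r * (indicator {0..1} r * \<tau>) \<partial>lborel) ^ k / fact k)) \<partial>lborel)"
    using x by (simp add: iter_int_replicate[OF int] scaled_state_def augment_def)
  also have "\<dots> = (\<integral>s. \<tau> ^ k / fact k * (indicator {0..1} s * (l (scaled_velocity x s) * s ^ k)) \<partial>lborel)"
  proof (rule Bochner_Integration.integral_cong[OF refl])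
    fix s :: real
    show "indicator {0..1} s * (l (scaled_velocity x s) * ((\<integral>r. indicator {0..s} r * (indicator {0..1} r * \<tau>) \<partial>lborel) ^ k / fact k))
        = \<tau> ^ k / fact k * (indicator {0..1} s * (l (scaled_velocity x s) * s ^ k))"
      by (cases "s \<in> {0..1}") (simp_all only: I power_mult_distrib indicator_simps, simp_all)
  qed
  finally show ?thesis by (simp add: \<tau>_def)
qed

lemma integrable_poly_weight:
  fixes l :: "'v \<Rightarrow> real"
  assumes l: "bounded_linear l" and x: "x \<in> C1_paths"
  shows "integrable lborel (\<lambda>s. indicator {0..1} s * (l (scaled_velocity x s) * s ^ k))"
proof (rule Bochner_Integration.integrable_bound)
  show i: "integrable lborel (\<lambda>s. l (scaled_velocity x s))"
    by (intro nice_real nice_bounded_linear[OF l] nice_scaled_velocity x)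
  show "(\<lambda>s. indicator {0..1} s * (l (scaled_velocity x s) * s ^ k)) \<in> borel_measurable lborel"
    using borel_measurable_integrable[OF i] by measurable
  have "\<bar>s ^ k\<bar> \<le> 1" if "s \<in> {0..1}" for s :: real using that by (simp add: power_le_one)
  then show "AE s in lborel. norm (indicator {0..1} s * (l (scaled_velocity x s) * s ^ k)) \<le> norm (l (scaled_velocity x s))"
    by (intro AE_I2) (auto simp: indicator_def abs_mult intro!: mult_left_le)
qed

text \<open>The factor in \<open>coord_moment\<close> is divided out: the scaled total time is
  itself a coordinate and is positive on paths.\<close>

lemma moment_measurable:
  fixes l :: "'v \<Rightarrow> real"
  assumes l: "bounded_linear l"
  shows "(\<lambda>x. \<integral>s. indicator {0..1} s * (l (scaled_velocity x s) * s ^ k) \<partial>lborel) \<in> borel_measurable coord_sets"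
proof -
  have w: "bl_word (replicate k snd @ [\<lambda>p. l (fst p)])"
    using bounded_linear_compose[OF l bounded_linear_fst] by (auto simp: bounded_linear_snd)
  have [measurable]: "coord (replicate k snd @ [\<lambda>p. l (fst p)]) \<in> borel_measurable coord_sets"
    "coord [snd] \<in> borel_measurable coord_sets"
    by (intro coord_sets_measurable w) (intro coord_sets_measurable bl_snd)
  have "(\<lambda>x. fact k * coord (replicate k snd @ [\<lambda>p. l (fst p)]) x / coord [snd] x ^ k) \<in> borel_measurable coord_sets"
    by measurable
  moreover have "fact k * coord (replicate k snd @ [\<lambda>p. l (fst p)]) x / coord [snd] x ^ k
      = (\<integral>s. indicator {0..1} s * (l (scaled_velocity x s) * s ^ k) \<partial>lborel)" if "x \<in> space coord_sets" for x
  proof -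
    have x: "x \<in> C1_paths" using that by (simp add: space_coord_sets)
    have nz: "lamx x * fst x \<noteq> 0" using lamx_pos[OF x] C1_pos[OF x] by simp
    have "fact k * (\<tau> ^ k / fact k * J) / \<tau> ^ k = J" if "\<tau> \<noteq> 0" for \<tau> J :: real using that by simp
    from this[OF nz] show ?thesis unfolding coord_moment[OF l x] coord_time[OF x] .
  qed
  ultimately show ?thesis by (simp cong: measurable_cong)
qed

text \<open>The position at \<open>u\<close> integrates the velocity against the indicator of [0,u];
  polynomials in place of the indicator give moments.\<close>

lemma position_measurable:
  fixes l :: "'v \<Rightarrow> real"
  assumes l: "bounded_linear l" and u: "u \<in> {0..1}"
  shows "(\<lambda>x. l (prim (scaled_velocity x) u)) \<in> borel_measurable coord_sets"
proof -
  obtain p :: "nat \<Rightarrow> real poly" where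
    p: "\<And>r. \<bar>r\<bar> \<le> 1 \<Longrightarrow> (\<lambda>n. poly (p n) r) \<longlonglongrightarrow> (if r > u then 1 else 0)" "\<And>n r. \<bar>r\<bar> \<le> 1 \<Longrightarrow> \<bar>poly (p n) r\<bar> \<le> 2"
    using poly_indicator_approx by blast
  \<comment> \<open>The complement turns the indicator of \<open>r > u\<close> into that of
    \<open>r \<le> u\<close>, and the bound 2 into 3.\<close>
  define q where "q n = 1 - p n" for n
  define A where "A n x = (\<Sum>i\<le>degree (q n). coeff (q n) i * (\<integral>s. indicator {0..1} s * (l (scaled_velocity x s) * s ^ i) \<partial>lborel))" for n x
  have A_meas: "A n \<in> borel_measurable coord_sets" for n
    unfolding A_def using moment_measurable[OF l] by measurable
  have lim: "(\<lambda>n. A n x) \<longlonglongrightarrow> l (prim (scaled_velocity x) u)" if "x \<in> space coord_sets" for x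
  proof -
    have x: "x \<in> C1_paths" using that by (simp add: space_coord_sets)
    define h where "h s = l (scaled_velocity x s)" for s
    have nh: "nice lborel h" unfolding h_def by (intro nice_bounded_linear[OF l] nice_scaled_velocity x)
    then have ih: "integrable lborel h" by (rule nice_real)
    then have [measurable]: "h \<in> borel_measurable borel" using borel_measurable_integrable by fastforce
    have A_eq: "A n x = (\<integral>s. indicator {0..1} s * (h s * poly (q n) s) \<partial>lborel)" for n
    proof -
      have "A n x = (\<integral>s. (\<Sum>i\<le>degree (q n). coeff (q n) i * (indicator {0..1} s * (h s * s ^ i))) \<partial>lborel)"
        unfolding A_def h_def using integrable_poly_weight[OF l x]
        by (subst Bochner_Integration.integral_sum) auto
      also have "\<dots> = (\<integral>s. indicator {0..1} s * (h s * poly (q n) s) \<partial>lborel)"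
        by (intro Bochner_Integration.integral_cong) (auto simp: poly_altdef sum_distrib_left mult_ac)
      finally show ?thesis .
    qed
    have "(\<lambda>n. \<integral>s. indicator {0..1} s * (h s * poly (q n) s) \<partial>lborel) \<longlonglongrightarrow> (\<integral>s. indicator {0..u} s * h s \<partial>lborel)"
    proof (rule integral_dominated_convergence[where w = "\<lambda>s. 3 * \<bar>h s\<bar>"])
      show "(\<lambda>s. indicator {0..u} s * h s) \<in> borel_measurable lborel" by measurable
      show "(\<lambda>s. indicator {0..1} s * (h s * poly (q n) s)) \<in> borel_measurable lborel" for n
        by (simp add: poly_altdef)
      show "integrable lborel (\<lambda>s. 3 * \<bar>h s\<bar>)" using ih by simp
      show "AE s in lborel. (\<lambda>n. indicator {0..1} s * (h s * poly (q n) s)) \<longlonglongrightarrow> indicator {0..u} s * h s"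
      proof (rule AE_I2)
        fix s :: real
        show "(\<lambda>n. indicator {0..1} s * (h s * poly (q n) s)) \<longlonglongrightarrow> indicator {0..u} s * h s"
        proof (cases "s \<in> {0..1}")
          case True
          then have "(\<lambda>n. indicator {0..1} s * (h s * (1 - poly (p n) s))) \<longlonglongrightarrow> indicator {0..1} s * (h s * (1 - (if s > u then 1 else 0)))"
            by (intro tendsto_intros p(1)) auto
          moreover have "indicator {0..1} s * (h s * (1 - (if s > u then 1 else 0))) = indicator {0..u} s * h s"
            using True by (auto simp: indicator_def)
          ultimately show ?thesis by (simp add: q_def)
        next
          case False
          then show ?thesis using u by (auto simp: indicator_def)
        qed
      qed
      show "AE s in lborel. norm (indicator {0..1} s * (h s * poly (q n) s)) \<le> 3 * \<bar>h s\<bar>" for n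
      proof (rule AE_I2)
        fix s :: real
        show "norm (indicator {0..1} s * (h s * poly (q n) s)) \<le> 3 * \<bar>h s\<bar>"
        proof (cases "s \<in> {0..1}")
          case True
          then have "\<bar>poly (q n) s\<bar> \<le> 3" using p(2)[of s n] by (auto simp: q_def)
          then show ?thesis using True mult_left_mono[of "\<bar>poly (q n) s\<bar>" 3 "\<bar>h s\<bar>"] by (simp add: abs_mult)
        qed simp
      qed
    qed
    moreover have "l (prim (scaled_velocity x) u) = (\<integral>s. indicator {0..u} s * h s \<partial>lborel)"
    proof -
      have "l (prim (scaled_velocity x) u) = (\<integral>s. l (indicator {0..u} s *\<^sub>R scaled_velocity x s) \<partial>lborel)"
        unfolding prim_def by (intro functional_bint(1)[OF l] nice_ind nice_scaled_velocity x) simp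
      also have "\<dots> = (\<integral>s. indicator {0..u} s * h s \<partial>lborel)"
        by (simp add: h_def linear_scale[OF bounded_linear.linear[OF l]])
      finally show ?thesis .
    qed
    ultimately show ?thesis unfolding A_eq by simp
  qed
  show ?thesis by (rule borel_measurable_LIMSEQ_real[OF lim A_meas])
qed

section \<open>Measurability on a separable support\<close>

definition supported_paths :: "'v set \<Rightarrow> 'v path set" where
  "supported_paths Q = {x\<in>C1_paths. \<forall>t\<in>{0..fst x}. snd x t \<in> closure Q}"

lemma scaled_increment_closure:
  assumes x: "x \<in> supported_paths Q" and s: "s \<in> {0..1}" "r \<in> {0..1}"
  shows "c *\<^sub>R (prim (scaled_velocity x) s - prim (scaled_velocity x) r)
    \<in> closure {r *\<^sub>R (p - q) | r p q. r \<in> \<rat> \<and> p \<in> Q \<and> q \<in> Q}"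
proof -
  have xC: "x \<in> C1_paths" and cl: "\<And>t. t \<in> {0..fst x} \<Longrightarrow> snd x t \<in> closure Q" using x by (auto simp: supported_paths_def)
  have "prim (scaled_velocity x) u = lamx x *\<^sub>R snd x (fst x * u)" if "u \<in> {0..1}" for u
    unfolding scaled_velocity_def velocity(3)[OF xC that] by (rule prim_scaleR[OF velocity(1)[OF xC]])
  then have "c *\<^sub>R (prim (scaled_velocity x) s - prim (scaled_velocity x) r)
      = (c * lamx x) *\<^sub>R (snd x (fst x * s) - snd x (fst x * r))"
    using s by (simp add: scaleR_diff_right)
  moreover have "fst x * u \<in> {0..fst x}" if "u \<in> {0..1}" for u
    using that C1_pos[OF xC] by (simp add: mult_left_le)
  ultimately show ?thesis using closure_scaled_differences[OF cl cl, of "fst x * s" "fst x * r" "c * lamx x"] s by simp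
qed

text \<open>The \<open>edist\<close> formula for a scaled path and a pair of duration
  \<open>q\<close> and step velocity. The pair need not be the scaled version of any path.\<close>

definition step_dist :: "real \<Rightarrow> nat \<Rightarrow> (nat \<Rightarrow> 'v) \<Rightarrow> 'v path \<Rightarrow> real" where
  "step_dist q n c x = \<bar>lamx x * fst x - q\<bar> + L1n (\<lambda>t. scaled_velocity x t - step n c t)"

lemma dyadic_point_unit: "j < 2 ^ n \<Longrightarrow> real j / 2 ^ n \<in> {0..1} \<and> (real j + 1) / 2 ^ n \<in> {0..1}"
proof -
  assume "j < 2 ^ n"
  then have "real j + 1 \<le> 2 ^ n" by (metis Suc_leI add.commute of_nat_Suc of_nat_le_iff of_nat_numeral of_nat_power)
  moreover from this have "real j \<le> 2 ^ n" by linarith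
  ultimately show ?thesis by (simp del: of_nat_le_iff of_nat_le_numeral_power_cancel_iff)
qed

text \<open>The L1 distance is the limit of dyadic variation sums, whose terms involve finitely many
  positions. The restriction to \<open>supported_paths Q\<close> makes norms of increments
  measurable.\<close>

lemma step_dist_measurable:
  assumes Q: "countable Q"
  shows "step_dist q n c \<in> borel_measurable (restrict_space coord_sets (supported_paths Q))"
proof -
  define M where "M = restrict_space coord_sets (supported_paths Q)"
  have sp: "space M = supported_paths Q"
    by (auto simp: M_def space_restrict_space space_coord_sets supported_paths_def)
  define Q' where "Q' = {r *\<^sub>R (p - q) | r p q. r \<in> \<rat> \<and> p \<in> Q \<and> q \<in> Q}"
  have Q': "countable Q'" unfolding Q'_def by (rule countable_scaled_differences[OF Q])
  have C1: "x \<in> C1_paths" if "x \<in> space M" for x using that by (simp add: sp supported_paths_def)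
  have pos: "(\<lambda>x. l (prim (scaled_velocity x) u)) \<in> borel_measurable M" if "bounded_linear l" "u \<in> {0..1}" for l :: "'v \<Rightarrow> real" and u
    unfolding M_def by (intro measurable_restrict_space1 position_measurable that)
  have inc: "(\<lambda>x. norm (prim (scaled_velocity x) s - prim (scaled_velocity x) r - v)) \<in> borel_measurable M"
    if s: "s \<in> {0..1}" and r: "r \<in> {0..1}" for s r v
  proof (rule borel_measurable_norm_functionals)
    show "countable ((\<lambda>p. p - v) ` Q')" using Q' by simp
    fix x assume "x \<in> space M"
    then have "1 *\<^sub>R (prim (scaled_velocity x) s - prim (scaled_velocity x) r) \<in> closure Q'"
      unfolding Q'_def sp by (rule scaled_increment_closure[OF _ s r])
    then show "prim (scaled_velocity x) s - prim (scaled_velocity x) r - v \<in> closure ((\<lambda>p. p - v) ` Q')"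
      using closure_translation_subtract[of v Q'] by simp
  next
    fix l :: "'v \<Rightarrow> real" assume l: "bounded_linear l"
    have "(\<lambda>x. l (prim (scaled_velocity x) s) - l (prim (scaled_velocity x) r) - l v) \<in> borel_measurable M"
      by (intro borel_measurable_diff pos[OF l] s r) simp
    then show "(\<lambda>x. l (prim (scaled_velocity x) s - prim (scaled_velocity x) r - v)) \<in> borel_measurable M"
      by (simp add: linear_diff[OF bounded_linear.linear[OF l]])
  qed
  define E where "E m x = (\<Sum>j<2^m. norm (prim (scaled_velocity x) ((real j + 1) / 2 ^ m) - prim (scaled_velocity x) (real j / 2 ^ m)
      - (prim (step n c) ((real j + 1) / 2 ^ m) - prim (step n c) (real j / 2 ^ m))))" for m x
  have E_meas: "E m \<in> borel_measurable M" for m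
    unfolding E_def by (intro borel_measurable_sum inc) (auto dest: dyadic_point_unit simp del: atLeastAtMost_iff)
  have E_lim: "(\<lambda>m. E m x) \<longlonglongrightarrow> L1n (\<lambda>t. scaled_velocity x t - step n c t)" if "x \<in> space M" for x
  proof -
    note x = C1[OF that]
    note ns = nice_scaled_velocity[OF x]
    have "step_approx (\<lambda>t. scaled_velocity x t - step n c t)"
      by (rule nice_step_approx[OF nice_diff[OF ns nice_step]])
         (use velocity(2)[OF x] in \<open>auto simp: scaled_velocity_def step_def\<close>)
    from dysum_tendsto[OF this] show ?thesis
      unfolding dysum_def E_def prim_diff[OF ns nice_step] by (simp add: algebra_simps)
  qed
  have "(\<lambda>x. L1n (\<lambda>t. scaled_velocity x t - step n c t)) \<in> borel_measurable M"
    by (rule borel_measurable_LIMSEQ_real[OF E_lim E_meas])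
  moreover have "coord [snd] \<in> borel_measurable M"
    unfolding M_def by (intro measurable_restrict_space1 coord_sets_measurable bl_snd)
  ultimately have "(\<lambda>x. \<bar>coord [snd] x - q\<bar> + L1n (\<lambda>t. scaled_velocity x t - step n c t)) \<in> borel_measurable M"
    by measurable
  then show ?thesis
    unfolding M_def[symmetric] by (rule measurable_cong[THEN iffD1, rotated]) (simp add: step_dist_def coord_time C1)
qed

lemma edist_le_step_dist:
  assumes "x \<in> C1_paths" "y \<in> C1_paths" shows "edist x y \<le> step_dist q n c x + step_dist q n c y"
proof -
  have "L1n (\<lambda>t. scaled_velocity x t - scaled_velocity y t)
      \<le> L1n (\<lambda>t. scaled_velocity x t - step n c t) + L1n (\<lambda>t. scaled_velocity y t - step n c t)"
    using L1n_diff_le[OF nice_scaled_velocity[OF assms(1)] nice_step[of n c] nice_scaled_velocity[OF assms(2)]]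
      L1n_minus_commute[of "step n c" "scaled_velocity y"] by simp
  then show ?thesis unfolding edist_def step_dist_def scaled_velocity_def by linarith
qed

text \<open>Dyadic averages of the scaled velocity are scaled differences of path values, so they
  can be replaced by nearby elements of one countable set.\<close>

lemma step_dist_dense:
  assumes x: "x \<in> supported_paths Q" and e: "\<epsilon> > 0"
  obtains q n cs where "q \<in> \<rat>" "cs \<in> lists {r *\<^sub>R (p - q) | r p q. r \<in> \<rat> \<and> p \<in> Q \<and> q \<in> Q}" "step_dist q n ((!) cs) x < \<epsilon>"
proof -
  define Q' where "Q' = {r *\<^sub>R (p - q) | r p q. r \<in> \<rat> \<and> p \<in> Q \<and> q \<in> Q}"
  have xC: "x \<in> C1_paths" using x by (simp add: supported_paths_def)
  note ns = nice_scaled_velocity[OF xC]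
  have sa: "step_approx (scaled_velocity x)"
    by (rule nice_step_approx[OF ns]) (use velocity(2)[OF xC] in \<open>auto simp: scaled_velocity_def\<close>)
  have e3: "\<epsilon> / 3 > 0" using e by simp
  define d where "d n j = 2 ^ n *\<^sub>R (prim (scaled_velocity x) ((real j + 1) / 2 ^ n) - prim (scaled_velocity x) (real j / 2 ^ n))" for n j
  obtain n where n: "L1n (\<lambda>t. scaled_velocity x t - step n (d n) t) < \<epsilon> / 3"
    using dyadic_average_approx[OF sa e3] unfolding d_def[abs_def] by blast
  have "\<exists>u\<in>Q'. dist u (d n j) < \<epsilon> / 3" if "j < 2 ^ n" for j
  proof -
    have "d n j \<in> closure Q'"
      unfolding d_def Q'_def using dyadic_point_unit[OF that] by (intro scaled_increment_closure[OF x]) auto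
    then show ?thesis using e3 unfolding closure_approachable by blast
  qed
  then obtain u where u: "\<And>j. j < 2 ^ n \<Longrightarrow> u j \<in> Q' \<and> dist (u j) (d n j) < \<epsilon> / 3" by metis
  \<comment> \<open>Finite lists keep the family of approximations countable, which functions on all
    naturals would not.\<close>
  define cs where "cs = map u [0..<2 ^ n]"
  have cs: "cs \<in> lists Q'" using u by (auto simp: cs_def)
  have nth: "cs ! j = u j" if "j < 2 ^ n" for j using that by (simp add: cs_def)
  have "L1n (\<lambda>t. step n (d n) t - step n ((!) cs) t) = (\<Sum>j<2^n. norm (d n j - cs ! j)) / 2 ^ n"
    unfolding step_diff L1n_step ..
  also have "\<dots> \<le> (\<Sum>j<(2::nat)^n. \<epsilon> / 3) / 2 ^ n"
  proof (intro divide_right_mono sum_mono)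
    fix j assume "j \<in> {..<(2::nat) ^ n}"
    then show "norm (d n j - cs ! j) \<le> \<epsilon> / 3"
      using u[of j] nth[of j] by (simp add: dist_norm norm_minus_commute less_imp_le)
  qed simp
  also have "\<dots> = \<epsilon> / 3" by simp
  finally have 2: "L1n (\<lambda>t. scaled_velocity x t - step n ((!) cs) t) < \<epsilon> / 3 + \<epsilon> / 3"
    using L1n_diff_le[OF ns nice_step[of n "d n"] nice_step[of n "(!) cs"]] n by linarith
  obtain q where q: "q \<in> \<rat>" "\<bar>lamx x * fst x - q\<bar> < \<epsilon> / 3"
    using Rats_dense_in_real[of "lamx x * fst x" "lamx x * fst x + \<epsilon> / 3"] e3 by fastforce
  have "step_dist q n ((!) cs) x < \<epsilon>" unfolding step_dist_def using 2 q(2) by linarith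
  then show ?thesis using that q(1) cs unfolding Q'_def by blast
qed

text \<open>A Lindelof argument with countably many \<open>step_dist\<close> balls. Coordinates
  control \<open>edist\<close>, and \<open>edist_controls_vdist\<close> transfers smallness to the
  topology of paths.\<close>

lemma open_in_coord_sets:
  assumes Q: "countable Q" and U: "openin (Metric_space.mtopology C1_paths path_dist) U"
  obtains K where "K \<in> sets coord_sets" "U \<inter> supported_paths Q = K \<inter> supported_paths Q"
proof -
  define S where "S = supported_paths Q"
  define M where "M = restrict_space coord_sets S"
  have SC: "S \<subseteq> C1_paths" by (auto simp: S_def supported_paths_def)
  have sp: "space M = S" using SC by (auto simp: M_def space_restrict_space space_coord_sets)
  define Q' where "Q' = {r *\<^sub>R (p - q) | r p q. r \<in> \<rat> \<and> p \<in> Q \<and> q \<in> Q}"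
  have Q': "countable Q'" unfolding Q'_def by (rule countable_scaled_differences[OF Q])
  define B where "B = (\<lambda>(q, n, cs, r). {x\<in>S. step_dist q n ((!) cs) x < r})"
  \<comment> \<open>The inclusion in \<open>U\<close> is required for all paths, the measurable set
    \<open>B\<close> takes only the supported ones.\<close>
  define I where "I = {(q, n, cs, r) \<in> (\<rat> :: real set) \<times> UNIV \<times> lists Q' \<times> \<rat>. \<forall>y\<in>C1_paths. step_dist q n ((!) cs) y < r \<longrightarrow> y \<in> U}"
  have UC: "U \<subseteq> C1_paths" and Uo: "\<And>x. x \<in> U \<Longrightarrow> \<exists>\<epsilon>>0. \<forall>y\<in>C1_paths. vdist x y < \<epsilon> \<longrightarrow> y \<in> U"
    using U unfolding open_path_iff by auto
  have "countable ((\<rat> :: real set) \<times> (UNIV :: nat set) \<times> lists Q' \<times> (\<rat> :: real set))"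
    using Q' countable_rat by (intro countable_SIGMA countable_lists) auto
  then have I: "countable I" by (rule countable_subset[rotated]) (auto simp: I_def)
  have "U \<inter> S = (\<Union>i\<in>I. B i)"
  proof (intro equalityI subsetI)
    fix x assume "x \<in> U \<inter> S"
    then have x: "x \<in> U" "x \<in> S" and xC: "x \<in> C1_paths" using UC by auto
    obtain \<epsilon> where e: "\<epsilon> > 0" "\<And>y. y \<in> C1_paths \<Longrightarrow> vdist x y < \<epsilon> \<Longrightarrow> y \<in> U" using Uo[OF x(1)] by blast
    obtain \<delta> where d: "\<delta> > 0" "\<And>y. y \<in> C1_paths \<Longrightarrow> edist x y < \<delta> \<Longrightarrow> vdist x y < \<epsilon>"
      using edist_controls_vdist[OF xC e(1)] by blast
    have "\<delta> / 4 > 0" using d(1) by simp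
    then obtain q n cs where z: "q \<in> \<rat>" "cs \<in> lists Q'" "step_dist q n ((!) cs) x < \<delta> / 4"
      using step_dist_dense[OF x(2)[unfolded S_def], of "\<delta> / 4"] unfolding Q'_def[symmetric] by metis
    \<comment> \<open>A radius above \<open>\<delta> / 4\<close> puts \<open>x\<close> into the
      ball; below \<open>\<delta> / 2\<close> it keeps every member at \<open>edist\<close> less
      than \<delta> from \<open>x\<close>.\<close>
    obtain r where r: "r \<in> \<rat>" "\<delta> / 4 < r" "r < \<delta> / 2"
      using Rats_dense_in_real[of "\<delta> / 4" "\<delta> / 2"] d(1) by auto
    have "y \<in> U" if y: "y \<in> C1_paths" and "step_dist q n ((!) cs) y < r" for y
      using edist_le_step_dist[OF xC y, of q n "(!) cs"] that z(3) r d(1) by (intro e(2) d(2)) auto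
    then have "(q, n, cs, r) \<in> I" using z r by (auto simp: I_def)
    moreover have "x \<in> B (q, n, cs, r)" using z r x by (auto simp: B_def)
    ultimately show "x \<in> (\<Union>i\<in>I. B i)" by blast
  next
    fix x assume "x \<in> (\<Union>i\<in>I. B i)"
    then obtain q n cs r where "(q, n, cs, r) \<in> I" "x \<in> B (q, n, cs, r)" by (metis UN_E prod_cases4)
    then show "x \<in> U \<inter> S" using SC by (auto simp: I_def B_def)
  qed
  moreover have "B i \<in> sets M" for i
  proof -
    obtain q n cs r where i: "i = (q, n, cs, r)" by (metis prod_cases4)
    have [measurable]: "step_dist q n ((!) cs) \<in> borel_measurable M"
      unfolding M_def S_def by (rule step_dist_measurable[OF Q])
    have "{x\<in>space M. step_dist q n ((!) cs) x < r} \<in> sets M" by measurable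
    then show ?thesis by (simp add: B_def i sp)
  qed
  ultimately have "U \<inter> S \<in> sets M" by (simp only:) (rule sets.countable_UN''[OF I])
  then obtain K where "K \<in> sets coord_sets" "U \<inter> S = S \<inter> K" unfolding M_def sets_restrict_space by auto
  then show ?thesis using that by (auto simp: S_def)
qed

text \<open>Values of the countably many paths in \<open>D\<close> at rational times suffice: a
  small distance brings the value of \<open>x\<close> near the value of some \<open>d\<close> at the
  changed time, and continuity of \<open>d\<close> moves on to a rational time.\<close>

lemma separable_support:
  assumes D: "countable D" "D \<subseteq> C1_paths"
  obtains Q where "countable Q" "\<And>x. x \<in> C1_paths \<Longrightarrow> (\<forall>\<epsilon>>0. \<exists>d\<in>D. path_dist x d < \<epsilon>) \<Longrightarrow> x \<in> supported_paths Q"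
proof -
  define Q where "Q = (\<Union>d\<in>D. snd d ` (\<rat> \<inter> {0..fst d}))"
  have "countable Q" unfolding Q_def using D(1) countable_rat by (intro countable_UN countable_image countable_Int1) auto
  moreover have "x \<in> supported_paths Q" if x: "x \<in> C1_paths" and app: "\<forall>\<epsilon>>0. \<exists>d\<in>D. path_dist x d < \<epsilon>" for x
  proof -
    have "snd x t \<in> closure Q" if t: "t \<in> {0..fst x}" for t
      unfolding closure_approachable
    proof (intro allI impI)
      fix e :: real assume e: "e > 0"
      then obtain d where d: "d \<in> D" "path_dist x d < e / 2" using app half_gt_zero by blast
      have dC: "d \<in> C1_paths" using d(1) D(2) by blast
      obtain \<tau> where \<tau>: "\<tau> \<in> increasing_bijections (fst x) (fst d)" "tvb 0 (fst x) (\<lambda>t. gpath x t - gpath d (\<tau> t)) (e / 2)"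
        using path_dist_less_obtain[OF x dC d(2)] by blast
      note g = gpath_close[OF x dC \<tau> t]
      have cont: "continuous_on {0..fst d} (snd d)" using dC by (auto simp: C1_paths_def)
      obtain \<delta> where \<delta>: "\<delta> > 0" "\<And>s. s \<in> {0..fst d} \<Longrightarrow> dist s (\<tau> t) < \<delta> \<Longrightarrow> dist (snd d s) (snd d (\<tau> t)) < e / 2"
        using cont g(3) e unfolding continuous_on_iff by (metis half_gt_zero)
      have Td: "fst d > 0" by (rule C1_pos[OF dC])
      \<comment> \<open>The time is nudged inside the interval of \<open>d\<close>, so that end
        points cause no exception.\<close>
      have "max 0 (\<tau> t - \<delta>) < min (fst d) (\<tau> t + \<delta>)" using g(3) Td \<delta>(1) by auto
      then obtain s where s: "s \<in> \<rat>" "max 0 (\<tau> t - \<delta>) < s" "s < min (fst d) (\<tau> t + \<delta>)"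
        using Rats_dense_in_real by blast
      have sd: "s \<in> {0..fst d}" "dist s (\<tau> t) < \<delta>" using s by (auto simp: dist_real_def)
      have "dist (snd d s) (snd x t) \<le> dist (snd d s) (snd d (\<tau> t)) + dist (snd d (\<tau> t)) (snd x t)" by (rule dist_triangle)
      also have "\<dots> < e" using \<delta>(2)[OF sd] g(1) by (simp add: dist_norm norm_minus_commute)
      finally show "\<exists>y\<in>Q. dist y (snd x t) < e" using s(1) sd(1) d(1) unfolding Q_def by blast
    qed
    then show ?thesis using x by (simp add: supported_paths_def)
  qed
  ultimately show ?thesis using that by blast
qed

section \<open>Equality of the laws\<close>

lemma path_laws_eqI:
  assumes \<mu>: "path_law \<mu>" "separably_supported \<mu>" and \<nu>: "path_law \<nu>" "separably_supported \<nu>"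
    and eq: "\<And>m l. m \<ge> 1 \<Longrightarrow> l \<in> dual_space (tensor_power tens m) \<Longrightarrow>
       (\<integral>x. l (normalized_signature tens \<Lambda> x m) \<partial>\<mu>) = (\<integral>y. l (normalized_signature tens \<Lambda> y m) \<partial>\<nu>)"
  shows "\<mu> = \<nu>"
proof -
  interpret \<mu>: prob_space \<mu> using \<mu> by (simp add: path_law_def)
  interpret \<nu>: prob_space \<nu> using \<nu> by (simp add: path_law_def)
  have s\<mu>: "sets \<mu> = sets path_borel" and s\<nu>: "sets \<nu> = sets path_borel" using \<mu> \<nu> by (auto simp: path_law_def)
  have sp: "space \<mu> = C1_paths" "space \<nu> = C1_paths"
    using sets_eq_imp_space_eq[OF s\<mu>] sets_eq_imp_space_eq[OF s\<nu>] by (auto simp: space_path_borel)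
  have meas: "coord w \<in> borel_measurable \<mu>" "coord w \<in> borel_measurable \<nu>" if "bl_word w" for w
    using coord_continuous[OF that] by (simp_all add: measurable_cong_sets[OF s\<mu> refl] measurable_cong_sets[OF s\<nu> refl])
  have integrable: "integrable \<mu> (coord w)" "integrable \<nu> (coord w)" if w: "bl_word w" for w
  proof -
    obtain B where "\<And>x. x \<in> C1_paths \<Longrightarrow> \<bar>coord w x\<bar> \<le> B" using coord_bounded[OF w] by blast
    then show "integrable \<mu> (coord w)" "integrable \<nu> (coord w)"
      by (auto intro!: \<mu>.integrable_const_bound[where B = B] \<nu>.integrable_const_bound[where B = B] meas[OF w] AE_I2 simp: sp)
  qed
  have coord_int: "(\<integral>x. coord w x \<partial>\<mu>) = (\<integral>x. coord w x \<partial>\<nu>)" if w: "bl_word w" for w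
  \<comment> \<open>The hypothesis starts at degree 1. The empty word is the constant 1, whose
    integral is the total mass of either law.\<close>
  proof (cases "w = []")
    case True
    then show ?thesis using \<mu>.prob_space \<nu>.prob_space by (simp add: coord_Nil)
  next
    case False
    then have m: "length w \<ge> 1" by (simp add: Suc_leI)
    interpret L: bounded_linear "word_functional w" by (rule word_functional(1)[OF w])
    obtain K where K: "\<And>v. norm (word_functional w v) \<le> norm v * K" using L.bounded by blast
    have "word_functional w \<in> dual_space (tensor_power tens (length w))"
      unfolding dual_space_def using L.add L.scaleR K by (auto intro!: exI[of _ K] simp: mult.commute)
    from eq[OF m this] show ?thesis
      using Bochner_Integration.integral_cong[OF refl, of \<mu> "coord w" "\<lambda>x. word_functional w (normalized_signature tens \<Lambda> x (length w))"]
        Bochner_Integration.integral_cong[OF refl, of \<nu> "coord w" "\<lambda>x. word_functional w (normalized_signature tens \<Lambda> x (length w))"]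
      by (simp add: sp coord_eq[OF w])
  qed
  have alg: "integrable \<mu> f \<and> integrable \<nu> f \<and> (\<integral>x. f x \<partial>\<mu>) = (\<integral>x. f x \<partial>\<nu>) \<and> (\<exists>B. \<forall>x\<in>C1_paths. \<bar>f x\<bar> \<le> B)"
    if "f \<in> coord_algebra" for f
    using that
  proof induction
    case (coord w c)
    obtain B where B: "\<And>x. x \<in> C1_paths \<Longrightarrow> \<bar>coord w x\<bar> \<le> B" using coord_bounded[OF coord] by blast
    have "\<bar>c * coord w x\<bar> \<le> \<bar>c\<bar> * B" if "x \<in> C1_paths" for x
      using B[OF that] by (simp add: abs_mult mult_left_mono)
    then have "\<exists>B. \<forall>x\<in>C1_paths. \<bar>c * coord w x\<bar> \<le> B" by blast
    then show ?case using integrable[OF coord] coord_int[OF coord] by simp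
  next
    case (add f g)
    then obtain B C where "\<And>x. x \<in> C1_paths \<Longrightarrow> \<bar>f x\<bar> \<le> B" "\<And>x. x \<in> C1_paths \<Longrightarrow> \<bar>g x\<bar> \<le> C" by blast
    then have "\<bar>f x + g x\<bar> \<le> B + C" if "x \<in> C1_paths" for x
      using that by (intro order_trans[OF abs_triangle_ineq] add_mono)
    then have "\<exists>B. \<forall>x\<in>C1_paths. \<bar>f x + g x\<bar> \<le> B" by blast
    then show ?case using add by simp
  qed
  have coincide: "K \<in> sets \<mu>" "emeasure \<mu> K = emeasure \<nu> K" if K: "K \<in> sets coord_sets" for K
  proof -
    have "K \<in> sigma_sets (space \<mu>) {{x\<in>space \<mu>. f x > a} | f a. f \<in> coord_algebra}"
      using K by (simp add: sets_coord_sets sp)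
    note * = algebra_determines_measure[OF \<mu>.prob_space_axioms \<nu>.prob_space_axioms _ _ _ _ _ _ _ this]
    show "K \<in> sets \<mu>"
      by (rule *(1)) (use alg s\<mu> s\<nu> sp in \<open>auto intro: coord_algebra.add coord_algebra_mult coord_algebra_const\<close>)
    show "emeasure \<mu> K = emeasure \<nu> K"
      by (rule *(2)) (use alg s\<mu> s\<nu> sp in \<open>auto intro: coord_algebra.add coord_algebra_mult coord_algebra_const\<close>)
  qed
  obtain D\<mu> where D\<mu>: "countable D\<mu>" "D\<mu> \<subseteq> C1_paths" "AE x in \<mu>. \<forall>\<epsilon>>0. \<exists>d\<in>D\<mu>. path_dist x d < \<epsilon>"
    using \<mu>(2) unfolding separably_supported_def by blast
  obtain D\<nu> where D\<nu>: "countable D\<nu>" "D\<nu> \<subseteq> C1_paths" "AE x in \<nu>. \<forall>\<epsilon>>0. \<exists>d\<in>D\<nu>. path_dist x d < \<epsilon>"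
    using \<nu>(2) unfolding separably_supported_def by blast
  \<comment> \<open>A single \<open>Q\<close> has to support both laws, hence the union of the two
    countable sets.\<close>
  have "countable (D\<mu> \<union> D\<nu>)" "D\<mu> \<union> D\<nu> \<subseteq> C1_paths" using D\<mu> D\<nu> by auto
  then obtain Q where Q: "countable Q"
    "\<And>x. x \<in> C1_paths \<Longrightarrow> (\<forall>\<epsilon>>0. \<exists>d\<in>D\<mu> \<union> D\<nu>. path_dist x d < \<epsilon>) \<Longrightarrow> x \<in> supported_paths Q"
    using separable_support by metis
  have ae: "AE x in \<mu>. x \<in> supported_paths Q" "AE x in \<nu>. x \<in> supported_paths Q"
  proof -
    show "AE x in \<mu>. x \<in> supported_paths Q"
      using D\<mu>(3) AE_space by eventually_elim (intro Q(2), simp add: sp, blast)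
    show "AE x in \<nu>. x \<in> supported_paths Q"
      using D\<nu>(3) AE_space by eventually_elim (intro Q(2), simp add: sp, blast)
  qed
  have open_eq: "emeasure \<mu> U = emeasure \<nu> U" if U: "openin (Metric_space.mtopology C1_paths path_dist) U" for U
  proof -
    obtain K where K: "K \<in> sets coord_sets" "U \<inter> supported_paths Q = K \<inter> supported_paths Q"
      using open_in_coord_sets[OF Q(1) U] by blast
    have UB: "U \<in> sets path_borel" using U unfolding sets_path_borel by blast
    \<comment> \<open>The sets \<open>U\<close> and \<open>K\<close> agree on
      \<open>supported_paths Q\<close>, where both laws live almost surely.\<close>
    have "emeasure \<mu> U = emeasure \<mu> K"
      by (rule emeasure_eq_AE) (use ae(1) K UB s\<mu> coincide(1) in \<open>auto elim!: eventually_mono\<close>)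
    also have "\<dots> = emeasure \<nu> K" by (rule coincide(2)[OF K(1)])
    also have "\<dots> = emeasure \<nu> U"
      by (rule emeasure_eq_AE) (use ae(2) K UB s\<mu> s\<nu> coincide(1) in \<open>auto elim!: eventually_mono\<close>)
    finally show ?thesis .
  qed
  interpret Metric_space "C1_paths :: 'v path set" path_dist by (rule path_metric_space)
  show ?thesis
  proof (rule measure_eqI_generator_eq[where A = "\<lambda>_. C1_paths" and \<Omega> = C1_paths and E = "{U. openin mtopology U}"])
    show "Int_stable {U. openin mtopology U}" by (auto simp: Int_stable_def)
    show "{U. openin mtopology U} \<subseteq> Pow C1_paths" by (auto simp: open_path_iff)
    show "range (\<lambda>_. C1_paths) \<subseteq> {U. openin mtopology U}" using openin_topspace[of mtopology] by auto
    show "emeasure \<mu> C1_paths \<noteq> \<infinity>" by simp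
  qed (use s\<mu> s\<nu> open_eq sets_path_borel in auto)
qed

end

theorem corollary23:
  fixes tens :: "('v::banach \<times> real) list \<Rightarrow> 'e::banach"
    and \<Lambda> :: "(nat \<Rightarrow> 'e) \<Rightarrow> nat \<Rightarrow> 'e"
    and \<mu> \<nu> :: "'v path measure"
  assumes "admissible_tensor_powers tens"
    and "tensor_normalization tens \<Lambda>"
    and "path_law \<mu>" and "separably_supported \<mu>"
    and "path_law \<nu>" and "separably_supported \<nu>"
  shows "\<mu> = \<nu> \<longleftrightarrow>
    (\<forall>m\<ge>1. \<forall>l\<in>dual_space (tensor_power tens m).
       (\<integral>x. l (normalized_signature tens \<Lambda> x m) \<partial>\<mu>) =
       (\<integral>y. l (normalized_signature tens \<Lambda> y m) \<partial>\<nu>))"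
proof -
  interpret tensor_normalized tens \<Lambda>
    using assms(1,2) by (simp add: tensor_normalized_def tensor_normalized_axioms_def)
  show ?thesis using path_laws_eqI[OF assms(3-6)] by blast
qed

end
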